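(* (Elliptic part.) Let $\lambda>0$ and $f\in C_b(\mathbb R^n)$. Then there exists a unique distributional solution $u\in C_b(\mathbb R^n)$ to the equation $\lambda u(x)-\mathcal Au(x)=f(x)$, $x\in\mathbb R^n$. Moreover $u$ is given by $$u(x)=\int_0^\infty e^{-\lambda t}P_tf(x)\,dt,\qquad x\in\mathbb R^n.$$ (Parabolic part.) Let $g\in C_b(\mathbb R^n)$, $T>0$, and let $H:[0,T]\times\mathbb R^n\to\mathbb R$ be continuous and bounded. Then there exists a unique space-distributional solution $v$ to the Cauchy problem $$\partial_tv(t,x)=\mathcal Av(t,x)+H(t,x),\ t\in(0,T],\ x\in\mathbb R^n,\qquad v(0,x)=g(x),\ x\in\mathbb R^n.$$ Moreover $$v(t,x)=P_tg(x)+\int_0^tP_{t-s}\big(H(s,\cdot)\big)(x)\,ds,\qquad x\in\mathbb R^n,\ t\in[0,T].$$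
   Context: Setting. $\mathcal A u(x)=\frac12\mathrm{Tr}(Q D^2u(x))+\langle Ax,Du(x)\rangle+\langle F(x),Du(x)\rangle$, $x\in\mathbb R^n$, where $Q,A$ are real $n\times n$ matrices, $F:\mathbb R^n\to\mathbb R^n$, and the following hold. (i) $Q=\begin{pmatrix}Q_0&0\\0&0\end{pmatrix}$ with $Q_0$ a symmetric positive definite $\tilde p\times\tilde p$ matrix, $1\le\tilde p\le n$. (ii) $F(x)=(F_1(x),\dots,F_{\tilde p}(x),0,\dots,0)$. (iii) $F_1,\dots,F_{\tilde p}:\mathbb R^n\to\mathbb R$ are Lipschitz continuous and have bounded partial derivatives up to the third order on $\mathbb R^n$ ($F$ itself may be unbounded). (iv) There is a nonnegative integer $k$ such that, with $e_1,\dots,e_{\tilde p}$ the first $\tilde p$ elements of the canonical basis, the vectors $e_1,\dots,e_{\tilde p},Ae_1,\dots,Ae_{\tilde p},\dots,A^ke_1,\dots,A^ke_{\tilde p}$ generate $\mathbb R^n$. Semigroup. On a complete stochastic basis $(\Omega,(\mathcal F_t)_{t\ge0},\mathcal F,\mathbb P)$ satisfying the usual assumptions, $W_t$ is a standard $n$-dimensional Wiener process and $X^x_t$ is the unique strong solution of $X_t^x=x+\int_0^tAX_s^xds+\int_0^tF(X_s^x)ds+Q^{1/2}W_t$, $t\ge0$, $x\in\mathbb R^n$, where $Q^{1/2}$ is the symmetric nonnegative square root of $Q$. $P_tg(x)=\mathbb E[g(X_t^x)]$ for $g$ Borel and bounded on $\mathbb R^n$. $C_b(\mathbb R^n)$ is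 the space of uniformly continuous bounded real functions on $\mathbb R^n$. The formal adjoint of $\mathcal A$ is $\mathcal A^*\phi(x)=\frac12\mathrm{Tr}(QD^2\phi(x))-\langle Ax+F(x),D\phi(x)\rangle-\phi(x)[\mathrm{div}F(x)+\mathrm{Tr}(A)]$. Distributional solution. $u\in C_b(\mathbb R^n)$ is a distributional solution to $\lambda u-\mathcal Au=f$ if $\lambda\int_{\mathbb R^n}u\phi\,dx=\int_{\mathbb R^n}u\,\mathcal A^*\phi\,dx+\int_{\mathbb R^n}f\phi\,dx$ for every $\phi\in C_0^\infty(\mathbb R^n)$. Space-distributional solution. A continuous bounded $v:[0,T]\times\mathbb R^n\to\mathbb R$ with $v(0,\cdot)=g$ is a space-distributional solution of the Cauchy problem if: (a) $v(t,\cdot)\in C_b(\mathbb R^n)$ uniformly in $t\in[0,T]$, i.e. for every $\epsilon>0$ there is $\delta>0$ such that $|y|<\delta$ implies $\sup_{t\in[0,T],x\in\mathbb R^n}|v(t,x+y)-v(t,x)|<\epsilon$; (b) for every $\phi\in C_0^\infty(\mathbb R^n)$ the map $t\mapsto\int_{\mathbb R^n}v(t,x)\phi(x)dx$ is continuously differentiable on $[0,T]$ and $\frac{d}{dt}\int v(t,x)\phi(x)dx=\int v(t,x)\mathcal A^*\phi(x)dx+\int H(t,x)\phi(x)dx$ for $t\in[0,T]$. *)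

theory Defs
  imports "HOL-Probability.Probability"
begin

section \<open>Partial derivatives and function spaces\<close>

definition has_partial :: "'n::finite \<Rightarrow> (real^'n \<Rightarrow> real) \<Rightarrow> bool" where
  "has_partial i f \<longleftrightarrow> (\<forall>x. (\<lambda>h. f (x + h *\<^sub>R axis i 1)) differentiable (at 0))"

definition partial :: "'n::finite \<Rightarrow> (real^'n \<Rightarrow> real) \<Rightarrow> real^'n \<Rightarrow> real" where
  "partial i f x = deriv (\<lambda>h. f (x + h *\<^sub>R axis i 1)) 0"

text \<open>Only the partial derivatives of order at least one are required to be bounded, not the
  function itself; they are not required to be continuous.\<close>
primrec bounded_partials :: "nat \<Rightarrow> (real^'n::finite \<Rightarrow> real) \<Rightarrow> bool" where
  "bounded_partials 0 f \<longleftrightarrow> True"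
| "bounded_partials (Suc k) f \<longleftrightarrow>
     (\<forall>i. has_partial i f \<and> bounded (range (partial i f)) \<and> bounded_partials k (partial i f))"

primrec C_k :: "nat \<Rightarrow> (real^'n::finite \<Rightarrow> real) \<Rightarrow> bool" where
  "C_k 0 f \<longleftrightarrow> continuous_on UNIV f"
| "C_k (Suc k) f \<longleftrightarrow>
     continuous_on UNIV f \<and> (\<forall>i. has_partial i f \<and> C_k k (partial i f))"

definition test_functions :: "(real^'n::finite \<Rightarrow> real) set" where
  "test_functions = {\<phi>. (\<forall>k. C_k k \<phi>) \<and> compact (closure {x. \<phi> x \<noteq> 0})}"

definition C_b :: "(real^'n::finite \<Rightarrow> real) set" where
  "C_b = {f. uniformly_continuous_on UNIV f \<and> bounded (range f)}"

definition grad :: "(real^'n::finite \<Rightarrow> real) \<Rightarrow> real^'n \<Rightarrow> real^'n" where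
  "grad f x = (\<chi> i. partial i f x)"

definition hessian :: "(real^'n::finite \<Rightarrow> real) \<Rightarrow> real^'n \<Rightarrow> real^'n^'n" where
  "hessian f x = (\<chi> i j. partial i (partial j f) x)"

definition divergence :: "(real^'n::finite \<Rightarrow> real^'n) \<Rightarrow> real^'n \<Rightarrow> real" where
  "divergence F x = (\<Sum>i\<in>UNIV. partial i (\<lambda>y. F y $ i) x)"

section \<open>Assumptions on the coefficients\<close>

text \<open>The index set of the first \<open>p\<close> coordinates, in the order of the index type.\<close>
definition first_coords :: "nat \<Rightarrow> 'n::{finite,linorder} set" where
  "first_coords p = {i. card {j. j < i} < p}"

definition block_diffusion :: "nat \<Rightarrow> real^'n::{finite,linorder}^'n::{finite,linorder} \<Rightarrow> bool" where
  "block_diffusion p Q \<longleftrightarrow>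
     (\<forall>i j. i \<notin> first_coords p \<or> j \<notin> first_coords p \<longrightarrow> Q $ i $ j = 0) \<and>
     (\<forall>i\<in>first_coords p. \<forall>j\<in>first_coords p. Q $ i $ j = Q $ j $ i) \<and>
     (\<forall>\<xi>. \<xi> \<noteq> 0 \<and> (\<forall>i. i \<notin> first_coords p \<longrightarrow> \<xi> $ i = 0) \<longrightarrow> 0 < \<xi> \<bullet> (Q *v \<xi>))"

definition regular_drift :: "nat \<Rightarrow> (real^'n::{finite,linorder} \<Rightarrow> real^'n::{finite,linorder}) \<Rightarrow> bool" where
  "regular_drift p F \<longleftrightarrow>
     (\<forall>i. i \<notin> first_coords p \<longrightarrow> (\<forall>x. F x $ i = 0)) \<and>
     (\<forall>i\<in>first_coords p. (\<exists>L. L-lipschitz_on UNIV (\<lambda>x. F x $ i)) \<and>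
        bounded_partials 3 (\<lambda>x. F x $ i))"

definition generates :: "nat \<Rightarrow> real^'n::{finite,linorder}^'n::{finite,linorder} \<Rightarrow> bool" where
  "generates p A \<longleftrightarrow>
     (\<exists>k::nat. span {(((*v) A) ^^ j) (axis i 1) | i j. i \<in> first_coords p \<and> j \<le> k} = UNIV)"

definition adjoint_operator ::
    "real^'n::finite^'n::finite \<Rightarrow> real^'n^'n \<Rightarrow> (real^'n \<Rightarrow> real^'n) \<Rightarrow> (real^'n \<Rightarrow> real) \<Rightarrow> real^'n \<Rightarrow> real" where
  "adjoint_operator Q A F \<phi> x =
     1/2 * trace (Q ** hessian \<phi> x) - (A *v x + F x) \<bullet> grad \<phi> x
     - \<phi> x * (divergence F x + trace A)"

section \<open>The stochastic differential equation and its semigroup\<close>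

text \<open>Complete filtered probability space under the usual assumptions; only the values of the
  filtration at nonnegative times matter.\<close>
definition stochastic_basis :: "'w measure \<Rightarrow> (real \<Rightarrow> 'w measure) \<Rightarrow> bool" where
  "stochastic_basis M \<F> \<longleftrightarrow>
     prob_space M \<and> complete_measure M \<and>
     (\<forall>t\<ge>0. subalgebra M (\<F> t)) \<and>
     (\<forall>s t. 0 \<le> s \<and> s \<le> t \<longrightarrow> sets (\<F> s) \<subseteq> sets (\<F> t)) \<and>
     (\<forall>t\<ge>0. sets (\<F> t) = (\<Inter>s\<in>{t<..}. sets (\<F> s))) \<and>
     null_sets M \<subseteq> sets (\<F> 0)"

definition adapted :: "(real \<Rightarrow> 'w measure) \<Rightarrow> (real \<Rightarrow> 'w \<Rightarrow> real^'n::finite) \<Rightarrow> bool" where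
  "adapted \<F> Y \<longleftrightarrow> (\<forall>t\<ge>0. Y t \<in> borel_measurable (\<F> t))"

definition wiener_process ::
    "'w measure \<Rightarrow> (real \<Rightarrow> 'w measure) \<Rightarrow> (real \<Rightarrow> 'w \<Rightarrow> real^'n::finite) \<Rightarrow> bool" where
  "wiener_process M \<F> W \<longleftrightarrow>
     adapted \<F> W \<and>
     (AE \<omega> in M. W 0 \<omega> = 0) \<and>
     (AE \<omega> in M. continuous_on {0..} (\<lambda>t. W t \<omega>)) \<and>
     (\<forall>s t. 0 \<le> s \<and> s < t \<longrightarrow>
        distributed M lborel (\<lambda>\<omega>. W t \<omega> - W s \<omega>)
          (\<lambda>y. ennreal (\<Prod>i\<in>UNIV. normal_density 0 (sqrt (t - s)) (y $ i))) \<and>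
        prob_space.indep_set M (sets (\<F> s))
          (sets (vimage_algebra (space M) (\<lambda>\<omega>. W t \<omega> - W s \<omega>) borel)))"

definition nonneg_sqrt :: "real^'n::finite^'n::finite \<Rightarrow> real^'n^'n \<Rightarrow> bool" where
  "nonneg_sqrt R Q \<longleftrightarrow> transpose R = R \<and> (\<forall>\<xi>. 0 \<le> \<xi> \<bullet> (R *v \<xi>)) \<and> R ** R = Q"

text \<open>Existence and uniqueness (up to indistinguishability) follow from Lipschitz continuity of the
  drift; \<open>R\<close> plays the role of the square root of \<open>Q\<close>.\<close>
definition strong_solution ::
    "'w measure \<Rightarrow> (real \<Rightarrow> 'w measure) \<Rightarrow> (real \<Rightarrow> 'w \<Rightarrow> real^'n::finite) \<Rightarrow>
     real^'n^'n \<Rightarrow> real^'n^'n \<Rightarrow> (real^'n \<Rightarrow> real^'n) \<Rightarrow> real^'n \<Rightarrow> (real \<Rightarrow> 'w \<Rightarrow> real^'n) \<Rightarrow> bool" where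
  "strong_solution M \<F> W R A F x Y \<longleftrightarrow>
     adapted \<F> Y \<and>
     (AE \<omega> in M. continuous_on {0..} (\<lambda>t. Y t \<omega>) \<and>
        (\<forall>t\<ge>0. Y t \<omega> = x + (LBINT s:{0..t}. A *v Y s \<omega>) + (LBINT s:{0..t}. F (Y s \<omega>)) + R *v W t \<omega>))"

definition transition_semigroup ::
    "'w measure \<Rightarrow> (real^'n::finite \<Rightarrow> real \<Rightarrow> 'w \<Rightarrow> real^'n) \<Rightarrow>
     real \<Rightarrow> (real^'n \<Rightarrow> real) \<Rightarrow> real^'n \<Rightarrow> real" where
  "transition_semigroup M X t g x = prob_space.expectation M (\<lambda>\<omega>. g (X x t \<omega>))"

section \<open>Notions of solution\<close>

definition distributional_solution ::
    "real^'n::finite^'n::finite \<Rightarrow> real^'n^'n \<Rightarrow> (real^'n \<Rightarrow> real^'n) \<Rightarrow>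
     real \<Rightarrow> (real^'n \<Rightarrow> real) \<Rightarrow> (real^'n \<Rightarrow> real) \<Rightarrow> bool" where
  "distributional_solution Q A F lam f u \<longleftrightarrow>
     u \<in> C_b \<and>
     (\<forall>\<phi>\<in>test_functions.
        lam * (LINT x|lborel. u x * \<phi> x) =
        (LINT x|lborel. u x * adjoint_operator Q A F \<phi> x) + (LINT x|lborel. f x * \<phi> x))"

text \<open>Functions on \<open>[0,T] \<times> \<real>\<^sup>n\<close> are represented by total functions whose values at times outside
  \<open>{0..T}\<close> are irrelevant. At the endpoints the time derivative is one-sided.\<close>
definition space_distributional_solution ::
    "real^'n::finite^'n::finite \<Rightarrow> real^'n^'n \<Rightarrow> (real^'n \<Rightarrow> real^'n) \<Rightarrow>
     real \<Rightarrow> (real \<Rightarrow> real^'n \<Rightarrow> real) \<Rightarrow> (real^'n \<Rightarrow> real) \<Rightarrow> (real \<Rightarrow> real^'n \<Rightarrow> real) \<Rightarrow> bool" where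
  "space_distributional_solution Q A F T H g v \<longleftrightarrow>
     continuous_on ({0..T} \<times> UNIV) (\<lambda>(t, x). v t x) \<and>
     bounded ((\<lambda>(t, x). v t x) ` ({0..T} \<times> UNIV)) \<and>
     (\<forall>x. v 0 x = g x) \<and>
     (\<forall>\<epsilon>>0. \<exists>\<delta>>0. \<forall>y. norm y < \<delta> \<longrightarrow>
        (SUP (t, x)\<in>{0..T} \<times> UNIV. \<bar>v t (x + y) - v t x\<bar>) < \<epsilon>) \<and>
     (\<forall>\<phi>\<in>test_functions. \<exists>m'. continuous_on {0..T} m' \<and>
        (\<forall>t\<in>{0..T}.
           ((\<lambda>r. LINT x|lborel. v r x * \<phi> x) has_real_derivative m' t) (at t within {0..T}) \<and>
           m' t = (LINT x|lborel. v t x * adjoint_operator Q A F \<phi> x)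
             + (LINT x|lborel. H t x * \<phi> x)))"

end

(*
  Write b(x) = Ax + F(x) and let S_h g(x) = E g(x + h b(x) + R w), w normal with covariance h I, be one
  step of the Euler scheme. Its iterates converge to P_t g, and for a test function phi and bounded
  Borel g a change of variables and a Taylor expansion give
    int (S_h g) phi = int g phi + h int g (A* phi) + O(h^(3/2)),
  with a constant depending only on phi and the bound of g. Telescoping shows that P_t f satisfies the
  integrated weak equation; no stochastic calculus and no regularity of P_t f is used. The resolvent
  and Duhamel formulas then give solutions by Fubini.

  Only the spatial uniform continuity of the Duhamel integral needs the spanning condition. It follows
  from |P_t f(x+z) - P_t f(x)| <= C |z| sup|f| for t >= delta, which is proved by a Wang-type Harnack
  inequality for the Euler scheme: the noise is shifted so that a second copy started at x+z is steered
  to the first one by time delta along a control z' = Az + u, with u in the range of Q.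

  Uniqueness: a weak solution v is mollified in space with a radial bump. The commutator of the drift
  with the mollification tends to 0 because b is Lipschitz and v is uniformly continuous, so a maximum
  principle with penalty kappa e^(ct) (1+|x|^2) applies and yields v <= sup v(0).
*)

theory Submission
  imports Defs
begin

section \<open>Partial derivatives and test functions\<close>

text \<open>The one-step error is stated for all bounded Borel \<open>g\<close> because nothing
  better is known of the iterates of the scheme: every derivative falls on \<phi>, and the only
  property of \<open>g\<close> that enters is its sup bound, which the scheme preserves. One
  constant then serves all \<open>t/h\<close> steps, and errors of size \<open>h^(3/2)\<close> sum
  to order \<open>sqrt h\<close>.

  A source \<open>H s\<close> is continuous and bounded but need not be uniformly continuous, so
  \<open>P_(t-s) (H s)\<close> inherits no modulus from it; this is the obstacle behind the
  smoothing part. Shifting the noise of one step by \<open>h \<beta>\<close> costs the second moment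
  \<open>exp (h |\<beta>|^2)\<close> of a Gaussian density ratio. The product over all steps is
  \<open>exp (t c^2 |z|^2)\<close>, independent of \<open>h\<close>. As the exponent is quadratic in
  \<open>|z|\<close>, the inequality applied to \<open>1 + |z| f\<close> gives a bound linear in
  \<open>|z|\<close>.

  In the uniqueness part \<open>b\<close> is unbounded, but it enters the commutator only through
  \<open>b y - b x\<close> with \<open>y\<close> within the mollification radius; its smallness
  there cancels the size of the gradient of the mollifier.\<close>

lemma has_partial_real_derivative:
  assumes "has_partial i f"
  shows "((\<lambda>s. f (x + s *\<^sub>R axis i 1)) has_real_derivative partial i f (x + s *\<^sub>R axis i 1)) (at s)"
proof -
  let ?y = "x + s *\<^sub>R axis i 1"
  have "(\<lambda>h. f (?y + h *\<^sub>R axis i 1)) differentiable (at 0)"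
    using assms unfolding has_partial_def by blast
  then have "((\<lambda>h. f (?y + h *\<^sub>R axis i 1)) has_real_derivative partial i f ?y) (at 0)"
    unfolding partial_def by (metis DERIV_imp_deriv differentiable_def has_real_derivative)
  then have *: "((\<lambda>h. f (x + (h + s) *\<^sub>R axis i 1)) has_real_derivative partial i f ?y) (at 0)"
    by (simp add: algebra_simps)
  from DERIV_shift[of "\<lambda>r. f (x + r *\<^sub>R axis i 1)" "partial i f ?y" 0 s] *
  show ?thesis by simp
qed

lemma has_partialI:
  assumes "\<And>x. ((\<lambda>h. f (x + h *\<^sub>R axis i 1)) has_real_derivative g x) (at 0)"
  shows "has_partial i f" "partial i f = g"
  using assms unfolding has_partial_def partial_def
  by (auto intro!: DERIV_imp_deriv simp: differentiable_def has_field_derivative_def)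

lemma partial_mvt:
  assumes "has_partial i f"
  obtains c where "\<bar>c\<bar> \<le> \<bar>a\<bar>" "f (x + a *\<^sub>R axis i 1) - f x = a * partial i f (x + c *\<^sub>R axis i 1)"
proof -
  have D: "DERIV (\<lambda>s. f (x + s *\<^sub>R axis i 1)) s :> partial i f (x + s *\<^sub>R axis i 1)" for s
    using has_partial_real_derivative[OF assms] .
  consider "a = 0" | "a > 0" | "a < 0" by linarith
  then show thesis
  proof cases
    case 1 then show ?thesis using that[of 0] by simp
  next
    case 2
    then obtain z where "0 < z" "z < a" "f (x + a *\<^sub>R axis i 1) - f (x + 0 *\<^sub>R axis i 1)
      = (a - 0) * partial i f (x + z *\<^sub>R axis i 1)"
      using MVT2[of 0 a "\<lambda>s. f (x + s *\<^sub>R axis i 1)" "\<lambda>s. partial i f (x + s *\<^sub>R axis i 1)"] D by blast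
    then show ?thesis using that[of z] by simp
  next
    case 3
    then obtain z where "a < z" "z < 0" "f (x + 0 *\<^sub>R axis i 1) - f (x + a *\<^sub>R axis i 1)
      = (0 - a) * partial i f (x + z *\<^sub>R axis i 1)"
      using MVT2[of a 0 "\<lambda>s. f (x + s *\<^sub>R axis i 1)" "\<lambda>s. partial i f (x + s *\<^sub>R axis i 1)"] D by blast
    then show ?thesis using that[of z] by (simp add: algebra_simps)
  qed
qed

lemma norm_remove_component:
  fixes v :: "real^'n"
  shows "norm (v - (v$i) *\<^sub>R axis i 1) \<le> norm v"
  by (rule norm_le_componentwise_cart) (auto simp: axis_def)

lemma norm_remove_component_part:
  fixes v :: "real^'n"
  assumes "\<bar>c\<bar> \<le> \<bar>v$i\<bar>"
  shows "norm (v - (v$i) *\<^sub>R axis i 1 + c *\<^sub>R axis i 1) \<le> norm v"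
  by (rule norm_le_componentwise_cart) (use assms in \<open>auto simp: axis_def\<close>)

text \<open>The increment is built up one coordinate at a time, with the mean value theorem in each
  coordinate. Deleting or shrinking a coordinate does not increase the norm, so all intermediate
  points stay in the ball where \<open>B\<close> holds. The numbers \<open>d i\<close> are free: the
  partials at \<open>x\<close> give differentiability, and \<open>d = 0\<close> gives a Lipschitz
  bound.\<close>

lemma partial_increment:
  fixes f :: "real^'n \<Rightarrow> real"
  assumes hp: "\<And>i. has_partial i f"
    and B: "\<And>i y. norm (y - x) \<le> norm v \<Longrightarrow> \<bar>partial i f y - d i\<bar> \<le> B"
  shows "\<bar>f (x + v) - f x - (\<Sum>i\<in>UNIV. v$i * d i)\<bar> \<le> B * (\<Sum>i\<in>UNIV. \<bar>v$i\<bar>)"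
proof -
  \<comment> \<open>Induction on the set \<open>S\<close> of coordinates in which the increment may
    be nonzero. Quantifying over all \<open>v'\<close> in the ball lets the hypothesis be applied to
    the increment with one coordinate removed.\<close>
  have "\<forall>v'. norm v' \<le> norm v \<longrightarrow> (\<forall>i. i \<notin> S \<longrightarrow> v'$i = 0) \<longrightarrow>
     \<bar>f (x + v') - f x - (\<Sum>i\<in>S. v'$i * d i)\<bar> \<le> B * (\<Sum>i\<in>S. \<bar>v'$i\<bar>)" if "finite S" for S
    using that
  proof (induction S)
    case empty
    then show ?case by (auto, metis (no_types) add.right_neutral diff_self abs_zero order_refl vec_eq_iff zero_index)
  next
    case (insert i S)
    show ?case
    proof (intro allI impI)
      fix v' :: "real^'n" assume n: "norm v' \<le> norm v" and z: "\<forall>j. j \<notin> insert i S \<longrightarrow> v'$j = 0"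
      let ?w = "v' - (v'$i) *\<^sub>R axis i 1"
      have w: "?w $ j = (if j = i then 0 else v'$j)" for j by (auto simp: axis_def)
      have "norm ?w \<le> norm v" using n norm_remove_component[of v' i] by linarith
      moreover have "\<forall>j. j \<notin> S \<longrightarrow> ?w$j = 0" using z w by auto
      ultimately have 1: "\<bar>f (x + ?w) - f x - (\<Sum>j\<in>S. ?w$j * d j)\<bar> \<le> B * (\<Sum>j\<in>S. \<bar>?w$j\<bar>)"
        using insert.IH by blast
      obtain c where c: "\<bar>c\<bar> \<le> \<bar>v'$i\<bar>" "f (x + ?w + v'$i *\<^sub>R axis i 1) - f (x + ?w) =
         v'$i * partial i f (x + ?w + c *\<^sub>R axis i 1)"
        using partial_mvt[OF hp] by blast
      have "norm (?w + c *\<^sub>R axis i 1) \<le> norm v" using norm_remove_component_part[OF c(1)] n by linarith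
      then have "\<bar>partial i f (x + ?w + c *\<^sub>R axis i 1) - d i\<bar> \<le> B"
        by (intro B) (simp add: algebra_simps)
      then have "\<bar>v'$i\<bar> * \<bar>partial i f (x + ?w + c *\<^sub>R axis i 1) - d i\<bar> \<le> \<bar>v'$i\<bar> * B"
        by (intro mult_left_mono) auto
      then have "\<bar>v'$i * (partial i f (x + ?w + c *\<^sub>R axis i 1) - d i)\<bar> \<le> B * \<bar>v'$i\<bar>"
        by (simp only: abs_mult mult.commute)
      then have 2: "\<bar>f (x + v') - f (x + ?w) - v'$i * d i\<bar> \<le> B * \<bar>v'$i\<bar>"
        using c(2) by (simp add: algebra_simps)
      have S: "(\<Sum>j\<in>S. ?w$j * d j) = (\<Sum>j\<in>S. v'$j * d j)" "(\<Sum>j\<in>S. \<bar>?w$j\<bar>) = (\<Sum>j\<in>S. \<bar>v'$j\<bar>)"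
        using insert.hyps by (auto intro!: sum.cong simp: w simp del: vector_minus_component)
      show "\<bar>f (x + v') - f x - (\<Sum>j\<in>insert i S. v'$j * d j)\<bar> \<le> B * (\<Sum>j\<in>insert i S. \<bar>v'$j\<bar>)"
        using 1 2 insert.hyps unfolding S by (simp add: algebra_simps)
    qed
  qed
  from this[of UNIV] show ?thesis by simp
qed

lemma sum_abs_le_card_norm:
  fixes v :: "real^'n"
  shows "(\<Sum>i\<in>UNIV. \<bar>v$i\<bar>) \<le> CARD('n) * norm v"
  using sum_bounded_above[of UNIV "\<lambda>i. \<bar>v$i\<bar>" "norm v"] component_le_norm_cart[of v] by simp

lemma has_derivative_partials:
  fixes f :: "real^'n \<Rightarrow> real"
  assumes hp: "\<And>i. has_partial i f" and c: "\<And>i. isCont (partial i f) x"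
  shows "(f has_derivative (\<lambda>v. grad f x \<bullet> v)) (at x)"
proof (rule has_derivativeI_sandwich[where e=1])
  show "bounded_linear (\<lambda>v. grad f x \<bullet> v)" by (rule bounded_linear_inner_right)
  have ev: "\<forall>\<^sub>F y in at x. norm ((f y - f x - grad f x \<bullet> (y - x)) /\<^sub>R norm (y - x)) < e" if "e > 0" for e
  proof -
    \<comment> \<open>\<open>CARD('n)\<close> pays for passing from the sum of the components to the
      norm; the factor 2 leaves room for a strict inequality.\<close>
    define e' where "e' = e / (2 * real CARD('n))"
    have e': "e' > 0" unfolding e'_def using that by simp
    have "\<exists>d>0. \<forall>y. dist y x < d \<longrightarrow> \<bar>partial i f y - partial i f x\<bar> < e'" for i
      using c[of i] e' unfolding continuous_at_eps_delta dist_real_def by blast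
    then obtain d where d: "\<And>i. d i > 0" "\<And>i y. dist y x < d i \<Longrightarrow> \<bar>partial i f y - partial i f x\<bar> < e'"
      by metis
    let ?d = "Min (range d)"
    have "?d > 0" using d(1) by simp
    moreover have "norm ((f y - f x - grad f x \<bullet> (y - x)) /\<^sub>R norm (y - x)) < e"
      if "0 < dist y x" "dist y x < ?d" for y
    proof -
      have "\<bar>f (x + (y - x)) - f x - (\<Sum>i\<in>UNIV. (y - x)$i * partial i f x)\<bar> \<le> e' * (\<Sum>i\<in>UNIV. \<bar>(y - x)$i\<bar>)"
      proof (rule partial_increment[OF hp])
        fix i z assume "norm (z - x) \<le> norm (y - x)"
        then have "dist z x < d i" using that(2) by (simp add: dist_norm) (meson le_less_trans rangeI)
        then show "\<bar>partial i f z - partial i f x\<bar> \<le> e'" using d(2) by (simp add: less_imp_le)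
      qed
      also have "\<dots> \<le> e' * (CARD('n) * norm (y - x))"
        using sum_abs_le_card_norm[of "y - x"] e' by (intro mult_left_mono) auto
      also have "\<dots> = e / 2 * norm (y - x)" unfolding e'_def by (simp add: field_simps)
      finally have "\<bar>f y - f x - grad f x \<bullet> (y - x)\<bar> \<le> e / 2 * norm (y - x)"
        by (simp add: grad_def inner_vec_def mult.commute)
      moreover have "e / 2 * norm (y - x) < e * norm (y - x)" using that(1) \<open>e > 0\<close> by (simp add: dist_norm)
      ultimately have "\<bar>f y - f x - grad f x \<bullet> (y - x)\<bar> < e * norm (y - x)" by linarith
      then show ?thesis using that(1) by (simp add: field_simps dist_norm)
    qed
    ultimately show ?thesis unfolding eventually_at by (intro exI[of _ ?d]) simp
  qed
  show "((\<lambda>y. norm (f y - f x - grad f x \<bullet> (y - x)) / norm (y - x)) \<longlongrightarrow> 0) (at x within UNIV)"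
    using ev by (auto simp: tendsto_iff dist_real_def divide_inverse mult.commute abs_mult)
qed auto

text \<open>\<open>partial_increment\<close> with \<open>d = 0\<close>. Applied to the first
  partials of the drift, it turns bounded second partials into continuity of the first ones.\<close>

lemma lipschitz_bounded_partials:
  fixes f :: "real^'n \<Rightarrow> real"
  assumes hp: "\<And>i. has_partial i f" and B: "\<And>i. bounded (range (partial i f))"
  shows "\<exists>L\<ge>0. L-lipschitz_on UNIV f"
proof -
  have "\<exists>B. \<forall>y. \<bar>partial i f y\<bar> \<le> B" for i using B[of i] by (auto simp: bounded_iff)
  then obtain C where C: "\<And>i y. \<bar>partial i f y\<bar> \<le> C i" by metis
  let ?B = "Max (range C)"
  have m: "\<bar>partial i f y - 0\<bar> \<le> ?B" for i y using C[of i y] by (simp, meson Max_ge finite rangeI finite_imageI order_trans)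
  then have B0: "0 \<le> ?B" by (meson abs_ge_zero order_trans)
  have "\<bar>f x - f y\<bar> \<le> (?B * CARD('n)) * norm (x - y)" for x y
  proof -
    have "\<bar>f (y + (x - y)) - f y - (\<Sum>i\<in>UNIV. (x - y)$i * 0)\<bar> \<le> ?B * (\<Sum>i\<in>UNIV. \<bar>(x - y)$i\<bar>)"
      using m by (intro partial_increment[OF hp]) auto
    also have "\<dots> \<le> ?B * (CARD('n) * norm (x - y))" using sum_abs_le_card_norm[of "x - y"] B0 by (intro mult_left_mono) auto
    finally show ?thesis by simp
  qed
  then have "(?B * CARD('n))-lipschitz_on UNIV f"
    using B0 by (auto simp: lipschitz_on_def dist_norm)
  then show ?thesis using B0 by (metis lipschitz_on_nonneg)
qed

lemma test_function_C_k: "\<phi> \<in> test_functions \<Longrightarrow> C_k k \<phi>"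
  by (simp add: test_functions_def)

lemma test_function_has_partial: "\<phi> \<in> test_functions \<Longrightarrow> has_partial i \<phi>"
  using test_function_C_k[of \<phi> 1] by simp

lemma test_function_continuous: "\<phi> \<in> test_functions \<Longrightarrow> continuous_on A \<phi>"
  using test_function_C_k[of \<phi> 0] by (auto intro: continuous_on_subset)

lemma test_function_ball:
  assumes "\<phi> \<in> test_functions"
  obtains r where "r > 0" "\<And>x. r \<le> norm x \<Longrightarrow> \<phi> x = 0"
proof -
  have "bounded {x. \<phi> x \<noteq> 0}"
    using assms by (auto simp: test_functions_def intro: bounded_closure_image compact_imp_bounded bounded_subset[OF _ closure_subset])
  then obtain r where "r > 0" "\<And>x. \<phi> x \<noteq> 0 \<Longrightarrow> norm x < r" by (auto simp: bounded_pos_less)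
  then show ?thesis using that[of r] by force
qed

lemma test_functionI:
  assumes "\<And>k. C_k k \<phi>" "\<And>x. r \<le> norm x \<Longrightarrow> \<phi> x = 0"
  shows "\<phi> \<in> test_functions"
proof -
  have "{x. \<phi> x \<noteq> 0} \<subseteq> cball 0 r" using assms(2) by (auto simp: not_le[symmetric]) (meson linear)
  then have "bounded (closure {x. \<phi> x \<noteq> 0})" using bounded_cball bounded_closure bounded_subset by blast
  then show ?thesis using assms(1) by (simp add: test_functions_def compact_eq_bounded_closed)
qed

text \<open>The inequality is strict because the derivative is read off a neighbourhood of
  \<open>x\<close>. This is why supports of derivatives are often placed in the ball of radius
  \<open>r + 1\<close> later on.\<close>

lemma partial_eq_0_outside:
  assumes z: "\<And>x. r < norm x \<Longrightarrow> f x = 0" and x: "r < norm (x::real^'n)"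
  shows "partial i f x = 0"
proof -
  have "\<forall>\<^sub>F h in nhds 0. r < norm (x + h *\<^sub>R axis i 1)"
  proof -
    have "((\<lambda>h. norm (x + h *\<^sub>R axis i 1)) \<longlongrightarrow> norm (x + 0 *\<^sub>R axis i 1)) (nhds 0)"
      by (intro tendsto_intros filterlim_ident)
    then show ?thesis using x by (intro order_tendstoD(1)) auto
  qed
  then have "\<forall>\<^sub>F h in nhds 0. f (x + h *\<^sub>R axis i 1) = 0"
    by eventually_elim (rule z)
  then have "deriv (\<lambda>h. f (x + h *\<^sub>R axis i 1)) 0 = deriv (\<lambda>_. 0) 0"
    by (intro deriv_cong_ev) auto
  then show ?thesis by (simp add: partial_def)
qed

lemma partial_test_function:
  assumes "\<phi> \<in> test_functions"
  shows "partial i \<phi> \<in> test_functions"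
proof -
  obtain r where r: "r > 0" "\<And>x. r \<le> norm x \<Longrightarrow> \<phi> x = 0" using test_function_ball[OF assms] by blast
  show ?thesis
  proof (rule test_functionI[where r="r+1"])
    show "C_k k (partial i \<phi>)" for k using test_function_C_k[OF assms, of "Suc k"] by simp
    show "partial i \<phi> x = 0" if "r + 1 \<le> norm x" for x
      by (rule partial_eq_0_outside[where r=r]) (use r that in auto)
  qed
qed

lemma compact_support_bounded:
  fixes f :: "real^'n \<Rightarrow> real"
  assumes "continuous_on UNIV f" "\<And>x. r \<le> norm x \<Longrightarrow> f x = 0"
  obtains B where "B > 0" "\<And>x. \<bar>f x\<bar> \<le> B"
proof -
  have "compact (f ` cball 0 r)" by (intro compact_continuous_image) (auto intro: continuous_on_subset[OF assms(1)])
  then obtain B where "B > 0" "\<And>x. norm x \<le> r \<Longrightarrow> \<bar>f x\<bar> \<le> B"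
    using compact_imp_bounded[of "f ` cball 0 r"] by (auto simp: bounded_pos)
  then show ?thesis using that[of B] assms(2) by (metis abs_zero less_imp_le linear)
qed

lemma test_function_bounded:
  assumes "\<phi> \<in> test_functions"
  obtains B where "B > 0" "\<And>x. \<bar>\<phi> x\<bar> \<le> B"
  using test_function_ball[OF assms] compact_support_bounded[OF test_function_continuous[OF assms]] by metis

lemma test_function_lipschitz:
  assumes "\<phi> \<in> test_functions"
  shows "\<exists>L\<ge>0. L-lipschitz_on UNIV \<phi>"
proof (rule lipschitz_bounded_partials)
  show "has_partial i \<phi>" for i using test_function_has_partial[OF assms] .
  show "bounded (range (partial i \<phi>))" for i
    using test_function_bounded[OF partial_test_function[OF assms, of i]] unfolding bounded_iff
    by (metis (no_types, lifting) rangeE real_norm_def)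
qed

section \<open>Integrals of compactly supported functions\<close>

lemma integrable_indicator_cball: "integrable lborel (indicator (cball c r) :: 'a::euclidean_space \<Rightarrow> real)"
proof (rule integrable_real_indicator)
  show "emeasure lborel (cball c r) < \<infinity>" by (rule emeasure_lborel_cball_finite)
qed simp

lemma integrable_compact_support_bounded:
  fixes f :: "real^'n \<Rightarrow> real"
  assumes "f \<in> borel_measurable borel" "\<And>x. r \<le> norm x \<Longrightarrow> f x = 0" "\<And>x. \<bar>f x\<bar> \<le> B"
  shows "integrable lborel f"
proof (rule Bochner_Integration.integrable_bound)
  show "integrable lborel (\<lambda>x. B * indicator (cball 0 r) x :: real)"
    by (intro integrable_mult_right integrable_indicator_cball)
  have "0 \<le> B" using assms(3)[of 0] by linarith
  then show "AE x in lborel. norm (f x) \<le> norm (B * indicator (cball 0 r) x :: real)"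
    using assms(2,3) by (auto simp: indicator_def)
qed (use assms in auto)

lemma integrable_continuous_compact_support:
  fixes f :: "real^'n \<Rightarrow> real"
  assumes c: "continuous_on UNIV f" and r: "\<And>x. r \<le> norm x \<Longrightarrow> f x = 0"
  shows "integrable lborel f"
proof -
  obtain B where "B > 0" "\<And>x. \<bar>f x\<bar> \<le> B" using compact_support_bounded[OF c r] by metis
  then show ?thesis using r borel_measurable_continuous_onI[OF c]
    by (intro integrable_compact_support_bounded) auto
qed

lemma test_function_integrable:
  fixes \<phi> :: "real^'n \<Rightarrow> real"
  assumes \<phi>: "\<phi> \<in> test_functions" shows "integrable lborel \<phi>"
  using test_function_ball[OF \<phi>] integrable_continuous_compact_support[OF test_function_continuous[OF \<phi>]] by metis

lemma integral_translate:
  fixes f :: "'a::euclidean_space \<Rightarrow> real"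
  assumes "f \<in> borel_measurable borel"
  shows "(LINT x|lborel. f (x + a)) = (LINT x|lborel. f x)"
proof -
  have "(LINT x|lborel. f x) = (LINT x|distr lborel borel ((+) a). f x)"
    by (simp add: lborel_distr_plus)
  also have "\<dots> = (LINT x|lborel. f (a + x))" using assms by (subst integral_distr) auto
  finally show ?thesis by (simp add: add.commute)
qed

lemma integrable_translate:
  fixes f :: "'a::euclidean_space \<Rightarrow> real"
  assumes "integrable lborel f"
  shows "integrable lborel (\<lambda>x. f (x + a))"
proof -
  have "integrable (distr lborel borel ((+) a)) f" using assms by (simp add: lborel_distr_plus)
  then show ?thesis by (subst (asm) integrable_distr_eq) (use assms in \<open>auto simp: add.commute dest: borel_measurable_integrable\<close>)
qed

text \<open>Difference quotients have integral zero by translation invariance, and the Lipschitz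
  bound dominates them, so the limit may be taken under the integral. The argument also supplies the
  measurability of the partial derivative, as a pointwise limit.\<close>

lemma integral_partial_eq_0:
  fixes f :: "real^'n \<Rightarrow> real"
  assumes hp: "has_partial i f" and lip: "L-lipschitz_on UNIV f" and r: "\<And>x. r \<le> norm x \<Longrightarrow> f x = 0"
  shows "(LINT x|lborel. partial i f x) = 0"
proof -
  have cont: "continuous_on UNIV f" using lip by (rule lipschitz_on_continuous_on)
  have int: "integrable lborel f" by (rule integrable_continuous_compact_support[OF cont r])
  have fm: "f \<in> borel_measurable borel" by (rule borel_measurable_continuous_onI[OF cont])
  let ?h = "\<lambda>n. inverse (real (Suc n))"
  let ?q = "\<lambda>n x. (f (x + ?h n *\<^sub>R axis i 1) - f x) / ?h n"
  have z: "(LINT x|lborel. ?q n x) = 0" for n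
    using int integrable_translate[OF int] by (simp add: integral_translate[OF fm])
  have h0: "?h \<longlonglongrightarrow> 0" using LIMSEQ_inverse_real_of_nat by simp
  have "(\<lambda>n. LINT x|lborel. ?q n x) \<longlonglongrightarrow> (LINT x|lborel. partial i f x)"
  proof (rule integral_dominated_convergence)
    \<comment> \<open>The steps \<open>?h n\<close> are at most 1, so every difference quotient
      vanishes outside the ball of radius \<open>r + 1\<close>.\<close>
    show "integrable lborel (\<lambda>x::real^'n. L * indicator (cball 0 (r+1)) x :: real)"
      by (intro integrable_mult_right integrable_indicator_cball)
    have lim: "(\<lambda>n. ?q n x) \<longlonglongrightarrow> partial i f x" for x
    proof -
      have "((\<lambda>h. (f (x + h *\<^sub>R axis i 1) - f x) / h) \<longlongrightarrow> partial i f x) (at 0)"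
        using has_partial_real_derivative[OF hp, of x 0] by (simp add: DERIV_def)
      then show ?thesis
        by (rule filterlim_compose) (use h0 in \<open>auto simp: filterlim_at\<close>)
    qed
    then show "AE x in lborel. (\<lambda>n. ?q n x) \<longlonglongrightarrow> partial i f x" by simp
    show "(\<lambda>x. ?q n x) \<in> borel_measurable lborel" for n using fm by measurable
    show "partial i f \<in> borel_measurable lborel"
      by (rule borel_measurable_LIMSEQ_metric[where f="?q"]) (use fm lim in auto)
    have "\<bar>?q n x\<bar> \<le> L * indicator (cball 0 (r+1)) x" for n x
    proof (cases "norm x \<le> r + 1")
      case True
      have "\<bar>f (x + ?h n *\<^sub>R axis i 1) - f x\<bar> \<le> L * ?h n"
        using lipschitz_onD[OF lip, of "x + ?h n *\<^sub>R axis i 1" x] by (simp add: dist_norm norm_axis_1)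
      then show ?thesis using True by (simp add: abs_divide pos_divide_le_eq)
    next
      case False
      have "norm x \<le> norm (x + ?h n *\<^sub>R axis i 1) + norm (?h n *\<^sub>R axis i (1::real))"
        by (metis add_diff_cancel norm_triangle_ineq4)
      moreover have "norm (?h n *\<^sub>R (axis i 1::real^'n)) \<le> 1" by (simp add: norm_axis_1 inverse_le_1_iff)
      ultimately have "r \<le> norm (x + ?h n *\<^sub>R axis i 1)" "r \<le> norm x" using False by linarith+
      then show ?thesis using r False by simp
    qed
    then show "AE x in lborel. norm (?q n x) \<le> L * indicator (cball 0 (r+1)) x" for n by simp
  qed
  then show ?thesis using z LIMSEQ_unique[OF _ tendsto_const] by (simp add: LIMSEQ_unique)
qed

section \<open>Algebra of partial derivatives, smoothness classes and test functions\<close>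

lemma partial_add:
  assumes "has_partial i f" "has_partial i g"
  shows "has_partial i (\<lambda>x. f x + g x)" "partial i (\<lambda>x. f x + g x) = (\<lambda>x. partial i f x + partial i g x)"
proof -
  have "((\<lambda>h. f (x + h *\<^sub>R axis i 1) + g (x + h *\<^sub>R axis i 1)) has_real_derivative partial i f x + partial i g x) (at 0)" for x
    using has_partial_real_derivative[OF assms(1), of x 0] has_partial_real_derivative[OF assms(2), of x 0]
    by (auto intro: DERIV_add)
  from has_partialI[OF this] show "has_partial i (\<lambda>x. f x + g x)" 
    "partial i (\<lambda>x. f x + g x) = (\<lambda>x. partial i f x + partial i g x)" by auto
qed

lemma partial_mult:
  assumes "has_partial i f" "has_partial i g"
  shows "has_partial i (\<lambda>x. f x * g x)" "partial i (\<lambda>x. f x * g x) = (\<lambda>x. partial i f x * g x + f x * partial i g x)"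
proof -
  have "((\<lambda>h. f (x + h *\<^sub>R axis i 1) * g (x + h *\<^sub>R axis i 1)) has_real_derivative partial i f x * g x + f x * partial i g x) (at 0)" for x
    using DERIV_mult[OF has_partial_real_derivative[OF assms(1), of x 0] has_partial_real_derivative[OF assms(2), of x 0]]
    by (simp add: algebra_simps)
  from has_partialI[OF this] show "has_partial i (\<lambda>x. f x * g x)" 
    "partial i (\<lambda>x. f x * g x) = (\<lambda>x. partial i f x * g x + f x * partial i g x)" by auto
qed

lemma partial_const: "has_partial i (\<lambda>x. c)" "partial i (\<lambda>x. c) = (\<lambda>x. 0)"
proof -
  have "((\<lambda>h. c) has_real_derivative 0) (at 0)" by simp
  from has_partialI[where f="\<lambda>x. c" and g="\<lambda>x. 0", OF this]
  show "has_partial i (\<lambda>x. c)" "partial i (\<lambda>x. c) = (\<lambda>x. 0)" by auto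
qed

lemma partial_cmult:
  assumes "has_partial i f"
  shows "has_partial i (\<lambda>x. c * f x)" "partial i (\<lambda>x. c * f x) = (\<lambda>x. c * partial i f x)"
  using partial_mult[OF partial_const(1) assms, of c] by (auto simp: partial_const)

lemma partial_sum:
  assumes "\<And>j. j \<in> S \<Longrightarrow> has_partial i (f j)" "finite S"
  shows "has_partial i (\<lambda>x. \<Sum>j\<in>S. f j x) \<and> partial i (\<lambda>x. \<Sum>j\<in>S. f j x) = (\<lambda>x. \<Sum>j\<in>S. partial i (f j) x)"
  using assms(2,1)
proof (induction S)
  case empty then show ?case by (simp add: partial_const)
next
  case (insert j S)
  then show ?case using partial_add[of i "f j" "\<lambda>x. \<Sum>j\<in>S. f j x"] by simp
qed

lemma partial_lincomb:
  assumes "\<And>j. has_partial i (f j)"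
  shows "has_partial i (\<lambda>x. \<Sum>j\<in>UNIV. c j * f (j::'m::finite) x)"
    "partial i (\<lambda>x. \<Sum>j\<in>UNIV. c j * f j x) = (\<lambda>x. \<Sum>j\<in>UNIV. c j * partial i (f j) x)"
  using partial_sum[of UNIV i "\<lambda>j x. c j * f j x"] partial_cmult(1)[OF assms]
  by (simp_all add: partial_cmult(2)[OF assms])

lemma C_k_const: "C_k k (\<lambda>x. c)"
  by (induction k arbitrary: c) (auto simp: partial_const)

lemma C_k_add: "C_k k f \<Longrightarrow> C_k k g \<Longrightarrow> C_k k (\<lambda>x. f x + g x)"
proof (induction k arbitrary: f g)
  case 0
  then show ?case by (simp add: continuous_on_add)
next
  case (Suc k)
  have "C_k k (partial i (\<lambda>x. f x + g x))" "has_partial i (\<lambda>x. f x + g x)" for i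
    using Suc.IH[of "partial i f" "partial i g"] Suc.prems by (simp_all add: partial_add)
  moreover have "continuous_on UNIV (\<lambda>x. f x + g x)"
    using Suc.prems by (intro continuous_on_add) auto
  ultimately show ?case by simp
qed

lemma C_k_cmult: "C_k k f \<Longrightarrow> C_k k (\<lambda>x. c * f x)"
proof (induction k arbitrary: f)
  case 0
  then show ?case by (simp add: continuous_on_mult_left)
next
  case (Suc k)
  have "C_k k (partial i (\<lambda>x. c * f x))" "has_partial i (\<lambda>x. c * f x)" for i
    using Suc.IH[of "partial i f"] Suc.prems by (simp_all add: partial_cmult)
  moreover have "continuous_on UNIV (\<lambda>x. c * f x)"
    using Suc.prems by (intro continuous_on_mult_left) auto
  ultimately show ?case by simp
qed

lemma C_k_sum:
  assumes f: "\<And>j. C_k k (f j)" and "finite S"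
  shows "C_k k (\<lambda>x. \<Sum>j\<in>S. f j x)"
  using assms(2)
proof (induction S)
  case empty
  show ?case by (simp add: C_k_const)
next
  case (insert j S)
  show ?case using C_k_add[OF f[of j] insert.IH] insert.hyps by simp
qed

lemma test_function_sum:
  assumes "\<And>j. f j \<in> test_functions" "finite S"
  shows "(\<lambda>x. \<Sum>j\<in>S. f j x) \<in> test_functions"
proof -
  have "\<exists>r. \<forall>x. r \<le> norm x \<longrightarrow> f j x = 0" if "j \<in> S" for j
    using test_function_ball[OF assms(1)] by metis
  then obtain r where r: "\<And>j x. j \<in> S \<Longrightarrow> r j \<le> norm x \<Longrightarrow> f j x = 0" by metis
  show ?thesis
  proof (rule test_functionI[where r="Max (insert 0 (r ` S))"])
    show "C_k k (\<lambda>x. \<Sum>j\<in>S. f j x)" for k using assms test_function_C_k by (intro C_k_sum) auto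
    show "(\<Sum>j\<in>S. f j x) = 0" if "Max (insert 0 (r ` S)) \<le> norm x" for x
      using that assms(2) by (intro sum.neutral) (auto intro: r)
  qed
qed

lemma test_function_cmult:
  assumes "\<phi> \<in> test_functions" shows "(\<lambda>x. c * \<phi> x) \<in> test_functions"
proof -
  obtain r where "\<And>x. r \<le> norm x \<Longrightarrow> \<phi> x = 0" using test_function_ball[OF assms] by blast
  then show ?thesis using test_function_C_k[OF assms] by (intro test_functionI[where r=r] C_k_cmult) auto
qed

section \<open>Directional derivatives and Taylor expansion of test functions\<close>

lemma grad_inner: "grad f x \<bullet> z = (\<Sum>i\<in>UNIV. z$i * partial i f x)"
  by (simp add: grad_def inner_vec_def mult.commute)

lemma grad_inner_test_function:
  assumes "\<phi> \<in> test_functions" shows "(\<lambda>x. grad \<phi> x \<bullet> z) \<in> test_functions"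
  unfolding grad_inner by (intro test_function_sum test_function_cmult partial_test_function assms) auto

lemma test_function_has_derivative:
  assumes "\<phi> \<in> test_functions" shows "(\<phi> has_derivative (\<lambda>v. grad \<phi> x \<bullet> v)) (at x)"
proof (rule has_derivative_partials)
  show "isCont (partial i \<phi>) x" for i
    using test_function_continuous[OF partial_test_function[OF assms], of UNIV]
    by (simp add: continuous_on_eq_continuous_at)
qed (rule test_function_has_partial[OF assms])

lemma test_function_line_derivative:
  assumes "\<phi> \<in> test_functions"
  shows "((\<lambda>s. \<phi> (y + s *\<^sub>R z)) has_real_derivative grad \<phi> (y + s *\<^sub>R z) \<bullet> z) (at s)"
proof -
  have "((\<lambda>s. y + s *\<^sub>R z) has_derivative (\<lambda>r. r *\<^sub>R z)) (at s)"
    by (auto intro!: derivative_eq_intros)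
  from has_derivative_compose[OF this test_function_has_derivative[OF assms]]
  moreover have "(\<lambda>r. grad \<phi> (y + s *\<^sub>R z) \<bullet> (r *\<^sub>R z)) = (*) (grad \<phi> (y + s *\<^sub>R z) \<bullet> z)"
    by (auto simp: mult.commute)
  ultimately show ?thesis by (simp only: has_field_derivative_def)
qed

lemma grad_grad_inner:
  assumes "\<phi> \<in> test_functions"
  shows "grad (\<lambda>x. grad \<phi> x \<bullet> z) x \<bullet> z = z \<bullet> (hessian \<phi> x *v z)"
proof -
  have "partial i (\<lambda>x. grad \<phi> x \<bullet> z) = (\<lambda>x. \<Sum>j\<in>UNIV. z$j * partial i (partial j \<phi>) x)" for i
    unfolding grad_inner
    by (rule partial_lincomb) (rule test_function_has_partial[OF partial_test_function[OF assms]])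
  then show ?thesis
    unfolding grad_inner[of "\<lambda>x. grad \<phi> x \<bullet> z"]
    by (simp add: inner_vec_def matrix_vector_mult_def hessian_def mult.commute)
qed

lemma test_function_taylor:
  fixes \<phi> :: "real^'n \<Rightarrow> real"
  assumes \<phi>: "\<phi> \<in> test_functions"
  obtains C where "C \<ge> 0" "\<And>y z. \<bar>\<phi> (y + z) - \<phi> y - grad \<phi> y \<bullet> z - (1/2) * (z \<bullet> (hessian \<phi> y *v z))\<bar> \<le> C * norm z ^ 3"
proof -
  have "\<exists>B\<ge>0. \<forall>x. \<bar>partial i (partial j (partial k \<phi>)) x\<bar> \<le> B" for i j k
    using test_function_bounded[OF partial_test_function[OF partial_test_function[OF partial_test_function[OF \<phi>]]]]
    by (metis less_imp_le)
  then obtain B where B: "\<And>i j k. B i j k \<ge> 0" "\<And>i j k x. \<bar>partial i (partial j (partial k \<phi>)) x\<bar> \<le> B i j k" by metis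
  define C where "C = (\<Sum>i\<in>UNIV. \<Sum>j\<in>UNIV. \<Sum>k\<in>UNIV. B i j k)"
  have C0: "C \<ge> 0" unfolding C_def by (intro sum_nonneg B)
  have "\<bar>\<phi> (y + z) - \<phi> y - grad \<phi> y \<bullet> z - (1/2) * (z \<bullet> (hessian \<phi> y *v z))\<bar> \<le> C * norm z ^ 3" for y z
  proof -
    \<comment> \<open>\<open>D\<close> is the derivative in the direction \<open>z\<close>. It maps
      test functions to test functions, so its powers are the successive derivatives of \<phi> along
      the line, and the one-dimensional Taylor formula applies.\<close>
    define D where "D f = (\<lambda>x. grad f x \<bullet> z)" for f :: "real^'n \<Rightarrow> real"
    have tD: "(D ^^ m) \<phi> \<in> test_functions" for m
      by (induction m) (auto simp: \<phi> D_def intro: grad_inner_test_function)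
    have der: "DERIV (\<lambda>s. (D ^^ m) \<phi> (y + s *\<^sub>R z)) s :> (D ^^ Suc m) \<phi> (y + s *\<^sub>R z)" for m s
      using test_function_line_derivative[OF tD[of m], where y=y and z=z and s=s] by (simp add: D_def)
    obtain t where t: "\<bar>t\<bar> \<le> \<bar>1\<bar>" "\<phi> (y + 1 *\<^sub>R z) = (\<Sum>m<3. (D ^^ m) \<phi> (y + 0 *\<^sub>R z) / fact m * 1 ^ m) + (D ^^ 3) \<phi> (y + t *\<^sub>R z) / fact 3 * 1 ^ 3"
      using Maclaurin_all_le[where diff="\<lambda>m s. (D ^^ m) \<phi> (y + s *\<^sub>R z)" and f="\<lambda>s. \<phi> (y + s *\<^sub>R z)" and x=1 and n=3] der by auto
    have "(D ^^ 2) \<phi> y = z \<bullet> (hessian \<phi> y *v z)"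
      using grad_grad_inner[OF \<phi>] by (simp add: D_def numeral_2_eq_2)
    then have e: "\<phi> (y + z) - \<phi> y - grad \<phi> y \<bullet> z - (1/2) * (z \<bullet> (hessian \<phi> y *v z)) = (D ^^ 3) \<phi> (y + t *\<^sub>R z) / 6"
      using t(2) by (simp add: eval_nat_numeral D_def)
    have hp: "has_partial i (partial j \<phi>)" "has_partial i (partial k (partial j \<phi>))" for i j k
      by (auto intro!: test_function_has_partial partial_test_function \<phi>)
    have D1: "D \<phi> = (\<lambda>x. \<Sum>k\<in>UNIV. z$k * partial k \<phi> x)" by (simp add: D_def grad_inner)
    have p1: "partial j (D \<phi>) = (\<lambda>x. \<Sum>k\<in>UNIV. z$k * partial j (partial k \<phi>) x)" for j
      unfolding D1 by (rule partial_lincomb[OF hp(1)])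
    have D2: "D (D \<phi>) = (\<lambda>x. \<Sum>j\<in>UNIV. z$j * (\<Sum>k\<in>UNIV. z$k * partial j (partial k \<phi>) x))"
      unfolding D_def[of "D \<phi>"] grad_inner p1 ..
    have p2: "partial i (D (D \<phi>)) = (\<lambda>x. \<Sum>j\<in>UNIV. z$j * (\<Sum>k\<in>UNIV. z$k * partial i (partial j (partial k \<phi>)) x))" for i
      unfolding D2 partial_lincomb(2)[OF partial_lincomb(1)[OF hp(2)]] partial_lincomb(2)[OF hp(2)] ..
    have D3: "(D ^^ 3) \<phi> x = (\<Sum>i\<in>UNIV. \<Sum>j\<in>UNIV. \<Sum>k\<in>UNIV. z$i * z$j * z$k * partial i (partial j (partial k \<phi>)) x)" for x
      by (simp add: eval_nat_numeral D_def[of "D (D \<phi>)"] grad_inner p2 sum_distrib_left mult.assoc)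
    have "\<bar>z$i * z$j * z$k * partial i (partial j (partial k \<phi>)) x\<bar> \<le> norm z ^ 3 * B i j k" for i j k x
      unfolding abs_mult power3_eq_cube
      by (intro mult_mono B component_le_norm_cart mult_nonneg_nonneg) (auto simp: component_le_norm_cart)
    then have "\<bar>(D ^^ 3) \<phi> x\<bar> \<le> (\<Sum>i\<in>UNIV. \<Sum>j\<in>UNIV. \<Sum>k\<in>UNIV. norm z ^ 3 * B i j k)" for x
      unfolding D3 by (intro order_trans[OF sum_abs] sum_mono)
    then have "\<bar>(D ^^ 3) \<phi> x\<bar> \<le> C * norm z ^ 3" for x
      unfolding C_def sum_distrib_left[symmetric] by (metis mult.commute)
    moreover have "\<bar>a / 6\<bar> \<le> b" if "\<bar>a\<bar> \<le> b" for a b :: real using that by (simp add: abs_divide)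
    ultimately show ?thesis unfolding e by blast
  qed
  then show ?thesis using that C0 by blast
qed

text \<open>Where neither \<open>y\<close> nor \<open>y + z\<close> lies in the supporting ball, the
  whole expansion vanishes. The two indicators record this and make the remainder integrable in
  \<open>y\<close>, with an integral that depends on \<open>z\<close> only through
  \<open>norm z ^ 3\<close>; this permits testing against functions that are merely bounded.\<close>

lemma test_function_taylor_local:
  fixes \<phi> :: "real^'n \<Rightarrow> real"
  assumes \<phi>: "\<phi> \<in> test_functions"
  obtains C r where "C \<ge> 0" "\<And>y z. \<bar>\<phi> (y + z) - \<phi> y - grad \<phi> y \<bullet> z - (1/2) * (z \<bullet> (hessian \<phi> y *v z))\<bar>
     \<le> C * norm z ^ 3 * (indicator (cball 0 r) y + indicator (cball 0 r) (y + z))"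
proof -
  obtain C where C: "C \<ge> 0" "\<And>y z. \<bar>\<phi> (y + z) - \<phi> y - grad \<phi> y \<bullet> z - (1/2) * (z \<bullet> (hessian \<phi> y *v z))\<bar> \<le> C * norm z ^ 3"
    using test_function_taylor[OF \<phi>] by metis
  obtain r where r: "r > 0" "\<And>x. r \<le> norm x \<Longrightarrow> \<phi> x = 0" using test_function_ball[OF \<phi>] by blast
  have p0: "partial i \<phi> x = 0" if "r < norm x" for i x
    by (rule partial_eq_0_outside[where r=r]) (use r that in auto)
  have p1: "partial j (partial i \<phi>) x = 0" if "r < norm x" for i j x
    by (rule partial_eq_0_outside[where r=r]) (use p0 that in auto)
  show ?thesis
  proof (rule that[of C r])
    fix y z :: "real^'n"
    have z3: "0 \<le> C * norm z ^ 3" using C(1) by simp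
    show "\<bar>\<phi> (y + z) - \<phi> y - grad \<phi> y \<bullet> z - (1/2) * (z \<bullet> (hessian \<phi> y *v z))\<bar>
     \<le> C * norm z ^ 3 * (indicator (cball 0 r) y + indicator (cball 0 r) (y + z))"
    proof (cases "norm y \<le> r \<or> norm (y + z) \<le> r")
      case True
      then have "1 \<le> (indicator (cball 0 r) y + indicator (cball 0 r) (y + z) :: real)" by (auto simp: indicator_def)
      then have "C * norm z ^ 3 * 1 \<le> C * norm z ^ 3 * (indicator (cball 0 r) y + indicator (cball 0 r) (y + z))"
        using z3 by (intro mult_left_mono) auto
      then show ?thesis using C(2)[of y z] by linarith
    next
      case False
      then have "grad \<phi> y = 0" "hessian \<phi> y = 0" "\<phi> y = 0" "\<phi> (y+z) = 0"
        using p0 p1 r(2) by (auto simp: grad_def hessian_def vec_eq_iff not_le less_imp_le)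
      then show ?thesis using z3 by simp
    qed
  qed (rule C)
qed

section \<open>Gaussian measures\<close>

text \<open>Lebesgue measure on \<open>real^'n\<close> is the image of a product measure indexed by
  the basis vectors. The map \<open>e\<close> identifies the index \<open>i\<close> with
  \<open>axis i 1\<close>, and the product formula for integrals is transported along it.\<close>

lemma integral_lborel_vec_prod:
  fixes f :: "'n::finite \<Rightarrow> real \<Rightarrow> real"
  assumes f: "\<And>i. integrable lborel (f i)"
  shows "integrable lborel (\<lambda>y::real^'n. \<Prod>i\<in>UNIV. f i (y$i))"
    "(LINT y|lborel. (\<Prod>i\<in>UNIV. f i ((y::real^'n)$i))) = (\<Prod>i\<in>UNIV. LINT s|lborel. f i s)"
proof -
  interpret product_sigma_finite "\<lambda>_::real^'n. lborel :: real measure" by standard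
  define e :: "'n \<Rightarrow> real^'n" where "e = (\<lambda>i. axis i 1)"
  have inj: "inj_on e UNIV" by (auto simp: e_def inj_on_def axis_eq_axis)
  have Be: "Basis = e ` UNIV" by (auto simp: Basis_vec_def e_def)
  define g where "g b = f (inv_into UNIV e b)" for b
  have ge: "g (e i) = f i" for i unfolding g_def using inj by simp
  let ?P = "\<Pi>\<^sub>M b\<in>(Basis::(real^'n) set). (lborel::real measure)"
  let ?T = "\<lambda>h::real^'n\<Rightarrow>real. \<Sum>b\<in>Basis. h b *\<^sub>R b"
  have T: "?T \<in> measurable ?P borel" by measurable
  have comp: "?T h $ i = h (e i)" for h i
  proof -
    have "?T h $ i = ?T h \<bullet> e i" by (simp add: e_def inner_axis)
    also have "\<dots> = h (e i)" by (subst inner_sum_left_Basis) (auto simp: Be)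
    finally show ?thesis .
  qed
  have m: "(\<lambda>y::real^'n. \<Prod>i\<in>UNIV. f i (y$i)) \<in> borel_measurable borel"
    using borel_measurable_integrable[OF f] by measurable
  have eq: "(\<Prod>i\<in>UNIV. f i (?T h $ i)) = (\<Prod>b\<in>Basis. g b (h b))" for h
    unfolding comp unfolding Be by (subst prod.reindex[OF inj]) (simp add: ge)
  have gi: "integrable lborel (g b)" for b unfolding g_def by (rule f)
  have "integrable ?P (\<lambda>h. \<Prod>b\<in>Basis. g b (h b))"
    by (rule product_integrable_prod) (auto simp: gi)
  then have "integrable (distr ?P borel ?T) (\<lambda>y::real^'n. \<Prod>i\<in>UNIV. f i (y$i))"
    by (subst integrable_distr_eq[OF T m]) (simp only: eq)
  then show "integrable lborel (\<lambda>y::real^'n. \<Prod>i\<in>UNIV. f i (y$i))" by (simp only: lborel_eq[where 'a="real^'n"])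
  have "(LINT y|lborel. (\<Prod>i\<in>UNIV. f i ((y::real^'n)$i))) = (LINT h|?P. (\<Prod>b\<in>Basis. g b (h b)))"
    unfolding lborel_eq[where 'a="real^'n"] by (subst integral_distr[OF T m]) (simp only: eq)
  also have "\<dots> = (\<Prod>b\<in>Basis. integral\<^sup>L lborel (g b))"
    by (rule product_integral_prod) (auto simp: gi)
  also have "\<dots> = (\<Prod>i\<in>UNIV. LINT s|lborel. f i s)"
    unfolding Be by (subst prod.reindex[OF inj]) (simp add: ge)
  finally show "(LINT y|lborel. (\<Prod>i\<in>UNIV. f i ((y::real^'n)$i))) = (\<Prod>i\<in>UNIV. LINT s|lborel. f i s)" .
qed

text \<open>The parameter is the variance, that is, the length of a time step. The form agrees with
  the density in \<open>wiener_process\<close>, so an increment of \<open>W\<close> over a time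
  \<open>h\<close> has law \<open>gauss h\<close>.\<close>

definition gauss_density :: "real \<Rightarrow> real^'n::finite \<Rightarrow> real" where
  "gauss_density h y = (\<Prod>i\<in>UNIV. normal_density 0 (sqrt h) (y $ i))"

definition gauss :: "real \<Rightarrow> (real^'n::finite) measure" where
  "gauss h = density lborel (\<lambda>y. ennreal (gauss_density h y))"

lemma gauss_density_nonneg: "0 \<le> gauss_density h y"
  unfolding gauss_density_def by (intro prod_nonneg) simp

lemma gauss_density_measurable [measurable]: "gauss_density h \<in> borel_measurable borel"
  unfolding gauss_density_def by measurable

lemma sets_gauss [simp, measurable_cong]: "sets (gauss h) = sets borel"
  by (simp add: gauss_def)

lemma space_gauss [simp]: "space (gauss h) = UNIV"
  by (simp add: gauss_def)

lemma integral_gauss: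
  fixes f :: "real^'n \<Rightarrow> real"
  assumes [measurable]: "f \<in> borel_measurable borel"
  shows "(LINT y|gauss h. f y) = (LINT y|lborel. gauss_density h y * f y)"
  unfolding gauss_def by (subst integral_density) (auto simp: gauss_density_nonneg)

lemma integrable_gauss:
  fixes f :: "real^'n \<Rightarrow> real"
  assumes [measurable]: "f \<in> borel_measurable borel"
  shows "integrable (gauss h) f \<longleftrightarrow> integrable lborel (\<lambda>y. gauss_density h y * f y)"
  unfolding gauss_def by (subst integrable_density) (auto simp: gauss_density_nonneg)

lemma gauss_prod:
  fixes f :: "'n::finite \<Rightarrow> real \<Rightarrow> real"
  assumes [measurable]: "\<And>i. f i \<in> borel_measurable borel"
    and f: "\<And>i. integrable lborel (\<lambda>s. normal_density 0 (sqrt h) s * f i s)"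
  shows "integrable (gauss h) (\<lambda>y::real^'n. \<Prod>i\<in>UNIV. f i (y$i))"
    "(LINT y|gauss h. (\<Prod>i\<in>UNIV. f i ((y::real^'n)$i))) = (\<Prod>i\<in>UNIV. LINT s|lborel. normal_density 0 (sqrt h) s * f i s)"
proof -
  have m: "(\<lambda>y::real^'n. \<Prod>i\<in>UNIV. f i (y$i)) \<in> borel_measurable borel" by measurable
  have e: "gauss_density h y * (\<Prod>i\<in>UNIV. f i (y$i)) = (\<Prod>i\<in>UNIV. normal_density 0 (sqrt h) (y$i) * f i (y$i))" for y :: "real^'n"
    by (simp add: gauss_density_def prod.distrib)
  show "integrable (gauss h) (\<lambda>y::real^'n. \<Prod>i\<in>UNIV. f i (y$i))"
    unfolding integrable_gauss[OF m] e using integral_lborel_vec_prod(1)[OF f] .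
  show "(LINT y|gauss h. (\<Prod>i\<in>UNIV. f i ((y::real^'n)$i))) = (\<Prod>i\<in>UNIV. LINT s|lborel. normal_density 0 (sqrt h) s * f i s)"
    unfolding integral_gauss[OF m] e using integral_lborel_vec_prod(2)[OF f] .
qed

lemma gauss_density_integral:
  assumes "h > 0"
  shows "integrable lborel (gauss_density h :: real^'n \<Rightarrow> real)" "(LINT y|lborel. gauss_density h (y::real^'n)) = 1"
  using integral_lborel_vec_prod[where f="\<lambda>_::'n. normal_density 0 (sqrt h)"] assms
  by (simp_all add: gauss_density_def[abs_def])

lemma prob_space_gauss:
  assumes "h > 0" shows "prob_space (gauss h :: (real^'n) measure)"
proof
  have "emeasure (gauss h :: (real^'n) measure) UNIV = (\<integral>\<^sup>+y. ennreal (gauss_density h (y::real^'n)) \<partial>lborel)"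
    unfolding gauss_def by (subst emeasure_density) auto
  also have "\<dots> = ennreal (LINT y|lborel. gauss_density h (y::real^'n))"
    by (rule nn_integral_eq_integral) (auto simp: gauss_density_nonneg gauss_density_integral[OF assms])
  finally show "emeasure (gauss h :: (real^'n) measure) (space (gauss h)) = 1"
    using gauss_density_integral[OF assms, where 'n='n] by simp
qed

lemma gauss_moment_1:
  assumes h: "h > 0"
  shows "integrable (gauss h) (\<lambda>y::real^'n. y$i)" "(LINT y|gauss h. (y::real^'n)$i) = 0"
proof -
  \<comment> \<open>All factors but the \<open>i\<close>-th are 1, so the product formula reduces
    the moment to a one-dimensional one.\<close>
  let ?f = "\<lambda>j s::real. if j = i then s else 1"
  have s: "sqrt h > 0" using h by simp
  have f: "integrable lborel (\<lambda>s. normal_density 0 (sqrt h) s * ?f j s)" for j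
    using integrable_normal_moment_nz_1[OF s, of 0] integrable_normal_density[OF s, of 0] by (cases "j = i") auto
  have e: "(\<Prod>j\<in>UNIV. ?f j (y$j)) = y$i" for y :: "real^'n" by simp
  have m: "?f j \<in> borel_measurable borel" for j by auto
  show "integrable (gauss h) (\<lambda>y::real^'n. y$i)" using gauss_prod(1)[where f="?f", OF m f] unfolding e .
  have "(LINT s|lborel. normal_density 0 (sqrt h) s * ?f i s) = 0"
    using integral_normal_moment_nz_1[OF s, of 0] by simp
  then have "(\<Prod>j\<in>UNIV. LINT s|lborel. normal_density 0 (sqrt h) s * ?f j s) = 0" by (intro prod_zero bexI[of _ i]) simp_all
  then show "(LINT y|gauss h. (y::real^'n)$i) = 0" using gauss_prod(2)[where f="?f", OF m f] unfolding e by simp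
qed

lemma normal_second_moment:
  assumes "0 < \<sigma>"
  shows "integrable lborel (\<lambda>s. normal_density 0 \<sigma> s * (s * s))" "(LINT s|lborel. normal_density 0 \<sigma> s * (s * s)) = \<sigma>\<^sup>2"
  using integrable_normal_moment[OF assms, of 0 2] integral_normal_moment_even[OF assms, of 0 1]
  by (simp_all add: power2_eq_square)

lemma gauss_moment_2:
  assumes h: "h > 0"
  shows "integrable (gauss h) (\<lambda>y::real^'n. y$i * y$j)" "(LINT y|gauss h. (y::real^'n)$i * y$j) = (if i = j then h else 0)"
proof -
  let ?f = "\<lambda>k s::real. (if k = i then s else 1) * (if k = j then s else 1)"
  have s: "sqrt h > 0" using h by simp
  note I = integrable_normal_moment_nz_1[OF s, of 0] integrable_normal_density[OF s, of 0] normal_second_moment[OF s]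
    integral_normal_moment_nz_1[OF s, of 0] integral_normal_density[OF s, of 0]
  have f: "integrable lborel (\<lambda>s. normal_density 0 (sqrt h) s * ?f k s)" for k
    using I by (cases "k = i"; cases "k = j") auto
  have e: "(\<Prod>k\<in>UNIV. ?f k (y$k)) = y$i * y$j" for y :: "real^'n" by (simp add: prod.distrib)
  have m: "?f k \<in> borel_measurable borel" for k by auto
  show "integrable (gauss h) (\<lambda>y::real^'n. y$i * y$j)" using gauss_prod(1)[where f="?f", OF m f] unfolding e .
  have "(\<Prod>k\<in>UNIV. LINT s|lborel. normal_density 0 (sqrt h) s * ?f k s) = (if i = j then h else 0)"
  proof (cases "i = j")
    case True
    have "(LINT s|lborel. normal_density 0 (sqrt h) s * ?f k s) = (if k = j then h else 1)" for k
      using I h True by (cases "k = j") auto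
    then show ?thesis using True by simp
  next
    case False
    then have "(LINT s|lborel. normal_density 0 (sqrt h) s * ?f i s) = 0" using I by simp
    then have "(\<Prod>k\<in>UNIV. LINT s|lborel. normal_density 0 (sqrt h) s * ?f k s) = 0" by (intro prod_zero bexI[of _ i]) simp_all
    then show ?thesis using False by simp
  qed
  then show "(LINT y|gauss h. (y::real^'n)$i * y$j) = (if i = j then h else 0)" using gauss_prod(2)[where f="?f", OF m f] unfolding e by simp
qed

lemma gauss_abs_moment:
  assumes h: "h > 0"
  shows "integrable (gauss h) (\<lambda>y::real^'n. \<bar>y$i\<bar> ^ (2*k+1))"
    "(LINT y|gauss h. \<bar>(y::real^'n)$i\<bar> ^ (2*k+1)) = 2 ^ k * fact k * sqrt (2 / pi) * sqrt h ^ (2*k+1)"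
proof -
  let ?f = "\<lambda>j s::real. if j = i then \<bar>s\<bar> ^ (2*k+1) else 1"
  have s: "sqrt h > 0" using h by simp
  have f: "integrable lborel (\<lambda>s. normal_density 0 (sqrt h) s * ?f j s)" for j
    using integrable_normal_moment_abs[OF s, of 0 "2*k+1"] integrable_normal_density[OF s, of 0] by (cases "j = i") auto
  have e: "(\<Prod>j\<in>UNIV. ?f j (y$j)) = \<bar>y$i\<bar> ^ (2*k+1)" for y :: "real^'n" by simp
  have m: "?f j \<in> borel_measurable borel" for j by auto
  show "integrable (gauss h) (\<lambda>y::real^'n. \<bar>y$i\<bar> ^ (2*k+1))" using gauss_prod(1)[where f="?f", OF m f] unfolding e .
  have v: "(LINT s|lborel. normal_density 0 (sqrt h) s * ?f j s) = (if j = i then 2 ^ k * fact k * sqrt (2 / pi) * sqrt h ^ (2*k+1) else 1)" for j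
    using integral_normal_moment_abs_odd[OF s, of 0 k] integral_normal_density[OF s, of 0] by (cases "j = i") (auto simp: mult_ac)
  show "(LINT y|gauss h. \<bar>(y::real^'n)$i\<bar> ^ (2*k+1)) = 2 ^ k * fact k * sqrt (2 / pi) * sqrt h ^ (2*k+1)"
    using gauss_prod(2)[where f="?f", OF m f] unfolding e v by simp
qed

lemma norm_power_le_sum_component:
  fixes y :: "real^'n"
  shows "norm y ^ m \<le> real CARD('n) ^ m * (\<Sum>i\<in>UNIV. \<bar>y$i\<bar> ^ m)"
proof -
  obtain j where j: "\<And>i. \<bar>y$i\<bar> \<le> \<bar>y$j\<bar>"
  proof -
    have "Max (range (\<lambda>i. \<bar>y$i\<bar>)) \<in> range (\<lambda>i. \<bar>y$i\<bar>)" by (intro Max_in) auto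
    then obtain j where "Max (range (\<lambda>i. \<bar>y$i\<bar>)) = \<bar>y$j\<bar>" by (elim rangeE)
    then show thesis using that[of j] by (metis Max_ge finite_imageI finite rangeI)
  qed
  have "norm y \<le> (\<Sum>i\<in>UNIV. \<bar>y$i\<bar>)" by (rule norm_le_l1_cart)
  also have "\<dots> \<le> CARD('n) * \<bar>y$j\<bar>" using sum_bounded_above[of UNIV "\<lambda>i. \<bar>y$i\<bar>" "\<bar>y$j\<bar>"] j by simp
  finally have "norm y ^ m \<le> (CARD('n) * \<bar>y$j\<bar>) ^ m" by (intro power_mono) auto
  also have "\<dots> \<le> real CARD('n) ^ m * (\<Sum>i\<in>UNIV. \<bar>y$i\<bar> ^ m)"
    unfolding power_mult_distrib by (intro mult_left_mono member_le_sum) auto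
  finally show ?thesis .
qed

text \<open>Odd moments appear only as sizes of errors: \<open>k = 0\<close> in
  \<open>noise_consistency_0\<close>, \<open>k = 1\<close> for the cubic Taylor remainder. What
  matters is the scaling in \<open>sqrt h\<close> with a constant free of \<open>h\<close>.\<close>

lemma gauss_norm_moment:
  obtains C where "C \<ge> 0" "\<And>h. h > 0 \<Longrightarrow> integrable (gauss h) (\<lambda>y::real^'n. norm y ^ (2*k+1))"
    "\<And>h. h > 0 \<Longrightarrow> (LINT y|gauss h. norm (y::real^'n) ^ (2*k+1)) \<le> C * sqrt h ^ (2*k+1)"
proof -
  let ?c = "2 ^ k * fact k * sqrt (2 / pi) :: real"
  let ?N = "real (CARD('n))"
  let ?b = "\<lambda>y::real^'n. ?N ^ (2*k+1) * (\<Sum>i\<in>UNIV. \<bar>y$i\<bar> ^ (2*k+1))"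
  have i1: "integrable (gauss h) ?b" if "h > 0" for h
    using gauss_abs_moment(1)[OF that] by (intro integrable_mult_right Bochner_Integration.integrable_sum)
  have i2: "integrable (gauss h) (\<lambda>y::real^'n. norm y ^ (2*k+1))" if "h > 0" for h
    by (rule Bochner_Integration.integrable_bound[OF i1[OF that]])
       (auto intro!: AE_I2 simp del: power_Suc simp: abs_of_nonneg sum_nonneg norm_power_le_sum_component)
  have "(LINT y|gauss h. norm (y::real^'n) ^ (2*k+1)) \<le> (?N ^ (2*k+1) * (?N * ?c)) * sqrt h ^ (2*k+1)" if h: "h > 0" for h
  proof -
    have "(LINT y|gauss h. norm (y::real^'n) ^ (2*k+1)) \<le> (LINT y|gauss h. ?b y)"
      by (rule integral_mono[OF i2[OF h] i1[OF h]]) (rule norm_power_le_sum_component)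
    also have "\<dots> = ?N ^ (2*k+1) * (\<Sum>i\<in>(UNIV::'n set). ?c * sqrt h ^ (2*k+1))"
      using gauss_abs_moment[OF h, where 'n='n, of _ k] by (simp del: power_Suc add: Bochner_Integration.integral_sum)
    finally show ?thesis by (simp add: mult_ac)
  qed
  then show ?thesis using that[of "?N ^ (2*k+1) * (?N * ?c)"] i2 by simp
qed

section \<open>Shifts of Gaussian measures\<close>

lemma gauss_density_shift:
  fixes a y :: "real^'n"
  assumes h: "h > 0"
  shows "gauss_density h (y - a) = gauss_density h y * exp (a \<bullet> y / h - (norm a)\<^sup>2 / (2*h))"
proof -
  have e: "normal_density 0 (sqrt h) (s - t) = normal_density 0 (sqrt h) s * exp (t * s / h - t\<^sup>2 / (2*h))" for s t :: real
  proof -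
    have "- (s - t)\<^sup>2 / (2 * h) = - s\<^sup>2 / (2 * h) + (t * s / h - t\<^sup>2 / (2*h))"
      using h by (simp add: field_simps power2_eq_square)
    then have "exp (- (s - t)\<^sup>2 / (2 * h)) = exp (- s\<^sup>2 / (2 * h)) * exp (t * s / h - t\<^sup>2 / (2*h))"
      by (simp only: exp_add)
    then show ?thesis using h by (simp add: normal_density_def)
  qed
  have "a \<bullet> y / h - (norm a)\<^sup>2 / (2*h) = (\<Sum>i\<in>UNIV. a$i * y$i / h - (a$i)\<^sup>2 / (2*h))"
    unfolding power2_norm_eq_inner by (simp add: inner_vec_def sum_subtractf sum_divide_distrib power2_eq_square)
  then show ?thesis by (simp add: gauss_density_def e prod.distrib exp_sum)
qed

text \<open>The Cameron-Martin formula in finite dimension: translating the argument amounts to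
  reweighting by the ratio of two Gaussian densities.\<close>

lemma gauss_shift:
  fixes f :: "real^'n \<Rightarrow> real"
  assumes h: "h > 0" and [measurable]: "f \<in> borel_measurable borel"
  shows "(LINT w|gauss h. f (w + a)) = (LINT w|gauss h. f w * exp (a \<bullet> w / h - (norm a)\<^sup>2 / (2*h)))"
proof -
  have "(LINT w|gauss h. f (w + a)) = (LINT w|lborel. gauss_density h w * f (w + a))"
    by (rule integral_gauss) measurable
  also have "\<dots> = (LINT w|lborel. gauss_density h (w + a - a) * f (w + a))" by simp
  also have "\<dots> = (LINT w|lborel. gauss_density h (w - a) * f w)"
    by (rule integral_translate) measurable
  also have "\<dots> = (LINT w|lborel. gauss_density h w * (f w * exp (a \<bullet> w / h - (norm a)\<^sup>2 / (2*h))))"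
    by (simp add: gauss_density_shift[OF h] mult_ac)
  also have "\<dots> = (LINT w|gauss h. f w * exp (a \<bullet> w / h - (norm a)\<^sup>2 / (2*h)))"
    by (rule integral_gauss[symmetric]) measurable
  finally show ?thesis .
qed

lemma gauss_exp:
  fixes a :: "real^'n"
  assumes h: "h > 0"
  shows "integrable (gauss h) (\<lambda>w. exp (a \<bullet> w / h - (norm a)\<^sup>2 / (2*h)))"
    "(LINT w|gauss h. exp (a \<bullet> w / h - (norm a)\<^sup>2 / (2*h))) = 1"
proof -
  interpret prob_space "gauss h :: (real^'n) measure" by (rule prob_space_gauss[OF h])
  have "integrable lborel (\<lambda>w. gauss_density h (w + - a))"
    by (rule integrable_translate[OF gauss_density_integral(1)[OF h]])
  then show "integrable (gauss h) (\<lambda>w. exp (a \<bullet> w / h - (norm a)\<^sup>2 / (2*h)))"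
    by (subst integrable_gauss) (auto simp: gauss_density_shift[OF h])
  show "(LINT w|gauss h. exp (a \<bullet> w / h - (norm a)\<^sup>2 / (2*h))) = 1"
    using gauss_shift[OF h, of "\<lambda>_. 1" a] prob_space by simp
qed

text \<open>The square of the density ratio for the shift \<open>a\<close> is
  \<open>exp (|a|^2 / h)\<close> times the ratio for the shift \<open>2 a\<close>, which has
  integral one.\<close>

lemma gauss_exp_square:
  fixes a :: "real^'n"
  assumes h: "h > 0"
  shows "integrable (gauss h) (\<lambda>w. (exp (a \<bullet> w / h - (norm a)\<^sup>2 / (2*h)))\<^sup>2)"
    "(LINT w|gauss h. (exp (a \<bullet> w / h - (norm a)\<^sup>2 / (2*h)))\<^sup>2) = exp ((norm a)\<^sup>2 / h)"
proof -
  have e: "(exp (a \<bullet> w / h - (norm a)\<^sup>2 / (2*h)))\<^sup>2 = exp ((norm a)\<^sup>2 / h) * exp ((2 *\<^sub>R a) \<bullet> w / h - (norm (2 *\<^sub>R a))\<^sup>2 / (2*h))" for w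
    unfolding power2_eq_square exp_add[symmetric] using h by (simp add: field_simps)
  show "integrable (gauss h) (\<lambda>w. (exp (a \<bullet> w / h - (norm a)\<^sup>2 / (2*h)))\<^sup>2)"
    unfolding e by (intro integrable_mult_right gauss_exp h)
  show "(LINT w|gauss h. (exp (a \<bullet> w / h - (norm a)\<^sup>2 / (2*h)))\<^sup>2) = exp ((norm a)\<^sup>2 / h)"
    unfolding e using gauss_exp[OF h, of "2 *\<^sub>R a"] by simp
qed

section \<open>Change of variables\<close>

text \<open>The change of variables formula of the library is stated for well-ordered index types only;
  a well-ordered copy of an arbitrary finite type makes it available on every \<open>real^'n\<close>.\<close>
typedef 'a wo = "UNIV :: 'a set" by simp

instantiation wo :: (finite) "{finite, wellorder}"
begin

definition less_eq_wo :: "'a wo \<Rightarrow> 'a wo \<Rightarrow> bool" where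
  "less_eq_wo x y \<longleftrightarrow> to_nat (Rep_wo x) \<le> to_nat (Rep_wo y)"

definition less_wo :: "'a wo \<Rightarrow> 'a wo \<Rightarrow> bool" where
  "less_wo x y \<longleftrightarrow> to_nat (Rep_wo x) < to_nat (Rep_wo y)"

instance
proof
  have "UNIV = range (Abs_wo :: 'a \<Rightarrow> 'a wo)" by (metis Rep_wo_inverse surj_def)
  then show "finite (UNIV :: 'a wo set)" by (metis finite finite_imageI)
next
  fix P :: "'a wo \<Rightarrow> bool" and a :: "'a wo" assume IH: "\<And>x. (\<And>y. y < x \<Longrightarrow> P y) \<Longrightarrow> P x"
  show "P a"
  proof (induction "to_nat (Rep_wo a)" arbitrary: a rule: less_induct)
    case less
    show ?case by (rule IH) (simp add: less less_wo_def)
  qed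
qed (auto simp: less_eq_wo_def less_wo_def Rep_wo_inject)

end

lemma bij_Rep_wo: "bij (Rep_wo :: 'n wo \<Rightarrow> 'n)"
  by (rule bij_betw_byWitness[where f'=Abs_wo]) (auto simp: Rep_wo_inverse Abs_wo_inverse)

definition wo_vec :: "real^'n \<Rightarrow> real^('n::finite) wo" where "wo_vec x = (\<chi> i. x $ Rep_wo i)"
definition unwo_vec :: "real^('n::finite) wo \<Rightarrow> real^'n" where "unwo_vec x = (\<chi> i. x $ Abs_wo i)"

lemma wo_vec_inverse [simp]: "unwo_vec (wo_vec x) = x" "wo_vec (unwo_vec y) = y"
  by (simp_all add: wo_vec_def unwo_vec_def Rep_wo_inverse Abs_wo_inverse)

lemma bounded_linear_wo_vec: "bounded_linear wo_vec" "bounded_linear unwo_vec"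
  by (auto intro!: linear_conv_bounded_linear[THEN iffD1] linearI simp: wo_vec_def unwo_vec_def vec_eq_iff)

lemma wo_vec_measurable [measurable]: "wo_vec \<in> borel_measurable borel" "unwo_vec \<in> borel_measurable borel"
  by (auto intro!: borel_measurable_continuous_onI linear_continuous_on bounded_linear_wo_vec)

lemma prod_Basis_vec: "(\<Prod>b\<in>(Basis::(real^'n) set). f b) = (\<Prod>i\<in>UNIV. f (axis i 1))"
proof -
  have B: "(Basis::(real^'n) set) = (\<lambda>i. axis i 1) ` UNIV" by (auto simp: Basis_vec_def)
  show ?thesis unfolding B by (subst prod.reindex) (auto simp: inj_on_def axis_eq_axis)
qed

lemma Basis_vec_iff: "b \<in> (Basis::(real^'n) set) \<longleftrightarrow> (\<exists>i. b = axis i 1)"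
  by (auto simp: Basis_vec_def)

text \<open>Lebesgue measure is determined by its values on boxes, and relabelling coordinates only
  permutes the side lengths.\<close>

lemma distr_wo_vec: "distr lborel borel wo_vec = (lborel :: (real^('n::finite) wo) measure)"
proof (rule lborel_eqI[symmetric])
  fix l u :: "real^'n wo" assume "\<And>b. b \<in> Basis \<Longrightarrow> l \<bullet> b \<le> u \<bullet> b"
  then have le: "l$i \<le> u$i" for i by (metis Basis_vec_iff cart_eq_inner_axis)
  have "wo_vec -` box l u = box (unwo_vec l) (unwo_vec u)"
    by (auto simp: mem_box_cart wo_vec_def unwo_vec_def) (metis Abs_wo_inverse Rep_wo_inverse UNIV_I)+
  then have "emeasure (distr lborel borel wo_vec) (box l u) = emeasure lborel (box (unwo_vec l) (unwo_vec u))"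
    by (subst emeasure_distr) auto
  also have "\<dots> = (\<Prod>b\<in>Basis. (unwo_vec u - unwo_vec l) \<bullet> b)"
    by (rule emeasure_lborel_box) (use le in \<open>auto simp: Basis_vec_iff unwo_vec_def inner_axis\<close>)
  also have "\<dots> = (\<Prod>i\<in>UNIV. (u - l) $ Abs_wo i)"
    unfolding prod_Basis_vec by (simp add: inner_axis unwo_vec_def)
  also have "\<dots> = (\<Prod>i\<in>UNIV. (u - l) $ i)"
    using prod.reindex_bij_betw[OF bij_Rep_wo, of "\<lambda>i. (u - l) $ Abs_wo i"] by (simp add: Rep_wo_inverse)
  also have "\<dots> = (\<Prod>b\<in>Basis. (u - l) \<bullet> b)" unfolding prod_Basis_vec by (simp add: inner_axis)
  finally show "emeasure (distr lborel borel wo_vec) (box l u) = ennreal (\<Prod>b\<in>Basis. (u - l) \<bullet> b)" .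
qed simp

lemma integral_unwo_vec:
  fixes f :: "real^'n \<Rightarrow> real"
  assumes [measurable]: "f \<in> borel_measurable borel"
  shows "(LINT x|lborel. f (unwo_vec x)) = (LINT x|lborel. f x)"
    "integrable lborel (\<lambda>x. f (unwo_vec x)) \<longleftrightarrow> integrable lborel f"
proof -
  have "(LINT x|distr lborel borel wo_vec. f (unwo_vec x)) = (LINT x|lborel. f x)"
    by (subst integral_distr) auto
  then show "(LINT x|lborel. f (unwo_vec x)) = (LINT x|lborel. f x)" by (simp add: distr_wo_vec)
  have "integrable (distr lborel borel wo_vec) (\<lambda>x. f (unwo_vec x)) \<longleftrightarrow> integrable lborel f"
    by (subst integrable_distr_eq) auto
  then show "integrable lborel (\<lambda>x. f (unwo_vec x)) \<longleftrightarrow> integrable lborel f" by (simp add: distr_wo_vec)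
qed

lemma lborel_change_of_variables_wo:
  fixes f :: "real^'m::{finite,wellorder} \<Rightarrow> real" and V :: "real^'m::_ \<Rightarrow> real^'m::_"
  assumes der: "\<And>x. (V has_derivative V' x) (at x)" and bij: "bij V"
    and f: "integrable lborel f" and D: "(\<lambda>x. det (matrix (V' x))) \<in> borel_measurable borel"
  shows "integrable lborel (\<lambda>x. \<bar>det (matrix (V' x))\<bar> * f (V x))"
    "(LINT x|lborel. \<bar>det (matrix (V' x))\<bar> * f (V x)) = (LINT x|lborel. f x)"
proof -
  let ?g = "\<lambda>x. \<bar>det (matrix (V' x))\<bar> * f (V x)"
  \<comment> \<open>The formula invoked below is for vector-valued integrands, so \<open>f\<close>
    is copied into every component and one component is read off at the end. It concerns Lebesgue
    measurable functions; Borel measurability of \<open>f\<close> and \<open>V\<close> brings the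
    result back to \<open>lborel\<close>.\<close>
  let ?F = "\<lambda>x. (\<chi> i::'m. f x)"
  note [measurable] = borel_measurable_integrable[OF f] D
  have "continuous_on UNIV V" using der by (meson continuous_at_imp_continuous_on has_derivative_continuous)
  then have [measurable]: "V \<in> borel_measurable borel" by (rule borel_measurable_continuous_onI)
  have m: "?g \<in> borel_measurable lborel" "f \<in> borel_measurable lborel" by measurable
  have fl: "integrable lebesgue f" using f m by (simp add: integrable_completion)
  have fi: "f absolutely_integrable_on UNIV" using fl by (simp add: set_integrable_def)
  then have Fi: "?F absolutely_integrable_on UNIV"
    by (subst absolutely_integrable_on_iff_component) auto
  have "(\<lambda>x. \<bar>det (matrix (V' x))\<bar> *\<^sub>R ?F (V x)) absolutely_integrable_on UNIV \<and>
           integral UNIV (\<lambda>x. \<bar>det (matrix (V' x))\<bar> *\<^sub>R ?F (V x)) = integral UNIV ?F"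
    using has_absolute_integral_change_of_variables[of UNIV V V' ?F "integral UNIV ?F"] der bij Fi
    by (auto simp: bij_def)
  moreover have e: "(\<lambda>x. \<bar>det (matrix (V' x))\<bar> *\<^sub>R ?F (V x)) = (\<lambda>x. \<chi> i. ?g x)"
    by (auto simp: vec_eq_iff)
  ultimately have G: "(\<lambda>x. (\<chi> i::'m. ?g x)) absolutely_integrable_on UNIV"
    "integral UNIV (\<lambda>x. (\<chi> i::'m. ?g x)) = integral UNIV ?F" by simp_all
  have gi: "?g absolutely_integrable_on UNIV" using G(1) by (subst (asm) absolutely_integrable_on_iff_component) auto
  then have "integrable lebesgue ?g" by (simp add: set_integrable_def)
  then show gl: "integrable lborel ?g" using m by (simp add: integrable_completion)
  have comp: "integral UNIV (\<lambda>x. (\<chi> i::'m. h x)) $ i = integral UNIV h" if "h absolutely_integrable_on UNIV" for h :: "real^'m::_ \<Rightarrow> real" and i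
  proof -
    have "(\<lambda>x. (\<chi> i::'m. h x)) absolutely_integrable_on UNIV" using that by (subst absolutely_integrable_on_iff_component) auto
    then have "(\<lambda>x. (\<chi> i::'m. h x)) integrable_on UNIV" by (rule absolutely_integrable_on_def[THEN iffD1, THEN conjunct1])
    from integral_component_eq_cart[OF this, of i] show ?thesis by simp
  qed
  have "integral UNIV ?g = integral UNIV f"
    using comp[OF gi, of undefined] comp[OF fi, of undefined] G(2) by simp
  then show "(LINT x|lborel. ?g x) = (LINT x|lborel. f x)"
    using integral_lborel[OF f] integral_lborel[OF gl] by simp
qed

text \<open>Jacobians are handled in the relabelled index type. Only their trace has to be carried
  back, by \<open>trace_wo_matrix\<close>.\<close>

definition wo_matrix :: "real^'n::finite^'n \<Rightarrow> real^'n wo^'n wo" where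
  "wo_matrix A = (\<chi> i j. A $ Rep_wo i $ Rep_wo j)"

lemma wo_matrix_mult_vec: "wo_matrix A *v x = wo_vec (A *v unwo_vec x)"
proof -
  have "(\<Sum>j\<in>UNIV. A $ i $ Rep_wo j * x $ j) = (\<Sum>j\<in>UNIV. A $ i $ j * x $ Abs_wo j)" for i
    using sum.reindex_bij_betw[OF bij_Rep_wo, of "\<lambda>j. A $ i $ j * x $ Abs_wo j"] by (simp add: Rep_wo_inverse)
  then show ?thesis by (simp add: matrix_vector_mult_def wo_matrix_def wo_vec_def unwo_vec_def)
qed

lemma lborel_change_of_variables:
  fixes f :: "real^'n::finite \<Rightarrow> real" and V :: "real^'n \<Rightarrow> real^'n"
  assumes der: "\<And>x. (V has_derivative (*v) (V' x)) (at x)" and bij: "bij V"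
    and f: "integrable lborel f" and D: "(\<lambda>x. det (wo_matrix (V' x))) \<in> borel_measurable borel"
  shows "integrable lborel (\<lambda>x. \<bar>det (wo_matrix (V' x))\<bar> * f (V x))"
    "(LINT x|lborel. \<bar>det (wo_matrix (V' x))\<bar> * f (V x)) = (LINT x|lborel. f x)"
proof -
  let ?V = "\<lambda>z. wo_vec (V (unwo_vec z))"
  let ?M = "\<lambda>z. (*v) (wo_matrix (V' (unwo_vec z)))"
  let ?f = "\<lambda>z. f (unwo_vec z)"
  note [measurable] = borel_measurable_integrable[OF f] D
  have "continuous_on UNIV V" using der by (meson continuous_at_imp_continuous_on has_derivative_continuous)
  then have [measurable]: "V \<in> borel_measurable borel" by (rule borel_measurable_continuous_onI)
  have d: "(?V has_derivative ?M z) (at z)" for z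
  proof -
    have "(unwo_vec has_derivative unwo_vec) (at z)" by (rule bounded_linear_imp_has_derivative[OF bounded_linear_wo_vec(2)])
    from has_derivative_compose[OF this der]
    have "((\<lambda>z. V (unwo_vec z)) has_derivative (\<lambda>v. V' (unwo_vec z) *v unwo_vec v)) (at z)" .
    from bounded_linear.has_derivative[OF bounded_linear_wo_vec(1) this]
    show ?thesis by (simp add: wo_matrix_mult_vec[abs_def])
  qed
  have b: "bij ?V"
  proof -
    have "bij (wo_vec :: real^'n \<Rightarrow> _)" "bij (unwo_vec :: _ \<Rightarrow> real^'n)" by (metis bijI' wo_vec_inverse)+
    then have "bij (wo_vec \<circ> (V \<circ> unwo_vec))" using bij by (intro bij_comp)
    then show ?thesis by (simp add: comp_def)
  qed
  have i: "integrable lborel ?f" using f by (subst integral_unwo_vec) auto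
  have m: "(\<lambda>z. det (matrix (?M z))) \<in> borel_measurable borel" by simp
  note C = lborel_change_of_variables_wo[OF d b i m]
  have e: "(\<lambda>z. \<bar>det (matrix (?M z))\<bar> * f (unwo_vec (?V z))) = (\<lambda>z. (\<lambda>x. \<bar>det (wo_matrix (V' x))\<bar> * f (V x)) (unwo_vec z))"
    by simp
  have m2: "(\<lambda>x. \<bar>det (wo_matrix (V' x))\<bar> * f (V x)) \<in> borel_measurable borel" by measurable
  show "integrable lborel (\<lambda>x. \<bar>det (wo_matrix (V' x))\<bar> * f (V x))"
    using C(1) unfolding e by (subst (asm) integral_unwo_vec(2)[OF m2])
  show "(LINT x|lborel. \<bar>det (wo_matrix (V' x))\<bar> * f (V x)) = (LINT x|lborel. f x)"
    using C(2) unfolding e integral_unwo_vec(1)[OF m2] by (simp add: integral_unwo_vec(1))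
qed

section \<open>Determinants of perturbations of the identity\<close>

lemma prod_perturb:
  fixes K :: real
  assumes "finite S" "K \<ge> 0"
  shows "\<exists>C\<ge>0. \<forall>b h. (\<forall>i\<in>S. \<bar>b i\<bar> \<le> K) \<longrightarrow> 0 \<le> h \<longrightarrow> h \<le> 1 \<longrightarrow>
    \<bar>(\<Prod>i\<in>S. 1 + h * b i) - 1 - h * (\<Sum>i\<in>S. b i)\<bar> \<le> C * h\<^sup>2"
  using assms(1)
proof (induction S)
  case empty then show ?case by (intro exI[of _ 0]) auto
next
  case (insert j S)
  then obtain C where C: "C \<ge> 0" "\<And>b h. (\<forall>i\<in>S. \<bar>b i\<bar> \<le> K) \<Longrightarrow> 0 \<le> h \<Longrightarrow> h \<le> 1 \<Longrightarrow>
    \<bar>(\<Prod>i\<in>S. 1 + h * b i) - 1 - h * (\<Sum>i\<in>S. b i)\<bar> \<le> C * h\<^sup>2" by blast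
  show ?case
  proof (intro exI[of _ "(1 + K) * C + K * (card S * K)"] conjI allI impI)
    show "0 \<le> (1 + K) * C + K * (card S * K)" using C(1) \<open>K \<ge> 0\<close> by simp
    fix b :: "'a \<Rightarrow> real" and h :: real
    assume b: "\<forall>i\<in>insert j S. \<bar>b i\<bar> \<le> K" and h: "0 \<le> h" "h \<le> 1"
    let ?P = "\<Prod>i\<in>S. 1 + h * b i" and ?s = "\<Sum>i\<in>S. b i"
    have P: "\<bar>?P - 1 - h * ?s\<bar> \<le> C * h\<^sup>2" using C(2) b h by auto
    have s: "\<bar>?s\<bar> \<le> card S * K" using b by (intro order_trans[OF sum_abs sum_bounded_above]) auto
    have bj: "\<bar>b j\<bar> \<le> K" using b by auto
    have "h * \<bar>b j\<bar> \<le> 1 * K" using h bj by (intro mult_mono) auto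
    then have "\<bar>h * b j\<bar> \<le> K" using h by (simp add: abs_mult)
    then have "\<bar>1 + h * b j\<bar> \<le> 1 + K" by linarith
    then have 1: "\<bar>1 + h * b j\<bar> * \<bar>?P - 1 - h * ?s\<bar> \<le> (1 + K) * (C * h\<^sup>2)" using P \<open>K \<ge> 0\<close> by (intro mult_mono) auto
    have 2: "\<bar>b j\<bar> * \<bar>?s\<bar> * h\<^sup>2 \<le> K * (card S * K) * h\<^sup>2" using s bj \<open>K \<ge> 0\<close> by (intro mult_mono) auto
    have "(\<Prod>i\<in>insert j S. 1 + h * b i) - 1 - h * (\<Sum>i\<in>insert j S. b i) =
       (1 + h * b j) * (?P - 1 - h * ?s) + b j * ?s * h\<^sup>2"
      using insert.hyps by (simp add: algebra_simps power2_eq_square)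
    also have "\<bar>\<dots>\<bar> \<le> \<bar>1 + h * b j\<bar> * \<bar>?P - 1 - h * ?s\<bar> + \<bar>b j\<bar> * \<bar>?s\<bar> * h\<^sup>2"
      by (rule order_trans[OF abs_triangle_ineq]) (simp add: abs_mult)
    also have "\<dots> \<le> ((1 + K) * C + K * (card S * K)) * h\<^sup>2" using 1 2 by (simp add: algebra_simps)
    finally show "\<bar>(\<Prod>i\<in>insert j S. 1 + h * b i) - 1 - h * (\<Sum>i\<in>insert j S. b i)\<bar> \<le> ((1 + K) * C + K * (card S * K)) * h\<^sup>2" .
  qed
qed

text \<open>A permutation other than the identity moves at least two indices, \<open>i\<close> and
  \<open>p i\<close>. Both contribute an off-diagonal entry of size at most \<open>h K\<close>,
  hence the factor \<open>h^2\<close>; the remaining factors are at most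
  \<open>1 + K\<close>.\<close>

lemma prod_off_diagonal:
  fixes B :: "real^'n^'n"
  assumes B: "\<And>i j. \<bar>B$i$j\<bar> \<le> K" and K: "K \<ge> 0" and h: "0 \<le> h" "h \<le> 1" and p: "p permutes (UNIV::'n set)" "p \<noteq> id"
  shows "\<bar>\<Prod>i\<in>UNIV. (mat 1 + h *\<^sub>R B)$i$p i\<bar> \<le> (K\<^sup>2 * (1 + K) ^ CARD('n)) * h\<^sup>2"
proof -
  obtain i where i: "p i \<noteq> i" using p(2) by (auto simp: fun_eq_iff)
  define j where "j = p i"
  have j: "p j \<noteq> j" "j \<noteq> i" using i p(1) unfolding j_def by (metis permutes_inj injD)+
  let ?f = "\<lambda>k. (mat 1 + h *\<^sub>R B)$k$p k"
  have le: "h * \<bar>B$k$l\<bar> \<le> h * K" for k l using B h by (intro mult_left_mono) auto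
  have le1: "h * K \<le> K" using h K mult_left_le_one_le by blast
  have f: "\<bar>?f k\<bar> \<le> 1 + K" for k
  proof -
    have "\<bar>?f k\<bar> \<le> 1 + h * \<bar>B$k$p k\<bar>" using h by (auto simp: mat_def abs_mult intro: order_trans[OF abs_triangle_ineq])
    then show ?thesis using le[of k "p k"] le1 by linarith
  qed
  have fo: "\<bar>?f k\<bar> \<le> h * K" if "p k \<noteq> k" for k using that h le[of k "p k"] by (auto simp: mat_def abs_mult)
  have "(\<Prod>k\<in>UNIV. ?f k) = ?f i * (?f j * (\<Prod>k\<in>UNIV - {i} - {j}. ?f k))"
    using j(2) by (subst prod.remove[of UNIV i], simp, simp, subst prod.remove[of "UNIV - {i}" j]) auto
  also have "\<bar>\<dots>\<bar> = \<bar>?f i\<bar> * (\<bar>?f j\<bar> * \<bar>\<Prod>k\<in>UNIV - {i} - {j}. ?f k\<bar>)" by (simp add: abs_mult)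
  also have "\<dots> \<le> (h * K) * ((h * K) * (1 + K) ^ CARD('n))"
  proof (intro mult_mono fo i j)
    have "\<bar>\<Prod>k\<in>UNIV - {i} - {j}. ?f k\<bar> \<le> (\<Prod>k\<in>UNIV - {i} - {j}. 1 + K)"
      unfolding abs_prod by (intro prod_mono) (use f in auto)
    also have "\<dots> \<le> (1 + K) ^ CARD('n)" unfolding prod_constant
      using K by (intro power_increasing card_mono) auto
    finally show "\<bar>\<Prod>k\<in>UNIV - {i} - {j}. ?f k\<bar> \<le> (1 + K) ^ CARD('n)" .
  qed (use h K in auto)
  finally show ?thesis by (simp add: power2_eq_square mult_ac)
qed

text \<open>In the Leibniz formula the identity permutation gives \<open>1 + h trace B\<close> up to
  order \<open>h^2\<close>, and all other permutations are of order \<open>h^2\<close>. The constant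
  depends on the entries only through \<open>K\<close>, which makes the expansion uniform over all
  points of space.\<close>

lemma det_perturb:
  assumes K: "(K::real) \<ge> 0"
  obtains C where "C \<ge> 0" "\<And>(B::real^'n::finite^'n) h. (\<And>i j. \<bar>B$i$j\<bar> \<le> K) \<Longrightarrow> 0 \<le> h \<Longrightarrow> h \<le> 1 \<Longrightarrow>
     \<bar>det (mat 1 + h *\<^sub>R B) - 1 - h * trace B\<bar> \<le> C * h\<^sup>2"
proof -
  obtain C where C: "C \<ge> 0" "\<And>b h. (\<forall>i\<in>(UNIV::'n set). \<bar>b i\<bar> \<le> K) \<Longrightarrow> 0 \<le> h \<Longrightarrow> h \<le> 1 \<Longrightarrow>
    \<bar>(\<Prod>i\<in>UNIV. 1 + h * b i) - 1 - h * (\<Sum>i\<in>UNIV. b i)\<bar> \<le> C * h\<^sup>2"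
    using prod_perturb[of "UNIV::'n set" K] K by (auto simp del: ball_UNIV)
  let ?Per = "{p. p permutes (UNIV::'n set)}"
  let ?C = "C + card ?Per * (K\<^sup>2 * (1 + K) ^ CARD('n))"
  have "\<bar>det (mat 1 + h *\<^sub>R B) - 1 - h * trace B\<bar> \<le> ?C * h\<^sup>2" if B: "\<And>i j. \<bar>B$i$j\<bar> \<le> K" and h: "0 \<le> h" "h \<le> 1" for B :: "real^'n^'n" and h
  proof -
    let ?t = "\<lambda>p. of_int (sign p) * (\<Prod>i\<in>UNIV. (mat 1 + h *\<^sub>R B)$i$p i)"
    have fin: "finite ?Per" by (simp add: finite_permutations)
    have "det (mat 1 + h *\<^sub>R B) = ?t id + (\<Sum>p\<in>?Per - {id}. ?t p)"
      unfolding det_def by (rule sum.remove[OF fin]) (simp add: permutes_id)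
    moreover have "?t id = (\<Prod>i\<in>UNIV. 1 + h * B$i$i)" by (simp add: mat_def)
    moreover have "\<bar>(\<Prod>i\<in>UNIV. 1 + h * B$i$i) - 1 - h * trace B\<bar> \<le> C * h\<^sup>2"
      unfolding trace_def using C(2)[of "\<lambda>i. B$i$i" h] B h by auto
    moreover have "\<bar>\<Sum>p\<in>?Per - {id}. ?t p\<bar> \<le> card ?Per * ((K\<^sup>2 * (1 + K) ^ CARD('n)) * h\<^sup>2)"
    proof -
      have "\<bar>\<Sum>p\<in>?Per - {id}. ?t p\<bar> \<le> card (?Per - {id}) * ((K\<^sup>2 * (1 + K) ^ CARD('n)) * h\<^sup>2)"
      proof (rule order_trans[OF sum_abs sum_bounded_above])
        fix p assume "p \<in> ?Per - {id}"
        then show "\<bar>?t p\<bar> \<le> (K\<^sup>2 * (1 + K) ^ CARD('n)) * h\<^sup>2"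
          using prod_off_diagonal[OF B K h, of p] by (auto simp: abs_mult sign_def)
      qed
      also have "\<dots> \<le> card ?Per * ((K\<^sup>2 * (1 + K) ^ CARD('n)) * h\<^sup>2)"
        using K fin by (intro mult_right_mono of_nat_mono card_mono) auto
      finally show ?thesis .
    qed
    ultimately show ?thesis by (simp add: algebra_simps)
  qed
  then show ?thesis using that[of ?C] C(1) K by simp
qed

lemma trace_wo_matrix: "trace (wo_matrix A) = trace A"
  using sum.reindex_bij_betw[OF bij_Rep_wo, of "\<lambda>i. A $ i $ i"] by (simp add: trace_def wo_matrix_def)

lemma wo_matrix_add_mat: "wo_matrix (mat 1 + h *\<^sub>R B) = mat 1 + h *\<^sub>R wo_matrix B"
  by (auto simp: wo_matrix_def mat_def vec_eq_iff Rep_wo_inject)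

section \<open>Consistency of the Euler scheme\<close>

lemma abs_integral_le:
  fixes f g :: "'a \<Rightarrow> real"
  assumes "integrable M f" "integrable M g" "\<And>x. \<bar>f x\<bar> \<le> g x"
  shows "\<bar>integral\<^sup>L M f\<bar> \<le> integral\<^sup>L M g"
proof -
  have "\<bar>integral\<^sup>L M f\<bar> \<le> (\<integral>x. \<bar>f x\<bar> \<partial>M)" by (rule integral_abs_bound)
  also have "\<dots> \<le> integral\<^sup>L M g" using assms by (intro integral_mono) auto
  finally show ?thesis .
qed

text \<open>The third integral does not depend on \<open>a\<close>: by translation invariance both
  indicators integrate to the volume of the ball. This turns localized remainders into bounds
  uniform in the shift.\<close>

lemma cball_integral:
  fixes a :: "real^'n" and c :: real
  shows "(LINT y|lborel. c * indicator (cball (0::real^'n) r) y) = c * measure lborel (cball (0::real^'n) r)"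
    "integrable lborel (\<lambda>y. c * (indicator (cball 0 r) y + indicator (cball 0 r) (y + a)))"
    "(LINT y|lborel. c * (indicator (cball 0 r) y + indicator (cball 0 r) (y + a))) = c * (2 * measure lborel (cball (0::real^'n) r))"
proof -
  have vi: "integrable lborel (indicator (cball (0::real^'n) r) :: _ \<Rightarrow> real)" by (rule integrable_indicator_cball)
  have v: "(LINT y|lborel. indicator (cball (0::real^'n) r) y :: real) = measure lborel (cball (0::real^'n) r)"
    by simp
  show "(LINT y|lborel. c * indicator (cball (0::real^'n) r) y) = c * measure lborel (cball (0::real^'n) r)"
    unfolding integral_mult_right_zero v ..
  show "integrable lborel (\<lambda>y. c * (indicator (cball 0 r) y + indicator (cball 0 r) (y + a)))"
    by (intro integrable_mult_right Bochner_Integration.integrable_add vi integrable_translate[OF vi])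
  have w: "(LINT y|lborel. indicator (cball 0 r) (y + a)) = (LINT y|lborel. indicator (cball (0::real^'n) r) y :: real)"
    using borel_measurable_integrable[OF vi] by (intro integral_translate) simp
  show "(LINT y|lborel. c * (indicator (cball 0 r) y + indicator (cball 0 r) (y + a))) = c * (2 * measure lborel (cball (0::real^'n) r))"
    unfolding integral_mult_right_zero Bochner_Integration.integral_add[OF vi integrable_translate[OF vi]] w v mult_2 ..
qed

lemma integral_mult_bound:
  fixes \<psi> :: "real^'n \<Rightarrow> real"
  assumes \<psi>: "integrable lborel \<psi>" and m: "g \<in> borel_measurable borel" and C: "\<And>x. \<bar>g x\<bar> \<le> C"
  shows "integrable lborel (\<lambda>x. g x * \<psi> x)" "\<bar>LINT x|lborel. g x * \<psi> x\<bar> \<le> C * (LINT x|lborel. \<bar>\<psi> x\<bar>)"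
proof -
  have le: "\<bar>g x * \<psi> x\<bar> \<le> C * \<bar>\<psi> x\<bar>" for x by (simp add: abs_mult C mult_right_mono)
  have [measurable]: "\<psi> \<in> borel_measurable borel" using borel_measurable_integrable[OF \<psi>] by simp
  have i2: "integrable lborel (\<lambda>x. C * \<bar>\<psi> x\<bar>)" using \<psi> by simp
  show i: "integrable lborel (\<lambda>x. g x * \<psi> x)"
    by (rule Bochner_Integration.integrable_bound[OF i2]) (use m le in \<open>auto intro!: AE_I2 intro: order_trans[OF _ abs_ge_self]\<close>)
  show "\<bar>LINT x|lborel. g x * \<psi> x\<bar> \<le> C * (LINT x|lborel. \<bar>\<psi> x\<bar>)"
    using abs_integral_le[OF i i2 le] by simp
qed

text \<open>The shift stays on the test function, so the expansion in \<open>z\<close> uses only a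
  bound on \<open>g\<close>, and \<open>C\<close> depends on \<phi> alone. It serves twice: averaged
  over Gaussian \<open>z\<close> for the consistency of the noise step, and for the derivative tests
  at a maximum of a mollification.\<close>

lemma pairing_taylor:
  fixes \<phi> :: "real^'n \<Rightarrow> real"
  assumes \<phi>: "\<phi> \<in> test_functions"
  obtains C where "C \<ge> 0" "\<And>g M z. \<lbrakk>g \<in> borel_measurable borel; \<And>x. \<bar>g x\<bar> \<le> M\<rbrakk> \<Longrightarrow>
    \<bar>(LINT y|lborel. g y * \<phi> (y - z)) - ((LINT y|lborel. g y * \<phi> y) - (\<Sum>i\<in>UNIV. z$i * (LINT y|lborel. g y * partial i \<phi> y))
     + (1/2) * (\<Sum>i\<in>UNIV. \<Sum>j\<in>UNIV. z$i * z$j * (LINT y|lborel. g y * partial i (partial j \<phi>) y)))\<bar> \<le> C * M * norm z ^ 3"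
proof -
  obtain Ct r where Ct: "Ct \<ge> 0" "\<And>y z. \<bar>\<phi> (y + z) - \<phi> y - grad \<phi> y \<bullet> z - (1/2) * (z \<bullet> (hessian \<phi> y *v z))\<bar>
     \<le> Ct * norm z ^ 3 * (indicator (cball 0 r) y + indicator (cball 0 r) (y + z))"
    using test_function_taylor_local[OF \<phi>] by metis
  define vol where "vol = measure lborel (cball (0::real^'n) r)"
  have p1: "partial i \<phi> \<in> test_functions" and p2: "partial i (partial j \<phi>) \<in> test_functions" for i j
    by (intro partial_test_function \<phi>)+
  have "\<bar>(LINT y|lborel. g y * \<phi> (y - z)) - ((LINT y|lborel. g y * \<phi> y) - (\<Sum>i\<in>UNIV. z$i * (LINT y|lborel. g y * partial i \<phi> y))
     + (1/2) * (\<Sum>i\<in>UNIV. \<Sum>j\<in>UNIV. z$i * z$j * (LINT y|lborel. g y * partial i (partial j \<phi>) y)))\<bar> \<le> (2 * Ct * vol) * M * norm z ^ 3"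
    if g[measurable]: "g \<in> borel_measurable borel" and M: "\<And>x. \<bar>g x\<bar> \<le> M" for g M z
  proof -
    have M0: "M \<ge> 0" using M[of 0] by linarith
    define \<Psi> where "\<Psi> z = (LINT y|lborel. g y * \<phi> (y - z))" for z
    define p where "p i = (LINT y|lborel. g y * partial i \<phi> y)" for i
    define q where "q i j = (LINT y|lborel. g y * partial i (partial j \<phi>) y)" for i j
    have gi: "integrable lborel (\<lambda>y. g y * \<psi> y)" if "integrable lborel \<psi>" for \<psi> :: "real^'n \<Rightarrow> real"
      by (rule integral_mult_bound(1)[OF that g M])
    have \<phi>z: "integrable lborel (\<lambda>y. \<phi> (y - z))" using integrable_translate[OF test_function_integrable[OF \<phi>], of "- z"] by simp
    define T where "T = \<Psi> 0 - (\<Sum>i\<in>UNIV. z$i * p i) + (1/2) * (\<Sum>i\<in>UNIV. \<Sum>j\<in>UNIV. z$i * z$j * q i j)"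
    have Te: "T = (LINT y|lborel. g y * (\<phi> y + grad \<phi> y \<bullet> (- z) + (1/2) * ((- z) \<bullet> (hessian \<phi> y *v (- z)))))"
    proof -
      have e: "(\<lambda>y. g y * (\<phi> y + grad \<phi> y \<bullet> (- z) + (1/2) * ((- z) \<bullet> (hessian \<phi> y *v (- z))))) =
         (\<lambda>y. g y * \<phi> y - (\<Sum>i\<in>UNIV. z$i * (g y * partial i \<phi> y)) + (1/2) * (\<Sum>i\<in>UNIV. \<Sum>j\<in>UNIV. z$i * z$j * (g y * partial i (partial j \<phi>) y)))"
        by (rule ext) (simp add: grad_def inner_vec_def matrix_vector_mult_def hessian_def sum_distrib_left algebra_simps sum_negf)
      show ?thesis unfolding T_def \<Psi>_def p_def q_def e
        using gi[OF test_function_integrable[OF \<phi>]] gi[OF test_function_integrable[OF p1]] gi[OF test_function_integrable[OF p2]]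
        by (simp add: Bochner_Integration.integral_sum)
    qed
    have "\<bar>\<Psi> z - T\<bar> \<le> (2 * Ct * vol) * M * norm z ^ 3"
    proof -
      let ?t = "\<lambda>y. \<phi> y + grad \<phi> y \<bullet> (- z) + (1/2) * ((- z) \<bullet> (hessian \<phi> y *v (- z)))"
      have ti2: "integrable lborel ?t"
      proof -
        have te: "?t = (\<lambda>y. \<phi> y + (\<Sum>i\<in>UNIV. (- z)$i * partial i \<phi> y) + (1/2) * (\<Sum>i\<in>UNIV. \<Sum>j\<in>UNIV. (- z)$i * (- z)$j * partial i (partial j \<phi>) y))"
          by (rule ext) (simp add: grad_def inner_vec_def matrix_vector_mult_def hessian_def sum_distrib_left algebra_simps sum_negf)
        show ?thesis unfolding te
          by (intro Bochner_Integration.integrable_add Bochner_Integration.integrable_sum integrable_mult_right test_function_integrable p1 p2 \<phi>)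
      qed
      have "\<Psi> z - T = (LINT y|lborel. g y * \<phi> (y - z) - g y * ?t y)"
        unfolding \<Psi>_def Te by (rule Bochner_Integration.integral_diff[symmetric, OF gi[OF \<phi>z] gi[OF ti2]])
      also have "\<bar>\<dots>\<bar> \<le> (LINT y|lborel. (M * (Ct * norm z ^ 3)) * (indicator (cball (0::real^'n) r) y + indicator (cball 0 r) (y + - z)))"
      proof (rule abs_integral_le)
        show "integrable lborel (\<lambda>y. g y * \<phi> (y - z) - g y * ?t y)" using gi[OF \<phi>z] gi[OF ti2] by (intro Bochner_Integration.integrable_diff)
        show "integrable lborel (\<lambda>y. (M * (Ct * norm z ^ 3)) * (indicator (cball (0::real^'n) r) y + indicator (cball 0 r) (y + - z)) :: real)"
          by (rule cball_integral)
        fix y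
        have "\<bar>g y * \<phi> (y - z) - g y * ?t y\<bar> = \<bar>g y\<bar> * \<bar>\<phi> (y + - z) - \<phi> y - grad \<phi> y \<bullet> (- z) - (1/2) * ((- z) \<bullet> (hessian \<phi> y *v (- z)))\<bar>"
          unfolding abs_mult[symmetric] by (simp add: algebra_simps)
        also have "\<dots> \<le> M * (Ct * norm (- z) ^ 3 * (indicator (cball 0 r) y + indicator (cball 0 r) (y + - z)))"
          by (intro mult_mono M M0 Ct(2)) auto
        finally show "\<bar>g y * \<phi> (y - z) - g y * ?t y\<bar> \<le> (M * (Ct * norm z ^ 3)) * (indicator (cball 0 r) y + indicator (cball 0 r) (y + - z))"
          by (simp only: norm_minus_cancel mult.assoc)
      qed
      also have "\<dots> = (M * (Ct * norm z ^ 3)) * (2 * vol)" unfolding vol_def by (rule cball_integral(3))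
      finally show ?thesis by (simp only: mult_ac)
    qed
    moreover have "\<Psi> 0 = (LINT y|lborel. g y * \<phi> y)" by (simp add: \<Psi>_def)
    ultimately show ?thesis unfolding T_def p_def q_def \<Psi>_def by (simp only:)
  qed
  moreover have "0 \<le> 2 * Ct * vol" using Ct(1) by (simp add: vol_def)
  ultimately show thesis using that by blast
qed

text \<open>Here \<open>f\<close> may be unbounded, like the drift. If both points lie outside the
  ball, the product is zero at both; otherwise the increment is split so that \<open>f\<close> is
  evaluated at a point inside, where it is bounded by \<open>M\<close>.\<close>

lemma lipschitz_mult_compact:
  fixes f g :: "real^'n \<Rightarrow> real"
  assumes f: "Lf-lipschitz_on UNIV f" and g: "Lg-lipschitz_on UNIV g" and r: "\<And>x. r \<le> norm x \<Longrightarrow> g x = 0"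
  shows "\<exists>C\<ge>0. C-lipschitz_on UNIV (\<lambda>x. f x * g x)"
proof -
  have cf: "continuous_on UNIV f" and cg: "continuous_on UNIV g"
    using f g by (auto intro: lipschitz_on_continuous_on)
  obtain G where G: "G > 0" "\<And>x. \<bar>g x\<bar> \<le> G" using compact_support_bounded[OF cg r] by metis
  have "compact (f ` cball 0 r)" by (intro compact_continuous_image) (auto intro: continuous_on_subset[OF cf])
  then obtain M where M: "M > 0" "\<And>x. norm x \<le> r \<Longrightarrow> \<bar>f x\<bar> \<le> M"
    using compact_imp_bounded[of "f ` cball 0 r"] by (auto simp: bounded_pos)
  have Lf: "Lf \<ge> 0" and Lg: "Lg \<ge> 0" using f g by (auto dest: lipschitz_on_nonneg)
  have lf: "\<bar>f x - f y\<bar> \<le> Lf * dist x y" and lg: "\<bar>g x - g y\<bar> \<le> Lg * dist x y" for x y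
    using lipschitz_onD[OF f, of x y] lipschitz_onD[OF g, of x y] by (auto simp: dist_real_def)
  have main: "\<bar>f x * g x - f y * g y\<bar> \<le> (G * Lf + M * Lg) * dist x y" if y: "norm y \<le> r" for x y
  proof -
    have "f x * g x - f y * g y = g x * (f x - f y) + f y * (g x - g y)" by (simp add: algebra_simps)
    also have "\<bar>\<dots>\<bar> \<le> \<bar>g x\<bar> * \<bar>f x - f y\<bar> + \<bar>f y\<bar> * \<bar>g x - g y\<bar>"
      by (rule order_trans[OF abs_triangle_ineq]) (simp add: abs_mult)
    also have "\<dots> \<le> G * (Lf * dist x y) + M * (Lg * dist x y)"
      using G M(1) M(2)[OF y] lf lg Lf Lg by (intro add_mono mult_mono) auto
    finally show ?thesis by (simp add: algebra_simps)
  qed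
  have "\<bar>f x * g x - f y * g y\<bar> \<le> (G * Lf + M * Lg) * dist x y" for x y
  proof -
    consider "norm y \<le> r" | "norm x \<le> r" | "r \<le> norm x" "r \<le> norm y" by linarith
    then show ?thesis
    proof cases
      case 2
      then show ?thesis using main[of x y] by (simp add: dist_commute abs_minus_commute)
    next
      case 3
      then show ?thesis using r G(1) M(1) Lf Lg by simp
    qed (rule main)
  qed
  then have "(G * Lf + M * Lg)-lipschitz_on UNIV (\<lambda>x. f x * g x)"
    using G(1) M(1) Lf Lg by (intro lipschitz_onI) (auto simp: dist_real_def)
  then show ?thesis using lipschitz_on_nonneg by blast
qed

lemma lipschitz_sum_real:
  fixes f :: "'i \<Rightarrow> 'a::metric_space \<Rightarrow> real"
  assumes "\<And>i. \<exists>C\<ge>0. C-lipschitz_on UNIV (f i)" "finite S"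
  shows "\<exists>C\<ge>0. C-lipschitz_on UNIV (\<lambda>x. \<Sum>i\<in>S. f i x)"
  using assms(2)
proof (induction S)
  case empty
  have "0-lipschitz_on UNIV (\<lambda>x::'a. 0::real)" by (rule lipschitz_on_constant)
  then show ?case by auto
next
  case (insert j S)
  then obtain C where C: "C \<ge> 0" "C-lipschitz_on UNIV (\<lambda>x. \<Sum>i\<in>S. f i x)" by blast
  obtain D where D: "D \<ge> 0" "D-lipschitz_on UNIV (f j)" using assms(1) by blast
  from lipschitz_on_add[OF D(2) C(2)] have "(D + C)-lipschitz_on UNIV (\<lambda>x. \<Sum>i\<in>insert j S. f i x)"
    using insert.hyps by simp
  then show ?case using C(1) D(1) by (intro exI[of _ "D + C"]) auto
qed

lemma grad_test_function_lipschitz: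
  fixes \<phi> :: "real^'n \<Rightarrow> real"
  assumes \<phi>: "\<phi> \<in> test_functions"
  obtains C where "C \<ge> 0" "\<And>y z. \<bar>\<phi> (y + z) - \<phi> y - grad \<phi> y \<bullet> z\<bar> \<le> C * norm z ^ 2"
proof -
  have "\<exists>C\<ge>0. C-lipschitz_on UNIV (partial i \<phi>)" for i
    by (rule test_function_lipschitz[OF partial_test_function[OF \<phi>]])
  then obtain l where l: "\<And>i. l i \<ge> 0" "\<And>i. (l i)-lipschitz_on UNIV (partial i \<phi>)" by metis
  define C where "C = (\<Sum>i\<in>UNIV. l i)"
  have "\<bar>\<phi> (y + z) - \<phi> y - grad \<phi> y \<bullet> z\<bar> \<le> C * norm z ^ 2" for y z
  proof -
    obtain t where t: "0 < t" "t < 1" "\<phi> (y + 1 *\<^sub>R z) - \<phi> (y + 0 *\<^sub>R z) = (1 - 0) * (grad \<phi> (y + t *\<^sub>R z) \<bullet> z)"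
      using MVT2[of 0 1 "\<lambda>s. \<phi> (y + s *\<^sub>R z)" "\<lambda>s. grad \<phi> (y + s *\<^sub>R z) \<bullet> z"] test_function_line_derivative[OF \<phi>]
      by auto
    have "\<phi> (y + z) - \<phi> y - grad \<phi> y \<bullet> z = (\<Sum>i\<in>UNIV. z$i * (partial i \<phi> (y + t *\<^sub>R z) - partial i \<phi> y))"
      using t(3) by (simp add: grad_inner algebra_simps sum_subtractf)
    also have "\<bar>\<dots>\<bar> \<le> (\<Sum>i\<in>UNIV. norm z * (l i * norm z))"
    proof (rule order_trans[OF sum_abs sum_mono])
      fix i
      have "\<bar>partial i \<phi> (y + t *\<^sub>R z) - partial i \<phi> y\<bar> \<le> l i * norm (t *\<^sub>R z)"
        using lipschitz_onD[OF l(2), of "y + t *\<^sub>R z" y i] by (simp add: dist_real_def dist_norm)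
      also have "\<dots> \<le> l i * norm z" using t l(1) by (intro mult_left_mono) (auto simp: mult_left_le_one_le)
      finally show "\<bar>z$i * (partial i \<phi> (y + t *\<^sub>R z) - partial i \<phi> y)\<bar> \<le> norm z * (l i * norm z)"
        unfolding abs_mult by (intro mult_mono component_le_norm_cart) auto
    qed
    also have "\<dots> = C * norm z ^ 2" by (simp add: C_def sum_distrib_left sum_distrib_right power2_eq_square mult_ac)
    finally show ?thesis .
  qed
  then show ?thesis using that[of C] l(1) by (simp add: C_def sum_nonneg)
qed

text \<open>Kept apart from the smoothness assumptions because it is interpreted a second time, for
  the linear map \<open>A\<close> of the control problem.\<close>

locale drift =
  fixes b :: "real^'n::finite \<Rightarrow> real^'n" and L :: real
  assumes lip: "L-lipschitz_on UNIV b"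
begin

lemma L_nonneg: "L \<ge> 0" using lip by (rule lipschitz_on_nonneg)

lemma lipD: "norm (b x - b y) \<le> L * norm (x - y)"
  using lipschitz_onD[OF lip, of x y] by (simp add: dist_norm)

lemma continuous_b: "continuous_on A b"
  using lipschitz_on_continuous_on[OF lip] continuous_on_subset by blast

lemma b_measurable [measurable]: "b \<in> borel_measurable borel"
  by (rule borel_measurable_continuous_onI[OF continuous_b])

lemma linear_growth: "norm (b x) \<le> norm (b 0) + L * norm x"
  using lipD[of x 0] norm_triangle_sub[of "b x" "b 0"] by simp

text \<open>Since \<open>h L < 1\<close>, the map from \<open>x\<close> to \<open>y - h b x\<close>
  is a contraction, and its unique fixed point is the preimage of \<open>y\<close>.\<close>

lemma bij_euler:
  assumes h: "0 \<le> h" "h * L < 1"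
  shows "bij (\<lambda>x. x + h *\<^sub>R b x)"
proof (rule bijI)
  show "inj (\<lambda>x. x + h *\<^sub>R b x)"
  proof (rule injI)
    fix x y assume "x + h *\<^sub>R b x = y + h *\<^sub>R b y"
    then have "x - y = h *\<^sub>R (b y - b x)" by (simp add: algebra_simps)
    then have "norm (x - y) = h * norm (b y - b x)" using h by simp
    also have "\<dots> \<le> h * (L * norm (y - x))" using lipD h by (intro mult_left_mono)
    finally have "(1 - h * L) * norm (x - y) \<le> 0" by (simp add: algebra_simps norm_minus_commute)
    then show "x = y" using h by (simp add: mult_le_0_iff)
  qed
  show "surj (\<lambda>x. x + h *\<^sub>R b x)"
    unfolding surj_def
  proof (intro allI)
    fix y
    have "\<exists>!x. y - h *\<^sub>R b x = x"
    proof (rule banach_fix_type[of "h * L"])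
      show "0 \<le> h * L" using h L_nonneg by simp
      show "\<forall>x x'. dist (y - h *\<^sub>R b x) (y - h *\<^sub>R b x') \<le> h * L * dist x x'"
      proof (intro allI)
        fix x x'
        have "dist (y - h *\<^sub>R b x) (y - h *\<^sub>R b x') = norm (h *\<^sub>R (b x' - b x))" by (simp add: dist_norm algebra_simps)
        also have "\<dots> = h * norm (b x' - b x)" using h by simp
        also have "\<dots> \<le> h * (L * norm (x' - x))" using lipD h by (intro mult_left_mono)
        finally show "dist (y - h *\<^sub>R b x) (y - h *\<^sub>R b x') \<le> h * L * dist x x'" by (simp add: dist_norm norm_minus_commute mult.assoc)
      qed
    qed (rule h)
    then show "\<exists>x. y = x + h *\<^sub>R b x" by (metis diff_eq_eq)
  qed
qed

end

text \<open>\<open>B\<close> is the Jacobian. Its bound controls determinants uniformly in space;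
  its Lipschitz continuity makes \<open>flux \<phi>\<close> below Lipschitz.\<close>

locale smooth_drift = drift +
  fixes B :: "real^'n::finite \<Rightarrow> real^'n^'n" and K :: real
  assumes derB: "(b has_derivative (*v) (B x)) (at x)"
    and boundB: "\<bar>B x $ i $ j\<bar> \<le> K"
    and lipB: "\<exists>C\<ge>0. C-lipschitz_on UNIV (\<lambda>x. B x $ i $ j)"
begin

lemma K_nonneg: "K \<ge> 0" using boundB[of undefined undefined undefined] by linarith

text \<open>The divergence of \<open>\<phi> b\<close>. Its negative is the part of the adjoint of
  order one and zero.\<close>

definition flux :: "(real^'n \<Rightarrow> real) \<Rightarrow> real^'n \<Rightarrow> real" where
  "flux \<phi> x = b x \<bullet> grad \<phi> x + \<phi> x * trace (B x)"

lemma flux_lipschitz: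
  assumes \<phi>: "\<phi> \<in> test_functions"
  shows "\<exists>C\<ge>0. C-lipschitz_on UNIV (flux \<phi>)"
proof -
  obtain r where r: "r > 0" "\<And>x. r \<le> norm x \<Longrightarrow> \<phi> x = 0" using test_function_ball[OF \<phi>] by blast
  have 1: "\<exists>C\<ge>0. C-lipschitz_on UNIV (\<lambda>x. b x $ i * partial i \<phi> x)" for i
  proof -
    have lb: "L-lipschitz_on UNIV (\<lambda>x. b x $ i)"
    proof (rule lipschitz_onI[OF _ L_nonneg])
      fix x y
      have "dist (b x $ i) (b y $ i) = \<bar>(b x - b y) $ i\<bar>" by (simp add: dist_real_def)
      also have "\<dots> \<le> norm (b x - b y)" by (rule component_le_norm_cart)
      finally show "dist (b x $ i) (b y $ i) \<le> L * dist x y" using lipD[of x y] by (simp add: dist_norm)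
    qed
    have p: "partial i \<phi> \<in> test_functions" by (rule partial_test_function[OF \<phi>])
    obtain C s where "C-lipschitz_on UNIV (partial i \<phi>)" "\<And>x. s \<le> norm x \<Longrightarrow> partial i \<phi> x = 0"
      using test_function_lipschitz[OF p] test_function_ball[OF p] by metis
    then show ?thesis using lipschitz_mult_compact[OF lb] by blast
  qed
  have 2: "\<exists>C\<ge>0. C-lipschitz_on UNIV (\<lambda>x. B x $ i $ i * \<phi> x)" for i
  proof -
    obtain C C' where "C-lipschitz_on UNIV (\<lambda>x. B x $ i $ i)" "C'-lipschitz_on UNIV \<phi>"
      using lipB test_function_lipschitz[OF \<phi>] by metis
    then show ?thesis using lipschitz_mult_compact r(2) by blast
  qed
  obtain C1 C2 where C: "C1 \<ge> 0" "C1-lipschitz_on UNIV (\<lambda>x. \<Sum>i\<in>UNIV. b x $ i * partial i \<phi> x)"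
     "C2 \<ge> 0" "C2-lipschitz_on UNIV (\<lambda>x. \<Sum>i\<in>UNIV. B x $ i $ i * \<phi> x)"
    using lipschitz_sum_real[OF 1, of UNIV "\<lambda>i. i"] lipschitz_sum_real[OF 2, of UNIV "\<lambda>i. i"] by auto
  have "flux \<phi> = (\<lambda>x. (\<Sum>i\<in>UNIV. b x $ i * partial i \<phi> x) + (\<Sum>i\<in>UNIV. B x $ i $ i * \<phi> x))"
    by (auto simp: flux_def inner_vec_def grad_def trace_def sum_distrib_left mult.commute fun_eq_iff)
  then show ?thesis using lipschitz_on_add[OF C(2,4)] C(1,3) by (intro exI[of _ "C1 + C2"]) auto
qed

lemma flux_eq_0_outside:
  assumes "\<And>x. r \<le> norm x \<Longrightarrow> \<phi> x = 0" "r < norm x"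
  shows "flux \<phi> x = 0"
proof -
  have "partial i \<phi> x = 0" for i
    by (rule partial_eq_0_outside[where r=r]) (use assms in auto)
  then show ?thesis using assms by (simp add: flux_def grad_def inner_vec_def)
qed

lemma det_euler:
  obtains C where "C \<ge> 0" "\<And>x h. 0 \<le> h \<Longrightarrow> h \<le> 1 \<Longrightarrow> \<bar>det (wo_matrix (mat 1 + h *\<^sub>R B x)) - 1 - h * trace (B x)\<bar> \<le> C * h\<^sup>2"
proof -
  obtain C where C: "C \<ge> 0" "\<And>(M::real^'n wo^'n wo) h. (\<And>i j. \<bar>M$i$j\<bar> \<le> K) \<Longrightarrow> 0 \<le> h \<Longrightarrow> h \<le> 1 \<Longrightarrow>
     \<bar>det (mat 1 + h *\<^sub>R M) - 1 - h * trace M\<bar> \<le> C * h\<^sup>2"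
    using det_perturb[OF K_nonneg] by metis
  have "\<bar>det (wo_matrix (mat 1 + h *\<^sub>R B x)) - 1 - h * trace (B x)\<bar> \<le> C * h\<^sup>2" if "0 \<le> h" "h \<le> 1" for x h
  proof -
    have "\<bar>det (mat 1 + h *\<^sub>R wo_matrix (B x)) - 1 - h * trace (wo_matrix (B x))\<bar> \<le> C * h\<^sup>2"
      by (rule C(2)) (use that boundB in \<open>auto simp: wo_matrix_def\<close>)
    then show ?thesis by (simp only: wo_matrix_add_mat trace_wo_matrix)
  qed
  then show ?thesis using that C(1) by blast
qed

lemma det_euler_measurable: "(\<lambda>x. det (wo_matrix (mat 1 + h *\<^sub>R B x))) \<in> borel_measurable borel"
proof -
  have "continuous_on UNIV (\<lambda>x. B x $ i $ j)" for i j
    using lipB lipschitz_on_continuous_on by blast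
  then have "continuous_on UNIV (\<lambda>x. det (wo_matrix (mat 1 + h *\<^sub>R B x)))"
    by (simp add: det_def wo_matrix_def)
      (intro continuous_on_sum continuous_on_mult continuous_on_prod continuous_on_add continuous_on_const)
  then show ?thesis by (rule borel_measurable_continuous_onI)
qed

lemma trace_bound: "\<bar>trace (B x)\<bar> \<le> CARD('n) * K"
  unfolding trace_def by (intro order_trans[OF sum_abs sum_bounded_above]) (simp add: boundB)

lemma euler_has_derivative: "((\<lambda>x. x + h *\<^sub>R b x) has_derivative (*v) (mat 1 + h *\<^sub>R B x)) (at x)"
proof -
  have "((\<lambda>x. x + h *\<^sub>R b x) has_derivative (\<lambda>v. v + h *\<^sub>R (B x *v v))) (at x)"
    by (intro derivative_intros derB)
  moreover have "(\<lambda>v. v + h *\<^sub>R (B x *v v)) = (*v) (mat 1 + h *\<^sub>R B x)"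
    by (auto simp: matrix_vector_mult_add_rdistrib scaleR_matrix_vector_assoc)
  ultimately show ?thesis by simp
qed

text \<open>With \<open>V x = x + h b x\<close>, the change of variables is applied to the expected
  answer \<open>G (\<phi> - h flux \<phi>)\<close> and not to the left-hand side. Both integrals
  then contain \<open>G (V x)\<close>, only the forward map \<open>V\<close> occurs, and it remains
  to compare the two continuous factors pointwise.\<close>

lemma drift_consistency:
  assumes \<phi>: "\<phi> \<in> test_functions"
  obtains C h0 where "C \<ge> 0" "h0 > 0" "h0 \<le> 1"
    "\<And>h G M. \<lbrakk>0 < h; h \<le> h0; G \<in> borel_measurable borel; \<And>x. \<bar>G x\<bar> \<le> M\<rbrakk> \<Longrightarrow>
       \<bar>(LINT x|lborel. G (x + h *\<^sub>R b x) * \<phi> x) - (LINT x|lborel. G x * (\<phi> x - h * flux \<phi> x))\<bar> \<le> C * M * h\<^sup>2"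
proof -
  obtain r0 where r0: "r0 > 0" "\<And>x. r0 \<le> norm x \<Longrightarrow> \<phi> x = 0" using test_function_ball[OF \<phi>] by blast
  define r where "r = r0 + 1"
  have r: "r > 0" "\<And>x. r \<le> norm x \<Longrightarrow> \<phi> x = 0" "\<And>x. r \<le> norm x \<Longrightarrow> flux \<phi> x = 0"
    using r0 flux_eq_0_outside[OF r0(2)] by (auto simp: r_def)
  obtain LD where LD: "LD \<ge> 0" "LD-lipschitz_on UNIV (flux \<phi>)" using flux_lipschitz[OF \<phi>] by blast
  obtain P where P: "P > 0" "\<And>x. \<bar>\<phi> x\<bar> \<le> P" using test_function_bounded[OF \<phi>] by metis
  obtain C2 where C2: "C2 \<ge> 0" "\<And>y z. \<bar>\<phi> (y + z) - \<phi> y - grad \<phi> y \<bullet> z\<bar> \<le> C2 * norm z ^ 2"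
    using grad_test_function_lipschitz[OF \<phi>] by metis
  obtain C3 where C3: "C3 \<ge> 0" "\<And>x h. 0 \<le> h \<Longrightarrow> h \<le> 1 \<Longrightarrow> \<bar>det (wo_matrix (mat 1 + h *\<^sub>R B x)) - 1 - h * trace (B x)\<bar> \<le> C3 * h\<^sup>2"
    using det_euler by metis
  \<comment> \<open>For \<open>norm x > r'\<close>, \<open>h \<le> 1\<close> and
    \<open>h L \<le> 1/2\<close> the image \<open>V x\<close> has norm at least \<open>r\<close>, so
    both integrands vanish there. \<beta> bounds \<open>b\<close> on the ball of radius
    \<open>r'\<close>, and \<tau> bounds the divergence of \<open>b\<close> everywhere.\<close>
  define r' where "r' = 2 * (r + norm (b 0))"
  define \<beta> where "\<beta> = norm (b 0) + L * r'"
  define \<tau> where "\<tau> = real CARD('n) * K"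
  \<comment> \<open>The three summands are the constants of \<open>b1\<close>, \<open>b2\<close> and
    \<open>b3\<close> below, each with \<open>h^2\<close> taken out.\<close>
  define E where "E = P * C3 + P * \<tau> * (\<tau> + C3) + (C2 * \<beta>\<^sup>2 + LD * \<beta>) * (1 + \<tau> + C3)"
  define h0 where "h0 = 1 / (2 * (1 + L + \<tau> + C3))"
  define vol where "vol = measure lborel (cball (0::real^'n) r')"
  have \<tau>0: "\<tau> \<ge> 0" using K_nonneg by (simp add: \<tau>_def)
  have r'0: "r' > 0" using r(1) norm_ge_zero[of "b 0"] unfolding r'_def by (simp add: add_pos_nonneg)
  have \<beta>0: "\<beta> \<ge> 0" using L_nonneg r'0 by (simp add: \<beta>_def)
  have E0: "E \<ge> 0" unfolding E_def using P(1) C3(1) \<tau>0 C2(1) LD(1) \<beta>0 by (intro add_nonneg_nonneg mult_nonneg_nonneg) auto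
  have vol0: "vol \<ge> 0" unfolding vol_def by simp
  have h00: "h0 > 0" unfolding h0_def using L_nonneg \<tau>0 C3(1) by simp
  have hsmall: "h \<le> 1" "h * L \<le> 1/2" "h * (\<tau> + C3) \<le> 1/2" if h: "0 < h" "h \<le> h0" for h
  proof -
    have "h * (2 * (1 + L + \<tau> + C3)) \<le> 1" using h L_nonneg \<tau>0 C3(1) unfolding h0_def
      by (simp add: pos_le_divide_eq)
    then have "2 * h + 2 * (h * L) + 2 * (h * \<tau>) + 2 * (h * C3) \<le> 1" by (simp add: algebra_simps)
    moreover have "0 \<le> h * L" "0 \<le> h * \<tau>" "0 \<le> h * C3" using h L_nonneg \<tau>0 C3(1) by auto
    ultimately show "h \<le> 1" "h * L \<le> 1/2" "h * (\<tau> + C3) \<le> 1/2" using h(1) unfolding distrib_left by linarith+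
  qed
  have "\<bar>(LINT x|lborel. G (x + h *\<^sub>R b x) * \<phi> x) - (LINT x|lborel. G x * (\<phi> x - h * flux \<phi> x))\<bar> \<le> (E * vol) * M * h\<^sup>2"
    if h: "0 < h" "h \<le> h0" and Gm[measurable]: "G \<in> borel_measurable borel" and GM: "\<And>x. \<bar>G x\<bar> \<le> M" for h G M
  proof -
    note hs = hsmall[OF h]
    have M0: "M \<ge> 0" using GM[of 0] by linarith
    let ?V = "\<lambda>x. x + h *\<^sub>R b x"
    let ?J = "\<lambda>x. \<bar>det (wo_matrix (mat 1 + h *\<^sub>R B x))\<bar>"
    let ?c = "\<lambda>x. \<phi> x - h * flux \<phi> x"
    have [measurable]: "\<phi> \<in> borel_measurable borel" "flux \<phi> \<in> borel_measurable borel"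
      using test_function_continuous[OF \<phi>, of UNIV] lipschitz_on_continuous_on[OF LD(2)]
      by (auto intro: borel_measurable_continuous_onI)
    have cc: "continuous_on UNIV ?c" using test_function_continuous[OF \<phi>, of UNIV] lipschitz_on_continuous_on[OF LD(2)]
      by (intro continuous_intros)
    obtain Bc where Bc: "Bc > 0" "\<And>x. \<bar>?c x\<bar> \<le> Bc" using compact_support_bounded[OF cc, of r] r by auto
    have bd: "\<bar>G x * ?c x\<bar> \<le> M * Bc" for x unfolding abs_mult using GM Bc M0 by (intro mult_mono) auto
    have iG: "integrable lborel (\<lambda>x. G x * ?c x)"
      by (rule integrable_compact_support_bounded[where r=r and B="M * Bc"]) (use r bd in auto)
    have bij: "bij ?V" using h hs by (intro bij_euler) auto
    note cov = lborel_change_of_variables[OF euler_has_derivative bij iG det_euler_measurable]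
    have bd2: "\<bar>G (?V x) * \<phi> x\<bar> \<le> M * P" for x unfolding abs_mult using GM P M0 by (intro mult_mono) auto
    have iG2: "integrable lborel (\<lambda>x. G (?V x) * \<phi> x)"
      by (rule integrable_compact_support_bounded[where r=r and B="M * P"]) (use r bd2 in auto)
    have main: "\<bar>\<phi> x - ?J x * ?c (?V x)\<bar> \<le> E * h\<^sup>2 * indicator (cball 0 r') x" for x
    proof (cases "norm x \<le> r'")
      case False
      have "norm x \<le> norm (?V x) + h * norm (b x)" using norm_triangle_ineq4[of "?V x" "h *\<^sub>R b x"] h by simp
      moreover have "h * norm (b x) \<le> h * norm (b 0) + (h * L) * norm x"
        using mult_left_mono[OF linear_growth[of x], of h] h by (simp add: algebra_simps)
      moreover have "h * norm (b 0) \<le> 1 * norm (b 0)" using hs by (intro mult_right_mono) auto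
      moreover have "(h * L) * norm x \<le> 1/2 * norm x" using hs by (intro mult_right_mono) auto
      ultimately have "norm x / 2 - norm (b 0) \<le> norm (?V x)" by simp
      then have "r \<le> norm (?V x)" using False unfolding r'_def by simp
      moreover have "r \<le> norm x" using False r(1) norm_ge_zero[of "b 0"] unfolding r'_def distrib_left by linarith
      ultimately show ?thesis using r False by simp
    next
      case True
      let ?t = "trace (B x)" and ?d = "grad \<phi> x \<bullet> b x"
      \<comment> \<open>Remainders of three expansions: \<phi> along the drift step, the Jacobian,
        and the flux along the drift step. The last is only of order \<open>h\<close>, but it occurs
        multiplied by \<open>h\<close>.\<close>
      define e1 where "e1 = \<phi> (?V x) - \<phi> x - h * ?d"
      define e2 where "e2 = ?J x - 1 - h * ?t"
      define e3 where "e3 = flux \<phi> (?V x) - flux \<phi> x"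
      have bx: "norm (b x) \<le> \<beta>" using linear_growth[of x] mult_left_mono[OF True L_nonneg] unfolding \<beta>_def by linarith
      have t: "\<bar>?t\<bar> \<le> \<tau>" using trace_bound[of x] by (simp add: \<tau>_def)
      have "\<bar>e1\<bar> \<le> C2 * (norm (h *\<^sub>R b x))\<^sup>2" using C2(2)[of x "h *\<^sub>R b x"] by (simp add: e1_def)
      also have "\<dots> \<le> C2 * (h * \<beta>)\<^sup>2" using bx h C2(1) by (intro mult_left_mono power_mono) auto
      finally have e1: "\<bar>e1\<bar> \<le> h\<^sup>2 * (C2 * \<beta>\<^sup>2)" by (simp add: power_mult_distrib mult_ac)
      have det: "\<bar>det (wo_matrix (mat 1 + h *\<^sub>R B x)) - 1 - h * ?t\<bar> \<le> C3 * h\<^sup>2" using C3(2) h hs by simp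
      have "C3 * h\<^sup>2 \<le> C3 * h" using hs h C3(1) by (intro mult_left_mono) (auto simp: power2_eq_square mult_left_le_one_le)
      moreover have "h * \<bar>?t\<bar> \<le> h * \<tau>" using t h by (intro mult_left_mono) auto
      moreover have "\<bar>h * ?t\<bar> = h * \<bar>?t\<bar>" using h by (simp add: abs_mult)
      ultimately have "det (wo_matrix (mat 1 + h *\<^sub>R B x)) > 0" using det hs(3) unfolding distrib_left by (simp add: mult.commute)
      then have e2: "\<bar>e2\<bar> \<le> h\<^sup>2 * C3" using det by (simp add: e2_def mult.commute)
      have "\<bar>e3\<bar> \<le> LD * norm (h *\<^sub>R b x)" using lipschitz_onD[OF LD(2), of "?V x" x] by (simp add: e3_def dist_norm)
      also have "\<dots> \<le> LD * (h * \<beta>)" using bx h LD(1) by (intro mult_left_mono) auto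
      finally have e3: "\<bar>h * e3\<bar> \<le> h\<^sup>2 * (LD * \<beta>)" using h by (simp add: abs_mult power2_eq_square mult_ac mult_left_mono)
      have J: "?J x = 1 + h * ?t + e2" by (simp add: e2_def)
      have "h\<^sup>2 * C3 \<le> 1 * C3" using h hs C3(1) by (intro mult_right_mono) (auto simp: power_le_one)
      then have e2': "\<bar>e2\<bar> \<le> C3" using e2 by simp
      have e2'': "\<bar>e2\<bar> \<le> h * C3"
      proof -
        have "h * h \<le> h * 1" using h hs by (intro mult_left_mono) auto
        then have "h\<^sup>2 * C3 \<le> h * C3" using C3(1) by (intro mult_right_mono) (simp_all add: power2_eq_square)
        then show ?thesis using e2 by linarith
      qed
      have ht: "\<bar>h * ?t\<bar> \<le> \<tau>"
      proof -
        have "h * \<bar>?t\<bar> \<le> 1 * \<tau>" using h hs t by (intro mult_mono) auto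
        then show ?thesis using h by (simp add: abs_mult)
      qed
      have Jb: "\<bar>?J x\<bar> \<le> 1 + \<tau> + C3" unfolding J using ht e2' by linarith
      \<comment> \<open>The transport term of the flux cancels the first-order change of \<phi>,
        which leaves \<open>- h \<phi> trace B\<close>. The Jacobian \<open>1 + h trace B\<close>
        cancels this in turn, up to order \<open>h^2\<close>.\<close>
      have "?c (?V x) = \<phi> x - h * (\<phi> x * ?t) + (e1 - h * e3)"
        by (simp add: e1_def e3_def flux_def[of _ x] inner_commute algebra_simps)
      then have "?J x * ?c (?V x) - \<phi> x = (1 + h * ?t + e2) * (\<phi> x - h * (\<phi> x * ?t)) + ?J x * (e1 - h * e3) - \<phi> x"
        by (simp only: distrib_left J)
      also have "\<dots> = \<phi> x * e2 - h * (\<phi> x * ?t * (h * ?t + e2)) + ?J x * (e1 - h * e3)"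
        by (simp add: algebra_simps)
      finally have eqn: "?J x * ?c (?V x) - \<phi> x = \<phi> x * e2 - h * (\<phi> x * ?t * (h * ?t + e2)) + ?J x * (e1 - h * e3)" .
      have tri: "\<bar>u - v + w\<bar> \<le> \<bar>u\<bar> + \<bar>v\<bar> + \<bar>w\<bar>" for u v w :: real by linarith
      have b0: "\<bar>?J x * ?c (?V x) - \<phi> x\<bar> \<le> \<bar>\<phi> x * e2\<bar> + \<bar>h * (\<phi> x * ?t * (h * ?t + e2))\<bar> + \<bar>?J x * (e1 - h * e3)\<bar>"
        unfolding eqn by (rule tri)
      have b1: "\<bar>\<phi> x * e2\<bar> \<le> P * (h\<^sup>2 * C3)" unfolding abs_mult using P e2 by (intro mult_mono) auto
      have b2: "\<bar>h * (\<phi> x * ?t * (h * ?t + e2))\<bar> \<le> h * (P * \<tau> * (h * (\<tau> + C3)))"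
      proof -
        have "\<bar>h * ?t + e2\<bar> \<le> h * (\<tau> + C3)"
          using \<open>h * \<bar>?t\<bar> \<le> h * \<tau>\<close> \<open>\<bar>h * ?t\<bar> = h * \<bar>?t\<bar>\<close> e2'' unfolding distrib_left by linarith
        moreover have "\<bar>\<phi> x * ?t\<bar> \<le> P * \<tau>" unfolding abs_mult
          by (rule mult_mono[OF P(2) t]) (use P(1) in simp_all)
        moreover have "0 \<le> P * \<tau>" using P(1) \<tau>0 by simp
        ultimately have "\<bar>\<phi> x * ?t\<bar> * \<bar>h * ?t + e2\<bar> \<le> (P * \<tau>) * (h * (\<tau> + C3))"
          by (intro mult_mono) simp_all
        then have "\<bar>\<phi> x * ?t * (h * ?t + e2)\<bar> \<le> P * \<tau> * (h * (\<tau> + C3))" by (simp only: abs_mult)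
        from mult_left_mono[OF this, of h] h show ?thesis by (simp only: abs_mult abs_of_pos less_imp_le)
      qed
      have b3: "\<bar>?J x * (e1 - h * e3)\<bar> \<le> (1 + \<tau> + C3) * (h\<^sup>2 * (C2 * \<beta>\<^sup>2) + h\<^sup>2 * (LD * \<beta>))"
      proof -
        have "\<bar>e1 - h * e3\<bar> \<le> h\<^sup>2 * (C2 * \<beta>\<^sup>2) + h\<^sup>2 * (LD * \<beta>)" using e1 e3 by linarith
        from mult_mono[OF Jb this] show ?thesis using \<tau>0 C3(1) by (simp add: abs_mult)
      qed
      have Eh: "P * (h\<^sup>2 * C3) + h * (P * \<tau> * (h * (\<tau> + C3))) + (1 + \<tau> + C3) * (h\<^sup>2 * (C2 * \<beta>\<^sup>2) + h\<^sup>2 * (LD * \<beta>)) = E * h\<^sup>2"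
        unfolding E_def by (simp add: algebra_simps power2_eq_square)
      from order_trans[OF b0 add_mono[OF add_mono[OF b1 b2] b3]]
      have "\<bar>?J x * ?c (?V x) - \<phi> x\<bar> \<le> E * h\<^sup>2" unfolding Eh .
      then show ?thesis using True by (simp add: abs_minus_commute)
    qed
    have vi: "integrable lborel (indicator (cball (0::real^'n) r') :: _ \<Rightarrow> real)" by (rule integrable_indicator_cball)
    have "(LINT x|lborel. G (?V x) * \<phi> x) - (LINT x|lborel. G x * ?c x) =
      (LINT x|lborel. G (?V x) * (\<phi> x - ?J x * ?c (?V x)))"
      unfolding cov(2)[symmetric] by (subst Bochner_Integration.integral_diff[symmetric, OF iG2 cov(1)]) (simp add: algebra_simps)
    also have "\<bar>\<dots>\<bar> \<le> (LINT x|lborel. M * (E * h\<^sup>2) * indicator (cball (0::real^'n) r') x)"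
    proof (rule abs_integral_le)
      show "integrable lborel (\<lambda>x. G (?V x) * (\<phi> x - ?J x * ?c (?V x)))"
        using Bochner_Integration.integrable_diff[OF iG2 cov(1)] by (simp add: algebra_simps)
      show "integrable lborel (\<lambda>x. M * (E * h\<^sup>2) * indicator (cball (0::real^'n) r') x)" using vi by simp
      fix x
      have "\<bar>G (?V x) * (\<phi> x - ?J x * ?c (?V x))\<bar> \<le> M * (E * h\<^sup>2 * indicator (cball 0 r') x)"
        unfolding abs_mult[of "G (?V x)"] by (rule mult_mono[OF GM main M0]) (rule abs_ge_zero)
      then show "\<bar>G (?V x) * (\<phi> x - ?J x * ?c (?V x))\<bar> \<le> M * (E * h\<^sup>2) * indicator (cball 0 r') x" by (simp only: mult.assoc)
    qed
    also have "\<dots> = (E * vol) * M * h\<^sup>2" unfolding cball_integral(1) by (simp add: vol_def)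
    finally show ?thesis .
  qed
  moreover have "h0 \<le> 1" unfolding h0_def using L_nonneg \<tau>0 C3(1) by simp
  ultimately show ?thesis using that[of "E * vol" h0] E0 vol0 h00 by simp
qed

end

section \<open>The noise step and its consistency\<close>

locale euler_scheme = drift b L for b :: "real^'n::finite \<Rightarrow> real^'n" and L +
  fixes R :: "real^'n::finite^'n"
begin

definition noise :: "real \<Rightarrow> (real^'n \<Rightarrow> real) \<Rightarrow> real^'n \<Rightarrow> real" where
  "noise h g x = (LINT w|gauss h. g (x + R *v w))"

definition euler :: "real \<Rightarrow> (real^'n \<Rightarrow> real) \<Rightarrow> real^'n \<Rightarrow> real" where
  "euler h g x = noise h g (x + h *\<^sub>R b x)"

lemma R_measurable [measurable]: "(*v) R \<in> borel_measurable borel"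
  by (intro borel_measurable_continuous_onI linear_continuous_on matrix_vector_mul_bounded_linear)

lemma noise_measurable [measurable]:
  assumes h: "h > 0" and [measurable]: "g \<in> borel_measurable borel"
  shows "noise h g \<in> borel_measurable borel"
proof -
  interpret prob_space "gauss h :: (real^'n) measure" by (rule prob_space_gauss[OF h])
  show ?thesis unfolding noise_def[abs_def] by measurable
qed

lemma euler_measurable [measurable]:
  assumes h: "h > 0" and [measurable]: "g \<in> borel_measurable borel"
  shows "euler h g \<in> borel_measurable borel"
  unfolding euler_def[abs_def] using h by measurable

lemma noise_integrable:
  assumes h: "h > 0" and [measurable]: "g \<in> borel_measurable borel" and M: "\<And>x. \<bar>g x\<bar> \<le> (M::real)"
  shows "integrable (gauss h) (\<lambda>w. g (x + R *v w))"
proof -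
  interpret prob_space "gauss h :: (real^'n) measure" by (rule prob_space_gauss[OF h])
  show ?thesis by (rule integrable_const_bound[where B=M]) (auto simp: M)
qed

lemma noise_bound:
  assumes h: "h > 0" and g: "g \<in> borel_measurable borel" and M: "\<And>x. \<bar>g x\<bar> \<le> (M::real)"
  shows "\<bar>noise h g x\<bar> \<le> M"
proof -
  interpret prob_space "gauss h :: (real^'n) measure" by (rule prob_space_gauss[OF h])
  have "\<bar>noise h g x\<bar> \<le> (LINT w|(gauss h::(real^'n) measure). M)"
    unfolding noise_def by (rule abs_integral_le[OF noise_integrable[OF h g M]]) (auto simp: M)
  then show ?thesis using prob_space by simp
qed

lemma euler_bound:
  assumes h: "h > 0" and g: "g \<in> borel_measurable borel" and M: "\<And>x. \<bar>g x\<bar> \<le> (M::real)"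
  shows "\<bar>euler h g x\<bar> \<le> M"
  unfolding euler_def by (rule noise_bound[OF assms])

lemma euler_iterate:
  assumes h: "h > 0" and g: "g \<in> borel_measurable borel" and M: "\<And>x. \<bar>g x\<bar> \<le> (M::real)"
  shows "(euler h ^^ k) g \<in> borel_measurable borel" "\<bar>(euler h ^^ k) g x\<bar> \<le> M"
proof -
  have "(euler h ^^ k) g \<in> borel_measurable borel \<and> (\<forall>x. \<bar>(euler h ^^ k) g x\<bar> \<le> M)"
    using g M by (induction k) (auto simp: euler_measurable[OF h] intro!: euler_bound[OF h])
  then show "(euler h ^^ k) g \<in> borel_measurable borel" "\<bar>(euler h ^^ k) g x\<bar> \<le> M" by auto
qed

text \<open>Fubini and a translation move the noise onto the weight \<zeta>, where Taylor expansions
  and Lipschitz bounds can act on it.\<close>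

lemma noise_duality:
  assumes h: "h > 0" and [measurable]: "g \<in> borel_measurable borel" and M: "\<And>x. \<bar>g x\<bar> \<le> (M::real)"
    and c: "integrable lborel \<zeta>"
  shows "(LINT x|lborel. noise h g x * \<zeta> x) = (LINT w|gauss h. (LINT y|lborel. g y * \<zeta> (y - R *v w)))"
proof -
  interpret G: prob_space "gauss h :: (real^'n) measure" by (rule prob_space_gauss[OF h])
  interpret pair_sigma_finite lborel "gauss h :: (real^'n) measure" ..
  note [measurable] = borel_measurable_integrable[OF c]
  have [measurable]: "\<zeta> \<in> borel_measurable borel" using borel_measurable_integrable[OF c] by simp
  let ?f = "\<lambda>(x, w). g (x + R *v w) * \<zeta> x"
  have M0: "M \<ge> 0" using M[of 0] by linarith
  have fb: "\<bar>g (x + R *v w) * \<zeta> x\<bar> \<le> M * \<bar>\<zeta> x\<bar>" for x w unfolding abs_mult using M M0 by (intro mult_mono) auto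
  have fw: "integrable (gauss h) (\<lambda>w. g (x + R *v w) * \<zeta> x)" for x
    using noise_integrable[OF h assms(2) M] by simp
  have "integrable (lborel \<Otimes>\<^sub>M gauss h) ?f"
  proof (rule Fubini_integrable)
    show "?f \<in> borel_measurable (lborel \<Otimes>\<^sub>M gauss h)" by measurable
    show "integrable lborel (\<lambda>x. LINT w|gauss h. norm (?f (x, w)))"
    proof (rule Bochner_Integration.integrable_bound[where f="\<lambda>x. M * \<bar>\<zeta> x\<bar>"])
      show "integrable lborel (\<lambda>x. M * \<bar>\<zeta> x\<bar>)" using c by simp
      show "(\<lambda>x. LINT w|gauss h. norm (?f (x, w))) \<in> borel_measurable lborel"
        by measurable
      have "\<bar>(LINT w|gauss h. \<bar>g (x + R *v w) * \<zeta> x\<bar>)\<bar> \<le> M * \<bar>\<zeta> x\<bar>" for x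
      proof -
        have "(LINT w|gauss h. \<bar>g (x + R *v w) * \<zeta> x\<bar>) \<le> (LINT w|(gauss h::(real^'n) measure). M * \<bar>\<zeta> x\<bar>)"
          using fw[of x] fb by (intro integral_mono) auto
        then show ?thesis using G.prob_space by simp
      qed
      then show "AE x in lborel. norm ((LINT w|gauss h. norm (?f (x, w)))) \<le> norm (M * \<bar>\<zeta> x\<bar>)"
        using M0 by (auto simp: abs_mult intro!: AE_I2)
    qed
    show "AE x in lborel. integrable (gauss h) (\<lambda>w. ?f (x, w))"
      using fw by simp
  qed
  from Fubini_integral[OF this]
  have "(LINT w|gauss h. (LINT x|lborel. g (x + R *v w) * \<zeta> x)) = (LINT x|lborel. (LINT w|gauss h. g (x + R *v w) * \<zeta> x))"
    by simp
  moreover have "(LINT x|lborel. g (x + R *v w) * \<zeta> x) = (LINT y|lborel. g y * \<zeta> (y - R *v w))" for w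
    using integral_translate[of "\<lambda>y. g y * \<zeta> (y - R *v w)" "R *v w"] by simp
  ultimately show ?thesis by (simp add: noise_def)
qed

lemma R_moments:
  obtains C where "C \<ge> 0"
    "\<And>h. h > 0 \<Longrightarrow> integrable (gauss h) (\<lambda>w. norm (R *v w) ^ (2*k+1))"
    "\<And>h. h > 0 \<Longrightarrow> (LINT w|gauss h. norm (R *v w) ^ (2*k+1)) \<le> C * sqrt h ^ (2*k+1)"
proof -
  obtain C where C: "C \<ge> 0" "\<And>h. h > 0 \<Longrightarrow> integrable (gauss h) (\<lambda>y::real^'n. norm y ^ (2*k+1))"
    "\<And>h. h > 0 \<Longrightarrow> (LINT y|gauss h. norm (y::real^'n) ^ (2*k+1)) \<le> C * sqrt h ^ (2*k+1)"
    using gauss_norm_moment[where 'n='n] by metis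
  obtain D where D: "D > 0" "\<And>w. norm (R *v w) \<le> norm w * D"
  proof -
    have "\<exists>D>0. \<forall>w. norm (R *v w) \<le> norm w * D"
      by (rule bounded_linear.pos_bounded) (rule matrix_vector_mul_bounded_linear)
    then show thesis using that by auto
  qed
  have le: "norm (R *v w) ^ (2*k+1) \<le> D ^ (2*k+1) * norm w ^ (2*k+1)" for w
    using power_mono[OF D(2), of w "2*k+1"] by (simp only: power_mult_distrib mult.commute norm_ge_zero)
  have i: "integrable (gauss h) (\<lambda>w. norm (R *v w) ^ (2*k+1))" if "h > 0" for h
  proof (rule Bochner_Integration.integrable_bound[where f="\<lambda>w. D ^ (2*k+1) * norm w ^ (2*k+1)"])
    show "integrable (gauss h) (\<lambda>w::real^'n. D ^ (2*k+1) * norm w ^ (2*k+1))" using C(2)[OF that] by (rule integrable_mult_right)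
    show "AE w in gauss h. norm (norm (R *v w) ^ (2*k+1)) \<le> norm (D ^ (2*k+1) * norm w ^ (2*k+1))"
      by (rule AE_I2) (use le D(1) in \<open>simp del: power_Suc\<close>)
  qed measurable
  have "(LINT w|gauss h. norm (R *v w) ^ (2*k+1)) \<le> D ^ (2*k+1) * C * sqrt h ^ (2*k+1)" if h: "h > 0" for h
  proof -
    have "(LINT w|gauss h. norm (R *v w) ^ (2*k+1)) \<le> (LINT w|gauss h. D ^ (2*k+1) * norm (w::real^'n) ^ (2*k+1))"
    proof (rule integral_mono)
      show "integrable (gauss h) (\<lambda>w. norm (R *v w) ^ (2*k+1))" by (rule i[OF h])
      show "integrable (gauss h) (\<lambda>w::real^'n. D ^ (2*k+1) * norm w ^ (2*k+1))" using C(2)[OF h] by (rule integrable_mult_right)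
    qed (rule le)
    also have "\<dots> \<le> D ^ (2*k+1) * (C * sqrt h ^ (2*k+1))"
      using C(3)[OF h] D(1) by (simp del: power_Suc)
    finally show ?thesis by (simp only: mult.assoc)
  qed
  then show ?thesis using that[of "D ^ (2*k+1) * C"] i C(1) D(1) by simp
qed

lemma R_moment_2:
  assumes h: "h > 0"
  shows "integrable (gauss h) (\<lambda>w. (R *v w)$i)" "(LINT w|gauss h. (R *v w)$i) = 0"
    "integrable (gauss h) (\<lambda>w. (R *v w)$i * (R *v w)$j)" "(LINT w|gauss h. (R *v w)$i * (R *v w)$j) = h * (R ** transpose R)$i$j"
proof -
  have e1: "(R *v w)$i = (\<Sum>k\<in>UNIV. R$i$k * w$k)" for w i by (simp add: matrix_vector_mult_def)
  have e2: "(R *v w)$i * (R *v w)$j = (\<Sum>k\<in>UNIV. \<Sum>l\<in>UNIV. R$i$k * R$j$l * (w$k * w$l))" for w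
    unfolding e1 sum_product by (simp add: mult_ac)
  note m1 = gauss_moment_1[OF h, where 'n='n] and m2 = gauss_moment_2[OF h, where 'n='n]
  show "integrable (gauss h) (\<lambda>w. (R *v w)$i)" unfolding e1 using m1 by simp
  show "(LINT w|gauss h. (R *v w)$i) = 0" unfolding e1 using m1 by (subst Bochner_Integration.integral_sum) auto
  show "integrable (gauss h) (\<lambda>w. (R *v w)$i * (R *v w)$j)" unfolding e2 using m2 by simp
  have "(LINT w|gauss h. (R *v w)$i * (R *v w)$j) = (\<Sum>k\<in>UNIV. \<Sum>l\<in>UNIV. R$i$k * R$j$l * (if k = l then h else 0))"
    unfolding e2 using m2 by (simp add: Bochner_Integration.integral_sum)
  also have "\<dots> = h * (R ** transpose R)$i$j"
    by (simp add: matrix_matrix_mult_def transpose_def sum_distrib_left mult_ac if_distrib cong: if_cong)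
  finally show "(LINT w|gauss h. (R *v w)$i * (R *v w)$j) = h * (R ** transpose R)$i$j" .
qed

text \<open>Meant for \<zeta> = \<open>flux \<phi>\<close>, which is Lipschitz with compact support
  but in general not a test function. The rate \<open>sqrt h\<close> suffices because the flux
  enters one Euler step with a factor \<open>h\<close>.\<close>

lemma noise_consistency_0:
  assumes c: "Lc-lipschitz_on UNIV \<zeta>" and r: "\<And>x. r \<le> norm x \<Longrightarrow> \<zeta> x = 0"
  obtains C where "C \<ge> 0" "\<And>h g M. \<lbrakk>h > 0; g \<in> borel_measurable borel; \<And>x. \<bar>g x\<bar> \<le> M\<rbrakk> \<Longrightarrow>
     \<bar>(LINT x|lborel. noise h g x * \<zeta> x) - (LINT x|lborel. g x * \<zeta> x)\<bar> \<le> C * M * sqrt h"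
proof -
  have Lc: "Lc \<ge> 0" using c by (rule lipschitz_on_nonneg)
  have cc: "continuous_on UNIV \<zeta>" using c by (rule lipschitz_on_continuous_on)
  then have [measurable]: "\<zeta> \<in> borel_measurable borel" by (rule borel_measurable_continuous_onI)
  have ci: "integrable lborel \<zeta>" by (rule integrable_continuous_compact_support[OF cc r])
  define vol where "vol = measure lborel (cball (0::real^'n) r)"
  obtain C where C: "C \<ge> 0"
    "\<And>h. h > 0 \<Longrightarrow> integrable (gauss h) (\<lambda>w. norm (R *v w) ^ (2*0+1))"
    "\<And>h. h > 0 \<Longrightarrow> (LINT w|gauss h. norm (R *v w) ^ (2*0+1)) \<le> C * sqrt h ^ (2*0+1)"
    using R_moments[of 0] by metis
  have "\<bar>(LINT x|lborel. noise h g x * \<zeta> x) - (LINT x|lborel. g x * \<zeta> x)\<bar> \<le> (2 * Lc * vol * C) * M * sqrt h"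
    if h: "h > 0" and g[measurable]: "g \<in> borel_measurable borel" and M: "\<And>x. \<bar>g x\<bar> \<le> (M::real)" for h g M
  proof -
    interpret G: prob_space "gauss h :: (real^'n) measure" by (rule prob_space_gauss[OF h])
    have M0: "M \<ge> 0" using M[of 0] by linarith
    define \<Psi> where "\<Psi> z = (LINT y|lborel. g y * \<zeta> (y - z))" for z
    have gi: "integrable lborel (\<lambda>y. g y * \<zeta> (y - z))" for z
      by (rule integral_mult_bound(1)[OF _ g M]) (use integrable_translate[OF ci, of "- z"] in simp)
    have \<Psi>: "\<bar>\<Psi> z - \<Psi> 0\<bar> \<le> (2 * Lc * vol * M) * norm z" for z
    proof -
      have "\<Psi> z - \<Psi> 0 = (LINT y|lborel. g y * \<zeta> (y - z) - g y * \<zeta> (y - 0))"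
        unfolding \<Psi>_def by (rule Bochner_Integration.integral_diff[symmetric, OF gi gi])
      also have "\<bar>\<dots>\<bar> \<le> (LINT y|lborel. (M * (Lc * norm z)) * (indicator (cball 0 r) y + indicator (cball 0 r) (y + - z)))"
      proof (rule abs_integral_le)
        show "integrable lborel (\<lambda>y. g y * \<zeta> (y - z) - g y * \<zeta> (y - 0))" using gi by (intro Bochner_Integration.integrable_diff)
        show "integrable lborel (\<lambda>y. (M * (Lc * norm z)) * (indicator (cball 0 r) y + indicator (cball 0 r) (y + - z)) :: real)"
          by (rule cball_integral)
        fix y
        have nn: "0 \<le> M * (Lc * norm z)" using M0 Lc by simp
        show "\<bar>g y * \<zeta> (y - z) - g y * \<zeta> (y - 0)\<bar> \<le> (M * (Lc * norm z)) * (indicator (cball 0 r) y + indicator (cball 0 r) (y + - z))"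
        proof (cases "norm y \<le> r \<or> norm (y - z) \<le> r")
          case True
          have "\<bar>g y * \<zeta> (y - z) - g y * \<zeta> (y - 0)\<bar> = \<bar>g y\<bar> * \<bar>\<zeta> (y - z) - \<zeta> y\<bar>"
            by (simp add: abs_mult[symmetric] algebra_simps)
          also have "\<dots> \<le> M * (Lc * norm z)"
            using M lipschitz_onD[OF c, of "y - z" y] M0 by (intro mult_mono) (auto simp: dist_norm)
          also have "\<dots> \<le> (M * (Lc * norm z)) * (indicator (cball 0 r) y + indicator (cball 0 r) (y + - z))"
          proof -
            have "1 \<le> (indicator (cball 0 r) y + indicator (cball 0 r) (y + - z) :: real)" using True by (auto simp: indicator_def)
            from mult_left_mono[OF this nn] show ?thesis by simp
          qed
          finally show ?thesis .
        next
          case False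
          then show ?thesis using r[of y] r[of "y - z"] nn by (simp add: indicator_def)
        qed
      qed
      also have "\<dots> = (M * (Lc * norm z)) * (2 * vol)" unfolding vol_def by (rule cball_integral(3))
      finally show ?thesis by (simp add: algebra_simps)
    qed
    have \<Psi>m: "(\<lambda>w. \<Psi> (R *v w)) \<in> borel_measurable (gauss h)" unfolding \<Psi>_def by measurable
    have Ri: "integrable (gauss h) (\<lambda>w. norm (R *v w))" using C(2)[OF h] by simp
    have di: "integrable (gauss h) (\<lambda>w. \<Psi> (R *v w) - \<Psi> 0)"
    proof (rule Bochner_Integration.integrable_bound[where f="\<lambda>w. (2 * Lc * vol * M) * norm (R *v w)"])
      show "AE w in gauss h. norm (\<Psi> (R *v w) - \<Psi> 0) \<le> norm ((2 * Lc * vol * M) * norm (R *v w))"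
        by (rule AE_I2) (use \<Psi> in \<open>auto intro: order_trans[OF _ abs_ge_self]\<close>)
    qed (use Ri \<Psi>m in auto)
    have "(LINT x|lborel. noise h g x * \<zeta> x) - (LINT x|lborel. g x * \<zeta> x) = (LINT w|gauss h. \<Psi> (R *v w)) - \<Psi> 0"
      unfolding noise_duality[OF h g M ci] by (simp add: \<Psi>_def)
    also have "\<dots> = (LINT w|gauss h. \<Psi> (R *v w) - \<Psi> 0)"
    proof -
      have "integrable (gauss h) (\<lambda>w. \<Psi> (R *v w))"
        using Bochner_Integration.integrable_add[OF di G.integrable_const[of "\<Psi> 0"]] by simp
      then show ?thesis using G.prob_space by simp
    qed
    also have "\<bar>\<dots>\<bar> \<le> (LINT w|gauss h. (2 * Lc * vol * M) * norm (R *v w))"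
      by (rule abs_integral_le) (use di Ri \<Psi> in auto)
    also have "\<dots> = (2 * Lc * vol * M) * (LINT w|gauss h. norm (R *v w))" by simp
    also have "\<dots> \<le> (2 * Lc * vol * M) * (C * sqrt h)"
      using C(3)[OF h] M0 Lc by (intro mult_left_mono) (auto simp: vol_def)
    finally show ?thesis by (simp add: mult_ac)
  qed
  moreover have "vol \<ge> 0" by (simp add: vol_def)
  ultimately show ?thesis using that[of "2 * Lc * vol * C"] Lc C(1) by simp
qed

text \<open>Averaging the expansion of the pairing over the noise removes the linear terms, since
  the noise has mean zero, and turns \<open>z_i z_j\<close> into \<open>h\<close> times an entry of
  \<open>R R^T\<close>; the cubic remainder averages to order \<open>sqrt h ^ 3\<close>.\<close>

lemma noise_consistency:
  assumes \<phi>: "\<phi> \<in> test_functions"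
  obtains C where "C \<ge> 0" "\<And>h g M. \<lbrakk>h > 0; g \<in> borel_measurable borel; \<And>x. \<bar>g x\<bar> \<le> M\<rbrakk> \<Longrightarrow>
     \<bar>(LINT x|lborel. noise h g x * \<phi> x) - (LINT x|lborel. g x * \<phi> x)
       - h * (LINT x|lborel. g x * (1/2 * trace ((R ** transpose R) ** hessian \<phi> x)))\<bar> \<le> C * M * sqrt h ^ 3"
proof -
  obtain Ct where Ct: "Ct \<ge> 0" "\<And>g M z. \<lbrakk>g \<in> borel_measurable borel; \<And>x. \<bar>g x\<bar> \<le> M\<rbrakk> \<Longrightarrow>
    \<bar>(LINT y|lborel. g y * \<phi> (y - z)) - ((LINT y|lborel. g y * \<phi> y) - (\<Sum>i\<in>UNIV. z$i * (LINT y|lborel. g y * partial i \<phi> y))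
     + (1/2) * (\<Sum>i\<in>UNIV. \<Sum>j\<in>UNIV. z$i * z$j * (LINT y|lborel. g y * partial i (partial j \<phi>) y)))\<bar> \<le> Ct * M * norm z ^ 3"
    by (rule pairing_taylor[OF \<phi>]) blast
  have p2: "partial i (partial j \<phi>) \<in> test_functions" for i j
    by (intro partial_test_function \<phi>)
  obtain C where C: "C \<ge> 0"
    "\<And>h. h > 0 \<Longrightarrow> integrable (gauss h) (\<lambda>w. norm (R *v w) ^ (2*1+1))"
    "\<And>h. h > 0 \<Longrightarrow> (LINT w|gauss h. norm (R *v w) ^ (2*1+1)) \<le> C * sqrt h ^ (2*1+1)"
    using R_moments[of 1] by metis
  have "\<bar>(LINT x|lborel. noise h g x * \<phi> x) - (LINT x|lborel. g x * \<phi> x)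
       - h * (LINT x|lborel. g x * (1/2 * trace ((R ** transpose R) ** hessian \<phi> x)))\<bar> \<le> (Ct * C) * M * sqrt h ^ 3"
    if h: "h > 0" and g[measurable]: "g \<in> borel_measurable borel" and M: "\<And>x. \<bar>g x\<bar> \<le> M" for h g M
  proof -
    interpret G: prob_space "gauss h :: (real^'n) measure" by (rule prob_space_gauss[OF h])
    have M0: "M \<ge> 0" using M[of 0] by linarith
    define \<Psi> where "\<Psi> z = (LINT y|lborel. g y * \<phi> (y - z))" for z
    define p where "p i = (LINT y|lborel. g y * partial i \<phi> y)" for i
    define q where "q i j = (LINT y|lborel. g y * partial i (partial j \<phi>) y)" for i j
    have gi: "integrable lborel (\<lambda>y. g y * \<psi> y)" if "integrable lborel \<psi>" for \<psi> :: "real^'n \<Rightarrow> real"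
      by (rule integral_mult_bound(1)[OF that g M])
    define T where "T z = \<Psi> 0 - (\<Sum>i\<in>UNIV. z$i * p i) + (1/2) * (\<Sum>i\<in>UNIV. \<Sum>j\<in>UNIV. z$i * z$j * q i j)" for z
    have \<Psi>: "\<bar>\<Psi> z - T z\<bar> \<le> (Ct * M) * norm z ^ 3" for z
      using Ct(2)[OF g M, of z] unfolding T_def \<Psi>_def p_def q_def diff_zero .
    have [measurable]: "\<phi> \<in> borel_measurable borel" using borel_measurable_integrable[OF test_function_integrable[OF \<phi>]] by simp
    have \<Psi>m: "(\<lambda>w. \<Psi> (R *v w)) \<in> borel_measurable (gauss h)" unfolding \<Psi>_def by measurable
    have Ri: "integrable (gauss h) (\<lambda>w. norm (R *v w) ^ 3)" using C(2)[OF h] by (simp add: eval_nat_numeral)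
    note R2 = R_moment_2[OF h]
    have TI: "integrable (gauss h) (\<lambda>w. T (R *v w))" unfolding T_def using R2 by simp
    have "(LINT w|gauss h. T (R *v w)) = \<Psi> 0 + (1/2) * (\<Sum>i\<in>UNIV. \<Sum>j\<in>UNIV. (h * (R ** transpose R)$i$j) * q i j)"
      unfolding T_def using R2 G.prob_space by (simp add: Bochner_Integration.integral_sum)
    also have "(\<Sum>i\<in>UNIV. \<Sum>j\<in>UNIV. (h * (R ** transpose R)$i$j) * q i j) = h * (LINT x|lborel. g x * trace ((R ** transpose R) ** hessian \<phi> x))"
    proof -
      \<comment> \<open>The Hessian enters the trace with its indices in the opposite order from
        \<open>q\<close>; the symmetry of \<open>R R^T\<close> reconciles them.\<close>
      have sym: "(R ** transpose R)$i$j = (R ** transpose R)$j$i" for i j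
        by (simp add: matrix_matrix_mult_def transpose_def mult.commute)
      have "g x * trace ((R ** transpose R) ** hessian \<phi> x) = (\<Sum>i\<in>UNIV. \<Sum>j\<in>UNIV. (R ** transpose R)$i$j * (g x * partial j (partial i \<phi>) x))" for x
        unfolding trace_def matrix_matrix_mult_def[of "R ** transpose R"] by (simp add: hessian_def sum_distrib_left mult_ac)
      then have "(LINT x|lborel. g x * trace ((R ** transpose R) ** hessian \<phi> x)) = (\<Sum>i\<in>UNIV. \<Sum>j\<in>UNIV. (R ** transpose R)$i$j * q j i)"
        unfolding q_def using gi[OF test_function_integrable[OF p2]] by (simp add: Bochner_Integration.integral_sum)
      also have "\<dots> = (\<Sum>i\<in>UNIV. \<Sum>j\<in>UNIV. (R ** transpose R)$i$j * q i j)"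
        by (subst sum.swap) (simp add: sym)
      finally show ?thesis by (simp add: sum_distrib_left mult.assoc)
    qed
    finally have TE: "(LINT w|gauss h. T (R *v w)) = \<Psi> 0 + h * (LINT x|lborel. g x * (1/2 * trace ((R ** transpose R) ** hessian \<phi> x)))"
      by simp
    have di: "integrable (gauss h) (\<lambda>w. \<Psi> (R *v w) - T (R *v w))"
    proof (rule Bochner_Integration.integrable_bound[where f="\<lambda>w. (Ct * M) * norm (R *v w) ^ 3"])
      show "AE w in gauss h. norm (\<Psi> (R *v w) - T (R *v w)) \<le> norm ((Ct * M) * norm (R *v w) ^ 3)"
        by (rule AE_I2) (use \<Psi> in \<open>auto intro: order_trans[OF _ abs_ge_self]\<close>)
    qed (use Ri \<Psi>m TI in auto)
    have \<Psi>I: "integrable (gauss h) (\<lambda>w. \<Psi> (R *v w))"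
      using Bochner_Integration.integrable_add[OF di TI] by simp
    have "(LINT x|lborel. noise h g x * \<phi> x) - (LINT x|lborel. g x * \<phi> x)
       - h * (LINT x|lborel. g x * (1/2 * trace ((R ** transpose R) ** hessian \<phi> x))) = (LINT w|gauss h. \<Psi> (R *v w)) - (LINT w|gauss h. T (R *v w))"
      unfolding noise_duality[OF h g M test_function_integrable[OF \<phi>]] TE by (simp add: \<Psi>_def)
    also have "\<dots> = (LINT w|gauss h. \<Psi> (R *v w) - T (R *v w))" using \<Psi>I TI by simp
    also have "\<bar>\<dots>\<bar> \<le> (LINT w|gauss h. (Ct * M) * norm (R *v w) ^ 3)"
      by (rule abs_integral_le) (use di Ri \<Psi> in auto)
    also have "\<dots> = (Ct * M) * (LINT w|gauss h. norm (R *v w) ^ 3)" by simp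
    also have "\<dots> \<le> (Ct * M) * (C * sqrt h ^ 3)"
      using C(3)[OF h] M0 Ct(1) by (intro mult_left_mono) (auto simp: eval_nat_numeral)
    finally show ?thesis by (simp add: mult_ac)
  qed
  then show ?thesis using that[of "Ct * C"] Ct(1) C(1) by simp
qed

end

section \<open>Consistency of a full Euler step with the adjoint operator\<close>

locale smooth_euler_scheme = smooth_drift b L B K + euler_scheme b L R
  for b :: "real^'n::finite \<Rightarrow> real^'n" and L B K R
begin

text \<open>The formal adjoint written in terms of \<open>R\<close>, with transport and divergence
  terms merged into the flux. It agrees with \<open>adjoint_operator\<close> once
  \<open>R ** transpose R = Q\<close> and \<open>B\<close> is the Jacobian of
  \<open>A x + F x\<close>.\<close>

definition adj :: "(real^'n \<Rightarrow> real) \<Rightarrow> real^'n \<Rightarrow> real" where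
  "adj \<phi> x = 1/2 * trace ((R ** transpose R) ** hessian \<phi> x) - flux \<phi> x"

lemma adj_continuous: "\<phi> \<in> test_functions \<Longrightarrow> continuous_on UNIV (adj \<phi>)"
proof -
  assume \<phi>: "\<phi> \<in> test_functions"
  have h: "continuous_on UNIV (\<lambda>x. hessian \<phi> x $ i $ j)" for i j
    by (simp add: hessian_def test_function_continuous[OF partial_test_function[OF partial_test_function[OF \<phi>]]])
  have "continuous_on UNIV (\<lambda>x. trace ((R ** transpose R) ** hessian \<phi> x))"
    unfolding trace_def matrix_matrix_mult_def[of "R ** transpose R"]
    by (simp, intro continuous_on_sum continuous_on_mult continuous_on_const h)
  moreover obtain C where "C-lipschitz_on UNIV (flux \<phi>)" using flux_lipschitz[OF \<phi>] by blast
  ultimately show ?thesis unfolding adj_def[abs_def]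
    by (intro continuous_on_diff continuous_on_mult continuous_on_const) (auto intro: lipschitz_on_continuous_on)
qed

lemma adj_eq_0_outside:
  assumes "\<And>x. r \<le> norm x \<Longrightarrow> \<phi> x = 0" "r < norm x"
  shows "adj \<phi> x = 0"
proof -
  have p: "partial i \<phi> x = 0" if "r < norm x" for i x
    by (rule partial_eq_0_outside[where r=r]) (use assms that in auto)
  have "partial j (partial i \<phi>) x = 0" for i j
    by (rule partial_eq_0_outside[where r=r]) (use p assms in auto)
  then have "hessian \<phi> x = 0" by (simp add: hessian_def vec_eq_iff)
  then show ?thesis using flux_eq_0_outside[OF assms] by (simp add: adj_def trace_def matrix_matrix_mult_def)
qed

lemma adj_integrable:
  assumes \<phi>: "\<phi> \<in> test_functions" shows "integrable lborel (adj \<phi>)"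
proof -
  obtain r where r: "\<And>x. r \<le> norm x \<Longrightarrow> \<phi> x = 0" using test_function_ball[OF \<phi>] by blast
  show ?thesis
    by (rule integrable_continuous_compact_support[OF adj_continuous[OF \<phi>], of "r + 1"]) (use adj_eq_0_outside[OF r] in auto)
qed

text \<open>The drift step is expanded first, which leaves \<open>noise h g\<close> paired with
  \<phi> and, with weight \<open>h\<close>, with the flux. The first pairing calls for the full
  noise expansion, the second for \<open>noise_consistency_0\<close>.\<close>

lemma euler_consistency:
  assumes \<phi>: "\<phi> \<in> test_functions"
  obtains C h0 where "C \<ge> 0" "h0 > 0"
    "\<And>h g M. \<lbrakk>0 < h; h \<le> h0; g \<in> borel_measurable borel; \<And>x. \<bar>g x\<bar> \<le> M\<rbrakk> \<Longrightarrow>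
       \<bar>(LINT x|lborel. euler h g x * \<phi> x) - (LINT x|lborel. g x * \<phi> x) - h * (LINT x|lborel. g x * adj \<phi> x)\<bar>
         \<le> C * M * (h * sqrt h)"
proof -
  obtain r where r: "\<And>x. r \<le> norm x \<Longrightarrow> \<phi> x = 0" using test_function_ball[OF \<phi>] by blast
  obtain LD where LD: "LD-lipschitz_on UNIV (flux \<phi>)" using flux_lipschitz[OF \<phi>] by blast
  have r1: "\<And>x. r + 1 \<le> norm x \<Longrightarrow> flux \<phi> x = 0" using flux_eq_0_outside[OF r] by auto
  have Fi: "integrable lborel (flux \<phi>)"
    by (rule integrable_continuous_compact_support[OF lipschitz_on_continuous_on[OF LD] r1])
  note \<phi>i = test_function_integrable[OF \<phi>]
  obtain C1 h0 where 1: "C1 \<ge> 0" "h0 > 0" "h0 \<le> 1"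
    "\<And>h G M. \<lbrakk>0 < h; h \<le> h0; G \<in> borel_measurable borel; \<And>x. \<bar>G x\<bar> \<le> M\<rbrakk> \<Longrightarrow>
       \<bar>(LINT x|lborel. G (x + h *\<^sub>R b x) * \<phi> x) - (LINT x|lborel. G x * (\<phi> x - h * flux \<phi> x))\<bar> \<le> C1 * M * h\<^sup>2"
    using drift_consistency[OF \<phi>] by blast
  obtain C2 where 2: "C2 \<ge> 0" "\<And>h g M. \<lbrakk>h > 0; g \<in> borel_measurable borel; \<And>x. \<bar>g x\<bar> \<le> M\<rbrakk> \<Longrightarrow>
     \<bar>(LINT x|lborel. noise h g x * \<phi> x) - (LINT x|lborel. g x * \<phi> x)
       - h * (LINT x|lborel. g x * (1/2 * trace ((R ** transpose R) ** hessian \<phi> x)))\<bar> \<le> C2 * M * sqrt h ^ 3"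
    using noise_consistency[OF \<phi>] by blast
  obtain C3 where 3: "C3 \<ge> 0" "\<And>h g M. \<lbrakk>h > 0; g \<in> borel_measurable borel; \<And>x. \<bar>g x\<bar> \<le> M\<rbrakk> \<Longrightarrow>
     \<bar>(LINT x|lborel. noise h g x * flux \<phi> x) - (LINT x|lborel. g x * flux \<phi> x)\<bar> \<le> C3 * M * sqrt h"
    using noise_consistency_0[OF LD r1] by blast
  have "\<bar>(LINT x|lborel. euler h g x * \<phi> x) - (LINT x|lborel. g x * \<phi> x) - h * (LINT x|lborel. g x * adj \<phi> x)\<bar>
         \<le> (C1 + C2 + C3) * M * (h * sqrt h)"
    if h: "0 < h" "h \<le> h0" and g[measurable]: "g \<in> borel_measurable borel" and M: "\<And>x. \<bar>g x\<bar> \<le> M" for h g M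
  proof -
    have M0: "M \<ge> 0" using M[of 0] by linarith
    have gi: "integrable lborel (\<lambda>y. f y * \<psi> y)" if "integrable lborel \<psi>" and f[measurable]: "f \<in> borel_measurable borel" "\<And>x. \<bar>f x\<bar> \<le> M" for f \<psi> :: "real^'n \<Rightarrow> real"
      by (rule integral_mult_bound(1)[OF that])
    let ?N = "noise h g"
    have Nm: "?N \<in> borel_measurable borel" using h by measurable
    have NM: "\<bar>?N x\<bar> \<le> M" for x by (rule noise_bound[OF h(1) g M])
    have hs: "h\<^sup>2 \<le> h * sqrt h"
    proof -
      have "h \<le> 1" using h 1(3) by linarith
      then have "sqrt h * sqrt h \<le> 1 * sqrt h" using h by (intro mult_right_mono) auto
      then have "h \<le> sqrt h" using h by simp
      then show ?thesis using h by (simp add: power2_eq_square)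
    qed
    have s3: "sqrt h ^ 3 = h * sqrt h" using h by (simp add: power3_eq_cube)
    have a: "\<bar>(LINT x|lborel. euler h g x * \<phi> x) - (LINT x|lborel. ?N x * (\<phi> x - h * flux \<phi> x))\<bar> \<le> C1 * M * h\<^sup>2"
      unfolding euler_def by (rule 1(4)[OF h Nm NM])
    have b: "(LINT x|lborel. ?N x * (\<phi> x - h * flux \<phi> x)) = (LINT x|lborel. ?N x * \<phi> x) - h * (LINT x|lborel. ?N x * flux \<phi> x)"
      using gi[OF \<phi>i Nm NM] gi[OF Fi Nm NM] by (simp add: right_diff_distrib mult.left_commute[of _ h])
    have ti: "integrable lborel (\<lambda>x. 1/2 * trace ((R ** transpose R) ** hessian \<phi> x))"
      using Bochner_Integration.integrable_add[OF adj_integrable[OF \<phi>] Fi] by (simp add: adj_def)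
    have c: "(LINT x|lborel. g x * adj \<phi> x) = (LINT x|lborel. g x * (1/2 * trace ((R ** transpose R) ** hessian \<phi> x))) - (LINT x|lborel. g x * flux \<phi> x)"
      unfolding adj_def right_diff_distrib[of "g _"]
      by (rule Bochner_Integration.integral_diff[OF gi[OF ti g M] gi[OF Fi g M]])
    have d: "\<bar>h * ((LINT x|lborel. ?N x * flux \<phi> x) - (LINT x|lborel. g x * flux \<phi> x))\<bar> \<le> h * (C3 * M * sqrt h)"
      unfolding abs_mult using 3(2)[OF h(1) g M] h by (intro mult_mono) auto
    have "C1 * M * h\<^sup>2 \<le> C1 * M * (h * sqrt h)" using hs 1(1) M0 by (intro mult_left_mono) auto
    moreover have "\<bar>X - gP - h * (gH - gF)\<bar> \<le> c1 + c2 + c3"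
      if "\<bar>X - (NP - h * NF)\<bar> \<le> c1" "\<bar>NP - gP - h * gH\<bar> \<le> c2" "\<bar>h * (NF - gF)\<bar> \<le> c3" for X gP gH gF NP NF c1 c2 c3 :: real
    proof -
      have e: "X - gP - h * (gH - gF) = (X - (NP - h * NF)) + (NP - gP - h * gH) - h * (NF - gF)" by (simp add: algebra_simps)
      have "\<bar>u + v - w\<bar> \<le> c1 + c2 + c3" if "\<bar>u\<bar> \<le> c1" "\<bar>v\<bar> \<le> c2" "\<bar>w\<bar> \<le> c3" for u v w :: real using that by linarith
      from this[OF that] show ?thesis unfolding e .
    qed
    note this[OF a[unfolded b] 2(2)[OF h(1) g M, unfolded s3] d]
    ultimately have "\<bar>(LINT x|lborel. euler h g x * \<phi> x) - (LINT x|lborel. g x * \<phi> x) - h * (LINT x|lborel. g x * adj \<phi> x)\<bar>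
      \<le> C1 * M * (h * sqrt h) + C2 * M * (h * sqrt h) + h * (C3 * M * sqrt h)" unfolding c by linarith
    then show ?thesis by (simp only: distrib_right mult.assoc mult.left_commute[of h])
  qed
  then show ?thesis using that[of "C1 + C2 + C3" h0] 1 2 3 by simp
qed

end

section \<open>Convergence of the Euler scheme\<close>

context drift
begin

text \<open>The scheme is driven by an arbitrary path \<gamma>: \<open>R W\<close> for the
  diffusion, and an integrated control for the linear system of the smoothing part.\<close>

primrec eul :: "real \<Rightarrow> (real \<Rightarrow> real^'n) \<Rightarrow> real^'n \<Rightarrow> nat \<Rightarrow> real^'n" where
  "eul h \<gamma> x 0 = x"
| "eul h \<gamma> x (Suc k) = eul h \<gamma> x k + h *\<^sub>R b (eul h \<gamma> x k) + (\<gamma> (real (Suc k) * h) - \<gamma> (real k * h))"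

text \<open>The driving increments cancel in the difference of two schemes, because the noise is
  additive.\<close>

lemma eul_stability:
  assumes h: "h \<ge> 0"
  shows "norm (eul h \<gamma> x k - eul h \<gamma> y k) \<le> (1 + h * L) ^ k * norm (x - y)"
proof (induction k)
  case (Suc k)
  let ?u = "eul h \<gamma> x k" and ?v = "eul h \<gamma> y k"
  have e: "eul h \<gamma> x (Suc k) - eul h \<gamma> y (Suc k) = (?u - ?v) + h *\<^sub>R (b ?u - b ?v)" by (simp add: algebra_simps)
  have "norm (eul h \<gamma> x (Suc k) - eul h \<gamma> y (Suc k)) \<le> norm (?u - ?v) + h * norm (b ?u - b ?v)"
    unfolding e using norm_triangle_ineq[of "?u - ?v" "h *\<^sub>R (b ?u - b ?v)"] h by simp
  also have "\<dots> \<le> norm (?u - ?v) + h * (L * norm (?u - ?v))"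
    by (intro add_left_mono mult_left_mono lipD h)
  also have "\<dots> = (1 + h * L) * norm (?u - ?v)" by (simp add: algebra_simps)
  also have "\<dots> \<le> (1 + h * L) * ((1 + h * L) ^ k * norm (x - y))"
    using Suc h L_nonneg by (intro mult_left_mono) simp_all
  finally show ?case by simp
qed simp

lemma power_le_exp: 
  assumes "h \<ge> 0" shows "(1 + h * L) ^ k \<le> exp (L * (real k * h))"
proof -
  have "(1 + h * L) ^ k \<le> exp (h * L) ^ k"
    using assms L_nonneg by (intro power_mono) simp_all
  also have "\<dots> = exp (L * (real k * h))" by (simp add: exp_of_nat_mult[symmetric] mult_ac)
  finally show ?thesis .
qed

text \<open>Additive noise makes convergence a pathwise matter. If \<open>w\<close> bounds the
  oscillation of \<open>X\<close> over one step, the error obeys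
  \<open>e' \<le> (1 + h L) e + h L w\<close>, and the stated bound solves this recursion with
  equality.\<close>

lemma eul_error:
  fixes X \<gamma> :: "real \<Rightarrow> real^'n"
  assumes h: "h > 0"
    and Xc: "continuous_on {0..} X"
    and X: "\<And>t. t \<ge> 0 \<Longrightarrow> X t = x + integral {0..t} (\<lambda>s. b (X s)) + \<gamma> t"
    and \<gamma>0: "\<gamma> 0 = 0"
    and w: "\<And>s s'. 0 \<le> s \<Longrightarrow> s \<le> s' \<Longrightarrow> s' \<le> T \<Longrightarrow> s' - s \<le> h \<Longrightarrow> norm (X s' - X s) \<le> w"
    and k: "real k * h \<le> T" and w0: "w \<ge> 0"
  shows "norm (X (real k * h) - eul h \<gamma> x k) \<le> ((1 + h * L) ^ k - 1) * w"
  using k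
proof (induction k)
  case 0
  then show ?case using X[of 0] \<gamma>0 by simp
next
  case (Suc k)
  let ?a = "real k * h" and ?c = "real (Suc k) * h" and ?Y = "eul h \<gamma> x k"
  have ac: "0 \<le> ?a" "?a \<le> ?c" "?c - ?a = h" using h by (simp_all add: algebra_simps)
  have aT: "?a \<le> T" using ac Suc.prems by linarith
  have IH: "norm (X ?a - ?Y) \<le> ((1 + h * L) ^ k - 1) * w" using Suc.IH aT by simp
  have cont: "continuous_on {s..t} (\<lambda>s. b (X s))" if "0 \<le> s" for s t
  proof -
    have "continuous_on {s..t} X" using Xc by (rule continuous_on_subset) (use that in auto)
    then show ?thesis by (rule continuous_on_compose2[OF continuous_b[of UNIV]]) auto
  qed
  have i: "(\<lambda>s. b (X s)) integrable_on {s..t}" if "0 \<le> s" for s t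
    by (rule integrable_continuous_real[OF cont[OF that]])
  have "integral {0..?a} (\<lambda>s. b (X s)) + integral {?a..?c} (\<lambda>s. b (X s)) = integral {0..?c} (\<lambda>s. b (X s))"
    by (rule Henstock_Kurzweil_Integration.integral_combine[OF ac(1,2) i]) simp
  then have "X ?c - X ?a = integral {?a..?c} (\<lambda>s. b (X s)) + (\<gamma> ?c - \<gamma> ?a)"
    using X[of ?c] X[of ?a] ac by (simp add: algebra_simps)
  moreover have "integral {?a..?c} (\<lambda>s. b (X s) - b ?Y) = integral {?a..?c} (\<lambda>s. b (X s)) - h *\<^sub>R b ?Y"
    using Henstock_Kurzweil_Integration.integral_diff[OF i[OF ac(1)] integrable_const_ivl[of "b ?Y" ?a ?c]] ac by (simp add: content_real)
  ultimately have e: "X ?c - eul h \<gamma> x (Suc k) = (X ?a - ?Y) + integral {?a..?c} (\<lambda>s. b (X s) - b ?Y)"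
    by (simp add: algebra_simps)
  have "norm (integral {?a..?c} (\<lambda>s. b (X s) - b ?Y)) \<le> (L * (w + norm (X ?a - ?Y))) * (?c - ?a)"
  proof (rule integral_bound[OF ac(2)])
    show "continuous_on {?a..?c} (\<lambda>s. b (X s) - b ?Y)" by (intro continuous_on_diff cont ac continuous_on_const)
    fix t assume t: "t \<in> {?a..?c}"
    have "norm (b (X t) - b ?Y) \<le> L * norm (X t - ?Y)" by (rule lipD)
    also have "norm (X t - ?Y) \<le> norm (X t - X ?a) + norm (X ?a - ?Y)"
      using norm_triangle_ineq[of "X t - X ?a" "X ?a - ?Y"] by simp
    also have "norm (X t - X ?a) \<le> w" using t ac Suc.prems by (intro w) auto
    finally show "norm (b (X t) - b ?Y) \<le> L * (w + norm (X ?a - ?Y))"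
      using L_nonneg by (simp add: mult_left_mono)
  qed
  then have "norm (X ?c - eul h \<gamma> x (Suc k)) \<le> norm (X ?a - ?Y) + h * L * (w + norm (X ?a - ?Y))"
    unfolding e ac(3) using norm_triangle_ineq[of "X ?a - ?Y" "integral {?a..?c} (\<lambda>s. b (X s) - b ?Y)"] by (simp add: mult_ac)
  also have "\<dots> = (1 + h * L) * norm (X ?a - ?Y) + h * L * w" by (simp add: algebra_simps)
  also have "\<dots> \<le> (1 + h * L) * (((1 + h * L) ^ k - 1) * w) + h * L * w"
    using IH h L_nonneg by (intro add_right_mono mult_left_mono) simp_all
  also have "\<dots> = ((1 + h * L) ^ Suc k - 1) * w" by (simp add: algebra_simps)
  finally show ?case .
qed

text \<open>The grid times need only converge to \<open>s\<close>; this covers both the grid that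
  hits \<open>t\<close> exactly and the rounded times of the step functions.\<close>

lemma eul_convergence:
  fixes X \<gamma> :: "real \<Rightarrow> real^'n"
  assumes Xc: "continuous_on {0..} X"
    and X: "\<And>t. t \<ge> 0 \<Longrightarrow> X t = x + integral {0..t} (\<lambda>s. b (X s)) + \<gamma> t"
    and \<gamma>0: "\<gamma> 0 = 0"
    and h: "\<And>N. h N > 0" "h \<longlonglongrightarrow> 0" and k: "(\<lambda>N. real (k N) * h N) \<longlonglongrightarrow> s"
  shows "(\<lambda>N. eul (h N) \<gamma> x (k N)) \<longlonglongrightarrow> X s"
proof -
  have kh0: "0 \<le> real (k N) * h N" for N using h(1)[of N] by simp
  have s0: "s \<ge> 0" by (rule tendsto_lowerbound[OF k]) (simp_all add: kh0)
  \<comment> \<open>The margin 1 keeps the grid times below \<open>T\<close> eventually, so that the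
    modulus of continuity of \<open>X\<close> on \<open>{0..T}\<close> applies.\<close>
  define T where "T = s + 1"
  have uc: "uniformly_continuous_on {0..T} X"
    by (rule compact_uniformly_continuous[OF continuous_on_subset[OF Xc]]) auto
  have kT: "\<forall>\<^sub>F N in sequentially. real (k N) * h N < T"
    by (rule order_tendstoD(2)[OF k]) (simp add: T_def)
  have 1: "(\<lambda>N. X (real (k N) * h N) - eul (h N) \<gamma> x (k N)) \<longlonglongrightarrow> 0"
  proof (rule tendstoI)
    fix e :: real assume e: "e > 0"
    define w where "w = e / (2 * exp (L * T))"
    have w: "w > 0" using e by (simp add: w_def)
    obtain d where d: "d > 0" "\<And>s s'. s \<in> {0..T} \<Longrightarrow> s' \<in> {0..T} \<Longrightarrow> dist s' s < d \<Longrightarrow> dist (X s') (X s) < w"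
      using uc w unfolding uniformly_continuous_on_def by metis
    have hd: "\<forall>\<^sub>F N in sequentially. h N < d" by (rule order_tendstoD(2)[OF h(2) d(1)])
    from hd kT show "\<forall>\<^sub>F N in sequentially. dist (X (real (k N) * h N) - eul (h N) \<gamma> x (k N)) 0 < e"
    proof eventually_elim
      case (elim N)
      have "norm (X (real (k N) * h N) - eul (h N) \<gamma> x (k N)) \<le> ((1 + h N * L) ^ k N - 1) * w"
      proof (rule eul_error[OF h(1) Xc X \<gamma>0])
        fix u v :: real assume "0 \<le> u" "u \<le> v" "v \<le> T" "v - u \<le> h N"
        then have "dist (X v) (X u) < w" using elim by (intro d(2)) (auto simp: dist_real_def)
        then show "norm (X v - X u) \<le> w" by (simp add: dist_norm)
      qed (use elim w in auto)
      also have "\<dots> \<le> (1 + h N * L) ^ k N * w" using w by (simp add: algebra_simps)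
      also have "\<dots> \<le> exp (L * (real (k N) * h N)) * w"
        using power_le_exp[of "h N" "k N"] h(1)[of N] w by (intro mult_right_mono) auto
      also have "\<dots> \<le> exp (L * T) * w"
        using elim L_nonneg w by (intro mult_right_mono) (auto intro!: mult_left_mono)
      also have "\<dots> = e / 2" by (simp add: w_def)
      also have "\<dots> < e" using e by simp
      finally show ?case by (simp add: dist_norm)
    qed
  qed
  have 2: "(\<lambda>N. X (real (k N) * h N)) \<longlonglongrightarrow> X s"
    by (rule continuous_on_tendsto_compose[OF Xc k]) (simp_all add: s0 kh0)
  from tendsto_diff[OF 2 1] show ?thesis by simp
qed

end

section \<open>The diffusion and the law of its Euler scheme\<close>

locale sde = euler_scheme b L R
  for b :: "real^'n::finite \<Rightarrow> real^'n" and L and R :: "real^'n^'n" +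
  fixes M :: "'w measure" and \<F> :: "real \<Rightarrow> 'w measure" and W :: "real \<Rightarrow> 'w \<Rightarrow> real^'n"
    and X :: "real^'n \<Rightarrow> real \<Rightarrow> 'w \<Rightarrow> real^'n"
  assumes basis: "stochastic_basis M \<F>" and wiener: "wiener_process M \<F> W"
    and X_adapted: "adapted \<F> (X x)"
    and X_solution: "AE \<omega> in M. continuous_on {0..} (\<lambda>t. X x t \<omega>) \<and>
       (\<forall>t\<ge>0. X x t \<omega> = x + integral {0..t} (\<lambda>s. b (X x s \<omega>)) + R *v W t \<omega>)"

sublocale sde \<subseteq> prob_space M
  using basis by (simp add: stochastic_basis_def)

context sde
begin

abbreviation "Pt t g x \<equiv> transition_semigroup M X t g x"

lemma subalgebra_filtration: "t \<ge> 0 \<Longrightarrow> subalgebra M (\<F> t)"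
  using basis unfolding stochastic_basis_def by blast

lemma filtration_measurable:
  assumes st: "0 \<le> s" "s \<le> t" and f: "f \<in> borel_measurable (\<F> s)"
  shows "f \<in> borel_measurable (\<F> t)"
proof -
  have "sets (\<F> s) \<subseteq> sets (\<F> t)" using basis st unfolding stochastic_basis_def by blast
  moreover have "space (\<F> s) = space (\<F> t)"
    using subalgebra_filtration[of s] subalgebra_filtration[of t] st by (simp add: subalgebra_def)
  ultimately have "subalgebra (\<F> t) (\<F> s)" by (simp add: subalgebra_def)
  then show ?thesis using f by (rule measurable_from_subalg)
qed

lemma filtration_measurable_M: "0 \<le> s \<Longrightarrow> f \<in> borel_measurable (\<F> s) \<Longrightarrow> f \<in> borel_measurable M"
  by (rule measurable_from_subalg[OF subalgebra_filtration])

lemma W_adapted: "t \<ge> 0 \<Longrightarrow> W t \<in> borel_measurable (\<F> t)"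
  using wiener by (auto simp: wiener_process_def adapted_def)

lemma W_measurable: "t \<ge> 0 \<Longrightarrow> W t \<in> borel_measurable M"
  using W_adapted filtration_measurable_M by blast

lemma X_measurable: "t \<ge> 0 \<Longrightarrow> X x t \<in> borel_measurable M"
  using X_adapted filtration_measurable_M by (auto simp: adapted_def)

lemma W_0: "AE \<omega> in M. W 0 \<omega> = 0"
  using wiener by (simp add: wiener_process_def)

lemma increment_distr:
  assumes "0 \<le> s" "s < t"
  shows "distr M borel (\<lambda>\<omega>. W t \<omega> - W s \<omega>) = gauss (t - s)"
proof -
  have "distributed M lborel (\<lambda>\<omega>. W t \<omega> - W s \<omega>) (\<lambda>y. ennreal (gauss_density (t - s) y))"
    using wiener assms by (simp add: wiener_process_def gauss_density_def)
  then have "distr M lborel (\<lambda>\<omega>. W t \<omega> - W s \<omega>) = gauss (t - s)"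
    by (simp add: distributed_def gauss_def)
  moreover have "distr M lborel (\<lambda>\<omega>. W t \<omega> - W s \<omega>) = distr M borel (\<lambda>\<omega>. W t \<omega> - W s \<omega>)"
    by (intro distr_cong) auto
  ultimately show ?thesis by simp
qed

lemma increment_indep:
  assumes st: "0 \<le> s" "s < t" and Y: "Y \<in> borel_measurable (\<F> s)"
  shows "indep_var borel (Y :: 'w \<Rightarrow> real^'n) borel (\<lambda>\<omega>. W t \<omega> - W s \<omega>)"
proof -
  let ?D = "\<lambda>\<omega>. W t \<omega> - W s \<omega>"
  have ind: "indep_set (sets (\<F> s)) (sets (vimage_algebra (space M) ?D borel))"
    using wiener st by (simp add: wiener_process_def)
  have sub: "subalgebra M (\<F> s)" by (rule subalgebra_filtration[OF st(1)])
  have sp: "space (\<F> s) = space M" using sub by (simp add: subalgebra_def)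
  have Ym: "Y \<in> borel_measurable M" by (rule filtration_measurable_M[OF st(1) Y])
  have Dm: "?D \<in> borel_measurable M" using W_measurable st by (intro borel_measurable_diff) auto
  have 1: "sigma_sets (space M) {Y -` A \<inter> space M |A. A \<in> sets borel} \<subseteq> sets (\<F> s)"
  proof -
    have "{Y -` A \<inter> space M |A. A \<in> sets borel} \<subseteq> sets (\<F> s)"
      using measurable_sets[OF Y] sp by auto
    then show ?thesis using sets.sigma_sets_subset[of _ "\<F> s"] sp by simp
  qed
  have 2: "sigma_sets (space M) {?D -` A \<inter> space M |A. A \<in> sets borel} \<subseteq> sets (vimage_algebra (space M) ?D borel)"
    by (simp add: sets_vimage_algebra)
  have "indep_set (sigma_sets (space M) {Y -` A \<inter> space M |A. A \<in> sets borel}) (sigma_sets (space M) {?D -` A \<inter> space M |A. A \<in> sets borel})"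
    using ind unfolding indep_set_def by (rule indep_sets_mono_sets) (use 1 2 in \<open>simp split: bool.split\<close>)
  then show ?thesis unfolding indep_var_eq using Ym Dm by simp
qed

text \<open>The increment is independent of \<open>Y\<close>, so the joint law is a product, and
  integrating out the noise first produces \<open>euler (t - s) g\<close>.\<close>

lemma expectation_euler_step:
  fixes g :: "real^'n \<Rightarrow> real"
  assumes st: "0 \<le> s" "s < t" and Y: "Y \<in> borel_measurable (\<F> s)"
    and g[measurable]: "g \<in> borel_measurable borel" and K: "\<And>x. \<bar>g x\<bar> \<le> K"
  shows "expectation (\<lambda>\<omega>. g (Y \<omega> + (t - s) *\<^sub>R b (Y \<omega>) + R *v (W t \<omega> - W s \<omega>))) = expectation (\<lambda>\<omega>. euler (t - s) g (Y \<omega>))"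
proof -
  let ?D = "\<lambda>\<omega>. W t \<omega> - W s \<omega>" and ?h = "t - s"
  have h: "?h > 0" using st by simp
  have Ym[measurable]: "Y \<in> borel_measurable M" by (rule filtration_measurable_M[OF st(1) Y])
  have Dm[measurable]: "?D \<in> borel_measurable M" using W_measurable st by (intro borel_measurable_diff) auto
  have [measurable]: "W t \<in> borel_measurable M" "W s \<in> borel_measurable M" using W_measurable st by simp_all
  let ?f = "\<lambda>(y, w). g (y + ?h *\<^sub>R b y + R *v w)"
  interpret G: prob_space "gauss ?h :: (real^'n) measure" by (rule prob_space_gauss[OF h])
  interpret Y: prob_space "distr M borel Y" by (rule prob_space_distr) measurable
  interpret P: pair_prob_space "distr M borel Y" "gauss ?h :: (real^'n) measure" ..
  have fm: "?f \<in> borel_measurable (borel \<Otimes>\<^sub>M borel)" by measurable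
  have Pm: "(\<lambda>\<omega>. (Y \<omega>, ?D \<omega>)) \<in> M \<rightarrow>\<^sub>M borel \<Otimes>\<^sub>M borel" by measurable
  have law: "distr M (borel \<Otimes>\<^sub>M borel) (\<lambda>\<omega>. (Y \<omega>, ?D \<omega>)) = distr M borel Y \<Otimes>\<^sub>M gauss ?h"
    using increment_indep[OF st Y] unfolding indep_var_distribution_eq increment_distr[OF st] by simp
  have "expectation (\<lambda>\<omega>. g (Y \<omega> + ?h *\<^sub>R b (Y \<omega>) + R *v ?D \<omega>)) = (LINT p|distr M (borel \<Otimes>\<^sub>M borel) (\<lambda>\<omega>. (Y \<omega>, ?D \<omega>)). ?f p)"
    by (subst integral_distr[OF Pm fm]) simp
  also have "\<dots> = (LINT y|distr M borel Y. LINT w|gauss ?h. ?f (y, w))"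
    unfolding law
  proof (rule P.integral_fst'[symmetric])
    show "integrable (distr M borel Y \<Otimes>\<^sub>M gauss ?h) ?f"
    proof (rule P.P.integrable_const_bound[where B=K])
      show "AE p in distr M borel Y \<Otimes>\<^sub>M gauss ?h. norm (?f p) \<le> K" by (rule AE_I2) (simp add: K split_beta)
      show "?f \<in> borel_measurable (distr M borel Y \<Otimes>\<^sub>M gauss ?h)" by measurable
    qed
  qed
  also have "\<dots> = (LINT y|distr M borel Y. euler ?h g y)" by (simp add: euler_def noise_def)
  also have "\<dots> = expectation (\<lambda>\<omega>. euler ?h g (Y \<omega>))"
    by (rule integral_distr) (use h in measurable)
  finally show ?thesis .
qed

lemma eul_adapted:
  assumes h: "h > 0"
  shows "(\<lambda>\<omega>. eul h (\<lambda>t. R *v W t \<omega>) x k) \<in> borel_measurable (\<F> (real k * h))"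
proof (induction k)
  case (Suc k)
  let ?Y = "\<lambda>\<omega>. eul h (\<lambda>t. R *v W t \<omega>) x k"
  have le: "0 \<le> real k * h" "real k * h \<le> real (Suc k) * h" using h by (simp_all add: algebra_simps)
  have 1: "?Y \<in> borel_measurable (\<F> (real (Suc k) * h))" by (rule filtration_measurable[OF le Suc])
  have 2: "W (real k * h) \<in> borel_measurable (\<F> (real (Suc k) * h))" by (rule filtration_measurable[OF le W_adapted[OF le(1)]])
  have 3: "W (real (Suc k) * h) \<in> borel_measurable (\<F> (real (Suc k) * h))" using h by (intro W_adapted) simp
  note [measurable] = 1 2 3
  show ?case unfolding eul.simps by measurable
qed simp

text \<open>The last step of the path is peeled off and absorbed into \<open>g\<close>, so the
  induction runs over all bounded Borel \<open>g\<close> at once.\<close>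

lemma expectation_eul:
  fixes g :: "real^'n \<Rightarrow> real"
  assumes h: "h > 0" and g: "g \<in> borel_measurable borel" and K: "\<And>x. \<bar>g x\<bar> \<le> K"
  shows "expectation (\<lambda>\<omega>. g (eul h (\<lambda>t. R *v W t \<omega>) x k)) = (euler h ^^ k) g x"
  using g K
proof (induction k arbitrary: g)
  case 0
  then show ?case by (simp add: prob_space)
next
  case (Suc k)
  let ?Y = "\<lambda>\<omega>. eul h (\<lambda>t. R *v W t \<omega>) x k"
  have le: "0 \<le> real k * h" "real k * h < real (Suc k) * h" "real (Suc k) * h - real k * h = h" using h by (simp_all add: algebra_simps)
  have "expectation (\<lambda>\<omega>. g (eul h (\<lambda>t. R *v W t \<omega>) x (Suc k))) = expectation (\<lambda>\<omega>. euler h g (?Y \<omega>))"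
    using expectation_euler_step[OF le(1,2) eul_adapted[OF h] Suc.prems] unfolding le(3)
    by (simp add: matrix_vector_mult_diff_distrib)
  also have "\<dots> = (euler h ^^ k) (euler h g) x"
    by (rule Suc.IH[OF euler_measurable[OF h Suc.prems(1)] euler_bound[OF h Suc.prems]])
  also have "\<dots> = (euler h ^^ Suc k) g x" by (simp add: funpow_swap1)
  finally show ?case .
qed

text \<open>Convergence holds path by path wherever \<open>X x\<close> solves its equation and
  \<open>W\<close> starts at 0, so a single null set serves all step sizes, step numbers and
  times.\<close>

lemma AE_eul_convergence:
  "AE \<omega> in M. \<forall>h k s. (\<forall>N. h N > 0) \<longrightarrow> h \<longlonglongrightarrow> 0 \<longrightarrow> (\<lambda>N. real (k N) * h N) \<longlonglongrightarrow> s \<longrightarrow>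
     (\<lambda>N. eul (h N) (\<lambda>t. R *v W t \<omega>) x (k N)) \<longlonglongrightarrow> X x s \<omega>"
  using X_solution[of x] W_0
proof eventually_elim
  case (elim \<omega>)
  then show ?case by (intro allI impI eul_convergence) auto
qed

text \<open>\<open>eul_stability\<close> passes to the limit. The null set may depend on the pair
  \<open>x\<close>, \<open>y\<close> but not on \<open>t\<close>, which is enough when starting
  points run through a sequence.\<close>

lemma AE_flow_lipschitz:
  "AE \<omega> in M. \<forall>t\<ge>0. norm (X x t \<omega> - X y t \<omega>) \<le> exp (L * t) * norm (x - y)"
  using AE_eul_convergence[of x] AE_eul_convergence[of y]
proof eventually_elim
  case (elim \<omega>)
  show ?case
  proof (intro allI impI)
    fix t :: real assume t: "t \<ge> 0"
    define h where "h N = inverse (real (Suc N))" for N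
    define k where "k N = nat \<lfloor>t / h N\<rfloor>" for N
    have h: "h N > 0" "h \<longlonglongrightarrow> 0" for N using LIMSEQ_inverse_real_of_nat by (simp_all add: h_def[abs_def])
    have kt: "real (k N) * h N \<le> t" "t - h N \<le> real (k N) * h N" for N
    proof -
      have q: "0 \<le> t / h N" using t h(1)[of N] by simp
      have "real (k N) \<le> t / h N" "t / h N \<le> real (k N) + 1" unfolding k_def using q by linarith+
      then show "real (k N) * h N \<le> t" "t - h N \<le> real (k N) * h N"
        using h(1)[of N] by (simp_all add: field_simps)
    qed
    have kl: "(\<lambda>N. real (k N) * h N) \<longlonglongrightarrow> t"
    proof (rule tendsto_sandwich)
      show "(\<lambda>N. t - h N) \<longlonglongrightarrow> t" using tendsto_diff[OF tendsto_const h(2)] by simp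
    qed (use kt in auto)
    have c: "(\<lambda>N. eul (h N) (\<lambda>t. R *v W t \<omega>) x (k N)) \<longlonglongrightarrow> X x t \<omega>" "(\<lambda>N. eul (h N) (\<lambda>t. R *v W t \<omega>) y (k N)) \<longlonglongrightarrow> X y t \<omega>"
      using elim h kl by blast+
    show "norm (X x t \<omega> - X y t \<omega>) \<le> exp (L * t) * norm (x - y)"
    proof (rule tendsto_upperbound[OF tendsto_norm[OF tendsto_diff[OF c]]])
      show "\<forall>\<^sub>F N in sequentially. norm (eul (h N) (\<lambda>t. R *v W t \<omega>) x (k N) - eul (h N) (\<lambda>t. R *v W t \<omega>) y (k N)) \<le> exp (L * t) * norm (x - y)"
      proof (intro always_eventually allI)
        fix N
        have hN: "h N \<ge> 0" using h(1)[of N] by simp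
        have "(1 + h N * L) ^ k N \<le> exp (L * t)"
          by (rule order_trans[OF power_le_exp[OF hN]]) (use kt L_nonneg in \<open>simp add: mult_left_mono\<close>)
        then show "norm (eul (h N) (\<lambda>t. R *v W t \<omega>) x (k N) - eul (h N) (\<lambda>t. R *v W t \<omega>) y (k N)) \<le> exp (L * t) * norm (x - y)"
          by (rule order_trans[OF eul_stability[OF hN] mult_right_mono]) simp
      qed
    qed simp
  qed
qed

text \<open>The functions may vary with \<open>N\<close> provided \<open>gN N (yN N)\<close>
  converges along every convergent sequence. The Harnack inequality calls for this, since the
  endpoint of the discrete control is only asymptotically zero.\<close>

lemma euler_iterate_convergence_gen:
  fixes g :: "real^'n \<Rightarrow> real" and gN :: "nat \<Rightarrow> real^'n \<Rightarrow> real"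
  assumes gm[measurable]: "g \<in> borel_measurable borel" "\<And>N. gN N \<in> borel_measurable borel"
    and K: "\<And>N x. \<bar>gN N x\<bar> \<le> K"
    and gN: "\<And>y yN. yN \<longlonglongrightarrow> y \<Longrightarrow> (\<lambda>N. gN N (yN N)) \<longlonglongrightarrow> g y"
    and h: "\<And>N. h N > 0" "h \<longlonglongrightarrow> 0" and k: "(\<lambda>N. real (k N) * h N) \<longlonglongrightarrow> s"
  shows "(\<lambda>N. (euler (h N) ^^ k N) (gN N) x) \<longlonglongrightarrow> Pt s g x"
proof -
  have kh0: "0 \<le> real (k N) * h N" for N using h(1)[of N] by simp
  have s0: "s \<ge> 0" by (rule tendsto_lowerbound[OF k]) (simp_all add: kh0)
  have "(\<lambda>N. expectation (\<lambda>\<omega>. gN N (eul (h N) (\<lambda>t. R *v W t \<omega>) x (k N)))) \<longlonglongrightarrow> expectation (\<lambda>\<omega>. g (X x s \<omega>))"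
  proof (rule integral_dominated_convergence[where w="\<lambda>_. K"])
    show "(\<lambda>\<omega>. g (X x s \<omega>)) \<in> borel_measurable M" using X_measurable[OF s0, of x] by measurable
    show "(\<lambda>\<omega>. gN N (eul (h N) (\<lambda>t. R *v W t \<omega>) x (k N))) \<in> borel_measurable M" for N
      by (rule measurable_compose[OF filtration_measurable_M[OF kh0 eul_adapted[OF h(1)]] gm(2)])
    show "AE \<omega> in M. (\<lambda>N. gN N (eul (h N) (\<lambda>t. R *v W t \<omega>) x (k N))) \<longlonglongrightarrow> g (X x s \<omega>)"
      using AE_eul_convergence[of x]
    proof eventually_elim
      case (elim \<omega>)
      then have "(\<lambda>N. eul (h N) (\<lambda>t. R *v W t \<omega>) x (k N)) \<longlonglongrightarrow> X x s \<omega>" using h k by blast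
      then show ?case by (rule gN)
    qed
  qed (auto simp: K)
  then show ?thesis unfolding expectation_eul[OF h(1) gm(2) K] transition_semigroup_def .
qed

lemma euler_iterate_convergence:
  fixes g :: "real^'n \<Rightarrow> real"
  assumes gc: "continuous_on UNIV g" and K: "\<And>x. \<bar>g x\<bar> \<le> K"
    and h: "\<And>N. h N > 0" "h \<longlonglongrightarrow> 0" and k: "(\<lambda>N. real (k N) * h N) \<longlonglongrightarrow> s"
  shows "(\<lambda>N. (euler (h N) ^^ k N) g x) \<longlonglongrightarrow> Pt s g x"
proof (rule euler_iterate_convergence_gen[OF _ _ K _ h k])
  show "g \<in> borel_measurable borel" "g \<in> borel_measurable borel" by (rule borel_measurable_continuous_onI[OF gc])+
  show "(\<lambda>N. g (yN N)) \<longlonglongrightarrow> g y" if "yN \<longlonglongrightarrow> y" for y yN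
    by (rule continuous_on_tendsto_compose[OF gc that]) auto
qed

lemma Pt_bound:
  fixes g :: "real^'n \<Rightarrow> real"
  assumes "t \<ge> 0" "g \<in> borel_measurable borel" "\<And>x. \<bar>g x\<bar> \<le> K"
  shows "\<bar>Pt t g x\<bar> \<le> K" "integrable M (\<lambda>\<omega>. g (X x t \<omega>))"
proof -
  show i: "integrable M (\<lambda>\<omega>. g (X x t \<omega>))"
  proof (rule integrable_const_bound[where B=K])
    show "AE \<omega> in M. norm (g (X x t \<omega>)) \<le> K" by (rule AE_I2) (simp add: assms)
    show "(\<lambda>\<omega>. g (X x t \<omega>)) \<in> borel_measurable M"
      by (rule measurable_compose[OF X_measurable[OF assms(1)] assms(2)])
  qed
  have "\<bar>Pt t g x\<bar> \<le> (LINT \<omega>|M. K)" unfolding transition_semigroup_def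
    by (rule abs_integral_le[OF i]) (use assms in auto)
  then show "\<bar>Pt t g x\<bar> \<le> K" by (simp add: prob_space)
qed

end

section \<open>The weak equation for the semigroup\<close>

lemma cauchy_schwarz_integral:
  fixes u v :: "'a \<Rightarrow> real"
  assumes u: "integrable M (\<lambda>x. (u x)\<^sup>2)" and v: "integrable M (\<lambda>x. (v x)\<^sup>2)" and uv: "integrable M (\<lambda>x. u x * v x)"
    and pos: "(\<integral>x. (v x)\<^sup>2 \<partial>M) > 0"
  shows "(\<integral>x. u x * v x \<partial>M)\<^sup>2 \<le> (\<integral>x. (u x)\<^sup>2 \<partial>M) * (\<integral>x. (v x)\<^sup>2 \<partial>M)"
proof -
  let ?a = "\<integral>x. (u x)\<^sup>2 \<partial>M" and ?b = "\<integral>x. (v x)\<^sup>2 \<partial>M" and ?c = "\<integral>x. u x * v x \<partial>M"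
  \<comment> \<open>The minimiser of the integral of \<open>(u - s v)^2\<close>.\<close>
  define s where "s = ?c / ?b"
  have "0 \<le> (\<integral>x. (u x - s * v x)\<^sup>2 \<partial>M)" by simp
  also have "(\<lambda>x. (u x - s * v x)\<^sup>2) = (\<lambda>x. (u x)\<^sup>2 - (2 * s) * (u x * v x) + s\<^sup>2 * (v x)\<^sup>2)"
    by (auto simp: power2_eq_square algebra_simps)
  also have "(\<integral>x. (u x)\<^sup>2 - (2 * s) * (u x * v x) + s\<^sup>2 * (v x)\<^sup>2 \<partial>M) = ?a - (2 * s) * ?c + s\<^sup>2 * ?b"
    using u v uv by simp
  also have "\<dots> = ?a - ?c\<^sup>2 / ?b" using pos unfolding s_def by (simp add: power2_eq_square field_simps)
  finally show ?thesis using pos by (simp add: field_simps)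
qed

lemma grid_floor:
  fixes t h :: real
  assumes "t \<ge> 0" "h > 0"
  shows "real (nat \<lfloor>t / h\<rfloor>) * h \<le> t" "t - h \<le> real (nat \<lfloor>t / h\<rfloor>) * h"
proof -
  have q: "0 \<le> t / h" using assms by simp
  have "real (nat \<lfloor>t / h\<rfloor>) \<le> t / h" "t / h \<le> real (nat \<lfloor>t / h\<rfloor>) + 1" using q by linarith+
  moreover have "n * h \<le> t" "t - h \<le> n * h" if "n \<le> t / h" "t / h \<le> n + 1" for n
    using that assms by (simp_all add: field_simps)
  ultimately show "real (nat \<lfloor>t / h\<rfloor>) * h \<le> t" "t - h \<le> real (nat \<lfloor>t / h\<rfloor>) * h" by blast+
qed

lemma grid_floor_tendsto:
  assumes t: "t \<ge> 0" and h: "\<And>N. h N > 0" "h \<longlonglongrightarrow> 0"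
  shows "(\<lambda>N. real (nat \<lfloor>t / h N\<rfloor>) * h N) \<longlonglongrightarrow> t"
proof (rule tendsto_sandwich)
  show "(\<lambda>N. t - h N) \<longlonglongrightarrow> t" using tendsto_diff[OF tendsto_const h(2)] by simp
qed (use grid_floor[OF t h(1)] in auto)

text \<open>Rewrites a sum over time steps as the integral of a step function, so that its limit can
  be taken by dominated convergence.\<close>

lemma step_function_integral:
  fixes c :: "nat \<Rightarrow> real"
  assumes h: "h > 0"
  shows "integrable lborel (\<lambda>s. indicator {0..<real n * h} s * c (nat \<lfloor>s / h\<rfloor>)) \<and>
    (LINT s|lborel. indicator {0..<real n * h} s * c (nat \<lfloor>s / h\<rfloor>)) = h * (\<Sum>k<n. c k)"
proof (induction n)
  case (Suc n)
  let ?I = "{real n * h..<real (Suc n) * h}"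
  have fl: "nat \<lfloor>s / h\<rfloor> = n" if "s \<in> ?I" for s
  proof -
    have "real n \<le> s / h" "s / h < real n + 1" using that h by (simp_all add: field_simps)
    then have "\<lfloor>s / h\<rfloor> = int n" by linarith
    then show ?thesis by simp
  qed
  have split: "indicator {0..<real (Suc n) * h} s * c (nat \<lfloor>s / h\<rfloor>) =
    indicator {0..<real n * h} s * c (nat \<lfloor>s / h\<rfloor>) + indicator ?I s * c n" for s
  proof -
    have n0: "0 \<le> real n * h" "real n * h \<le> real (Suc n) * h" using h by (simp_all add: algebra_simps)
    consider "s < 0" | "0 \<le> s" "s < real n * h" | "s \<in> ?I" | "real (Suc n) * h \<le> s" by force
    then show ?thesis
    proof cases
      case 3 then show ?thesis using fl[OF 3] n0 by (auto simp: indicator_def)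
    qed (use n0 in \<open>auto simp: indicator_def\<close>)
  qed
  have len: "real n * h \<le> real (Suc n) * h" using h by (simp add: algebra_simps)
  have "integrable lborel (indicator ?I :: real \<Rightarrow> real)" using len by (intro integrable_real_indicator) auto
  then have i: "integrable lborel (\<lambda>s. indicator ?I s * c n)" by (rule integrable_mult_left)
  have v: "(LINT s|lborel. indicator ?I s * c n) = h * c n"
    using len by (simp add: measure_def algebra_simps)
  show ?case unfolding split using Suc i v by (simp add: algebra_simps)
qed simp

section \<open>A Harnack inequality for the discrete scheme\<close>

context euler_scheme
begin

text \<open>\<open>z k\<close> is the deterministic displacement of a second copy after
  \<open>k\<close> steps. The control \<beta> realises the required change of displacement through a
  shift of the noise, and Cauchy-Schwarz for the shifted Gaussian costs \<open>exp (h c^2)\<close>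
  per step. The control has to exist at every position \<open>x\<close> with one bound
  \<open>c\<close>, because the first copy is random.\<close>

lemma harnack_euler:
  fixes g :: "real^'n \<Rightarrow> real" and z :: "nat \<Rightarrow> real^'n"
  assumes h: "h > 0" and gm: "g \<in> borel_measurable borel" and gK: "\<And>x. \<bar>g x\<bar> \<le> K"
    and ctl: "\<And>k x. k < n \<Longrightarrow> \<exists>\<beta>. z k + h *\<^sub>R (b (x + z k) - b x) = z (Suc k) + h *\<^sub>R (R *v \<beta>) \<and> norm \<beta> \<le> c"
  shows "((euler h ^^ n) g (x + z 0))\<^sup>2 \<le> (euler h ^^ n) (\<lambda>y. (g (y + z n))\<^sup>2) x * exp (real n * h * c\<^sup>2)"
  using ctl
proof (induction n arbitrary: x z)
  case 0
  then show ?case by simp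
next
  case (Suc n)
  interpret G: prob_space "gauss h :: (real^'n) measure" by (rule prob_space_gauss[OF h])
  let ?G = "(euler h ^^ n) g"
  let ?H = "\<lambda>y. (g (y + z (Suc n)))\<^sup>2"
  have K0: "K \<ge> 0" using gK[of 0] by linarith
  note Gm[measurable] = euler_iterate(1)[OF h gm gK, of n]
  note GK = euler_iterate(2)[OF h gm gK, of n]
  have Hm[measurable]: "?H \<in> borel_measurable borel" using gm by measurable
  have HK: "\<bar>?H y\<bar> \<le> K\<^sup>2" for y using power_mono[OF gK[of "y + z (Suc n)"], of 2] by simp
  note EHm[measurable] = euler_iterate(1)[OF h Hm HK, of n]
  note EHK = euler_iterate(2)[OF h Hm HK, of n]
  let ?E = "exp (real n * h * c\<^sup>2)"
  \<comment> \<open>The outermost factor of \<open>euler h ^^ Suc n\<close> is the first time step;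
    the remaining \<open>n\<close> steps start with the displacement \<open>z 1\<close>.\<close>
  have IH: "(?G (y + z 1))\<^sup>2 \<le> (euler h ^^ n) ?H y * ?E" for y
    using Suc.IH[of "\<lambda>k. z (Suc k)" y] Suc.prems by simp
  obtain \<beta> where \<beta>: "z 0 + h *\<^sub>R (b (x + z 0) - b x) = z 1 + h *\<^sub>R (R *v \<beta>)" "norm \<beta> \<le> c"
    using Suc.prems[of 0 x] by auto
  let ?a = "h *\<^sub>R \<beta>" and ?y = "x + h *\<^sub>R b x"
  let ?u = "\<lambda>w. ?G (?y + R *v w + z 1)" and ?\<rho> = "\<lambda>w. exp (?a \<bullet> w / h - (norm ?a)\<^sup>2 / (2*h))"
  have um[measurable]: "?u \<in> borel_measurable borel" by measurable
  \<comment> \<open>Starting from \<open>x + z 0\<close> with noise \<open>w\<close> amounts to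
    starting from \<open>x\<close> with noise \<open>w + h \<beta>\<close> and then displacing by
    \<open>z 1\<close>.\<close>
  have arg: "x + z 0 + h *\<^sub>R b (x + z 0) + R *v w = ?y + R *v (w + ?a) + z 1" for w
  proof -
    have "x + z 0 + h *\<^sub>R b (x + z 0) + R *v w = ?y + R *v w + (z 0 + h *\<^sub>R (b (x + z 0) - b x))"
      by (simp add: algebra_simps)
    also have "\<dots> = ?y + R *v w + (z 1 + h *\<^sub>R (R *v \<beta>))" unfolding \<beta>(1) ..
    also have "\<dots> = ?y + R *v (w + ?a) + z 1"
      by (simp add: matrix_vector_right_distrib matrix_vector_mult_scaleR)
    finally show ?thesis .
  qed
  have e1: "(euler h ^^ Suc n) g (x + z 0) = (LINT w|gauss h. ?u w * ?\<rho> w)"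
  proof -
    have "(euler h ^^ Suc n) g (x + z 0) = (LINT w|gauss h. ?u (w + ?a))"
      by (simp add: euler_def noise_def arg)
    also have "\<dots> = (LINT w|gauss h. ?u w * ?\<rho> w)" by (rule gauss_shift[OF h um])
    finally show ?thesis .
  qed
  have u2: "\<bar>(?u w)\<^sup>2\<bar> \<le> K\<^sup>2" for w using power_mono[OF GK[of "?y + R *v w + z 1"], of 2] by simp
  have i1: "integrable (gauss h) (\<lambda>w. (?u w)\<^sup>2)"
    by (rule G.integrable_const_bound[where B="K\<^sup>2"]) (use u2 in auto)
  note i2 = gauss_exp_square[OF h, of ?a]
  have i3: "integrable (gauss h) (\<lambda>w. ?u w * ?\<rho> w)"
  proof (rule Bochner_Integration.integrable_bound[where f="\<lambda>w. K * ?\<rho> w"])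
    show "integrable (gauss h) (\<lambda>w. K * ?\<rho> w)" using gauss_exp(1)[OF h, of ?a] by (rule integrable_mult_right)
    show "AE w in gauss h. norm (?u w * ?\<rho> w) \<le> norm (K * ?\<rho> w)"
      by (rule AE_I2) (simp add: abs_mult GK K0 mult_right_mono)
  qed measurable
  have "((euler h ^^ Suc n) g (x + z 0))\<^sup>2 \<le> (LINT w|gauss h. (?u w)\<^sup>2) * (LINT w|gauss h. (?\<rho> w)\<^sup>2)"
    unfolding e1 by (rule cauchy_schwarz_integral[OF i1 i2(1) i3]) (simp only: i2(2) exp_gt_zero)
  also have "\<dots> \<le> ((euler h ^^ Suc n) ?H x * ?E) * exp (h * c\<^sup>2)"
  proof (rule mult_mono)
    have i4: "integrable (gauss h) (\<lambda>w. (euler h ^^ n) ?H (?y + R *v w))"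
      by (rule noise_integrable[OF h EHm EHK])
    have "(LINT w|gauss h. (?u w)\<^sup>2) \<le> (LINT w|gauss h. (euler h ^^ n) ?H (?y + R *v w) * ?E)"
      by (rule integral_mono[OF i1 integrable_mult_left[OF i4] IH])
    also have "\<dots> = (euler h ^^ Suc n) ?H x * ?E" by (simp add: euler_def noise_def)
    finally show "(LINT w|gauss h. (?u w)\<^sup>2) \<le> (euler h ^^ Suc n) ?H x * ?E" .
    then show "0 \<le> (euler h ^^ Suc n) ?H x * ?E"
      by (rule order_trans[rotated]) (rule integral_nonneg_AE, simp)
    \<comment> \<open>The shift \<open>h \<beta>\<close>, squared and measured against the variance
      \<open>h\<close>, leaves a single factor \<open>h\<close>; the costs of the steps therefore
      add up like a time integral.\<close>
    have "(norm ?a)\<^sup>2 / h = h * (norm \<beta>)\<^sup>2" using h by (simp add: power_mult_distrib power2_eq_square)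
    also have "\<dots> \<le> h * c\<^sup>2" using \<beta>(2) h by (intro mult_left_mono power_mono) auto
    finally show "(LINT w|gauss h. (?\<rho> w)\<^sup>2) \<le> exp (h * c\<^sup>2)" unfolding i2(2) by simp
    show "0 \<le> (LINT w|gauss h. (?\<rho> w)\<^sup>2)" by simp
  qed
  also have "\<dots> = (euler h ^^ Suc n) ?H x * exp (real (Suc n) * h * c\<^sup>2)"
    by (simp add: mult_exp_exp[symmetric] algebra_simps exp_add)
  finally show ?case .
qed

end

section \<open>Joint continuity of the semigroup\<close>

context sde
begin

lemma AE_X_continuous: "AE \<omega> in M. continuous_on {0..} (\<lambda>t. X x t \<omega>)"
  using X_solution[of x] by eventually_elim simp

text \<open>Time, starting point and function vary together. Almost surely the flow is Lipschitz in
  the starting point, locally uniformly in time, and continuous in time; dominated convergence does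
  the rest.\<close>

lemma Pt_tendsto:
  fixes g :: "real^'n \<Rightarrow> real" and gN :: "nat \<Rightarrow> real^'n \<Rightarrow> real"
  assumes gm: "g \<in> borel_measurable borel" "\<And>N. gN N \<in> borel_measurable borel"
    and K: "\<And>N x. \<bar>gN N x\<bar> \<le> K"
    and gN: "\<And>y yN. yN \<longlonglongrightarrow> y \<Longrightarrow> (\<lambda>N. gN N (yN N)) \<longlonglongrightarrow> g y"
    and t: "\<And>N. tN N \<ge> 0" "tN \<longlonglongrightarrow> t" and x: "xN \<longlonglongrightarrow> x"
  shows "(\<lambda>N. Pt (tN N) (gN N) (xN N)) \<longlonglongrightarrow> Pt t g x"
  unfolding transition_semigroup_def
proof (rule integral_dominated_convergence[where w="\<lambda>_. K"])
  have t0: "t \<ge> 0" by (rule tendsto_lowerbound[OF t(2)]) (simp_all add: t(1))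
  show "(\<lambda>\<omega>. g (X x t \<omega>)) \<in> borel_measurable M" by (rule measurable_compose[OF X_measurable[OF t0] gm(1)])
  show "(\<lambda>\<omega>. gN N (X (xN N) (tN N) \<omega>)) \<in> borel_measurable M" for N by (rule measurable_compose[OF X_measurable[OF t(1)] gm(2)])
  \<comment> \<open>Only countably many starting points occur, so the exceptional sets can be
    united.\<close>
  have "AE \<omega> in M. \<forall>N. \<forall>t\<ge>0. norm (X (xN N) t \<omega> - X x t \<omega>) \<le> exp (L * t) * norm (xN N - x)"
    unfolding AE_all_countable using AE_flow_lipschitz by blast
  then show "AE \<omega> in M. (\<lambda>N. gN N (X (xN N) (tN N) \<omega>)) \<longlonglongrightarrow> g (X x t \<omega>)"
    using AE_X_continuous[of x]
  proof eventually_elim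
    case (elim \<omega>)
    have "(\<lambda>N. X x (tN N) \<omega>) \<longlonglongrightarrow> X x t \<omega>"
      by (rule continuous_on_tendsto_compose[OF elim(2) t(2)]) (simp_all add: t0 t(1))
    moreover have "(\<lambda>N. X (xN N) (tN N) \<omega> - X x (tN N) \<omega>) \<longlonglongrightarrow> 0"
    proof (rule Lim_null_comparison)
      show "\<forall>\<^sub>F N in sequentially. norm (X (xN N) (tN N) \<omega> - X x (tN N) \<omega>) \<le> exp (L * tN N) * norm (xN N - x)"
        using elim(1) t(1) by simp
      have "(\<lambda>N. exp (L * tN N) * norm (xN N - x)) \<longlonglongrightarrow> exp (L * t) * norm (x - x)"
        by (intro tendsto_intros t x)
      then show "(\<lambda>N. exp (L * tN N) * norm (xN N - x)) \<longlonglongrightarrow> 0" by simp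
    qed
    ultimately have "(\<lambda>N. X x (tN N) \<omega> + (X (xN N) (tN N) \<omega> - X x (tN N) \<omega>)) \<longlonglongrightarrow> X x t \<omega> + 0" by (rule tendsto_add)
    then have "(\<lambda>N. X (xN N) (tN N) \<omega>) \<longlonglongrightarrow> X x t \<omega>" by simp
    then show ?case by (rule gN)
  qed
qed (auto simp: K)

lemma Pt_continuous:
  fixes g :: "real^'n \<Rightarrow> real"
  assumes gc: "continuous_on UNIV g" and K: "\<And>x. \<bar>g x\<bar> \<le> K"
  shows "continuous_on ({0..} \<times> UNIV) (\<lambda>(t, x). Pt t g x)"
  unfolding continuous_on_sequentially
proof (intro ballI allI impI, elim conjE)
  fix p :: "nat \<Rightarrow> real \<times> (real^'n)" and q
  assume q: "q \<in> {0..} \<times> UNIV" and p: "\<forall>n. p n \<in> {0..} \<times> UNIV" "p \<longlonglongrightarrow> q"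
  have gm: "g \<in> borel_measurable borel" by (rule borel_measurable_continuous_onI[OF gc])
  have "(\<lambda>N. Pt (fst (p N)) g (snd (p N))) \<longlonglongrightarrow> Pt (fst q) g (snd q)"
  proof (rule Pt_tendsto[OF gm gm K])
    show "(\<lambda>N. g (yN N)) \<longlonglongrightarrow> g y" if "yN \<longlonglongrightarrow> y" for y yN
      by (rule continuous_on_tendsto_compose[OF gc that]) auto
    show "0 \<le> fst (p N)" for N using p(1) by (metis atLeast_iff mem_Times_iff)
  qed (use p(2) tendsto_fst tendsto_snd in blast)+
  then show "((\<lambda>(t, x). Pt t g x) \<circ> p) \<longlonglongrightarrow> (case q of (t, x) \<Rightarrow> Pt t g x)"
    by (simp add: comp_def split_beta)
qed

lemma Pt_measurable:
  fixes g :: "real^'n \<Rightarrow> real"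
  assumes gc: "continuous_on UNIV g" and K: "\<And>x. \<bar>g x\<bar> \<le> K" and t: "t \<ge> 0"
  shows "continuous_on UNIV (\<lambda>x. Pt t g x)" "(\<lambda>x. Pt t g x) \<in> borel_measurable borel"
proof -
  have "continuous_on UNIV ((\<lambda>(t, x). Pt t g x) \<circ> (\<lambda>x. (t, x)))"
    by (rule continuous_on_compose) (use t in \<open>auto intro!: continuous_intros continuous_on_subset[OF Pt_continuous[OF gc K]]\<close>)
  then show "continuous_on UNIV (\<lambda>x. Pt t g x)" by (simp add: comp_def)
  then show "(\<lambda>x. Pt t g x) \<in> borel_measurable borel" by (rule borel_measurable_continuous_onI)
qed

lemma Pt_0: assumes gm: "g \<in> borel_measurable borel" shows "Pt 0 g x = g x"
proof -
  have "AE \<omega> in M. X x 0 \<omega> = x"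
    using X_solution[of x] W_0 by eventually_elim simp
  then have "expectation (\<lambda>\<omega>. g (X x 0 \<omega>)) = expectation (\<lambda>\<omega>. g x)"
    using measurable_compose[OF X_measurable[of 0 x] gm] by (intro integral_cong_AE) auto
  then show ?thesis by (simp add: transition_semigroup_def prob_space)
qed

end

lemma integral_mult_tendsto:
  fixes \<psi> :: "real^'n \<Rightarrow> real"
  assumes \<psi>: "integrable lborel \<psi>" and m: "\<And>N. gN N \<in> borel_measurable borel" "g \<in> borel_measurable borel"
    and C: "\<And>N x. \<bar>gN N x\<bar> \<le> C" and lim: "\<And>x. (\<lambda>N. gN N x) \<longlonglongrightarrow> g x"
  shows "(\<lambda>N. LINT x|lborel. gN N x * \<psi> x) \<longlonglongrightarrow> (LINT x|lborel. g x * \<psi> x)"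
proof (rule integral_dominated_convergence[where w="\<lambda>x. C * \<bar>\<psi> x\<bar>"])
  have [measurable]: "\<psi> \<in> borel_measurable borel" using borel_measurable_integrable[OF \<psi>] by simp
  note [measurable] = m
  show "(\<lambda>x. g x * \<psi> x) \<in> borel_measurable lborel" by measurable
  show "(\<lambda>x. gN N x * \<psi> x) \<in> borel_measurable lborel" for N by measurable
  show "integrable lborel (\<lambda>x. C * \<bar>\<psi> x\<bar>)" using \<psi> by simp
  show "AE x in lborel. (\<lambda>N. gN N x * \<psi> x) \<longlonglongrightarrow> g x * \<psi> x" by (intro AE_I2 tendsto_mult lim tendsto_const)
  show "AE x in lborel. norm (gN N x * \<psi> x) \<le> C * \<bar>\<psi> x\<bar>" for N
    by (rule AE_I2) (simp add: abs_mult C mult_right_mono)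
qed

locale smooth_sde = smooth_euler_scheme b L B K R + sde b L R M \<F> W X
  for b :: "real^'n::finite \<Rightarrow> real^'n" and L B K R and M :: "'w measure" and \<F> W X
begin

lemma Pt_pairing_continuous:
  fixes f \<psi> :: "real^'n \<Rightarrow> real"
  assumes \<psi>: "integrable lborel \<psi>" and fc: "continuous_on UNIV f" and C: "\<And>x. \<bar>f x\<bar> \<le> C"
  shows "continuous_on {0..} (\<lambda>s. LINT x|lborel. Pt s f x * \<psi> x)"
  unfolding continuous_on_sequentially comp_def
proof (intro ballI allI impI, elim conjE)
  fix sN :: "nat \<Rightarrow> real" and s assume s: "s \<in> {0..}" "\<forall>n. sN n \<in> {0..}" "sN \<longlonglongrightarrow> s"
  have fm: "f \<in> borel_measurable borel" by (rule borel_measurable_continuous_onI[OF fc])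
  show "(\<lambda>n. LINT x|lborel. Pt (sN n) f x * \<psi> x) \<longlonglongrightarrow> (LINT x|lborel. Pt s f x * \<psi> x)"
  proof (rule integral_mult_tendsto[OF \<psi>])
    show "\<bar>Pt (sN N) f x\<bar> \<le> C" for N x using s by (intro Pt_bound fm C) auto
    show "(\<lambda>N. Pt (sN N) f x) \<longlonglongrightarrow> Pt s f x" for x
    proof (rule Pt_tendsto[OF fm fm C])
      show "(\<lambda>N. f (yN N)) \<longlonglongrightarrow> f y" if "yN \<longlonglongrightarrow> y" for y yN
        by (rule continuous_on_tendsto_compose[OF fc that]) auto
    qed (use s in auto)
  qed (use s Pt_measurable[OF fc C] in auto)
qed

text \<open>The one-step errors are summed over \<open>N + 1\<close> steps of length
  \<open>t / (N + 1)\<close>, so the grid ends exactly at \<open>t\<close>. The main terms form the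
  integral of a step function in time, which converges because the iterates converge boundedly at
  every rounded time.\<close>

lemma weak_equation:
  fixes f :: "real^'n \<Rightarrow> real"
  assumes \<phi>: "\<phi> \<in> test_functions" and fc: "continuous_on UNIV f" and C: "\<And>x. \<bar>f x\<bar> \<le> C" and t: "t \<ge> 0"
  shows "(LINT x|lborel. Pt t f x * \<phi> x) - (LINT x|lborel. f x * \<phi> x) =
    (LINT s|lborel. indicator {0..<t} s * (LINT x|lborel. Pt s f x * adj \<phi> x))"
proof (cases "t = 0")
  case True
  have "f \<in> borel_measurable borel" by (rule borel_measurable_continuous_onI[OF fc])
  then show ?thesis using True by (simp add: Pt_0)
next
  case False
  then have t: "t > 0" using t by simp
  have fm: "f \<in> borel_measurable borel" by (rule borel_measurable_continuous_onI[OF fc])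
  have C0: "C \<ge> 0" using C[of 0] by linarith
  define h where "h N = t / real (Suc N)" for N
  have h: "\<And>N. h N > 0" "h \<longlonglongrightarrow> 0"
  proof -
    show "h N > 0" for N using t by (simp add: h_def)
    have "(\<lambda>N. t * inverse (real (Suc N))) \<longlonglongrightarrow> t * 0" by (intro tendsto_mult tendsto_const LIMSEQ_inverse_real_of_nat)
    then show "h \<longlonglongrightarrow> 0" by (simp add: h_def[abs_def] divide_inverse)
  qed
  have nh: "real (Suc N) * h N = t" for N by (simp add: h_def)
  define S where "S N k = (euler (h N) ^^ k) f" for N k
  have Sm: "S N k \<in> borel_measurable borel" and SC: "\<bar>S N k x\<bar> \<le> C" for N k x
    unfolding S_def using euler_iterate[OF h(1) fm C] by auto
  define a where "a N k = (LINT x|lborel. S N k x * \<phi> x)" for N k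
  define c where "c N k = (LINT x|lborel. S N k x * adj \<phi> x)" for N k
  note ai = adj_integrable[OF \<phi>] and \<phi>i = test_function_integrable[OF \<phi>]
  obtain D h0 where D: "D \<ge> 0" "h0 > 0"
    "\<And>h g M. \<lbrakk>0 < h; h \<le> h0; g \<in> borel_measurable borel; \<And>x. \<bar>g x\<bar> \<le> M\<rbrakk> \<Longrightarrow>
       \<bar>(LINT x|lborel. euler h g x * \<phi> x) - (LINT x|lborel. g x * \<phi> x) - h * (LINT x|lborel. g x * adj \<phi> x)\<bar>
         \<le> D * M * (h * sqrt h)"
    using euler_consistency[OF \<phi>] by blast
  \<comment> \<open>Each step is applied to the bounded Borel function \<open>S N n\<close>, about
    which only the bound \<open>C\<close> is known.\<close>
  have tel: "\<bar>a N n - a N 0 - h N * (\<Sum>k<n. c N k)\<bar> \<le> real n * (D * C * (h N * sqrt (h N)))" if "h N \<le> h0" for N n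
  proof (induction n)
    case (Suc n)
    have "S N (Suc n) = euler (h N) (S N n)" by (simp add: S_def)
    then have "\<bar>a N (Suc n) - a N n - h N * c N n\<bar> \<le> D * C * (h N * sqrt (h N))"
      unfolding a_def c_def using D(3)[OF h(1) that Sm SC] by simp
    with Suc show ?case by (simp add: algebra_simps)
  qed simp
  have lim0: "(\<lambda>N. a N (Suc N) - a N 0 - h N * (\<Sum>k<Suc N. c N k)) \<longlonglongrightarrow> 0"
  proof (rule Lim_null_comparison)
    have "\<forall>\<^sub>F N in sequentially. h N < h0" by (rule order_tendstoD(2)[OF h(2) D(2)])
    then show "\<forall>\<^sub>F N in sequentially. norm (a N (Suc N) - a N 0 - h N * (\<Sum>k<Suc N. c N k)) \<le> t * (D * C * sqrt (h N))"
    proof eventually_elim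
      case (elim N)
      have "real (Suc N) * (D * C * (h N * sqrt (h N))) = (real (Suc N) * h N) * (D * C * sqrt (h N))" by (simp only: mult_ac)
      also have "\<dots> = t * (D * C * sqrt (h N))" unfolding nh ..
      finally show ?case using tel[OF less_imp_le[OF elim], of "Suc N"] by (simp only: real_norm_def)
    qed
    have "(\<lambda>N. t * (D * C * sqrt (h N))) \<longlonglongrightarrow> t * (D * C * sqrt 0)" by (intro tendsto_intros h(2))
    then show "(\<lambda>N. t * (D * C * sqrt (h N))) \<longlonglongrightarrow> 0" by simp
  qed
  have lim1: "(\<lambda>N. a N (Suc N)) \<longlonglongrightarrow> (LINT x|lborel. Pt t f x * \<phi> x)"
    unfolding a_def
  proof (rule integral_mult_tendsto[OF \<phi>i Sm _ SC])
    show "(\<lambda>x. Pt t f x) \<in> borel_measurable borel" using Pt_measurable[OF fc C] t by simp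
    show "(\<lambda>N. S N (Suc N) x) \<longlonglongrightarrow> Pt t f x" for x
      unfolding S_def by (rule euler_iterate_convergence[OF fc C h]) (simp only: nh tendsto_const)
  qed
  have a0: "a N 0 = (LINT x|lborel. f x * \<phi> x)" for N by (simp add: a_def S_def)
  let ?D = "C * (LINT x|lborel. \<bar>adj \<phi> x\<bar>)"
  have lim2: "(\<lambda>N. LINT s|lborel. indicator {0..<t} s * c N (nat \<lfloor>s / h N\<rfloor>)) \<longlonglongrightarrow> (LINT s|lborel. indicator {0..<t} s * (LINT x|lborel. Pt s f x * adj \<phi> x))"
  proof (rule integral_dominated_convergence[where w="\<lambda>s. ?D * indicator {0..<t} s"])
    have "integrable lborel (indicator {0..<t} :: real \<Rightarrow> real)" using t by (intro integrable_real_indicator) auto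
    then show "integrable lborel (\<lambda>s. ?D * indicator {0..<t} s)" by (rule integrable_mult_right)
    have m1: "(\<lambda>s. indicator {0..<t} s * c N (nat \<lfloor>s / h N\<rfloor>)) \<in> borel_measurable lborel" for N
      by measurable
    then show "(\<lambda>s. indicator {0..<t} s * c N (nat \<lfloor>s / h N\<rfloor>)) \<in> borel_measurable lborel" for N .
    have lim: "(\<lambda>N. indicator {0..<t} s * c N (nat \<lfloor>s / h N\<rfloor>)) \<longlonglongrightarrow> indicator {0..<t} s * (LINT x|lborel. Pt s f x * adj \<phi> x)" for s
    proof (cases "s \<in> {0..<t}")
      case True
      have "(\<lambda>N. c N (nat \<lfloor>s / h N\<rfloor>)) \<longlonglongrightarrow> (LINT x|lborel. Pt s f x * adj \<phi> x)"
        unfolding c_def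
      proof (rule integral_mult_tendsto[OF ai Sm _ SC])
        show "(\<lambda>x. Pt s f x) \<in> borel_measurable borel" using Pt_measurable[OF fc C] True by simp
        show "(\<lambda>N. S N (nat \<lfloor>s / h N\<rfloor>) x) \<longlonglongrightarrow> Pt s f x" for x
          unfolding S_def by (rule euler_iterate_convergence[OF fc C h grid_floor_tendsto[OF _ h]]) (use True in simp)
      qed
      then show ?thesis using True by simp
    qed simp
    then show "AE s in lborel. (\<lambda>N. indicator {0..<t} s * c N (nat \<lfloor>s / h N\<rfloor>)) \<longlonglongrightarrow> indicator {0..<t} s * (LINT x|lborel. Pt s f x * adj \<phi> x)" by simp
    show "(\<lambda>s. indicator {0..<t} s * (LINT x|lborel. Pt s f x * adj \<phi> x)) \<in> borel_measurable lborel"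
      by (rule borel_measurable_LIMSEQ_metric[OF m1]) (rule lim)
    show "AE s in lborel. norm (indicator {0..<t} s * c N (nat \<lfloor>s / h N\<rfloor>)) \<le> ?D * indicator {0..<t} s" for N
      using integral_mult_bound(2)[OF ai Sm SC] by (intro AE_I2) (auto simp: c_def indicator_def)
  qed
  have "(\<lambda>N. h N * (\<Sum>k<Suc N. c N k)) \<longlonglongrightarrow> (LINT s|lborel. indicator {0..<t} s * (LINT x|lborel. Pt s f x * adj \<phi> x))"
  proof -
    have "(LINT s|lborel. indicator {0..<t} s * c N (nat \<lfloor>s / h N\<rfloor>)) = h N * (\<Sum>k<Suc N. c N k)" for N
      using step_function_integral[OF h(1)[of N], where n="Suc N" and c="c N"] unfolding nh by blast
    then show ?thesis using lim2 by (simp only:)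
  qed
  from tendsto_diff[OF tendsto_diff[OF lim1 tendsto_const] this]
  have "(\<lambda>N. a N (Suc N) - (LINT x|lborel. f x * \<phi> x) - h N * (\<Sum>k<Suc N. c N k)) \<longlonglongrightarrow>
     (LINT x|lborel. Pt t f x * \<phi> x) - (LINT x|lborel. f x * \<phi> x) - (LINT s|lborel. indicator {0..<t} s * (LINT x|lborel. Pt s f x * adj \<phi> x))" .
  from LIMSEQ_unique[OF this lim0[unfolded a0]] show ?thesis by simp
qed

end

section \<open>Smoothing under the spanning condition\<close>

lemma power_dvd_pderiv:
  fixes e p :: "real poly"
  assumes "e ^ Suc n dvd p"
  shows "e ^ n dvd pderiv p"
proof -
  obtain q where q: "p = e ^ Suc n * q" using assms by (auto simp: dvd_def)
  have "pderiv p = e ^ n * (smult (of_nat (Suc n)) (pderiv e * q) + e * pderiv q)"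
    unfolding q pderiv_mult pderiv_power_Suc by (simp add: algebra_simps)
  then show ?thesis by simp
qed

text \<open>Each derivative lowers the order of a zero by at most one.\<close>

lemma power_dvd_higher_pderiv:
  fixes e p :: "real poly"
  assumes "e ^ n dvd p" "l \<le> n"
  shows "e ^ (n - l) dvd (pderiv ^^ l) p"
  using assms(2)
proof (induction l)
  case (Suc l)
  then have "e ^ Suc (n - Suc l) dvd (pderiv ^^ l) p" by (simp add: Suc_diff_Suc)
  then show ?case using power_dvd_pderiv by simp
qed (simp add: assms)

lemma linear_funpow_matrix: "linear ((*v) (A::real^'n^'n) ^^ j)"
  by (induction j) (auto intro: linear_compose[unfolded comp_def] simp: linear_id[unfolded id_def] comp_def)

lemma sum_scaleR_delta:
  fixes f :: "'a \<Rightarrow> 'b::real_vector"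
  assumes "finite T" "i0 \<in> T"
  shows "(\<Sum>i\<in>T. (if i = i0 then a else 0) *\<^sub>R f i) = a *\<^sub>R f i0"
proof -
  have "(\<Sum>i\<in>T. (if i = i0 then a else 0) *\<^sub>R f i) = (\<Sum>i\<in>T. if i = i0 then a *\<^sub>R f i0 else 0)"
    by (intro sum.cong) auto
  also have "\<dots> = a *\<^sub>R f i0" using assms by simp
  finally show ?thesis .
qed

lemma matrix_vector_mult_sum: "(A::real^'n^'m) *v (\<Sum>i\<in>T. f i) = (\<Sum>i\<in>T. A *v f i)"
  by (rule linear_sum[OF matrix_vector_mul_linear])

text \<open>A representation of each basis vector is fixed and extended linearly. The maps
  \<open>C j\<close> must be linear because they are applied along a curve and have to commute with
  its derivative.\<close>

lemma generates_representation:
  fixes A :: "real^'n^'n"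
  assumes span: "span {((*v) A ^^ j) (axis i 1) | i j. i \<in> S \<and> j \<le> k} = UNIV"
  obtains C :: "nat \<Rightarrow> real^'n \<Rightarrow> real^'n" where "\<And>j. linear (C j)" "\<And>j x i. i \<notin> S \<Longrightarrow> C j x $ i = 0"
    "\<And>x. x = (\<Sum>j\<le>k. ((*v) A ^^ j) (C j x))"
proof -
  let ?P = "\<lambda>j. (*v) A ^^ j"
  have fin: "finite S" by simp
  have "\<exists>c. x = (\<Sum>j\<le>k. \<Sum>i\<in>S. c i j *\<^sub>R ?P j (axis i 1))" for x
  proof -
    have "x \<in> span {?P j (axis i 1) | i j. i \<in> S \<and> j \<le> k}" using span by simp
    then show ?thesis
    proof (induction rule: span_induct_alt)
      case base
      show ?case by (rule exI[of _ "\<lambda>_ _. 0"]) simp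
    next
      case (step a v y)
      then obtain c i0 j0 where c: "y = (\<Sum>j\<le>k. \<Sum>i\<in>S. c i j *\<^sub>R ?P j (axis i 1))"
        and v: "v = ?P j0 (axis i0 1)" "i0 \<in> S" "j0 \<le> k" by blast
      have inner: "(\<Sum>i\<in>S. (if j = j0 then if i = i0 then a else 0 else 0) *\<^sub>R ?P j (axis i 1)) = (if j = j0 then a else 0) *\<^sub>R ?P j (axis i0 1)" for j
        by (cases "j = j0") (simp_all add: sum_scaleR_delta[OF fin v(2)])
      have "(\<Sum>j\<le>k. \<Sum>i\<in>S. (if j = j0 then if i = i0 then a else 0 else 0) *\<^sub>R ?P j (axis i 1)) = a *\<^sub>R v"
        unfolding inner v(1) by (rule sum_scaleR_delta[where f="\<lambda>j. ?P j (axis i0 1)" and T="{..k}"]) (simp_all add: v(3))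
      then have "a *\<^sub>R v + y = (\<Sum>j\<le>k. \<Sum>i\<in>S. (c i j + (if j = j0 then if i = i0 then a else 0 else 0)) *\<^sub>R ?P j (axis i 1))"
        by (simp add: c scaleR_left_distrib sum.distrib)
      then show ?case by (rule exI[of _ "\<lambda>i j. c i j + (if j = j0 then if i = i0 then a else 0 else 0)"])
    qed
  qed
  then have "\<forall>x. \<exists>c. x = (\<Sum>j\<le>k. \<Sum>i\<in>S. c i j *\<^sub>R ?P j (axis i 1))" by blast
  from choice[OF this] obtain c where c: "\<And>x. x = (\<Sum>j\<le>k. \<Sum>i\<in>S. c x i j *\<^sub>R ?P j (axis i 1))" by blast
  define V where "V j m = (\<Sum>i\<in>S. c (axis m 1) i j *\<^sub>R (axis i 1 :: real^'n))" for j m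
  define C where "C j x = (\<Sum>m\<in>UNIV. x$m *\<^sub>R V j m)" for j and x :: "real^'n"
  show thesis
  proof (rule that[of C])
    show "linear (C j)" for j
    proof (rule linearI)
      show "C j (x + y) = C j x + C j y" for x y
        by (simp only: C_def vector_add_component scaleR_left_distrib sum.distrib)
      show "C j (r *\<^sub>R x) = r *\<^sub>R C j x" for r x
        by (simp only: C_def vector_scaleR_component scaleR_sum_right scaleR_scaleR real_scaleR_def)
    qed
    have "V j m $ i = 0" if "i \<notin> S" for j m i
      using that by (auto simp: V_def axis_def intro!: sum.neutral)
    then show "C j x $ i = 0" if "i \<notin> S" for j x i using that by (simp add: C_def)
    fix x :: "real^'n"
    have PV: "?P j (V j m) = (\<Sum>i\<in>S. c (axis m 1) i j *\<^sub>R ?P j (axis i 1))" for j m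
      unfolding V_def by (simp only: linear_sum[OF linear_funpow_matrix] linear_cmul[OF linear_funpow_matrix])
    have PC: "?P j (C j x) = (\<Sum>m\<in>UNIV. x$m *\<^sub>R (\<Sum>i\<in>S. c (axis m 1) i j *\<^sub>R ?P j (axis i 1)))" for j
      unfolding C_def PV[symmetric] by (simp only: linear_sum[OF linear_funpow_matrix] linear_cmul[OF linear_funpow_matrix])
    have "(\<Sum>j\<le>k. ?P j (C j x)) = (\<Sum>m\<in>UNIV. x$m *\<^sub>R (\<Sum>j\<le>k. \<Sum>i\<in>S. c (axis m 1) i j *\<^sub>R ?P j (axis i 1)))"
      unfolding PC scaleR_sum_right[of "x $ _" _ "{..k}"] by (rule sum.swap)
    also have "\<dots> = (\<Sum>m\<in>UNIV. x$m *\<^sub>R axis m 1)" using c by simp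
    also have "\<dots> = x" by (simp add: vec_eq_iff axis_def if_distrib cong: if_cong)
    finally show "x = (\<Sum>j\<le>k. ?P j (C j x))" by simp
  qed
qed

section \<open>Steering the linear system to zero\<close>

lemma poly_curve_derivative:
  fixes v :: "nat \<Rightarrow> 'a::real_normed_vector"
  shows "((\<lambda>s. \<Sum>i\<in>I. poly (p i) s *\<^sub>R v i) has_vector_derivative (\<Sum>i\<in>I. poly (pderiv (p i)) s *\<^sub>R v i)) (at s)"
proof (rule has_vector_derivative_sum)
  fix i
  have "((\<lambda>s. poly (p i) s) has_real_derivative poly (pderiv (p i)) s) (at s)" by (rule poly_DERIV)
  from has_vector_derivative_scaleR[OF this has_vector_derivative_const[of "v i"]]
  show "((\<lambda>s. poly (p i) s *\<^sub>R v i) has_vector_derivative poly (pderiv (p i)) s *\<^sub>R v i) (at s)" by simp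
qed

text \<open>A curve from \<open>z0\<close> to \<open>0\<close> is corrected so that its residual \<open>z' - A z\<close> becomes admissible. The
  residual \<open>r = \<Sum>j. A^j (C j r)\<close> of the first guess vanishes to high order at both ends, and adding
  \<open>\<Sum>j. \<Sum>l<j. A^(j-1-l) (C j r^(l))\<close> trades every term \<open>A^j (C j r)\<close> for \<open>C j r^(j)\<close>.\<close>
lemma control_curve:
  fixes A :: "real^'n^'n" and z0 :: "real^'n"
  assumes span: "span {((*v) A ^^ j) (axis i 1) | i j. i \<in> S \<and> j \<le> k} = UNIV" and \<delta>: "\<delta> > 0"
  shows "\<exists>z u. continuous_on UNIV u \<and> (\<forall>s. (z has_vector_derivative A *v z s + u s) (at s)) \<and>
    z 0 = z0 \<and> z \<delta> = 0 \<and> (\<forall>s i. i \<notin> S \<longrightarrow> u s $ i = (0::real))"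
proof -
  obtain C :: "nat \<Rightarrow> real^'n \<Rightarrow> real^'n" where C: "\<And>j. linear (C j)" "\<And>j x i. i \<notin> S \<Longrightarrow> C j x $ i = 0"
    "\<And>x. x = (\<Sum>j\<le>k. ((*v) A ^^ j) (C j x))" using generates_representation[OF span] by blast
  let ?P = "\<lambda>j. (*v) A ^^ j"
  define m where "m = Suc k"
  define N where "N = Suc m"
  define w :: "real poly" where "w = 1 - monom (1 / \<delta> ^ N) N"
  define \<theta> where "\<theta> = w ^ N"
  \<comment> \<open>The sum of \<open>\<mu> l\<close> times \<open>A^l z0\<close> is a Taylor
    polynomial of \<open>exp (s A) z0\<close>; multiplied by the cut-off \<theta> it gives the first
    guess \<open>z\<close>.\<close>
  define \<mu> :: "nat \<Rightarrow> real poly" where "\<mu> l = monom (1 / fact l) l" for l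
  define v where "v l = ?P l z0" for l
  \<comment> \<open>Coefficients of the residual \<open>z' - A z\<close> on the vectors
    \<open>A^i z0\<close>: the cut-off contributes the derivative of \<theta>, and truncating the
    exponential series contributes the single term of index \<open>m + 1\<close>. Below,
    \<open>d l\<close> is the \<open>l\<close>-th derivative of the residual.\<close>
  define p where "p i = (if i \<le> m then pderiv \<theta> * \<mu> i else - (\<theta> * \<mu> m))" for i
  define z where "z s = (\<Sum>l\<le>m. poly (\<theta> * \<mu> l) s *\<^sub>R v l)" for s
  define d where "d l s = (\<Sum>i\<le>Suc m. poly ((pderiv ^^ l) (p i)) s *\<^sub>R v i)" for l s
  have \<mu>0: "pderiv (\<mu> 0) = 0" by (simp add: \<mu>_def pderiv_monom)
  have \<mu>S: "pderiv (\<mu> (Suc l)) = \<mu> l" for l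
  proof -
    have "real (Suc l) * (1 / fact (Suc l)) = 1 / fact l" by (simp only: fact_Suc) (simp del: of_nat_Suc)
    then show ?thesis unfolding \<mu>_def pderiv_monom by simp
  qed
  have Av: "A *v v l = v (Suc l)" for l by (simp add: v_def)
  have zd: "(z has_vector_derivative A *v z s + d 0 s) (at s)" for s
  proof -
    have "(z has_vector_derivative (\<Sum>l\<le>m. poly (pderiv (\<theta> * \<mu> l)) s *\<^sub>R v l)) (at s)"
      unfolding z_def[abs_def] by (rule poly_curve_derivative)
    moreover have e2: "(\<Sum>l\<le>m. poly (pderiv (\<theta> * \<mu> l)) s *\<^sub>R v l) = (\<Sum>l\<le>m. poly (pderiv \<theta> * \<mu> l) s *\<^sub>R v l) + (\<Sum>l\<le>m. poly (\<theta> * pderiv (\<mu> l)) s *\<^sub>R v l)"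
      by (simp add: pderiv_mult scaleR_left_distrib sum.distrib algebra_simps)
    moreover have e3: "(\<Sum>l\<le>m. poly (\<theta> * pderiv (\<mu> l)) s *\<^sub>R v l) = (\<Sum>l<m. poly (\<theta> * \<mu> l) s *\<^sub>R v (Suc l))"
      by (simp add: sum.atMost_shift \<mu>0 \<mu>S)
    moreover have e4: "A *v z s = (\<Sum>l<m. poly (\<theta> * \<mu> l) s *\<^sub>R v (Suc l)) + poly (\<theta> * \<mu> m) s *\<^sub>R v (Suc m)"
      unfolding z_def by (simp add: matrix_vector_mult_sum matrix_vector_mult_scaleR matrix_vector_right_distrib Av lessThan_Suc_atMost[symmetric] del: poly_mult)
    moreover have e5: "d 0 s = (\<Sum>l\<le>m. poly (pderiv \<theta> * \<mu> l) s *\<^sub>R v l) - poly (\<theta> * \<mu> m) s *\<^sub>R v (Suc m)"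
    proof -
      have "(\<Sum>i\<le>m. poly (p i) s *\<^sub>R v i) = (\<Sum>l\<le>m. poly (pderiv \<theta> * \<mu> l) s *\<^sub>R v l)"
        by (intro sum.cong) (simp_all add: p_def)
      moreover have "d 0 s = (\<Sum>i\<le>m. poly (p i) s *\<^sub>R v i) + poly (p (Suc m)) s *\<^sub>R v (Suc m)"
        by (simp add: d_def)
      ultimately show ?thesis by (simp add: p_def)
    qed
    moreover have "(\<Sum>l\<le>m. poly (pderiv (\<theta> * \<mu> l)) s *\<^sub>R v l) = A *v z s + d 0 s"
      unfolding e2 e3 e4 e5 by simp
    ultimately show ?thesis by (simp only:)
  qed
  let ?x = "[:0, 1:] :: real poly" and ?y = "[:- \<delta>, 1:] :: real poly"
  have x_monom: "?x ^ a dvd monom c b" if "a \<le> b" for a b and c :: real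
  proof -
    have "?x ^ a = monom 1 a" by (simp add: monom_altdef)
    moreover have "monom c b = monom 1 a * monom c (b - a)" using that by (simp add: mult_monom)
    ultimately show ?thesis by simp
  qed
  have yw: "?y dvd w" using \<delta> by (simp add: poly_eq_0_iff_dvd[symmetric] w_def poly_monom)
  \<comment> \<open>Zeros of order \<open>k + 1\<close> at both ends survive up to \<open>k\<close>
    differentiations. For \<open>i \<le> m\<close> they come from the derivative of \<theta>; for
    the truncation term they come from \<open>s^m\<close> at 0 and from \<theta> at
    \<delta>.\<close>
  have div: "(?x * ?y) ^ Suc k dvd p i" for i
  proof (cases "i \<le> m")
    case True
    have "pderiv \<theta> = smult (real N) (w ^ Suc k * pderiv w)"
      unfolding \<theta>_def N_def m_def by (simp add: pderiv_power_Suc del: power_Suc of_nat_Suc)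
    moreover have "pderiv w = - monom (real N * (1 / \<delta> ^ N)) (Suc k)" by (simp add: w_def pderiv_diff pderiv_monom N_def m_def)
    moreover have "?x ^ Suc k dvd monom (real N * (1 / \<delta> ^ N)) (Suc k)" by (rule x_monom) simp
    moreover have "?y ^ Suc k dvd w ^ Suc k" using yw by (rule dvd_power_same)
    ultimately have "?x ^ Suc k * ?y ^ Suc k dvd pderiv \<theta>"
      by (simp only: mult.commute[of "?x ^ Suc k"]) (intro dvd_smult mult_dvd_mono, simp_all only: dvd_minus_iff)
    then have "(?x * ?y) ^ Suc k dvd pderiv \<theta> * \<mu> i" unfolding power_mult_distrib by (rule dvd_mult2)
    moreover have "p i = pderiv \<theta> * \<mu> i" using True by (simp add: p_def)
    ultimately show ?thesis by (simp only:)
  next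
    case False
    have "?y ^ Suc k dvd ?y ^ N" by (rule le_imp_power_dvd) (simp add: N_def m_def)
    also have "\<dots> dvd w ^ N" using yw by (rule dvd_power_same)
    finally have "?y ^ Suc k dvd \<theta>" unfolding \<theta>_def .
    moreover have "?x ^ Suc k dvd \<mu> m" unfolding \<mu>_def m_def by (rule x_monom) simp
    ultimately have "?y ^ Suc k * ?x ^ Suc k dvd \<theta> * \<mu> m" by (rule mult_dvd_mono)
    then have "(?x * ?y) ^ Suc k dvd - (\<theta> * \<mu> m)"
      unfolding power_mult_distrib by (simp only: dvd_minus_iff mult.commute)
    moreover have "p i = - (\<theta> * \<mu> m)" using False by (simp add: p_def)
    ultimately show ?thesis by (simp only:)
  qed
  have root: "poly ((pderiv ^^ l) (p i)) s = 0" if "s = 0 \<or> s = \<delta>" "l \<le> k" for l i s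
  proof -
    have "(?x * ?y) ^ (Suc k - l) dvd (pderiv ^^ l) (p i)" by (rule power_dvd_higher_pderiv[OF div]) (use that in simp)
    then obtain q where "(pderiv ^^ l) (p i) = (?x * ?y) ^ (Suc k - l) * q" by (auto simp: dvd_def)
    then show ?thesis using that by (auto simp: poly_power)
  qed
  have d0: "d l s = 0" if "s = 0 \<or> s = \<delta>" "l \<le> k" for l s
    unfolding d_def using root[OF that] by simp
  have dd: "((d l) has_vector_derivative d (Suc l) s) (at s)" for l s
    unfolding d_def[abs_def] using poly_curve_derivative[of "\<lambda>i. (pderiv ^^ l) (p i)" v "{..Suc m}" s] by simp
  have bl: "bounded_linear (\<lambda>x. ?P i (C j x))" for i j
    using linear_compose[OF C(1) linear_funpow_matrix] by (simp add: comp_def linear_conv_bounded_linear)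
  define y where "y s = (\<Sum>j\<le>k. \<Sum>l<j. ?P (j - Suc l) (C j (d l s)))" for s
  define u where "u s = (\<Sum>j\<le>k. C j (d j s))" for s
  have yd: "(y has_vector_derivative (\<Sum>j\<le>k. \<Sum>l<j. ?P (j - Suc l) (C j (d (Suc l) s)))) (at s)" for s
    unfolding y_def[abs_def] by (intro has_vector_derivative_sum bounded_linear.has_vector_derivative[OF bl] dd)
  have ye: "(\<Sum>j\<le>k. \<Sum>l<j. ?P (j - Suc l) (C j (d (Suc l) s))) = A *v y s + u s - d 0 s" for s
  proof -
    have Ay: "A *v y s = (\<Sum>j\<le>k. \<Sum>l<j. ?P (j - l) (C j (d l s)))"
    proof -
      have "A *v ?P (j - Suc l) a = ?P (j - l) a" if "l < j" for j l a
        using that by (metis Suc_diff_Suc comp_apply funpow.simps(2))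
      then show ?thesis unfolding y_def by (simp add: matrix_vector_mult_sum)
    qed
    have "(\<Sum>j\<le>k. \<Sum>l<j. ?P (j - Suc l) (C j (d (Suc l) s))) - A *v y s =
      (\<Sum>j\<le>k. \<Sum>l<j. ?P (j - Suc l) (C j (d (Suc l) s)) - ?P (j - l) (C j (d l s)))"
      unfolding Ay by (simp add: sum_subtractf)
    \<comment> \<open>For each \<open>j\<close> the sum telescopes in \<open>l\<close>: its upper
      end is the control contributed by the \<open>j\<close>-th derivative, its lower end the part
      of the residual to be removed.\<close>
    also have "\<dots> = (\<Sum>j\<le>k. ?P (j - j) (C j (d j s)) - ?P (j - 0) (C j (d 0 s)))"
      by (intro sum.cong refl sum_lessThan_telescope)
    also have "\<dots> = u s - (\<Sum>j\<le>k. ?P j (C j (d 0 s)))" by (simp add: u_def sum_subtractf)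
    also have "\<dots> = u s - d 0 s" using C(3)[of "d 0 s"] by simp
    finally show ?thesis by (simp add: algebra_simps)
  qed
  have "((\<lambda>s. z s + y s) has_vector_derivative A *v (z s + y s) + u s) (at s)" for s
    using has_vector_derivative_add[OF zd[of s] yd[of s]] unfolding ye by (simp add: matrix_vector_right_distrib algebra_simps)
  moreover have "continuous_on UNIV u"
  proof -
    have "continuous_on UNIV (d j)" for j
      using dd by (meson continuous_at_imp_continuous_on has_vector_derivative_continuous)
    then have "continuous_on UNIV (\<lambda>s. C j (d j s))" for j
      by (rule linear_continuous_on_compose) (rule C(1))
    then show ?thesis unfolding u_def[abs_def] by (rule continuous_on_sum)
  qed
  moreover have "z 0 + y 0 = z0"
  proof -
    have "y 0 = 0" unfolding y_def using d0 by (auto intro!: sum.neutral simp: linear_0[OF C(1)] linear_0[OF linear_funpow_matrix])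
    moreover have "z 0 = z0"
    proof -
      have "poly \<theta> 0 = 1" by (simp add: \<theta>_def w_def poly_monom N_def poly_power)
      then have "z 0 = (\<Sum>l\<le>m. (if l = 0 then 1 else 0) *\<^sub>R v l)"
        unfolding z_def by (intro sum.cong refl) (simp add: \<mu>_def poly_monom)
      also have "\<dots> = v 0" by (simp add: if_distrib[of "\<lambda>a. a *\<^sub>R _"] sum.delta cong: if_cong)
      finally show ?thesis by (simp add: v_def)
    qed
    ultimately show ?thesis by simp
  qed
  moreover have "z \<delta> + y \<delta> = 0"
  proof -
    have "y \<delta> = 0" unfolding y_def using d0 by (auto intro!: sum.neutral simp: linear_0[OF C(1)] linear_0[OF linear_funpow_matrix])
    moreover have "poly \<theta> \<delta> = 0" using yw by (simp add: \<theta>_def N_def poly_power poly_eq_0_iff_dvd)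
    ultimately show ?thesis by (simp add: z_def)
  qed
  moreover have "u s $ i = 0" if "i \<notin> S" for s i using C(2)[OF that] by (simp add: u_def)
  ultimately show ?thesis by (intro exI[of _ "\<lambda>s. z s + y s"] exI[of _ u]) blast
qed

text \<open>The system is linear, so controls for the basis vectors superpose; this is where the
  bound proportional to \<open>norm z0\<close> comes from.\<close>

lemma control_exists:
  fixes A :: "real^'n^'n"
  assumes span: "span {((*v) A ^^ j) (axis i 1) | i j. i \<in> S \<and> j \<le> k} = UNIV" and \<delta>: "\<delta> > 0"
  shows "\<exists>C\<ge>0. \<forall>z0. \<exists>z u. continuous_on UNIV u \<and> (\<forall>s. (z has_vector_derivative A *v z s + u s) (at s)) \<and>
    z 0 = z0 \<and> z \<delta> = 0 \<and> (\<forall>s i. i \<notin> S \<longrightarrow> u s $ i = (0::real)) \<and> (\<forall>s\<in>{0..\<delta>}. norm (u s) \<le> C * norm z0)"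
proof -
  let ?Q = "\<lambda>i z u. continuous_on UNIV u \<and> (\<forall>s. (z has_vector_derivative A *v z s + u s) (at s)) \<and>
    z 0 = axis i 1 \<and> z \<delta> = 0 \<and> (\<forall>s i. i \<notin> S \<longrightarrow> u s $ i = (0::real))"
  have "\<forall>i. \<exists>z u. ?Q i z u" using control_curve[OF span \<delta>] by blast
  from choice[OF this] obtain Z where "\<forall>i. \<exists>u. ?Q i (Z i) u" by blast
  from choice[OF this] obtain U where Q: "\<forall>i. ?Q i (Z i) (U i)" by blast
  have ZU: "\<And>i. continuous_on UNIV (U i)" "\<And>i s. (Z i has_vector_derivative A *v Z i s + U i s) (at s)"
    "\<And>i. Z i 0 = axis i 1" "\<And>i. Z i \<delta> = 0" "\<And>m s i. i \<notin> S \<Longrightarrow> U m s $ i = 0"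
    using Q by blast+
  have "\<exists>c. \<forall>s\<in>{0..\<delta>}. norm (U i s) \<le> c" for i
  proof -
    have "compact (U i ` {0..\<delta>})" by (intro compact_continuous_image continuous_on_subset[OF ZU(1)]) auto
    then have "bounded (U i ` {0..\<delta>})" by (rule compact_imp_bounded)
    then show ?thesis by (simp add: bounded_iff)
  qed
  then obtain c where c: "\<And>i s. s \<in> {0..\<delta>} \<Longrightarrow> norm (U i s) \<le> c i" by metis
  have c0: "0 \<le> c i" for i by (rule order_trans[OF norm_ge_zero c[of 0 i]]) (use \<delta> in simp)
  show ?thesis
  proof (intro exI[of _ "sum c UNIV"] conjI allI)
    show "0 \<le> sum c UNIV" by (intro sum_nonneg c0)
    fix z0 :: "real^'n"
    let ?z = "\<lambda>s. \<Sum>i\<in>UNIV. z0$i *\<^sub>R Z i s" and ?u = "\<lambda>s. \<Sum>i\<in>UNIV. z0$i *\<^sub>R U i s"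
    have 1: "continuous_on UNIV ?u" by (intro continuous_intros ZU(1))
    have 2: "(?z has_vector_derivative A *v ?z s + ?u s) (at s)" for s
    proof -
      have "(?z has_vector_derivative (\<Sum>i\<in>UNIV. z0$i *\<^sub>R (A *v Z i s + U i s))) (at s)"
        by (intro has_vector_derivative_sum bounded_linear.has_vector_derivative[OF bounded_linear_scaleR_right] ZU(2))
      then show ?thesis by (simp add: scaleR_right_distrib sum.distrib matrix_vector_mult_sum matrix_vector_mult_scaleR)
    qed
    have 3: "?z 0 = z0" unfolding ZU(3) by (simp add: vec_eq_iff axis_def if_distrib cong: if_cong)
    have 4: "norm (?u s) \<le> sum c UNIV * norm z0" if "s \<in> {0..\<delta>}" for s
    proof -
      have "norm (?u s) \<le> (\<Sum>i\<in>UNIV. norm (z0$i *\<^sub>R U i s))" by (rule norm_sum)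
      also have "\<dots> \<le> (\<Sum>i\<in>UNIV. c i * norm z0)"
      proof (rule sum_mono)
        fix i
        have "\<bar>z0$i\<bar> * norm (U i s) \<le> norm z0 * c i" by (intro mult_mono component_le_norm_cart c that) auto
        then show "norm (z0$i *\<^sub>R U i s) \<le> c i * norm z0" by (simp add: mult.commute)
      qed
      finally show ?thesis by (simp add: sum_distrib_right)
    qed
    show "\<exists>z u. continuous_on UNIV u \<and> (\<forall>s. (z has_vector_derivative A *v z s + u s) (at s)) \<and>
      z 0 = z0 \<and> z \<delta> = 0 \<and> (\<forall>s i. i \<notin> S \<longrightarrow> u s $ i = (0::real)) \<and> (\<forall>s\<in>{0..\<delta>}. norm (u s) \<le> sum c UNIV * norm z0)"
      by (rule exI[of _ ?z], rule exI[of _ ?u], intro conjI) (use 1 2 3 4 ZU(4,5) in simp_all)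
  qed
qed

text \<open>An increment of the drift differs from its linear part \<open>A z\<close> only in the
  directions of \<open>S\<close>, and \<open>R\<close> reaches these directions at the cost
  \<open>CR\<close>. Whatever the nonlinearity does to a displacement can thus be undone by the
  noise.\<close>

locale control_sde = sde b L R M \<F> W X
  for b :: "real^'n::finite \<Rightarrow> real^'n" and L R and M :: "'w measure" and \<F> W X +
  fixes A :: "real^'n^'n" and S :: "'n set" and k :: nat and CR :: real
  assumes nonlinearity: "i \<notin> S \<Longrightarrow> (b (x + z) - b x - A *v z) $ i = 0"
    and range_R: "(\<And>i. i \<notin> S \<Longrightarrow> v $ i = 0) \<Longrightarrow> \<exists>\<beta>. R *v \<beta> = v \<and> norm \<beta> \<le> CR * norm v"
    and CR_nonneg: "CR \<ge> 0"
    and generating: "span {((*v) A ^^ j) (axis i 1) | i j. i \<in> S \<and> j \<le> k} = UNIV"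
begin

lemma linear_drift: "drift ((*v) A) (onorm ((*v) A))"
proof
  show "(onorm ((*v) A))-lipschitz_on UNIV ((*v) A)"
  proof (rule lipschitz_onI)
    fix x y
    show "dist (A *v x) (A *v y) \<le> onorm ((*v) A) * dist x y"
      using onorm[OF matrix_vector_mul_bounded_linear[of A], of "x - y"]
      by (simp add: dist_norm matrix_vector_mult_diff_distrib)
  qed (rule onorm_pos_le[OF matrix_vector_mul_bounded_linear])
qed

sublocale lin: drift "(*v) A" "onorm ((*v) A)" by (rule linear_drift)

text \<open>The control is integrated to a driving path \<open>G\<close>, so that the controlled
  system has the form treated by \<open>eul_convergence\<close>. After time \<delta> it is switched
  off and \<open>z\<close> stays at 0; one control then serves all
  \<open>t \<ge> \<delta>\<close>.\<close>

lemma control_path: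
  assumes \<delta>: "\<delta> > 0"
  obtains C where "C \<ge> 0" "\<And>z0. \<exists>z G. continuous_on {0..} z \<and>
     (\<forall>t\<ge>0. z t = z0 + integral {0..t} (\<lambda>s. A *v z s) + G t) \<and> (\<forall>t\<ge>\<delta>. z t = 0) \<and> G 0 = 0 \<and>
     (\<forall>s t i. 0 \<le> s \<and> s \<le> t \<and> i \<notin> S \<longrightarrow> (G t - G s) $ i = 0) \<and>
     (\<forall>s t. 0 \<le> s \<and> s \<le> t \<longrightarrow> norm (G t - G s) \<le> C * norm z0 * (t - s))"
proof -
  obtain C where C: "C \<ge> 0" "\<And>z0. \<exists>z u. continuous_on UNIV u \<and> (\<forall>s. (z has_vector_derivative A *v z s + u s) (at s)) \<and>
    z 0 = z0 \<and> z \<delta> = 0 \<and> (\<forall>s i. i \<notin> S \<longrightarrow> u s $ i = 0) \<and> (\<forall>s\<in>{0..\<delta>}. norm (u s) \<le> C * norm z0)"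
    using control_exists[OF generating \<delta>] by blast
  show thesis
  proof (rule that[OF C(1)])
    fix z0
    obtain z u where u: "continuous_on UNIV u" and z: "\<And>s. (z has_vector_derivative A *v z s + u s) (at s)"
      and z0: "z 0 = z0" "z \<delta> = 0" and uS: "\<And>s i. i \<notin> S \<Longrightarrow> u s $ i = 0"
      and uC: "\<And>s. s \<in> {0..\<delta>} \<Longrightarrow> norm (u s) \<le> C * norm z0" using C(2)[of z0] by blast
    define zt where "zt s = z (min s \<delta>)" for s
    define G where "G s = integral {0..min s \<delta>} u" for s
    have zc: "continuous_on UNIV z"
      using z by (meson continuous_at_imp_continuous_on has_vector_derivative_continuous)
    have ztc: "continuous_on T zt" for T
      unfolding zt_def[abs_def] by (rule continuous_on_compose2[OF zc]) (auto intro!: continuous_intros)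
    have ui: "u integrable_on {s..t}" for s t
      by (rule integrable_continuous_real[OF continuous_on_subset[OF u]]) simp
    have Azi: "(\<lambda>s. A *v zt s) integrable_on {s..t}" for s t
      by (rule integrable_continuous_real, rule continuous_on_compose2[OF linear_continuous_on[OF matrix_vector_mul_bounded_linear] ztc subset_UNIV])
    have z3: "zt t = 0" if "t \<ge> \<delta>" for t using that z0 by (simp add: zt_def min_absorb2)
    have eq1: "zt t = z0 + integral {0..t} (\<lambda>s. A *v zt s) + G t" if t: "0 \<le> t" "t \<le> \<delta>" for t
    proof -
      have "((\<lambda>s. A *v z s + u s) has_integral z t - z 0) {0..t}"
        by (rule fundamental_theorem_of_calculus[OF t(1)]) (rule has_vector_derivative_at_within[OF z])
      then have "((\<lambda>s. A *v zt s + u s) has_integral z t - z 0) {0..t}"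
        by (rule has_integral_eq[rotated]) (use t in \<open>simp add: zt_def\<close>)
      then have "integral {0..t} (\<lambda>s. A *v zt s + u s) = z t - z 0" by (rule integral_unique)
      then have "integral {0..t} (\<lambda>s. A *v zt s) + integral {0..t} u = z t - z 0"
        by (simp add: Henstock_Kurzweil_Integration.integral_add[OF Azi ui])
      then show ?thesis using t z0 by (simp add: zt_def G_def algebra_simps)
    qed
    have eq2: "zt t = z0 + integral {0..t} (\<lambda>s. A *v zt s) + G t" if t: "\<delta> \<le> t" for t
    proof -
      have "integral {0..\<delta>} (\<lambda>s. A *v zt s) + integral {\<delta>..t} (\<lambda>s. A *v zt s) = integral {0..t} (\<lambda>s. A *v zt s)"
        by (rule Henstock_Kurzweil_Integration.integral_combine[OF _ t Azi]) (use \<delta> in simp)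
      moreover have "integral {\<delta>..t} (\<lambda>s. A *v zt s) = integral {\<delta>..t} (\<lambda>s. 0)"
        by (rule Henstock_Kurzweil_Integration.integral_cong) (simp add: z3)
      ultimately have "integral {0..t} (\<lambda>s. A *v zt s) = integral {0..\<delta>} (\<lambda>s. A *v zt s)" by simp
      moreover have "zt t = zt \<delta>" "G t = G \<delta>" using t by (simp_all add: zt_def G_def min_def)
      ultimately show ?thesis using eq1[of \<delta>] \<delta> by simp
    qed
    have Gd: "G t - G s = integral {min s \<delta>..min t \<delta>} u" if "0 \<le> s" "s \<le> t" for s t
    proof -
      have "integral {0..min s \<delta>} u + integral {min s \<delta>..min t \<delta>} u = integral {0..min t \<delta>} u"
        by (rule Henstock_Kurzweil_Integration.integral_combine[OF _ _ ui]) (use that \<delta> in auto)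
      then show ?thesis unfolding G_def by (simp add: algebra_simps)
    qed
    have GS: "(G t - G s) $ i = 0" if "0 \<le> s" "s \<le> t" "i \<notin> S" for s t i
    proof -
      have "integral {min s \<delta>..min t \<delta>} u $ i = integral {min s \<delta>..min t \<delta>} (\<lambda>s. u s $ i)"
        by (rule integral_component_eq_cart[OF ui, symmetric])
      then show ?thesis unfolding Gd[OF that(1,2)] using uS[OF that(3)] by simp
    qed
    have GL: "norm (G t - G s) \<le> C * norm z0 * (t - s)" if st: "0 \<le> s" "s \<le> t" for s t
    proof -
      have "norm (integral {min s \<delta>..min t \<delta>} u) \<le> (C * norm z0) * (min t \<delta> - min s \<delta>)"
        by (rule integral_bound) (use st \<delta> in \<open>auto intro: continuous_on_subset[OF u] intro!: uC\<close>)
      also have "\<dots> \<le> (C * norm z0) * (t - s)" using st C(1) by (intro mult_left_mono) auto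
      finally show ?thesis unfolding Gd[OF st] .
    qed
    have G0: "G 0 = 0" using \<delta> by (simp add: G_def)
    show "\<exists>z G. continuous_on {0..} z \<and>
     (\<forall>t\<ge>0. z t = z0 + integral {0..t} (\<lambda>s. A *v z s) + G t) \<and> (\<forall>t\<ge>\<delta>. z t = 0) \<and> G 0 = 0 \<and>
     (\<forall>s t i. 0 \<le> s \<and> s \<le> t \<and> i \<notin> S \<longrightarrow> (G t - G s) $ i = 0) \<and>
     (\<forall>s t. 0 \<le> s \<and> s \<le> t \<longrightarrow> norm (G t - G s) \<le> C * norm z0 * (t - s))"
    proof (rule exI[of _ zt], rule exI[of _ G], intro conjI allI impI)
      fix t :: real assume "0 \<le> t"
      then show "zt t = z0 + integral {0..t} (\<lambda>s. A *v zt s) + G t"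
        by (cases "t \<le> \<delta>") (use eq1 eq2 in simp_all)
    qed (use ztc z3 G0 GS GL in blast)+
  qed
qed

lemma control_path_bound:
  assumes h: "h \<ge> 0" and c: "c \<ge> 0" and G: "\<And>s t. 0 \<le> s \<Longrightarrow> s \<le> t \<Longrightarrow> norm (G t - G s) \<le> c * (t - s)"
  shows "norm (lin.eul h G z0 n) \<le> (1 + h * onorm ((*v) A)) ^ n * (norm z0 + real n * h * c)"
proof (induction n)
  case (Suc n)
  let ?a = "onorm ((*v) A)" and ?z = "lin.eul h G z0 n"
  have q: "1 \<le> (1 + h * ?a) ^ Suc n" by (rule one_le_power) (use h lin.L_nonneg in simp)
  have G1: "norm (G (real (Suc n) * h) - G (real n * h)) \<le> h * c"
    using G[of "real n * h" "real (Suc n) * h"] h by (simp add: algebra_simps)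
  have "norm (lin.eul h G z0 (Suc n)) \<le> norm (?z + h *\<^sub>R (A *v ?z)) + norm (G (real (Suc n) * h) - G (real n * h))"
    by (simp only: lin.eul.simps norm_triangle_ineq)
  also have "norm (?z + h *\<^sub>R (A *v ?z)) \<le> norm ?z + h * norm (A *v ?z)"
    using norm_triangle_ineq[of ?z "h *\<^sub>R (A *v ?z)"] h by simp
  also have "h * norm (A *v ?z) \<le> h * (?a * norm ?z)"
    by (intro mult_left_mono h onorm[OF matrix_vector_mul_bounded_linear])
  also have "norm ?z + h * (?a * norm ?z) = (1 + h * ?a) * norm ?z" by (simp add: algebra_simps)
  also have "\<dots> \<le> (1 + h * ?a) * ((1 + h * ?a) ^ n * (norm z0 + real n * h * c))"
    using Suc h lin.L_nonneg by (intro mult_left_mono) simp_all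
  also have "\<dots> = (1 + h * ?a) ^ Suc n * (norm z0 + real n * h * c)" by simp
  also have "norm (G (real (Suc n) * h) - G (real n * h)) \<le> (1 + h * ?a) ^ Suc n * (h * c)"
    using mult_right_mono[OF q, of "h * c"] G1 h c by simp
  finally have "norm (lin.eul h G z0 (Suc n)) \<le> (1 + h * ?a) ^ Suc n * (norm z0 + real n * h * c) + (1 + h * ?a) ^ Suc n * (h * c)" by simp
  also have "\<dots> = (1 + h * ?a) ^ Suc n * (norm z0 + real (Suc n) * h * c)" by (simp add: algebra_simps)
  finally show ?case .
qed simp

text \<open>The displacements are Euler approximations of the controlled linear path. Their
  recursion uses \<open>A\<close> in place of the drift; the discrepancy lies in the directions of
  \<open>S\<close> and is matched exactly by a shift of the noise, with a total cost independent of
  the step size.\<close>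

lemma harnack:
  assumes \<delta>: "0 < \<delta>"
  obtains C where "C \<ge> 0" "\<And>t x z0 g K. \<lbrakk>\<delta> \<le> t; t \<le> T; continuous_on UNIV g; \<And>y. \<bar>g y\<bar> \<le> K\<rbrakk> \<Longrightarrow>
     (Pt t g (x + z0))\<^sup>2 \<le> Pt t (\<lambda>y. (g y)\<^sup>2) x * exp (C * (norm z0)\<^sup>2)"
proof -
  let ?a = "onorm ((*v) A)"
  have a0: "?a \<ge> 0" by (rule lin.L_nonneg)
  obtain Cu where Cu: "Cu \<ge> 0" "\<And>z0. \<exists>z G. continuous_on {0..} z \<and>
     (\<forall>t\<ge>0. z t = z0 + integral {0..t} (\<lambda>s. A *v z s) + G t) \<and> (\<forall>t\<ge>\<delta>. z t = 0) \<and> G 0 = 0 \<and>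
     (\<forall>s t i. 0 \<le> s \<and> s \<le> t \<and> i \<notin> S \<longrightarrow> (G t - G s) $ i = 0) \<and>
     (\<forall>s t. 0 \<le> s \<and> s \<le> t \<longrightarrow> norm (G t - G s) \<le> Cu * norm z0 * (t - s))"
    using control_path[OF \<delta>] by blast
  \<comment> \<open>\<open>D * norm z0\<close> bounds all discrete displacements up to time
    \<open>T\<close>. In \<open>c\<close>, the term with \<open>L + ?a\<close> pays for the
    nonlinearity along these displacements and \<open>Cu\<close> for the control itself.\<close>
  define D where "D = exp (?a * T) * (1 + T * Cu)"
  define c where "c = CR * ((L + ?a) * D + Cu)"
  have main: "(Pt t g (x + z0))\<^sup>2 \<le> Pt t (\<lambda>y. (g y)\<^sup>2) x * exp (\<bar>T\<bar> * c\<^sup>2 * (norm z0)\<^sup>2)"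
    if t: "\<delta> \<le> t" "t \<le> T" and gc: "continuous_on UNIV g" and K: "\<And>y. \<bar>g y\<bar> \<le> K" for t x z0 K and g :: "real^'n \<Rightarrow> real"
  proof -
    have T0: "T > 0" and t0: "t > 0" using t \<delta> by linarith+
    have D0: "D \<ge> 0" unfolding D_def using T0 Cu(1) by simp
    have gm: "g \<in> borel_measurable borel" by (rule borel_measurable_continuous_onI[OF gc])
    obtain z G where zc: "continuous_on {0..} z" and ze: "\<And>t. t \<ge> 0 \<Longrightarrow> z t = z0 + integral {0..t} (\<lambda>s. A *v z s) + G t"
      and z\<delta>: "\<And>t. t \<ge> \<delta> \<Longrightarrow> z t = 0" and G0: "G 0 = 0"
      and GS: "\<And>s t i. 0 \<le> s \<Longrightarrow> s \<le> t \<Longrightarrow> i \<notin> S \<Longrightarrow> (G t - G s) $ i = 0"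
      and GL: "\<And>s t. 0 \<le> s \<Longrightarrow> s \<le> t \<Longrightarrow> norm (G t - G s) \<le> Cu * norm z0 * (t - s)"
      using Cu(2)[of z0] by blast
    define h where "h N = t / real (Suc N)" for N
    have h: "\<And>N. h N > 0" "h \<longlonglongrightarrow> 0"
    proof -
      show "h N > 0" for N using t0 by (simp add: h_def)
      have "(\<lambda>N. t * inverse (real (Suc N))) \<longlonglongrightarrow> t * 0" by (intro tendsto_mult tendsto_const LIMSEQ_inverse_real_of_nat)
      then show "h \<longlonglongrightarrow> 0" by (simp add: h_def[abs_def] divide_inverse)
    qed
    have nh: "real (Suc N) * h N = t" for N by (simp add: h_def)
    define zN where "zN N = lin.eul (h N) G z0" for N
    have zN_lim: "(\<lambda>N. zN N (Suc N)) \<longlonglongrightarrow> 0"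
      using lin.eul_convergence[OF zc ze G0 h, of "\<lambda>N. Suc N" t] z\<delta>[OF t(1)] unfolding nh zN_def by simp
    have zb: "norm (zN N j) \<le> D * norm z0" if "j \<le> Suc N" for N j
    proof -
      have hN: "h N \<ge> 0" using h(1)[of N] by simp
      have jt: "real j * h N \<le> T"
      proof -
        have "real j * h N \<le> real (Suc N) * h N" using that hN by (intro mult_right_mono) auto
        then show ?thesis unfolding nh using t by linarith
      qed
      have "norm (zN N j) \<le> (1 + h N * ?a) ^ j * (norm z0 + real j * h N * (Cu * norm z0))"
        unfolding zN_def by (rule control_path_bound[OF hN _ GL]) (use Cu(1) in simp_all)
      also have "\<dots> \<le> exp (?a * T) * (norm z0 + T * (Cu * norm z0))"
      proof (rule mult_mono)
        show "(1 + h N * ?a) ^ j \<le> exp (?a * T)"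
          by (rule order_trans[OF lin.power_le_exp[OF hN]]) (use jt a0 in \<open>simp add: mult_left_mono\<close>)
        show "norm z0 + real j * h N * (Cu * norm z0) \<le> norm z0 + T * (Cu * norm z0)"
          using jt Cu(1) by (intro add_left_mono mult_right_mono) simp_all
        show "0 \<le> norm z0 + real j * h N * (Cu * norm z0)" using hN Cu(1) by simp
      qed simp
      also have "\<dots> = D * norm z0" by (simp add: D_def algebra_simps)
      finally show ?thesis .
    qed
    have ctl: "\<exists>\<beta>. zN N j + h N *\<^sub>R (b (y + zN N j) - b y) = zN N (Suc j) + h N *\<^sub>R (R *v \<beta>) \<and> norm \<beta> \<le> c * norm z0"
      if j: "j < Suc N" for N j y
    proof -
      let ?z = "zN N j"
      let ?dG = "G (real (Suc j) * h N) - G (real j * h N)"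
      \<comment> \<open>What the noise must supply per unit time: the nonlinear part of the drift
        increment minus the mean rate of \<open>G\<close> over the step.\<close>
      define v where "v = (b (y + ?z) - b y - A *v ?z) - (1 / h N) *\<^sub>R ?dG"
      have ord: "0 \<le> real j * h N" "real j * h N \<le> real (Suc j) * h N" using h(1)[of N] by (simp_all add: algebra_simps)
      have vS: "v $ i = 0" if "i \<notin> S" for i
        using nonlinearity[OF that, of y ?z] GS[OF ord that] by (simp add: v_def)
      have "norm v \<le> (L + ?a) * (D * norm z0) + Cu * norm z0"
      proof -
        have "norm (b (y + ?z) - b y) \<le> L * norm ?z" using lipD[of "y + ?z" y] by simp
        moreover have "norm (A *v ?z) \<le> ?a * norm ?z" by (rule onorm[OF matrix_vector_mul_bounded_linear])
        ultimately have "norm (b (y + ?z) - b y - A *v ?z) \<le> (L + ?a) * norm ?z"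
          using norm_triangle_ineq4[of "b (y + ?z) - b y" "A *v ?z"] by (simp add: distrib_right)
        also have "\<dots> \<le> (L + ?a) * (D * norm z0)" using zb[of j N] j L_nonneg a0 by (intro mult_left_mono) simp_all
        finally have 1: "norm (b (y + ?z) - b y - A *v ?z) \<le> (L + ?a) * (D * norm z0)" .
        have "norm ((1 / h N) *\<^sub>R ?dG) = (1 / h N) * norm ?dG" using h(1)[of N] by simp
        also have "\<dots> \<le> (1 / h N) * (Cu * norm z0 * (real (Suc j) * h N - real j * h N))"
          using GL[OF ord] h(1)[of N] by (intro mult_left_mono) simp_all
        also have "\<dots> = Cu * norm z0" using h(1)[of N] by (simp add: field_simps)
        finally have 2: "norm ((1 / h N) *\<^sub>R ?dG) \<le> Cu * norm z0" .
        show ?thesis unfolding v_def using norm_triangle_ineq4[of "b (y + ?z) - b y - A *v ?z" "(1 / h N) *\<^sub>R ?dG"] 1 2 by linarith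
      qed
      then have vn: "CR * norm v \<le> c * norm z0"
        using mult_left_mono[OF _ CR_nonneg] by (fastforce simp: c_def algebra_simps)
      obtain \<beta> where \<beta>: "R *v \<beta> = v" "norm \<beta> \<le> CR * norm v" using range_R[of v] vS by blast
      have "h N *\<^sub>R v = h N *\<^sub>R (b (y + ?z) - b y) - h N *\<^sub>R (A *v ?z) - ?dG"
        unfolding v_def using h(1)[of N] by (simp add: scaleR_right_diff_distrib)
      moreover have "zN N (Suc j) = ?z + h N *\<^sub>R (A *v ?z) + ?dG" by (simp add: zN_def)
      ultimately have "?z + h N *\<^sub>R (b (y + ?z) - b y) = zN N (Suc j) + h N *\<^sub>R (R *v \<beta>)"
        unfolding \<beta>(1) by simp
      then show ?thesis using \<beta>(2) vn by (intro exI[of _ \<beta>]) simp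
    qed
    have z0: "zN N 0 = z0" for N by (simp add: zN_def)
    have step: "((euler (h N) ^^ Suc N) g (x + z0))\<^sup>2 \<le> (euler (h N) ^^ Suc N) (\<lambda>y. (g (y + zN N (Suc N)))\<^sup>2) x * exp (t * (c * norm z0)\<^sup>2)" for N
      using harnack_euler[OF h(1)[of N] gm K, of "Suc N" "zN N" "c * norm z0" x] ctl[of _ N] unfolding nh z0 by blast
    have lim1: "(\<lambda>N. (euler (h N) ^^ Suc N) g (x + z0)) \<longlonglongrightarrow> Pt t g (x + z0)"
      by (rule euler_iterate_convergence[OF gc K h]) (simp only: nh tendsto_const)
    \<comment> \<open>The discrete displacement at the final time tends to 0 but need not equal 0,
      hence the functions moving with \<open>N\<close>.\<close>
    have lim2: "(\<lambda>N. (euler (h N) ^^ Suc N) (\<lambda>y. (g (y + zN N (Suc N)))\<^sup>2) x) \<longlonglongrightarrow> Pt t (\<lambda>y. (g y)\<^sup>2) x"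
    proof (rule euler_iterate_convergence_gen[where K="K\<^sup>2" and gN="\<lambda>N y. (g (y + zN N (Suc N)))\<^sup>2" and k="\<lambda>N. Suc N", OF _ _ _ _ h])
      show "(\<lambda>y. (g y)\<^sup>2) \<in> borel_measurable borel" "(\<lambda>y. (g (y + zN N (Suc N)))\<^sup>2) \<in> borel_measurable borel" for N
        using gm by measurable
      show "\<bar>(g (y + zN N (Suc N)))\<^sup>2\<bar> \<le> K\<^sup>2" for N y using power_mono[OF K, of "y + zN N (Suc N)" 2] by simp
      show "(\<lambda>N. (g (yN N + zN N (Suc N)))\<^sup>2) \<longlonglongrightarrow> (g y)\<^sup>2" if "yN \<longlonglongrightarrow> y" for yN y
      proof -
        have "(\<lambda>N. yN N + zN N (Suc N)) \<longlonglongrightarrow> y" using tendsto_add[OF that zN_lim] by simp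
        then have "(\<lambda>N. g (yN N + zN N (Suc N))) \<longlonglongrightarrow> g y"
          by (rule continuous_on_tendsto_compose[OF gc]) auto
        then show ?thesis by (rule tendsto_power)
      qed
    qed (simp only: nh tendsto_const)
    have "(Pt t g (x + z0))\<^sup>2 \<le> Pt t (\<lambda>y. (g y)\<^sup>2) x * exp (t * (c * norm z0)\<^sup>2)"
      by (rule LIMSEQ_le[OF tendsto_power[OF lim1] tendsto_mult[OF lim2 tendsto_const]]) (use step in blast)
    also have "\<dots> \<le> Pt t (\<lambda>y. (g y)\<^sup>2) x * exp (\<bar>T\<bar> * c\<^sup>2 * (norm z0)\<^sup>2)"
    proof (rule mult_left_mono)
      have "t * (c * norm z0)\<^sup>2 \<le> \<bar>T\<bar> * (c * norm z0)\<^sup>2" using t by (intro mult_right_mono) auto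
      then show "exp (t * (c * norm z0)\<^sup>2) \<le> exp (\<bar>T\<bar> * c\<^sup>2 * (norm z0)\<^sup>2)" by (simp add: power_mult_distrib mult.assoc)
      show "0 \<le> Pt t (\<lambda>y. (g y)\<^sup>2) x" by (simp add: transition_semigroup_def)
    qed
    finally show ?thesis .
  qed
  show thesis
  \<comment> \<open>The absolute value keeps the constant nonnegative when \<open>T\<close> is
    negative and the estimate is vacuous.\<close>
  proof (rule that[of "\<bar>T\<bar> * c\<^sup>2"])
    show "0 \<le> \<bar>T\<bar> * c\<^sup>2" by simp
  qed (rule main)
qed

text \<open>For \<open>|f| \<le> 1\<close> and \<open>r = norm z\<close>, with \<open>u\<close> and
  \<open>v\<close> the values of \<open>P_t f\<close> at \<open>x + z\<close> and \<open>x\<close>,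
  the Harnack inequality for \<open>1 + r f\<close> gives
  \<open>(1 + r u)^2 \<le> (1 + 2 r v + r^2) exp (C r^2)\<close>. All terms but \<open>2 r u\<close>
  and \<open>2 r v\<close> are of order \<open>r^2\<close>, and division by \<open>2 r\<close>
  leaves \<open>u - v\<close> of order \<open>r\<close>. Exchanging the two points gives the other
  sign.\<close>

lemma smoothing:
  assumes \<delta>: "0 < \<delta>"
  obtains C where "C \<ge> 0" "\<And>t x z f K. \<lbrakk>\<delta> \<le> t; t \<le> T; continuous_on UNIV f; \<And>y. \<bar>f y\<bar> \<le> K; norm z \<le> 1\<rbrakk> \<Longrightarrow>
     Pt t f (x + z) - Pt t f x \<le> C * K * norm z"
proof -
  obtain C where C: "C \<ge> 0" "\<And>t x z0 g K. \<lbrakk>\<delta> \<le> t; t \<le> T; continuous_on UNIV g; \<And>y. \<bar>g y\<bar> \<le> K\<rbrakk> \<Longrightarrow>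
     (Pt t g (x + z0))\<^sup>2 \<le> Pt t (\<lambda>y. (g y)\<^sup>2) x * exp (C * (norm z0)\<^sup>2)"
    using harnack[OF \<delta>] by blast
  define E where "E = exp C"
  have E1: "E \<ge> 1" using C(1) by (simp add: E_def)
  have main: "Pt t f (x + z) - Pt t f x \<le> (E + 3 * (C * E)) / 2 * norm z"
    if t: "\<delta> \<le> t" "t \<le> T" and fc: "continuous_on UNIV f" and f1: "\<And>y. \<bar>f y\<bar> \<le> 1" and z: "norm z \<le> 1"
    for t x z and f :: "real^'n \<Rightarrow> real"
  proof (cases "z = 0")
    case False
    define r where "r = norm z"
    have r: "0 < r" "r \<le> 1" using False z by (simp_all add: r_def)
    have t0: "t \<ge> 0" using t \<delta> by linarith
    have fm: "f \<in> borel_measurable borel" by (rule borel_measurable_continuous_onI[OF fc])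
    let ?g = "\<lambda>y. 1 + r * f y"
    let ?u = "Pt t f (x + z)" and ?v = "Pt t f x"
    note fi = Pt_bound(2)[OF t0 fm f1]
    have fi2: "integrable M (\<lambda>\<omega>. (f (X x t \<omega>))\<^sup>2)"
      by (rule Pt_bound(2)[OF t0, where K=1]) (use fm f1 power_mono[OF f1, of _ 2] in auto)
    have v1: "\<bar>?v\<bar> \<le> 1" by (rule Pt_bound(1)[OF t0 fm f1])
    have Pg: "Pt t ?g (x + z) = 1 + r * ?u"
      unfolding transition_semigroup_def using fi by (simp add: prob_space)
    have Pg2: "Pt t (\<lambda>y. (?g y)\<^sup>2) x \<le> 1 + 2 * r * ?v + r\<^sup>2"
    proof -
      have "Pt t (\<lambda>y. (?g y)\<^sup>2) x = expectation (\<lambda>\<omega>. 1 + 2 * r * f (X x t \<omega>) + r\<^sup>2 * (f (X x t \<omega>))\<^sup>2)"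
        unfolding transition_semigroup_def by (simp add: power2_eq_square algebra_simps)
      also have "\<dots> = 1 + 2 * r * ?v + r\<^sup>2 * expectation (\<lambda>\<omega>. (f (X x t \<omega>))\<^sup>2)"
        unfolding transition_semigroup_def using fi fi2 by (simp add: prob_space)
      also have "expectation (\<lambda>\<omega>. (f (X x t \<omega>))\<^sup>2) \<le> expectation (\<lambda>\<omega>. 1)"
        using fi2 power_mono[OF f1, of _ 2] by (intro integral_mono) auto
      finally show ?thesis by (simp add: prob_space mult_left_mono)
    qed
    have gb: "\<bar>?g y\<bar> \<le> 2" for y
    proof -
      have "r * \<bar>f y\<bar> \<le> 1 * 1" using r f1 by (intro mult_mono) auto
      then have "\<bar>r * f y\<bar> \<le> 1" using r by (simp add: abs_mult)
      then show ?thesis by linarith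
    qed
    have gc: "continuous_on UNIV ?g" by (intro continuous_intros fc)
    define e where "e = exp (C * r\<^sup>2)"
    have H: "(1 + r * ?u)\<^sup>2 \<le> (1 + 2 * r * ?v + r\<^sup>2) * e"
    proof -
      have "(Pt t ?g (x + z))\<^sup>2 \<le> (1 + 2 * r * ?v + r\<^sup>2) * exp (C * (norm z)\<^sup>2)"
        by (rule order_trans[OF C(2)[OF t gc gb] mult_right_mono[OF Pg2]]) simp
      then show ?thesis unfolding Pg unfolding e_def by (simp only: r_def)
    qed
    have e1: "1 \<le> e" using C(1) by (simp add: e_def)
    have Cr: "C * r\<^sup>2 \<le> C" using r C(1) by (simp add: mult_left_le power_le_one)
    have eE: "e \<le> E" using Cr by (simp add: e_def E_def)
    \<comment> \<open>From \<open>1 - a \<le> exp (- a)\<close> multiplied by \<open>exp a\<close>,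
      with \<open>a = C r^2\<close>.\<close>
    have e2: "e - 1 \<le> C * r\<^sup>2 * E"
    proof -
      have "1 - C * r\<^sup>2 \<le> exp (- (C * r\<^sup>2))" using exp_ge_add_one_self[of "- (C * r\<^sup>2)"] by simp
      then have "(1 - C * r\<^sup>2) * e \<le> exp (- (C * r\<^sup>2)) * e" using e1 by (intro mult_right_mono) auto
      also have "\<dots> = 1" by (simp add: e_def exp_minus)
      finally have "e - 1 \<le> C * r\<^sup>2 * e" by (simp add: algebra_simps)
      also have "\<dots> \<le> C * r\<^sup>2 * E" using eE C(1) by (intro mult_left_mono) auto
      finally show ?thesis .
    qed
    have "(1 + r * ?u)\<^sup>2 = 1 + 2 * r * ?u + (r * ?u)\<^sup>2" by (simp add: power2_sum)
    then have "1 + 2 * r * ?u \<le> (1 + r * ?u)\<^sup>2" by (simp only: le_add_same_cancel1 zero_le_power2)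
    also note H
    also have "(1 + 2 * r * ?v + r\<^sup>2) * e = 1 + 2 * r * ?v + r\<^sup>2 * e + (1 + 2 * r * ?v) * (e - 1)"
      by (simp add: algebra_simps)
    also have "(1 + 2 * r * ?v) * (e - 1) \<le> 3 * (C * r\<^sup>2 * E)"
    proof -
      have "r * ?v \<le> r * 1" using r v1 by (intro mult_left_mono) auto
      then have "1 + 2 * (r * ?v) \<le> 3" unfolding mult_1_right using r(2) by linarith
      then have "1 + 2 * r * ?v \<le> 3" by (simp only: mult.assoc)
      then have "(1 + 2 * r * ?v) * (e - 1) \<le> 3 * (e - 1)" using e1 by (intro mult_right_mono) auto
      also have "3 * (e - 1) \<le> 3 * (C * r\<^sup>2 * E)" by (rule mult_left_mono[OF e2]) simp
      finally show ?thesis .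
    qed
    also have "r\<^sup>2 * e \<le> r\<^sup>2 * E" using eE by (intro mult_left_mono) auto
    finally have "1 + 2 * r * ?u \<le> 1 + 2 * r * ?v + r\<^sup>2 * E + 3 * (C * r\<^sup>2 * E)" by simp
    then have "r * (2 * (?u - ?v)) \<le> r * ((E + 3 * (C * E)) * r)" by (simp add: power2_eq_square algebra_simps)
    then have "2 * (?u - ?v) \<le> (E + 3 * (C * E)) * r" using r(1) by (simp only: mult_le_cancel_left_pos)
    then show ?thesis by (simp add: r_def)
  qed simp
  \<comment> \<open>The estimate is homogeneous in \<open>f\<close>, so a bound \<open>K > 0\<close>
    is normalised to 1.\<close>
  have "Pt t f (x + z) - Pt t f x \<le> ((E + 3 * (C * E)) / 2) * K * norm z"
    if t: "\<delta> \<le> t" "t \<le> T" and fc: "continuous_on UNIV f" and fK: "\<And>y. \<bar>f y\<bar> \<le> K" and z: "norm z \<le> 1"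
    for t x z K and f :: "real^'n \<Rightarrow> real"
  proof (cases "K = 0")
    case True
    then have "f = (\<lambda>_. 0)" using fK by auto
    then show ?thesis using True by (simp add: transition_semigroup_def)
  next
    case False
    then have K: "K > 0" using fK[of 0] by linarith
    let ?f = "\<lambda>y. f y / K"
    have "continuous_on UNIV ?f" using K by (intro continuous_intros fc) auto
    moreover have "\<bar>?f y\<bar> \<le> 1" for y using fK K by simp
    ultimately have "Pt t ?f (x + z) - Pt t ?f x \<le> (E + 3 * (C * E)) / 2 * norm z" by (rule main[OF t _ _ z])
    moreover have "Pt t ?f y = Pt t f y / K" for y by (simp add: transition_semigroup_def)
    ultimately show ?thesis using K by (simp add: field_simps)
  qed
  then show thesis using that[of "(E + 3 * (C * E)) / 2"] E1 C(1) by simp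
qed

end

section \<open>Mollifiers and the maximum principle\<close>

text \<open>A class closed under differentiation: in the variable \<open>u = 1/s\<close> the
  derivative replaces \<open>p\<close> by \<open>u^2 (p - p')\<close>. The choice
  \<open>p = 1\<close> is the usual bump profile.\<close>

definition ebump :: "real poly \<Rightarrow> real \<Rightarrow> real" where
  "ebump p s = (if s > 0 then poly p (1 / s) * exp (- (1 / s)) else 0)"

lemma poly_div_exp_tendsto: "((\<lambda>u. poly p u * exp (- u)) \<longlongrightarrow> (0::real)) at_top"
proof -
  have "((\<lambda>u. \<Sum>i\<le>degree p. coeff p i * (u ^ i / exp u)) \<longlongrightarrow> (\<Sum>i\<le>degree p. coeff p i * 0)) at_top"
    by (intro tendsto_sum tendsto_mult tendsto_const tendsto_power_div_exp_0)
  moreover have "poly p u * exp (- u) = (\<Sum>i\<le>degree p. coeff p i * (u ^ i / exp u))" for u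
    by (simp add: poly_altdef sum_distrib_right exp_minus field_simps sum_divide_distrib)
  ultimately show ?thesis by simp
qed

lemma ebump_tendsto_0: "((ebump p) \<longlongrightarrow> 0) (at_right 0)"
proof -
  have "filterlim (\<lambda>s::real. 1 / s) at_top (at_right 0)"
    using filterlim_inverse_at_top_right by (simp add: inverse_eq_divide)
  from filterlim_compose[OF poly_div_exp_tendsto this]
  have "((\<lambda>s. poly p (1 / s) * exp (- (1 / s))) \<longlongrightarrow> 0) (at_right 0)" .
  moreover have "\<forall>\<^sub>F s in at_right 0. poly p (1 / s) * exp (- (1 / s)) = ebump p s"
    unfolding eventually_at_right_field by (intro exI[of _ 1]) (simp add: ebump_def)
  ultimately show ?thesis by (rule Lim_transform_eventually)
qed

lemma ebump_derivative: "(ebump p has_real_derivative ebump ([:0, 0, 1:] * (p - pderiv p)) s) (at s)"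
proof -
  consider "s > 0" | "s < 0" | "s = 0" by linarith
  then show ?thesis
  proof cases
    case 1
    have "((\<lambda>s. poly p (1 / s) * exp (- (1 / s))) has_real_derivative
      (poly (pderiv p) (1 / s) * (- 1 / s\<^sup>2)) * exp (- (1 / s)) + poly p (1 / s) * (exp (- (1 / s)) * (1 / s\<^sup>2))) (at s)"
      using 1 by (auto intro!: derivative_eq_intros DERIV_chain2[OF poly_DERIV] simp: power2_eq_square field_simps)
    moreover have "(poly (pderiv p) (1 / s) * (- 1 / s\<^sup>2)) * exp (- (1 / s)) + poly p (1 / s) * (exp (- (1 / s)) * (1 / s\<^sup>2)) =
      ebump ([:0, 0, 1:] * (p - pderiv p)) s"
      using 1 by (simp add: ebump_def power2_eq_square field_simps)
    ultimately have "((\<lambda>s. poly p (1 / s) * exp (- (1 / s))) has_real_derivative ebump ([:0, 0, 1:] * (p - pderiv p)) s) (at s)"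
      by simp
    moreover have "\<forall>\<^sub>F x in nhds s. poly p (1 / x) * exp (- (1 / x)) = ebump p x"
      using eventually_nhds_in_open[of "{0<..}" s] 1 by (auto simp: ebump_def elim: eventually_mono)
    ultimately show ?thesis by (subst (asm) DERIV_cong_ev) auto
  next
    case 2
    have "((\<lambda>s. 0) has_real_derivative 0) (at s)" by simp
    moreover have "\<forall>\<^sub>F x in nhds s. 0 = ebump p x"
      using eventually_nhds_in_open[of "{..<0}" s] 2 by (auto simp: ebump_def elim: eventually_mono)
    ultimately have "(ebump p has_real_derivative 0) (at s)" by (subst (asm) DERIV_cong_ev) auto
    then show ?thesis using 2 by (simp add: ebump_def)
  next
    case 3
    \<comment> \<open>Division by \<open>h\<close> multiplies the polynomial by \<open>1/h\<close>,
      which stays in the class, so the difference quotient tends to 0.\<close>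
    have r: "((\<lambda>h. (ebump p (0 + h) - ebump p 0) / h) \<longlongrightarrow> 0) (at_right 0)"
    proof (rule Lim_transform_eventually[OF ebump_tendsto_0])
      show "\<forall>\<^sub>F h in at_right 0. ebump ([:0, 1:] * p) h = (ebump p (0 + h) - ebump p 0) / h"
        unfolding eventually_at_right_field by (intro exI[of _ 1]) (simp add: ebump_def)
    qed
    have l: "((\<lambda>h. (ebump p (0 + h) - ebump p 0) / h) \<longlongrightarrow> 0) (at_left 0)"
    proof (rule Lim_transform_eventually[OF tendsto_const])
      show "\<forall>\<^sub>F h in at_left 0. 0 = (ebump p (0 + h) - ebump p 0) / h"
        unfolding eventually_at_left_field by (intro exI[of _ "-1"]) (simp add: ebump_def)
    qed
    have "(ebump p has_real_derivative 0) (at 0)"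
      unfolding DERIV_def using filterlim_split_at[OF l r] by simp
    then show ?thesis using 3 by (simp add: ebump_def)
  qed
qed

text \<open>The algebra generated by constants, coordinates and bump profiles. It is closed under
  partial derivatives, so \<open>C_k\<close> for all \<open>k\<close> follows by one induction on
  \<open>k\<close>.\<close>

inductive bump_algebra :: "real \<Rightarrow> (real^'n \<Rightarrow> real) \<Rightarrow> bool" for r where
  const: "bump_algebra r (\<lambda>x. a)"
| coord: "bump_algebra r (\<lambda>x. x $ i)"
| bump: "bump_algebra r (\<lambda>x. ebump p (r\<^sup>2 - x \<bullet> x))"
| add: "bump_algebra r f \<Longrightarrow> bump_algebra r g \<Longrightarrow> bump_algebra r (\<lambda>x. f x + g x)"
| mult: "bump_algebra r f \<Longrightarrow> bump_algebra r g \<Longrightarrow> bump_algebra r (\<lambda>x. f x * g x)"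

lemma bump_partial:
  "has_partial i (\<lambda>x::real^'n. ebump p (r\<^sup>2 - x \<bullet> x))"
  "partial i (\<lambda>x::real^'n. ebump p (r\<^sup>2 - x \<bullet> x)) = (\<lambda>x. - 2 * x$i * ebump ([:0, 0, 1:] * (p - pderiv p)) (r\<^sup>2 - x \<bullet> x))"
proof -
  have d: "((\<lambda>h. ebump p (r\<^sup>2 - (x + h *\<^sub>R axis i 1) \<bullet> (x + h *\<^sub>R axis i 1))) has_real_derivative
    - 2 * x$i * ebump ([:0, 0, 1:] * (p - pderiv p)) (r\<^sup>2 - x \<bullet> x)) (at 0)" for x :: "real^'n"
  proof -
    have e: "(x + h *\<^sub>R axis i 1) \<bullet> (x + h *\<^sub>R axis i 1) = x \<bullet> x + 2 * h * x$i + h * h" for h :: real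
      by (simp add: inner_add_left inner_add_right inner_axis inner_axis' algebra_simps)
    have "((\<lambda>h. r\<^sup>2 - (x \<bullet> x + 2 * h * x$i + h * h)) has_real_derivative - 2 * x$i) (at 0)"
      by (auto intro!: derivative_eq_intros)
    moreover have "(ebump p has_real_derivative ebump ([:0, 0, 1:] * (p - pderiv p)) (r\<^sup>2 - (x \<bullet> x + 2 * 0 * x$i + 0 * 0)))
      (at (r\<^sup>2 - (x \<bullet> x + 2 * 0 * x$i + 0 * 0)))" by (rule ebump_derivative)
    ultimately show ?thesis unfolding e using DERIV_chain2[of "ebump p" _ "\<lambda>h. r\<^sup>2 - (x \<bullet> x + 2 * h * x$i + h * h)" 0]
      by (fastforce simp: mult.commute)
  qed
  from has_partialI[OF d] show "has_partial i (\<lambda>x::real^'n. ebump p (r\<^sup>2 - x \<bullet> x))"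
    "partial i (\<lambda>x::real^'n. ebump p (r\<^sup>2 - x \<bullet> x)) = (\<lambda>x. - 2 * x$i * ebump ([:0, 0, 1:] * (p - pderiv p)) (r\<^sup>2 - x \<bullet> x))" .
qed

lemma coord_partial:
  "has_partial i (\<lambda>x::real^'n. x $ j)" "partial i (\<lambda>x::real^'n. x $ j) = (\<lambda>x. if i = j then 1 else 0)"
proof -
  have d: "((\<lambda>h. (x + h *\<^sub>R axis i 1) $ j) has_real_derivative (if i = j then 1 else 0)) (at 0)" for x :: "real^'n"
    by (auto intro!: derivative_eq_intros simp: axis_def)
  from has_partialI[OF d] show "has_partial i (\<lambda>x::real^'n. x $ j)"
    "partial i (\<lambda>x::real^'n. x $ j) = (\<lambda>x. if i = j then 1 else 0)" .
qed

lemma bump_algebra_smooth: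
  fixes f :: "real^'n \<Rightarrow> real"
  assumes "bump_algebra r f"
  shows "continuous_on UNIV f \<and> (\<forall>i. has_partial i f \<and> bump_algebra r (partial i f))"
  using assms
proof induction
  case (const a)
  then show ?case by (simp add: partial_const bump_algebra.const)
next
  case (coord j)
  show ?case unfolding coord_partial(2) by (auto simp: coord_partial(1) bump_algebra.const intro!: continuous_intros)
next
  case (bump p)
  have "continuous_on UNIV (ebump p)"
    using ebump_derivative by (meson DERIV_isCont continuous_at_imp_continuous_on)
  then have "continuous_on UNIV (\<lambda>x::real^'n. ebump p (r\<^sup>2 - x \<bullet> x))"
    by (rule continuous_on_compose2) (auto intro!: continuous_intros)
  moreover have "bump_algebra r (\<lambda>x::real^'n. - 2 * x$i * ebump ([:0, 0, 1:] * (p - pderiv p)) (r\<^sup>2 - x \<bullet> x))" for i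
    by (rule bump_algebra.mult[OF bump_algebra.mult[OF bump_algebra.const bump_algebra.coord] bump_algebra.bump])
  ultimately show ?case unfolding bump_partial(2) by (simp only: bump_partial(1) simp_thms)
next
  case (add f g)
  then have c: "continuous_on UNIV (\<lambda>x. f x + g x)" by (intro continuous_on_add) auto
  have "has_partial i (\<lambda>x. f x + g x)" "bump_algebra r (partial i (\<lambda>x. f x + g x))" for i
    using add.IH partial_add[of i f g] bump_algebra.add[of r "partial i f" "partial i g"] by simp_all
  then show ?case using c by simp
next
  case (mult f g)
  then have c: "continuous_on UNIV (\<lambda>x. f x * g x)" by (intro continuous_on_mult) auto
  have 1: "has_partial i f" "has_partial i g" "bump_algebra r (partial i f)" "bump_algebra r (partial i g)" for i
    using mult.IH by simp_all
  have "has_partial i (\<lambda>x. f x * g x)" "bump_algebra r (partial i (\<lambda>x. f x * g x))" for i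
    unfolding partial_mult(2)[OF 1(1,2)]
    by (rule partial_mult(1)[OF 1(1,2)])
       (rule bump_algebra.add[OF bump_algebra.mult[OF 1(3) mult.hyps(2)] bump_algebra.mult[OF mult.hyps(1) 1(4)]])
  then show ?case using c by simp
qed

lemma bump_algebra_C_k: "bump_algebra r f \<Longrightarrow> C_k k f"
proof (induction k arbitrary: f)
  case 0
  then show ?case using bump_algebra_smooth[OF 0] by simp
next
  case (Suc k)
  have s: "continuous_on UNIV f" "\<And>i. has_partial i f" "\<And>i. bump_algebra r (partial i f)"
    using bump_algebra_smooth[OF Suc.prems] by blast+
  then show ?case using Suc.IH[OF s(3)] by simp
qed

text \<open>The bump depends on \<open>x \<bullet> x\<close> only and does not increase with it, so
  its gradient is a nonpositive multiple of \<open>x\<close>. The factor \<gamma> records this sign,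
  on which the commutator estimate rests.\<close>

lemma mollifier_exists:
  assumes r: "r > 0"
  obtains \<rho> \<gamma> :: "real^'n \<Rightarrow> real" where "\<rho> \<in> test_functions" "\<And>x. 0 \<le> \<rho> x" "(LINT x|lborel. \<rho> x) = 1"
    "\<And>x. r \<le> norm x \<Longrightarrow> \<rho> x = 0" "\<And>x. 0 \<le> \<gamma> x" "\<And>i x. partial i \<rho> x = - x$i * \<gamma> x"
proof -
  define k where "k x = ebump 1 (r\<^sup>2 - x \<bullet> x)" for x :: "real^'n"
  define l where "l x = 2 * ebump [:0, 0, 1:] (r\<^sup>2 - x \<bullet> x)" for x :: "real^'n"
  have k0: "k x \<ge> 0" and l0: "l x \<ge> 0" for x by (simp_all add: k_def l_def ebump_def)
  have kz: "k x = 0" if "r \<le> norm x" for x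
  proof -
    have "r\<^sup>2 \<le> (norm x)\<^sup>2" using that r by (intro power_mono) auto
    then show ?thesis by (simp add: k_def ebump_def power2_norm_eq_inner)
  qed
  have kt: "k \<in> test_functions"
    by (rule test_functionI[where r=r]) (use kz in \<open>auto simp: k_def[abs_def] intro: bump_algebra_C_k[OF bump_algebra.bump]\<close>)
  have kp: "has_partial i k" "partial i k x = - x$i * l x" for i x
    using bump_partial[where i=i and p=1 and r=r] by (simp_all add: k_def[abs_def] l_def)
  note kc = test_function_continuous[OF kt, of UNIV]
  have ki: "integrable lborel k" by (rule integrable_continuous_compact_support[OF kc kz])
  define Z where "Z = (LINT x|lborel. k x)"
  have Z: "Z > 0"
  proof -
    \<comment> \<open>A vanishing integral would make \<open>k\<close> zero almost everywhere, hence
      everywhere by continuity, but \<open>k 0 > 0\<close>.\<close>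
    have "Z \<noteq> 0"
    proof
      assume "Z = 0"
      then have "AE x in lborel. k x = 0"
        using integral_nonneg_eq_0_iff_AE[OF ki] k0 by (simp add: Z_def)
      then have "{x. k x = 0} = UNIV"
      proof -
        have cl: "closed {x. k x = 0}" using kc by (simp add: closed_Collect_eq continuous_on_const)
        show ?thesis using mem_closed_if_AE_lebesgue[OF cl] AE_completion[OF \<open>AE x in lborel. k x = 0\<close>] by auto
      qed
      then have "k 0 = 0" by blast
      then show False using r by (simp add: k_def ebump_def)
    qed
    moreover have "Z \<ge> 0" unfolding Z_def by (rule integral_nonneg_AE) (simp add: k0)
    ultimately show ?thesis by simp
  qed
  show thesis
  proof (rule that[of "\<lambda>x. (1 / Z) * k x" "\<lambda>x. (1 / Z) * l x"])
    show "(\<lambda>x. (1 / Z) * k x) \<in> test_functions" by (rule test_function_cmult[OF kt])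
    show "(LINT x|lborel. (1 / Z) * k x) = 1" using Z by (simp add: Z_def)
    show "partial i (\<lambda>x. (1 / Z) * k x) x = - x$i * ((1 / Z) * l x)" for i x
      unfolding partial_cmult(2)[OF kp(1)] kp(2) by simp
  qed (use k0 l0 kz Z in auto)
qed

section \<open>Translation, and derivative tests at a maximum\<close>

lemma partial_translate:
  "has_partial i f \<Longrightarrow> has_partial i (\<lambda>y. f (y - a))" "partial i (\<lambda>y. f (y - a)) = (\<lambda>y. partial i f (y - a))"
proof -
  have e: "x + h *\<^sub>R axis i 1 - a = (x - a) + h *\<^sub>R axis i 1" for x h by simp
  show "has_partial i f \<Longrightarrow> has_partial i (\<lambda>y. f (y - a))" unfolding has_partial_def e by blast
  show "partial i (\<lambda>y. f (y - a)) = (\<lambda>y. partial i f (y - a))" unfolding partial_def e ..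
qed

lemma C_k_translate: "C_k k f \<Longrightarrow> C_k k (\<lambda>y. f (y - a))"
proof (induction k arbitrary: f)
  case 0
  then have "continuous_on UNIV f" by simp
  then have "continuous_on UNIV (\<lambda>y. f (y - a))" by (rule continuous_on_compose2) (auto intro!: continuous_intros)
  then show ?case by simp
next
  case (Suc k)
  then have c: "continuous_on UNIV f" and p: "\<And>i. has_partial i f" "\<And>i. C_k k (partial i f)" by simp_all
  have "continuous_on UNIV (\<lambda>y. f (y - a))" by (rule continuous_on_compose2[OF c]) (auto intro!: continuous_intros)
  then show ?case using partial_translate(1)[OF p(1)] Suc.IH[OF p(2)] by (simp add: partial_translate(2))
qed

lemma test_function_translate:
  fixes \<phi> :: "real^'n \<Rightarrow> real"
  assumes "\<phi> \<in> test_functions" shows "(\<lambda>y. \<phi> (y - a)) \<in> test_functions"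
proof -
  obtain r where r: "r > 0" "\<And>x. r \<le> norm x \<Longrightarrow> \<phi> x = 0" using test_function_ball[OF assms] by blast
  show ?thesis
  proof (rule test_functionI[where r="r + norm a"])
    fix x :: "real^'n" assume "r + norm a \<le> norm x"
    moreover have "norm x \<le> norm (x - a) + norm a" by (metis diff_add_cancel norm_triangle_ineq)
    ultimately show "\<phi> (x - a) = 0" by (intro r) linarith
  qed (rule C_k_translate[OF test_function_C_k[OF assms]])
qed

lemma has_derivative_partial:
  assumes "(f has_derivative f') (at x)" "has_partial i f"
  shows "partial i f x = f' (axis i 1)"
proof -
  have d0: "((\<lambda>h. x + h *\<^sub>R axis i 1) has_derivative (\<lambda>h. h *\<^sub>R axis i 1)) (at 0)"
    by (auto intro!: derivative_eq_intros)
  have "(f has_derivative f') (at (x + 0 *\<^sub>R axis i 1))" using assms(1) by simp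
  from has_derivative_compose[OF d0 this]
  have "((\<lambda>h. f (x + h *\<^sub>R axis i 1)) has_derivative (\<lambda>h. f' (h *\<^sub>R axis i 1))) (at 0)" .
  moreover have "(\<lambda>h. f' (h *\<^sub>R axis i 1)) = (*) (f' (axis i 1))"
    using linear_cmul[OF has_derivative_linear[OF assms(1)]] by (auto simp: mult.commute)
  ultimately have "((\<lambda>h. f (x + h *\<^sub>R axis i 1)) has_real_derivative f' (axis i 1)) (at 0)"
    by (simp add: has_field_derivative_def)
  then show ?thesis unfolding partial_def by (rule DERIV_imp_deriv)
qed

lemma has_partial_of_has_derivative:
  assumes "\<And>x. (f has_derivative f' x) (at x)"
  shows "has_partial i f" "partial i f x = f' x (axis i 1)"
proof -
  show h: "has_partial i f" unfolding has_partial_def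
  proof
    fix x
    have "f differentiable (at (x + 0 *\<^sub>R axis i 1))" using assms[of x] by (auto simp: differentiable_def)
    moreover have "(\<lambda>h. x + h *\<^sub>R axis i 1) differentiable (at 0)"
      by (intro derivative_intros)
    ultimately have "(f \<circ> (\<lambda>h. x + h *\<^sub>R axis i 1)) differentiable (at 0)"
      by (rule differentiable_chain_at[rotated])
    then show "(\<lambda>h. f (x + h *\<^sub>R axis i 1)) differentiable (at 0)" by (simp add: comp_def)
  qed
  show "partial i f x = f' x (axis i 1)" by (rule has_derivative_partial[OF assms h])
qed

text \<open>Only times before \<open>t0\<close> are compared, so the endpoint \<open>t0 = T\<close>
  with its one-sided derivative is included.\<close>

lemma nonneg_derivative_at_max:
  fixes f :: "real \<Rightarrow> real"
  assumes d: "(f has_real_derivative D) (at t0 within {0..T})" and t0: "0 < t0" "t0 \<le> T"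
    and m: "\<And>t. 0 \<le> t \<Longrightarrow> t \<le> t0 \<Longrightarrow> f t \<le> f t0"
  shows "D \<ge> 0"
proof (rule ccontr)
  assume "\<not> D \<ge> 0"
  then have "D < 0" by simp
  from has_real_derivative_neg_dec_left[OF d this]
  obtain e where e: "e > 0" "\<And>h. h > 0 \<Longrightarrow> t0 - h \<in> {0..T} \<Longrightarrow> h < e \<Longrightarrow> f t0 < f (t0 - h)" by blast
  define h where "h = min (e / 2) t0"
  have "h > 0" "h < e" "h \<le> t0" using e(1) t0 by (simp_all add: h_def)
  then have "f t0 < f (t0 - h)" using t0 by (intro e(2)) auto
  moreover have "f (t0 - h) \<le> f t0" using \<open>h > 0\<close> \<open>h \<le> t0\<close> by (intro m) auto
  ultimately show False by simp
qed

text \<open>Divide by \<open>s\<close>, or by \<open>s^2\<close> once \<open>a = 0\<close>, and let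
  \<open>s\<close> tend to 0. These are the first- and second-order conditions at a maximum,
  extracted from an expansion with cubic remainder.\<close>

lemma taylor_nonpos:
  fixes a q C :: real
  assumes "\<And>s. 0 < s \<Longrightarrow> s * a + s\<^sup>2 * q \<le> s ^ 3 * C"
  shows "a \<le> 0" "a = 0 \<Longrightarrow> q \<le> 0"
proof -
  have 1: "a + s * q \<le> s\<^sup>2 * C" if "s > 0" for s
  proof -
    have "s * (a + s * q) \<le> s * (s\<^sup>2 * C)" using assms[OF that] by (simp add: power2_eq_square power3_eq_cube algebra_simps)
    then show ?thesis using that by (simp only: mult_le_cancel_left_pos)
  qed
  have "((\<lambda>s. a + s * q) \<longlongrightarrow> a + 0 * q) (at_right 0)" "((\<lambda>s. s\<^sup>2 * C) \<longlongrightarrow> 0\<^sup>2 * C) (at_right 0)"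
    by (intro tendsto_intros)+
  moreover have "\<forall>\<^sub>F s in at_right 0. a + s * q \<le> s\<^sup>2 * C"
    unfolding eventually_at_right_field using 1 by (intro exI[of _ 1]) simp
  ultimately have "a + 0 * q \<le> 0\<^sup>2 * C" by (intro tendsto_le[OF trivial_limit_at_right_real])
  then show "a \<le> 0" by simp
  assume "a = 0"
  then have 2: "q \<le> s * C" if "s > 0" for s
  proof -
    have "s * q \<le> s * (s * C)" using 1[OF that] \<open>a = 0\<close> by (simp add: power2_eq_square algebra_simps)
    then show ?thesis using that by (simp only: mult_le_cancel_left_pos)
  qed
  have "((\<lambda>s. s * C) \<longlongrightarrow> 0 * C) (at_right 0)" by (intro tendsto_intros)
  moreover have "\<forall>\<^sub>F s in at_right 0. q \<le> s * C"
    unfolding eventually_at_right_field using 2 by (intro exI[of _ 1]) simp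
  ultimately have "q \<le> 0 * C" by (intro tendsto_le[OF trivial_limit_at_right_real _ tendsto_const])
  then show "q \<le> 0" by simp
qed

lemma continuous_slice:
  fixes v :: "real \<Rightarrow> real^'n \<Rightarrow> real"
  assumes "continuous_on ({0..T} \<times> UNIV) (\<lambda>(t, x). v t x)" "t \<in> {0..T}"
  shows "continuous_on UNIV (v t)" "v t \<in> borel_measurable borel"
proof -
  have "continuous_on UNIV ((\<lambda>(t, x). v t x) \<circ> (\<lambda>x. (t, x)))"
    by (rule continuous_on_compose) (use assms(2) in \<open>auto intro!: continuous_intros continuous_on_subset[OF assms(1)]\<close>)
  then show "continuous_on UNIV (v t)" by (simp add: comp_def)
  then show "v t \<in> borel_measurable borel" by (rule borel_measurable_continuous_onI)
qed

lemma partial_by_parts: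
  fixes \<phi> a :: "real^'n \<Rightarrow> real"
  assumes \<phi>: "\<phi> \<in> test_functions" and lip: "La-lipschitz_on UNIV a" and hp: "has_partial i a"
    and c: "continuous_on UNIV (partial i a)"
  shows "integrable lborel (\<lambda>y. partial i a y * \<phi> y)" "integrable lborel (\<lambda>y. a y * partial i \<phi> y)"
    "(LINT y|lborel. a y * partial i \<phi> y) = - (LINT y|lborel. partial i a y * \<phi> y)"
proof -
  obtain r where r: "r > 0" "\<And>x. r \<le> norm x \<Longrightarrow> \<phi> x = 0" using test_function_ball[OF \<phi>] by blast
  have p: "partial i \<phi> \<in> test_functions" by (rule partial_test_function[OF \<phi>])
  obtain s where s: "\<And>x. s \<le> norm x \<Longrightarrow> partial i \<phi> x = 0" using test_function_ball[OF p] by blast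
  have ac: "continuous_on UNIV a" by (rule lipschitz_on_continuous_on[OF lip])
  note pc = test_function_continuous[OF p, of UNIV] and \<phi>c = test_function_continuous[OF \<phi>, of UNIV]
  show 1: "integrable lborel (\<lambda>y. partial i a y * \<phi> y)"
    by (rule integrable_continuous_compact_support[OF continuous_on_mult[OF c \<phi>c], of r]) (simp add: r)
  show 2: "integrable lborel (\<lambda>y. a y * partial i \<phi> y)"
    by (rule integrable_continuous_compact_support[OF continuous_on_mult[OF ac pc], of s]) (simp add: s)
  obtain L\<phi> where L\<phi>: "L\<phi>-lipschitz_on UNIV \<phi>" using test_function_lipschitz[OF \<phi>] by blast
  obtain Lm where Lm: "Lm-lipschitz_on UNIV (\<lambda>x. a x * \<phi> x)" using lipschitz_mult_compact[OF lip L\<phi> r(2)] by blast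
  note pm = partial_mult[OF hp test_function_has_partial[OF \<phi>, of i]]
  have "(LINT y|lborel. partial i (\<lambda>y. a y * \<phi> y) y) = 0"
    by (rule integral_partial_eq_0[OF pm(1) Lm, of r]) (simp add: r)
  then show "(LINT y|lborel. a y * partial i \<phi> y) = - (LINT y|lborel. partial i a y * \<phi> y)"
    unfolding pm(2) Bochner_Integration.integral_add[OF 1 2] by simp
qed

section \<open>Mollified weak solutions and the commutator with the drift\<close>

context smooth_euler_scheme
begin

lemma b_component:
  "L-lipschitz_on UNIV (\<lambda>y. b y $ i - a)" "has_partial j (\<lambda>y. b y $ i - a)"
  "partial j (\<lambda>y. b y $ i - a) = (\<lambda>y. B y $ i $ j)" "continuous_on UNIV (\<lambda>y. B y $ i $ j)"
proof -
  show "L-lipschitz_on UNIV (\<lambda>y. b y $ i - a)"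
  proof (rule lipschitz_onI[OF _ L_nonneg])
    fix x y
    have "dist (b x $ i - a) (b y $ i - a) = \<bar>(b x - b y) $ i\<bar>" by (simp add: dist_real_def)
    also have "\<dots> \<le> norm (b x - b y)" by (rule component_le_norm_cart)
    finally show "dist (b x $ i - a) (b y $ i - a) \<le> L * dist x y" using lipD[of x y] by (simp add: dist_norm)
  qed
  have d: "((\<lambda>y. b y $ i - a) has_derivative (\<lambda>v. (B y *v v) $ i)) (at y)" for y
    using has_derivative_diff[OF bounded_linear.has_derivative[OF bounded_linear_vec_nth derB] has_derivative_const] by simp
  show "has_partial j (\<lambda>y. b y $ i - a)" by (rule has_partial_of_has_derivative[OF d])
  show "partial j (\<lambda>y. b y $ i - a) = (\<lambda>y. B y $ i $ j)"
    using has_partial_of_has_derivative(2)[OF d] by (simp add: fun_eq_iff matrix_vector_mul_component inner_axis)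
  show "continuous_on UNIV (\<lambda>y. B y $ i $ j)" using lipB lipschitz_on_continuous_on by blast
qed

text \<open>The commutator of the drift with a mollification. Its kernel is a divergence, so it has integral
  zero; and \<open>\<bar>z\<bar> \<bar>grad \<rho> z\<bar> = - z \<bullet> grad \<rho> z\<close> has integral \<open>n\<close> whatever the radius of \<open>\<rho>\<close>.\<close>
lemma commutator_bound:
  fixes x :: "real^'n" and v \<rho> \<gamma> :: "real^'n \<Rightarrow> real"
  assumes \<rho>: "\<rho> \<in> test_functions" "\<And>y. 0 \<le> \<rho> y" "(LINT y|lborel. \<rho> y) = 1" "\<And>y. r \<le> norm y \<Longrightarrow> \<rho> y = 0"
    and \<gamma>: "\<And>y. 0 \<le> \<gamma> y" "\<And>i y. partial i \<rho> y = - y$i * \<gamma> y"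
    and v: "v \<in> borel_measurable borel" "\<And>y. \<bar>v y\<bar> \<le> N"
    and osc: "\<And>y. norm (y - x) \<le> r \<Longrightarrow> \<bar>v y - v x\<bar> \<le> \<omega>" and \<omega>: "\<omega> \<ge> 0"
  defines "\<phi> \<equiv> \<lambda>y. \<rho> (y - x)"
  shows "\<bar>(LINT y|lborel. v y * flux \<phi> y) - (\<Sum>i\<in>UNIV. b x $ i * (LINT y|lborel. v y * partial i \<phi> y))\<bar>
    \<le> \<omega> * (real CARD('n) * L + real CARD('n) * K)"
proof -
  let ?n = "real CARD('n)"
  have \<phi>: "\<phi> \<in> test_functions" unfolding \<phi>_def by (rule test_function_translate[OF \<rho>(1)])
  note \<phi>i = test_function_integrable[OF \<phi>]
  have \<phi>0: "0 \<le> \<phi> y" for y by (simp add: \<phi>_def \<rho>)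
  have \<phi>1: "(LINT y|lborel. \<phi> y) = 1"
    using integral_translate[of \<rho> "- x"] borel_measurable_continuous_onI[OF test_function_continuous[OF \<rho>(1)]] \<rho>(3) by (simp add: \<phi>_def)
  have p\<phi>: "partial i \<phi> y = - (y - x)$i * \<gamma> (y - x)" for i y
    unfolding \<phi>_def partial_translate(2) by (rule \<gamma>(2))
  have pi: "integrable lborel (partial i \<phi>)" for i by (rule test_function_integrable[OF partial_test_function[OF \<phi>]])
  have out: "\<phi> y = 0" "partial i \<phi> y = 0" if "r < norm (y - x)" for i y
  proof -
    show "\<phi> y = 0" unfolding \<phi>_def using that by (intro \<rho>(4)) simp
    show "partial i \<phi> y = 0" unfolding \<phi>_def partial_translate(2)
      by (rule partial_eq_0_outside[where r=r]) (use that \<rho>(4) in auto)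
  qed
  \<comment> \<open>\<open>e\<close> is the divergence of \<open>(b y - b x) \<phi> y\<close>, and
    \<open>E\<close> dominates it: the inner product of \<open>y - x\<close> with the gradient of
    \<phi> is nonpositive, so \<open>- L\<close> times this product bounds the gradient
    term.\<close>
  define e where "e y = (\<Sum>i\<in>UNIV. B y $ i $ i * \<phi> y + (b y $ i - b x $ i) * partial i \<phi> y)" for y
  define E where "E y = - L * (\<Sum>i\<in>UNIV. (y $ i - x $ i) * partial i \<phi> y) + ?n * K * \<phi> y" for y
  have bp: "integrable lborel (\<lambda>y. B y $ i $ i * \<phi> y)" "integrable lborel (\<lambda>y. (b y $ i - b x $ i) * partial i \<phi> y)"
    "(LINT y|lborel. (b y $ i - b x $ i) * partial i \<phi> y) = - (LINT y|lborel. B y $ i $ i * \<phi> y)" for i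
  proof -
    have c: "continuous_on UNIV (partial i (\<lambda>y. b y $ i - b x $ i))" unfolding b_component(3) by (rule b_component(4))
    from partial_by_parts[OF \<phi> b_component(1) b_component(2) c]
    show "integrable lborel (\<lambda>y. B y $ i $ i * \<phi> y)" "integrable lborel (\<lambda>y. (b y $ i - b x $ i) * partial i \<phi> y)"
      "(LINT y|lborel. (b y $ i - b x $ i) * partial i \<phi> y) = - (LINT y|lborel. B y $ i $ i * \<phi> y)"
      unfolding b_component(3) .
  qed
  have cl: "1-lipschitz_on UNIV (\<lambda>y::real^'n. y $ i - x $ i)" for i
  proof (rule lipschitz_onI)
    fix y z :: "real^'n"
    have "\<bar>(y - z) $ i\<bar> \<le> norm (y - z)" by (rule component_le_norm_cart)
    then show "dist (y $ i - x $ i) (z $ i - x $ i) \<le> 1 * dist y z" by (simp add: dist_real_def dist_norm)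
  qed simp
  have cpart: "has_partial i (\<lambda>y::real^'n. y $ i - x $ i)" "partial i (\<lambda>y::real^'n. y $ i - x $ i) = (\<lambda>y. 1)" for i
    using partial_add[OF coord_partial(1)[of i i] partial_const(1)[of i "- x $ i"]] by (simp_all add: partial_const(2) coord_partial(2))
  note cp = partial_by_parts[OF \<phi> cl cpart(1), unfolded cpart(2), OF continuous_on_const]
  have ei: "integrable lborel e" unfolding e_def[abs_def]
    by (intro Bochner_Integration.integrable_sum Bochner_Integration.integrable_add bp(1,2))
  have e0: "(LINT y|lborel. e y) = 0"
    unfolding e_def using bp by (simp add: Bochner_Integration.integral_sum)
  have Ei: "integrable lborel E" unfolding E_def[abs_def]
    by (intro Bochner_Integration.integrable_add integrable_mult_right Bochner_Integration.integrable_sum cp(2) \<phi>i)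
  have E1: "(LINT y|lborel. E y) = ?n * L + ?n * K"
  proof -
    have i1: "integrable lborel (\<lambda>y. - L * (\<Sum>i\<in>UNIV. (y $ i - x $ i) * partial i \<phi> y))" and i2: "integrable lborel (\<lambda>y. ?n * K * \<phi> y)"
      by (intro integrable_mult_right Bochner_Integration.integrable_sum cp(2) \<phi>i)+
    have "(LINT y|lborel. (\<Sum>i\<in>UNIV. (y $ i - x $ i) * partial i \<phi> y)) = (\<Sum>i\<in>(UNIV::'n set). - (LINT y|lborel. 1 * \<phi> y))"
      unfolding Bochner_Integration.integral_sum[OF cp(2)] cp(3) ..
    also have "\<dots> = - ?n" using \<phi>1 by simp
    finally have s: "(LINT y|lborel. (\<Sum>i\<in>UNIV. (y $ i - x $ i) * partial i \<phi> y)) = - ?n" .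
    show ?thesis unfolding E_def Bochner_Integration.integral_add[OF i1 i2] integral_mult_right_zero s \<phi>1 by simp
  qed
  have eE: "\<bar>e y\<bar> \<le> E y" for y
  proof -
    have s1: "(\<Sum>i\<in>UNIV. (b y $ i - b x $ i) * partial i \<phi> y) = - \<gamma> (y - x) * ((b y - b x) \<bullet> (y - x))"
      by (simp add: p\<phi> inner_vec_def sum_distrib_left algebra_simps sum_negf)
    have s2: "(\<Sum>i\<in>UNIV. (y $ i - x $ i) * partial i \<phi> y) = - \<gamma> (y - x) * (norm (y - x))\<^sup>2"
      unfolding power2_norm_eq_inner by (simp add: p\<phi> inner_vec_def sum_distrib_left algebra_simps sum_negf)
    have "\<bar>(b y - b x) \<bullet> (y - x)\<bar> \<le> norm (b y - b x) * norm (y - x)" by (rule Cauchy_Schwarz_ineq2)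
    also have "\<dots> \<le> (L * norm (y - x)) * norm (y - x)" by (intro mult_right_mono lipD) simp
    finally have "\<gamma> (y - x) * \<bar>(b y - b x) \<bullet> (y - x)\<bar> \<le> \<gamma> (y - x) * (L * (norm (y - x))\<^sup>2)"
      by (intro mult_left_mono \<gamma>) (simp add: power2_eq_square mult.assoc)
    then have 1: "\<bar>\<Sum>i\<in>UNIV. (b y $ i - b x $ i) * partial i \<phi> y\<bar> \<le> - L * (\<Sum>i\<in>UNIV. (y $ i - x $ i) * partial i \<phi> y)"
      unfolding s1 s2 by (simp add: abs_mult \<gamma> mult_ac)
    have 2: "\<bar>\<Sum>i\<in>UNIV. B y $ i $ i * \<phi> y\<bar> \<le> ?n * K * \<phi> y"
    proof -
      have "\<bar>\<Sum>i\<in>UNIV. B y $ i $ i * \<phi> y\<bar> \<le> (\<Sum>i\<in>(UNIV::'n set). K * \<phi> y)"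
        by (rule order_trans[OF sum_abs sum_mono]) (simp add: abs_mult \<phi>0 boundB mult_right_mono)
      then show ?thesis by simp
    qed
    have "e y = (\<Sum>i\<in>UNIV. B y $ i $ i * \<phi> y) + (\<Sum>i\<in>UNIV. (b y $ i - b x $ i) * partial i \<phi> y)" by (simp add: e_def sum.distrib)
    then show ?thesis unfolding E_def using 1 2 abs_triangle_ineq[of "\<Sum>i\<in>UNIV. B y $ i $ i * \<phi> y" "\<Sum>i\<in>UNIV. (b y $ i - b x $ i) * partial i \<phi> y"] by linarith
  qed
  note ve = integral_mult_bound(1)[OF ei v] and vp = integral_mult_bound(1)[OF pi v]
  have "flux \<phi> y = e y + (\<Sum>i\<in>UNIV. b x $ i * partial i \<phi> y)" for y
    by (simp add: flux_def e_def grad_def inner_vec_def trace_def sum.distrib[symmetric] sum_distrib_left algebra_simps)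
  then have "v y * flux \<phi> y = v y * e y + (\<Sum>i\<in>UNIV. b x $ i * (v y * partial i \<phi> y))" for y
    by (simp add: distrib_left sum_distrib_left mult.left_commute)
  then have "(LINT y|lborel. v y * flux \<phi> y) = (LINT y|lborel. v y * e y) + (\<Sum>i\<in>UNIV. b x $ i * (LINT y|lborel. v y * partial i \<phi> y))"
    using ve vp by (simp add: Bochner_Integration.integral_sum)
  \<comment> \<open>Because \<open>e\<close> has integral zero, the constant \<open>v x\<close> can
    be subtracted from \<open>v\<close>, and only the oscillation of \<open>v\<close> on the support
    remains.\<close>
  then have "(LINT y|lborel. v y * flux \<phi> y) - (\<Sum>i\<in>UNIV. b x $ i * (LINT y|lborel. v y * partial i \<phi> y)) = (LINT y|lborel. v y * e y) - v x * (LINT y|lborel. e y)"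
    using e0 by simp
  also have "\<dots> = (LINT y|lborel. v y * e y - v x * e y)" using ve ei by simp
  also have "\<bar>\<dots>\<bar> \<le> (LINT y|lborel. \<omega> * E y)"
  proof (rule abs_integral_le)
    show "integrable lborel (\<lambda>y. v y * e y - v x * e y)" using ve ei by simp
    show "integrable lborel (\<lambda>y. \<omega> * E y)" using Ei by simp
    fix y
    show "\<bar>v y * e y - v x * e y\<bar> \<le> \<omega> * E y"
    proof (cases "norm (y - x) \<le> r")
      case True
      have "\<bar>v y - v x\<bar> * \<bar>e y\<bar> \<le> \<omega> * E y" by (intro mult_mono osc[OF True] eE \<omega>) simp
      then show ?thesis by (simp only: left_diff_distrib[symmetric] abs_mult)
    next
      case False
      then have "e y = 0" "E y = 0" using out[of y] by (simp_all add: e_def E_def)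
      then show ?thesis by simp
    qed
  qed
  also have "\<dots> = \<omega> * (?n * L + ?n * K)" using E1 by simp
  finally show ?thesis .
qed

text \<open>Substituting \<open>y + x\<close> moves the dependence on \<open>x\<close> from the
  mollifier to \<open>v\<close>, so that dominated convergence has the fixed weight \<rho>.\<close>

lemma mollification_continuous:
  fixes v :: "real \<Rightarrow> real^'n \<Rightarrow> real" and \<rho> :: "real^'n \<Rightarrow> real"
  assumes \<rho>: "\<rho> \<in> test_functions" and vc: "continuous_on ({0..T} \<times> UNIV) (\<lambda>(t, x). v t x)"
    and vN: "\<And>t x. t \<in> {0..T} \<Longrightarrow> \<bar>v t x\<bar> \<le> N"
  shows "continuous_on ({0..T} \<times> UNIV) (\<lambda>(t, x). LINT y|lborel. v t y * \<rho> (y - x))"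
  unfolding continuous_on_sequentially
proof (intro ballI allI impI, elim conjE)
  fix p :: "nat \<Rightarrow> real \<times> (real^'n)" and q
  assume q: "q \<in> {0..T} \<times> UNIV" and p: "\<forall>n. p n \<in> {0..T} \<times> UNIV" "p \<longlonglongrightarrow> q"
  note vm = continuous_slice(2)[OF vc]
  have \<rho>m: "\<rho> \<in> borel_measurable borel" by (rule borel_measurable_continuous_onI[OF test_function_continuous[OF \<rho>]])
  have tr: "(LINT y|lborel. v t y * \<rho> (y - x)) = (LINT y|lborel. v t (y + x) * \<rho> y)" if t: "t \<in> {0..T}" for t x
  proof -
    have "(\<lambda>y. v t y * \<rho> (y - x)) \<in> borel_measurable borel" using vm[OF t] \<rho>m by measurable
    from integral_translate[OF this, of x] show ?thesis by simp
  qed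
  have pt: "fst (p n) \<in> {0..T}" "fst q \<in> {0..T}" for n using p(1) q by (auto simp: mem_Times_iff)
  have "(\<lambda>n. LINT y|lborel. v (fst (p n)) (y + snd (p n)) * \<rho> y) \<longlonglongrightarrow> (LINT y|lborel. v (fst q) (y + snd q) * \<rho> y)"
  proof (rule integral_mult_tendsto[OF test_function_integrable[OF \<rho>]])
    show "(\<lambda>y. v (fst (p n)) (y + snd (p n))) \<in> borel_measurable borel" "(\<lambda>y. v (fst q) (y + snd q)) \<in> borel_measurable borel" for n
      using vm[OF pt(1)] vm[OF pt(2)] by measurable
    show "\<bar>v (fst (p n)) (y + snd (p n))\<bar> \<le> N" for n y by (rule vN[OF pt(1)])
    fix y
    have "(\<lambda>n. (fst (p n), y + snd (p n))) \<longlonglongrightarrow> (fst q, y + snd q)"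
      by (intro tendsto_intros tendsto_fst[OF p(2)] tendsto_snd[OF p(2)])
    from continuous_on_tendsto_compose[OF vc this] pt
    show "(\<lambda>n. v (fst (p n)) (y + snd (p n))) \<longlonglongrightarrow> v (fst q) (y + snd q)" by (simp add: mem_Times_iff)
  qed
  then show "((\<lambda>(t, x). LINT y|lborel. v t y * \<rho> (y - x)) \<circ> p) \<longlonglongrightarrow> (case q of (t, x) \<Rightarrow> LINT y|lborel. v t y * \<rho> (y - x))"
    using pt by (simp add: comp_def split_beta tr)
qed

text \<open>The second-order part is sorted by the columns of \<open>R\<close>: each inner double
  sum is the second-derivative form in the direction of one column, to which the second-order
  condition at a maximum applies.\<close>

lemma adj_pairing:
  fixes v \<phi> :: "real^'n \<Rightarrow> real"
  assumes \<phi>: "\<phi> \<in> test_functions" and v: "v \<in> borel_measurable borel" "\<And>y. \<bar>v y\<bar> \<le> N"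
  shows "(LINT y|lborel. v y * adj \<phi> y) =
    (1/2) * (\<Sum>k\<in>UNIV. \<Sum>i\<in>UNIV. \<Sum>j\<in>UNIV. R$i$k * R$j$k * (LINT y|lborel. v y * partial i (partial j \<phi>) y)) - (LINT y|lborel. v y * flux \<phi> y)"
proof -
  have i2: "integrable lborel (\<lambda>y. v y * partial i (partial j \<phi>) y)" for i j
    by (rule integral_mult_bound(1)[OF test_function_integrable[OF partial_test_function[OF partial_test_function[OF \<phi>]]] v])
  obtain r where r: "\<And>x. r \<le> norm x \<Longrightarrow> \<phi> x = 0" using test_function_ball[OF \<phi>] by blast
  obtain Lf where Lf: "Lf-lipschitz_on UNIV (flux \<phi>)" using flux_lipschitz[OF \<phi>] by blast
  have fi: "integrable lborel (flux \<phi>)"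
    by (rule integrable_continuous_compact_support[OF lipschitz_on_continuous_on[OF Lf], of "r + 1"]) (use flux_eq_0_outside[OF r] in auto)
  note vf = integral_mult_bound(1)[OF fi v]
  have "trace ((R ** transpose R) ** hessian \<phi> y) = (\<Sum>k\<in>UNIV. \<Sum>i\<in>UNIV. \<Sum>j\<in>UNIV. R$i$k * R$j$k * partial i (partial j \<phi>) y)" for y
  proof -
    have "trace ((R ** transpose R) ** hessian \<phi> y) = (\<Sum>i\<in>UNIV. \<Sum>j\<in>UNIV. \<Sum>k\<in>UNIV. R$i$k * R$j$k * partial j (partial i \<phi>) y)"
      by (simp add: trace_def matrix_matrix_mult_def transpose_def hessian_def sum_distrib_right)
    also have "\<dots> = (\<Sum>i\<in>UNIV. \<Sum>k\<in>UNIV. \<Sum>j\<in>UNIV. R$i$k * R$j$k * partial j (partial i \<phi>) y)"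
      by (intro sum.cong refl sum.swap)
    also have "\<dots> = (\<Sum>k\<in>UNIV. \<Sum>i\<in>UNIV. \<Sum>j\<in>UNIV. R$i$k * R$j$k * partial j (partial i \<phi>) y)" by (rule sum.swap)
    also have "\<dots> = (\<Sum>k\<in>UNIV. \<Sum>i\<in>UNIV. \<Sum>j\<in>UNIV. R$j$k * R$i$k * partial i (partial j \<phi>) y)"
      by (intro sum.cong refl sum.swap)
    finally show ?thesis by (simp only: mult.commute)
  qed
  then have "v y * adj \<phi> y = (1/2) * (\<Sum>k\<in>UNIV. \<Sum>i\<in>UNIV. \<Sum>j\<in>UNIV. R$i$k * R$j$k * (v y * partial i (partial j \<phi>) y)) - v y * flux \<phi> y" for y
    by (simp add: adj_def right_diff_distrib sum_distrib_left mult_ac)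
  moreover have "integrable lborel (\<lambda>y. (1/2) * (\<Sum>k\<in>UNIV. \<Sum>i\<in>UNIV. \<Sum>j\<in>UNIV. R$i$k * R$j$k * (v y * partial i (partial j \<phi>) y)))"
    by (intro integrable_mult_right Bochner_Integration.integrable_sum i2)
  ultimately show ?thesis using vf i2
    by (simp add: Bochner_Integration.integral_sum)
qed

text \<open>Maximum principle for the mollification of a weak solution, in integrated form: the first and second
  order conditions at a maximum of \<open>x \<mapsto> \<integral> v y * \<rho> (y - x) dy - \<kappa> (1 + \<bar>x\<bar>\<^sup>2)\<close> bound the pairing
  with the adjoint.\<close>
lemma adj_pairing_at_max:
  fixes x :: "real^'n" and v \<rho> \<gamma> :: "real^'n \<Rightarrow> real"
  assumes \<rho>: "\<rho> \<in> test_functions" "\<And>y. 0 \<le> \<rho> y" "(LINT y|lborel. \<rho> y) = 1" "\<And>y. r \<le> norm y \<Longrightarrow> \<rho> y = 0"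
    and \<gamma>: "\<And>y. 0 \<le> \<gamma> y" "\<And>i y. partial i \<rho> y = - y$i * \<gamma> y"
    and v: "v \<in> borel_measurable borel" "\<And>y. \<bar>v y\<bar> \<le> N"
    and osc: "\<And>y. norm (y - x) \<le> r \<Longrightarrow> \<bar>v y - v x\<bar> \<le> \<omega>" and \<omega>: "\<omega> \<ge> 0"
    and max: "\<And>z. (LINT y|lborel. v y * \<rho> (y - (x + z))) - \<kappa> * (1 + (norm (x + z))\<^sup>2)
       \<le> (LINT y|lborel. v y * \<rho> (y - x)) - \<kappa> * (1 + (norm x)\<^sup>2)"
    and \<kappa>: "\<kappa> \<ge> 0"
  defines "\<phi> \<equiv> \<lambda>y. \<rho> (y - x)"
  shows "(LINT y|lborel. v y * adj \<phi> y) \<le> \<omega> * (real CARD('n) * L + real CARD('n) * K)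
    + ((\<Sum>k\<in>UNIV. \<Sum>i\<in>UNIV. (R$i$k)\<^sup>2) + 2 * (norm (b 0) + L)) * (\<kappa> * (1 + (norm x)\<^sup>2))"
proof -
  have \<phi>: "\<phi> \<in> test_functions" unfolding \<phi>_def by (rule test_function_translate[OF \<rho>(1)])
  define p where "p i = (LINT y|lborel. v y * partial i \<phi> y)" for i
  define q where "q i j = (LINT y|lborel. v y * partial i (partial j \<phi>) y)" for i j
  define w0 where "w0 = (LINT y|lborel. v y * \<phi> y)"
  obtain C where C: "\<And>z. \<bar>(LINT y|lborel. v y * \<phi> (y - z)) - (w0 - (\<Sum>i\<in>UNIV. z$i * p i)
     + (1/2) * (\<Sum>i\<in>UNIV. \<Sum>j\<in>UNIV. z$i * z$j * q i j))\<bar> \<le> C * norm z ^ 3"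
  proof -
    obtain C where C: "C \<ge> 0" "\<And>g M z. \<lbrakk>g \<in> borel_measurable borel; \<And>x. \<bar>g x\<bar> \<le> M\<rbrakk> \<Longrightarrow>
      \<bar>(LINT y|lborel. g y * \<phi> (y - z)) - ((LINT y|lborel. g y * \<phi> y) - (\<Sum>i\<in>UNIV. z$i * (LINT y|lborel. g y * partial i \<phi> y))
       + (1/2) * (\<Sum>i\<in>UNIV. \<Sum>j\<in>UNIV. z$i * z$j * (LINT y|lborel. g y * partial i (partial j \<phi>) y)))\<bar> \<le> C * M * norm z ^ 3"
      by (rule pairing_taylor[OF \<phi>]) blast
    show thesis by (rule that[of "C * N"]) (unfold p_def q_def w0_def, rule C(2)[OF v])
  qed
  \<comment> \<open>First- and second-order coefficients, in the direction \<open>z\<close>, of the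
    mollification minus its penalty.\<close>
  define a where "a z = - (\<Sum>i\<in>UNIV. z$i * p i) - 2 * \<kappa> * (x \<bullet> z)" for z
  define Q where "Q z = (1/2) * (\<Sum>i\<in>UNIV. \<Sum>j\<in>UNIV. z$i * z$j * q i j) - \<kappa> * (norm z)\<^sup>2" for z
  have sc: "s * a z + s\<^sup>2 * Q z \<le> s ^ 3 * (C * norm z ^ 3)" if s: "s > 0" for s z
  proof -
    have e: "(LINT y|lborel. v y * \<rho> (y - (x + s *\<^sub>R z))) = (LINT y|lborel. v y * \<phi> (y - s *\<^sub>R z))"
      by (simp add: \<phi>_def algebra_simps)
    have n: "(norm (x + s *\<^sub>R z))\<^sup>2 = (norm x)\<^sup>2 + 2 * s * (x \<bullet> z) + s\<^sup>2 * (norm z)\<^sup>2"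
      unfolding power2_norm_eq_inner by (simp add: inner_add_left inner_add_right inner_commute power2_eq_square algebra_simps)
    have "(LINT y|lborel. v y * \<phi> (y - s *\<^sub>R z)) - w0 \<le> \<kappa> * (2 * s * (x \<bullet> z) + s\<^sup>2 * (norm z)\<^sup>2)"
      using max[of "s *\<^sub>R z"] unfolding e n by (simp add: w0_def \<phi>_def algebra_simps)
    moreover have "\<bar>(LINT y|lborel. v y * \<phi> (y - s *\<^sub>R z)) - (w0 - s * (\<Sum>i\<in>UNIV. z$i * p i)
       + s\<^sup>2 * ((1/2) * (\<Sum>i\<in>UNIV. \<Sum>j\<in>UNIV. z$i * z$j * q i j)))\<bar> \<le> s ^ 3 * (C * norm z ^ 3)"
      using C[of "s *\<^sub>R z"] s by (simp add: sum_distrib_left power_mult_distrib power2_eq_square mult_ac)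
    ultimately have "- (s * (\<Sum>i\<in>UNIV. z$i * p i)) + s\<^sup>2 * ((1/2) * (\<Sum>i\<in>UNIV. \<Sum>j\<in>UNIV. z$i * z$j * q i j))
      - \<kappa> * (2 * s * (x \<bullet> z) + s\<^sup>2 * (norm z)\<^sup>2) \<le> s ^ 3 * (C * norm z ^ 3)"
      by linarith
    then show ?thesis unfolding a_def Q_def by (simp add: algebra_simps)
  qed
  \<comment> \<open>\<open>a\<close> is odd and nowhere positive.\<close>
  have az: "a z = 0" for z
  proof -
    have "a z \<le> 0" "a (- z) \<le> 0" using taylor_nonpos(1)[OF sc] by blast+
    moreover have "a (- z) = - a z" by (simp add: a_def sum_negf)
    ultimately show ?thesis by linarith
  qed
  have Qz: "(\<Sum>i\<in>UNIV. \<Sum>j\<in>UNIV. z$i * z$j * q i j) \<le> 2 * \<kappa> * (norm z)\<^sup>2" for z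
    using taylor_nonpos(2)[OF sc az, of z] by (simp add: Q_def)
  have "(\<Sum>k\<in>UNIV. \<Sum>i\<in>UNIV. \<Sum>j\<in>UNIV. R$i$k * R$j$k * q i j) \<le> (\<Sum>k\<in>UNIV. 2 * \<kappa> * (\<Sum>i\<in>UNIV. (R$i$k)\<^sup>2))"
  proof (rule sum_mono)
    fix k
    have "(norm (\<chi> i. R$i$k))\<^sup>2 = (\<Sum>i\<in>UNIV. (R$i$k)\<^sup>2)"
      unfolding power2_norm_eq_inner by (simp add: inner_vec_def power2_eq_square)
    then show "(\<Sum>i\<in>UNIV. \<Sum>j\<in>UNIV. R$i$k * R$j$k * q i j) \<le> 2 * \<kappa> * (\<Sum>i\<in>UNIV. (R$i$k)\<^sup>2)"
      using Qz[of "\<chi> i. R$i$k"] by simp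
  qed
  also have "\<dots> = 2 * (\<kappa> * (\<Sum>k\<in>UNIV. \<Sum>i\<in>UNIV. (R$i$k)\<^sup>2))" by (simp add: sum_distrib_left mult.assoc)
  finally have sec: "(1/2) * (\<Sum>k\<in>UNIV. \<Sum>i\<in>UNIV. \<Sum>j\<in>UNIV. R$i$k * R$j$k * q i j) \<le> \<kappa> * (\<Sum>k\<in>UNIV. \<Sum>i\<in>UNIV. (R$i$k)\<^sup>2)" by simp
  \<comment> \<open>The first-order condition in the direction \<open>b x\<close> converts transport
    by the unbounded drift into a derivative of the penalty; linear growth bounds
    \<open>x \<bullet> b x\<close> by a multiple of \<open>1 + (norm x)^2\<close>.\<close>
  have fst: "- (\<Sum>i\<in>UNIV. b x $ i * p i) = 2 * \<kappa> * (x \<bullet> b x)" using az[of "b x"] by (simp add: a_def)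
  have "x \<bullet> b x \<le> norm x * norm (b x)" by (rule norm_cauchy_schwarz)
  also have "\<dots> \<le> norm x * (norm (b 0) + L * norm x)" by (intro mult_left_mono linear_growth) simp
  also have "\<dots> \<le> (norm (b 0) + L) * (1 + (norm x)\<^sup>2)"
  proof -
    have "norm x \<le> 1 + (norm x)\<^sup>2"
    proof -
      have "0 \<le> (norm x - 1)\<^sup>2" by simp
      then have "2 * norm x \<le> 1 + (norm x)\<^sup>2" by (simp add: power2_diff)
      then show ?thesis using norm_ge_zero[of x] by linarith
    qed
    then have "norm (b 0) * norm x \<le> norm (b 0) * (1 + (norm x)\<^sup>2)" by (rule mult_left_mono) simp
    moreover have "L * (norm x)\<^sup>2 \<le> L * (1 + (norm x)\<^sup>2)" using L_nonneg by (intro mult_left_mono) simp_all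
    ultimately show ?thesis by (simp add: algebra_simps power2_eq_square)
  qed
  finally have "2 * \<kappa> * (x \<bullet> b x) \<le> 2 * \<kappa> * ((norm (b 0) + L) * (1 + (norm x)\<^sup>2))" using \<kappa> by (intro mult_left_mono) auto
  then have fst': "- (\<Sum>i\<in>UNIV. b x $ i * p i) \<le> 2 * (norm (b 0) + L) * (\<kappa> * (1 + (norm x)\<^sup>2))"
    unfolding fst by (simp add: algebra_simps)
  have sec': "\<kappa> * (\<Sum>k\<in>UNIV. \<Sum>i\<in>UNIV. (R$i$k)\<^sup>2) \<le> (\<Sum>k\<in>UNIV. \<Sum>i\<in>UNIV. (R$i$k)\<^sup>2) * (\<kappa> * (1 + (norm x)\<^sup>2))"
  proof -
    have "0 \<le> (\<Sum>k\<in>UNIV. \<Sum>i\<in>UNIV. (R$i$k)\<^sup>2)" by (intro sum_nonneg) simp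
    then have "0 \<le> (\<Sum>k\<in>UNIV. \<Sum>i\<in>UNIV. (R$i$k)\<^sup>2) * (\<kappa> * (norm x)\<^sup>2)" using \<kappa> by simp
    then show ?thesis by (simp add: algebra_simps)
  qed
  have com: "\<bar>(LINT y|lborel. v y * flux \<phi> y) - (\<Sum>i\<in>UNIV. b x $ i * p i)\<bar> \<le> \<omega> * (real CARD('n) * L + real CARD('n) * K)"
    unfolding p_def \<phi>_def by (rule commutator_bound[OF \<rho> \<gamma> v osc \<omega>])
  have "(LINT y|lborel. v y * adj \<phi> y) = (1/2) * (\<Sum>k\<in>UNIV. \<Sum>i\<in>UNIV. \<Sum>j\<in>UNIV. R$i$k * R$j$k * q i j) - (LINT y|lborel. v y * flux \<phi> y)"
    unfolding q_def by (rule adj_pairing[OF \<phi> v])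
  also have "\<dots> \<le> \<omega> * (real CARD('n) * L + real CARD('n) * K) + ((\<Sum>k\<in>UNIV. \<Sum>i\<in>UNIV. (R$i$k)\<^sup>2) * (\<kappa> * (1 + (norm x)\<^sup>2)) + 2 * (norm (b 0) + L) * (\<kappa> * (1 + (norm x)\<^sup>2)))"
    using sec sec' fst' com by linarith
  finally show ?thesis by (simp only: distrib_right)
qed

end

lemma mollification_le:
  fixes v \<rho> :: "real^'n \<Rightarrow> real"
  assumes \<rho>: "integrable lborel \<rho>" "\<And>y. 0 \<le> \<rho> y" "(LINT y|lborel. \<rho> y) = 1" "\<And>y. r \<le> norm y \<Longrightarrow> \<rho> y = 0"
    and v: "v \<in> borel_measurable borel" "\<And>y. \<bar>v y\<bar> \<le> N" and a: "\<And>y. norm (y - x) \<le> r \<Longrightarrow> v y \<le> a"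
  shows "(LINT y|lborel. v y * \<rho> (y - x)) \<le> a"
proof -
  have i: "integrable lborel (\<lambda>y. \<rho> (y - x))" using integrable_translate[OF \<rho>(1), of "- x"] by simp
  have "(LINT y|lborel. v y * \<rho> (y - x)) \<le> (LINT y|lborel. a * \<rho> (y - x))"
  proof (rule integral_mono)
    show "integrable lborel (\<lambda>y. v y * \<rho> (y - x))" by (rule integral_mult_bound(1)[OF i v])
    show "integrable lborel (\<lambda>y. a * \<rho> (y - x))" using i by simp
    show "v y * \<rho> (y - x) \<le> a * \<rho> (y - x)" for y
      by (cases "norm (y - x) \<le> r") (auto intro!: mult_right_mono a \<rho>(2) simp: \<rho>(4))
  qed
  also have "\<dots> = a * (LINT y|lborel. \<rho> (y + (- x)))" by simp
  also have "(LINT y|lborel. \<rho> (y + (- x))) = 1"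
    using integral_translate[of \<rho> "- x"] borel_measurable_integrable[OF \<rho>(1)] \<rho>(3) by simp
  finally show ?thesis by simp
qed

lemma mollification_ge:
  fixes v \<rho> :: "real^'n \<Rightarrow> real"
  assumes \<rho>: "integrable lborel \<rho>" "\<And>y. 0 \<le> \<rho> y" "(LINT y|lborel. \<rho> y) = 1" "\<And>y. r \<le> norm y \<Longrightarrow> \<rho> y = 0"
    and v: "v \<in> borel_measurable borel" "\<And>y. \<bar>v y\<bar> \<le> N" and a: "\<And>y. norm (y - x) \<le> r \<Longrightarrow> a \<le> v y"
  shows "a \<le> (LINT y|lborel. v y * \<rho> (y - x))"
proof -
  have vm: "(\<lambda>y. - v y) \<in> borel_measurable borel" using v(1) by simp
  have vb: "\<bar>- v y\<bar> \<le> N" for y using v(2) by simp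
  have "(LINT y|lborel. (- v y) * \<rho> (y - x)) \<le> - a"
    using a by (intro mollification_le[where r=r and N=N, OF \<rho> vm vb]) auto
  then show ?thesis by simp
qed

context smooth_euler_scheme
begin

text \<open>Since \<open>v\<close> itself need not be differentiable in \<open>x\<close>, the argument is run for a mollification in \<open>x\<close>;
  the penalty \<open>\<kappa> * exp ((c + 1) * t) * (1 + \<bar>x\<bar>\<^sup>2)\<close> forces a maximum to exist and dominates the
  second-order terms it creates.\<close>
lemma mollified_max_principle:
  fixes v :: "real \<Rightarrow> real^'n \<Rightarrow> real" and \<rho> \<gamma> :: "real^'n \<Rightarrow> real"
  assumes vc: "continuous_on ({0..T} \<times> UNIV) (\<lambda>(t, x). v t x)"
    and vN: "\<And>t x. t \<in> {0..T} \<Longrightarrow> \<bar>v t x\<bar> \<le> N"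
    and osc: "\<And>t x y. t \<in> {0..T} \<Longrightarrow> norm (y - x) \<le> r \<Longrightarrow> \<bar>v t y - v t x\<bar> \<le> \<epsilon>" and \<epsilon>: "\<epsilon> > 0"
    and veq: "\<And>\<phi> t. \<phi> \<in> test_functions \<Longrightarrow> t \<in> {0..T} \<Longrightarrow>
      ((\<lambda>r. LINT x|lborel. v r x * \<phi> x) has_real_derivative (LINT x|lborel. v t x * adj \<phi> x)) (at t within {0..T})"
    and v0: "\<And>x. v 0 x \<le> m" and t: "t \<in> {0..T}"
    and \<rho>: "\<rho> \<in> test_functions" "\<And>y. 0 \<le> \<rho> y" "(LINT y|lborel. \<rho> y) = 1" "\<And>y. r \<le> norm y \<Longrightarrow> \<rho> y = 0"
    and \<gamma>: "\<And>y. 0 \<le> \<gamma> y" "\<And>i y. partial i \<rho> y = - y$i * \<gamma> y"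
    and \<kappa>: "\<kappa> > 0"
  defines "c \<equiv> (\<Sum>k\<in>UNIV. \<Sum>i\<in>UNIV. (R$i$k)\<^sup>2) + 2 * (norm (b 0) + L)"
    and "E \<equiv> \<epsilon> * (real CARD('n) * L + real CARD('n) * K)"
  shows "(LINT y|lborel. v t y * \<rho> (y - x)) \<le> m + E * t + \<kappa> * exp ((c + 1) * t) * (1 + (norm x)\<^sup>2)"
proof (rule ccontr)
  assume neg: "\<not> ?thesis"
  define w where "w t x = (LINT y|lborel. v t y * \<rho> (y - x))" for t x
  define p where "p t x = \<kappa> * exp ((c + 1) * t) * (1 + (norm x)\<^sup>2)" for t and x :: "real^'n"
  \<comment> \<open>\<open>Z\<close> is positive at the given point by assumption and negative for
    large \<open>x\<close>, so it has a positive maximum at some \<open>(t0, x0)\<close>; the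
    initial bound forces \<open>t0 > 0\<close>.\<close>
  define Z where "Z t x = w t x - m - E * t - p t x" for t x
  have K0: "K \<ge> 0" using boundB[of 0 undefined undefined] by linarith
  have c0: "c \<ge> 0" unfolding c_def by (intro add_nonneg_nonneg sum_nonneg mult_nonneg_nonneg L_nonneg) auto
  have E0: "E \<ge> 0" unfolding E_def using \<epsilon> L_nonneg K0 by simp
  have Ztx: "Z t x > 0" using neg by (simp add: Z_def w_def p_def)
  have T: "0 \<le> t" "t \<le> T" using t by auto
  have N0: "N \<ge> 0" using vN[OF t, of 0] by linarith
  note vm = continuous_slice(2)[OF vc]
  note \<rho>i = test_function_integrable[OF \<rho>(1)]
  have wN: "w s z \<le> N" if "s \<in> {0..T}" for s z
    unfolding w_def using vN[OF that] abs_le_D1 by (intro mollification_le[where r=r and N=N, OF \<rho>i \<rho>(2-4) vm[OF that]]) auto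
  have w0: "w 0 z \<le> m" for z
    unfolding w_def using T v0 vN by (intro mollification_le[where r=r and N=N, OF \<rho>i \<rho>(2-4) vm]) auto
  have pk: "\<kappa> * (1 + (norm z)\<^sup>2) \<le> p s z" if "0 \<le> s" for s z
  proof -
    have "1 \<le> exp ((c + 1) * s)" using c0 that by simp
    then have "\<kappa> * 1 \<le> \<kappa> * exp ((c + 1) * s)" using \<kappa> by (intro mult_left_mono) auto
    then show ?thesis unfolding p_def by (intro mult_right_mono) auto
  qed
  \<comment> \<open>Beyond this radius the penalty alone exceeds \<open>N + |m|\<close>.\<close>
  define \<rho>0 where "\<rho>0 = sqrt ((N + \<bar>m\<bar>) / \<kappa>)"
  have out: "Z s z < 0" if s: "s \<in> {0..T}" and z: "\<rho>0 \<le> norm z" for s z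
  proof -
    have "0 \<le> (N + \<bar>m\<bar>) / \<kappa>" using N0 \<kappa> by simp
    then have "(N + \<bar>m\<bar>) / \<kappa> \<le> (norm z)\<^sup>2" using z unfolding \<rho>0_def by (metis power_mono real_sqrt_ge_zero real_sqrt_pow2)
    then have "N + \<bar>m\<bar> \<le> \<kappa> * (norm z)\<^sup>2" using \<kappa> by (simp add: pos_divide_le_eq mult.commute)
    then have "N + \<bar>m\<bar> < p s z" using pk[of s z] s \<kappa> by (simp add: distrib_left)
    moreover have "0 \<le> E * s" using E0 s by simp
    ultimately show ?thesis using wN[OF s, of z] unfolding Z_def by linarith
  qed
  let ?D = "{0..T} \<times> cball (0::real^'n) \<rho>0"
  have "compact ?D" by (intro compact_Times) auto
  moreover have tD: "(t, x) \<in> ?D" using out[OF t, of x] Ztx t by (force simp: not_le)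
  moreover have "continuous_on ?D (\<lambda>(t, x). Z t x)"
  proof -
    have "continuous_on ?D (\<lambda>(t, x). w t x)"
      unfolding w_def by (rule continuous_on_subset[OF mollification_continuous[OF \<rho>(1) vc vN]]) auto
    then show ?thesis unfolding Z_def p_def split_beta by (intro continuous_intros)
  qed
  ultimately have "\<exists>q\<in>?D. \<forall>y\<in>?D. (case y of (t, x) \<Rightarrow> Z t x) \<le> (case q of (t, x) \<Rightarrow> Z t x)"
    by (intro continuous_attains_sup) blast+
  then obtain q where q: "q \<in> ?D" and qm: "\<And>y. y \<in> ?D \<Longrightarrow> (case y of (t, x) \<Rightarrow> Z t x) \<le> (case q of (t, x) \<Rightarrow> Z t x)"
    by blast
  obtain t0 x0 where q0: "q = (t0, x0)" by (cases q)
  have t0: "t0 \<in> {0..T}" using q q0 by auto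
  have Z0: "Z t0 x0 > 0" using qm[OF tD] Ztx q0 by simp
  have max: "Z s z \<le> Z t0 x0" if s: "s \<in> {0..T}" for s z
  proof (cases "norm z \<le> \<rho>0")
    case True
    then show ?thesis using qm[of "(s, z)"] s q0 by simp
  next
    case False
    then show ?thesis using out[OF s, of z] Z0 by simp
  qed
  have "t0 \<noteq> 0"
  proof
    assume "t0 = 0"
    moreover have "0 \<le> p 0 x0" using \<kappa> unfolding p_def by simp
    ultimately show False using Z0 w0[of x0] by (simp add: Z_def)
  qed
  then have t0p: "0 < t0" "t0 \<le> T" using t0 by auto
  let ?\<phi> = "\<lambda>y. \<rho> (y - x0)"
  have \<phi>: "?\<phi> \<in> test_functions" by (rule test_function_translate[OF \<rho>(1)])
  have "((\<lambda>s. Z s x0) has_real_derivative (LINT y|lborel. v t0 y * adj ?\<phi> y) - E - (c + 1) * p t0 x0) (at t0 within {0..T})"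
    unfolding Z_def w_def p_def by (rule derivative_eq_intros veq[OF \<phi> t0] refl | simp)+
  then have 1: "(LINT y|lborel. v t0 y * adj ?\<phi> y) - E - (c + 1) * p t0 x0 \<ge> 0"
    by (rule nonneg_derivative_at_max[OF _ t0p]) (use max t0 in auto)
  have mx: "(LINT y|lborel. v t0 y * \<rho> (y - (x0 + z))) - \<kappa> * exp ((c + 1) * t0) * (1 + (norm (x0 + z))\<^sup>2)
       \<le> (LINT y|lborel. v t0 y * \<rho> (y - x0)) - \<kappa> * exp ((c + 1) * t0) * (1 + (norm x0)\<^sup>2)" for z
    using max[OF t0, of "x0 + z"] unfolding Z_def w_def p_def by linarith
  have "(LINT y|lborel. v t0 y * adj ?\<phi> y) \<le> \<epsilon> * (real CARD('n) * L + real CARD('n) * K)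
    + ((\<Sum>k\<in>UNIV. \<Sum>i\<in>UNIV. (R$i$k)\<^sup>2) + 2 * (norm (b 0) + L)) * (\<kappa> * exp ((c + 1) * t0) * (1 + (norm x0)\<^sup>2))"
    using \<epsilon> \<kappa> by (intro adj_pairing_at_max[OF \<rho> \<gamma> vm[OF t0] vN[OF t0] osc[OF t0] _ mx]) auto
  then have "(LINT y|lborel. v t0 y * adj ?\<phi> y) \<le> E + c * p t0 x0" unfolding E_def c_def p_def .
  \<comment> \<open>The maximum in time forces the pairing to be at least
    \<open>E + (c + 1) p\<close>, while the maximum in space makes it at most
    \<open>E + c p\<close>; the extra 1 in the exponent yields the contradiction.\<close>
  moreover have "p t0 x0 > 0" unfolding p_def using \<kappa> by (intro mult_pos_pos add_pos_nonneg) auto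
  ultimately show False using 1 by (simp add: distrib_right)
qed

text \<open>The same \<epsilon> is taken for the oscillation on the support of the mollifier and for
  the penalty constant. All errors at the fixed point \<open>(t, x)\<close> are then \<epsilon>
  times the constant \<open>Q\<close>, and \<epsilon> tends to 0.\<close>

lemma weak_max_principle:
  fixes v :: "real \<Rightarrow> real^'n \<Rightarrow> real"
  assumes vc: "continuous_on ({0..T} \<times> UNIV) (\<lambda>(t, x). v t x)"
    and vN: "\<And>t x. t \<in> {0..T} \<Longrightarrow> \<bar>v t x\<bar> \<le> N"
    and vu: "\<And>\<epsilon>. \<epsilon> > 0 \<Longrightarrow> \<exists>\<delta>>0. \<forall>t\<in>{0..T}. \<forall>x y. norm y < \<delta> \<longrightarrow> \<bar>v t (x + y) - v t x\<bar> \<le> \<epsilon>"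
    and veq: "\<And>\<phi> t. \<phi> \<in> test_functions \<Longrightarrow> t \<in> {0..T} \<Longrightarrow>
      ((\<lambda>r. LINT x|lborel. v r x * \<phi> x) has_real_derivative (LINT x|lborel. v t x * adj \<phi> x)) (at t within {0..T})"
    and v0: "\<And>x. v 0 x \<le> m" and t: "t \<in> {0..T}"
  shows "v t x \<le> m"
proof -
  define c where "c = (\<Sum>k\<in>UNIV. \<Sum>i\<in>UNIV. (R$i$k)\<^sup>2) + 2 * (norm (b 0) + L)"
  define E where "E = real CARD('n) * L + real CARD('n) * K"
  have K0: "K \<ge> 0" using boundB[of 0 undefined undefined] by linarith
  define Q where "Q = 1 + E * t + exp ((c + 1) * t) * (1 + (norm x)\<^sup>2)"
  have "v t x \<le> m + \<epsilon> * Q" if \<epsilon>: "\<epsilon> > 0" for \<epsilon>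
  proof -
    obtain \<delta> where \<delta>: "\<delta> > 0" and vd: "\<And>t x y. t \<in> {0..T} \<Longrightarrow> norm y < \<delta> \<Longrightarrow> \<bar>v t (x + y) - v t x\<bar> \<le> \<epsilon>"
      using vu[OF \<epsilon>] by blast
    have osc: "\<bar>v t y - v t x\<bar> \<le> \<epsilon>" if "t \<in> {0..T}" "norm (y - x) \<le> \<delta> / 2" for t x y
      using vd[of t "y - x" x] that \<delta> by simp
    have "\<delta> / 2 > 0" using \<delta> by simp
    then obtain \<rho> \<gamma> :: "real^'n \<Rightarrow> real" where \<rho>: "\<rho> \<in> test_functions" "\<And>x. 0 \<le> \<rho> x" "(LINT x|lborel. \<rho> x) = 1"
      "\<And>x. \<delta> / 2 \<le> norm x \<Longrightarrow> \<rho> x = 0" and \<gamma>: "\<And>x. 0 \<le> \<gamma> x" "\<And>i x. partial i \<rho> x = - x$i * \<gamma> x"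
      by (rule mollifier_exists) blast
    note vm = continuous_slice(2)[OF vc t]
    have lo: "v t x - \<epsilon> \<le> v t y" if "norm (y - x) \<le> \<delta> / 2" for y using osc[OF t that] by linarith
    have "v t x - \<epsilon> \<le> (LINT y|lborel. v t y * \<rho> (y - x))"
      by (rule mollification_ge[OF test_function_integrable[OF \<rho>(1)] \<rho>(2-4) vm vN[OF t] lo])
    also have "\<dots> \<le> m + \<epsilon> * (real CARD('n) * L + real CARD('n) * K) * t + \<epsilon> * exp (((\<Sum>k\<in>UNIV. \<Sum>i\<in>UNIV. (R$i$k)\<^sup>2) + 2 * (norm (b 0) + L) + 1) * t) * (1 + (norm x)\<^sup>2)"
      by (rule mollified_max_principle[OF vc vN osc \<epsilon> veq v0 t \<rho> \<gamma> \<epsilon>])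
    finally show ?thesis unfolding Q_def c_def E_def by (simp add: algebra_simps)
  qed
  moreover have "((\<lambda>\<epsilon>. m + \<epsilon> * Q) \<longlongrightarrow> m + 0 * Q) (at_right 0)" by (intro tendsto_intros)
  ultimately have "v t x \<le> m + 0 * Q"
    by (intro tendsto_lowerbound[of "\<lambda>\<epsilon>. m + \<epsilon> * Q" _ "at_right 0"]) (auto simp: eventually_at_right_less intro: eventually_mono[OF eventually_at_right_less])
  then show ?thesis by simp
qed

text \<open>The maximum principle for \<open>v\<close> and \<open>- v\<close>. It is used with
  \<open>m = 0\<close> for the Cauchy problem, and with \<open>m\<close> the bound of
  \<open>u\<close> in the elliptic case.\<close>

lemma weak_solution_0:
  fixes v :: "real \<Rightarrow> real^'n \<Rightarrow> real"
  assumes vc: "continuous_on ({0..T} \<times> UNIV) (\<lambda>(t, x). v t x)"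
    and vN: "\<And>t x. t \<in> {0..T} \<Longrightarrow> \<bar>v t x\<bar> \<le> N"
    and vu: "\<And>\<epsilon>. \<epsilon> > 0 \<Longrightarrow> \<exists>\<delta>>0. \<forall>t\<in>{0..T}. \<forall>x y. norm y < \<delta> \<longrightarrow> \<bar>v t (x + y) - v t x\<bar> \<le> \<epsilon>"
    and veq: "\<And>\<phi> t. \<phi> \<in> test_functions \<Longrightarrow> t \<in> {0..T} \<Longrightarrow>
      ((\<lambda>r. LINT x|lborel. v r x * \<phi> x) has_real_derivative (LINT x|lborel. v t x * adj \<phi> x)) (at t within {0..T})"
    and v0: "\<And>x. \<bar>v 0 x\<bar> \<le> m" and t: "t \<in> {0..T}"
  shows "\<bar>v t x\<bar> \<le> m"
proof -
  have "v t x \<le> m" by (rule weak_max_principle[OF vc vN vu veq abs_le_D1[OF v0] t])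
  moreover have "- v t x \<le> m"
  proof (rule weak_max_principle[where v="\<lambda>t x. - v t x" and T=T and N=N])
    show "continuous_on ({0..T} \<times> UNIV) (\<lambda>(t, x). - v t x)"
      using continuous_on_minus[OF vc] by (simp add: split_beta)
    show "\<exists>\<delta>>0. \<forall>t\<in>{0..T}. \<forall>x y. norm y < \<delta> \<longrightarrow> \<bar>- v t (x + y) - - v t x\<bar> \<le> \<epsilon>" if "\<epsilon> > 0" for \<epsilon>
    proof -
      have "\<bar>- v t (x + y) - - v t x\<bar> = \<bar>v t (x + y) - v t x\<bar>" for t x y by linarith
      then show ?thesis using vu[OF that] by simp
    qed
    show "((\<lambda>r. LINT x|lborel. - v r x * \<phi> x) has_real_derivative (LINT x|lborel. - v t x * adj \<phi> x)) (at t within {0..T})"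
      if "\<phi> \<in> test_functions" "t \<in> {0..T}" for \<phi> t
      using DERIV_minus[OF veq[OF that]] by simp
    show "- v 0 x \<le> m" for x using v0[of x] by linarith
  qed (use vN t in auto)
  ultimately show ?thesis by linarith
qed

text \<open>If \<open>\<lambda> u - A u = 0\<close>, then \<open>exp (\<lambda> t) u(x)\<close> solves the homogeneous Cauchy problem, so it is bounded
  in time by its initial value.\<close>
lemma elliptic_weak_solution_0:
  fixes u :: "real^'n \<Rightarrow> real"
  assumes uc: "uniformly_continuous_on UNIV u" and uN: "\<And>x. \<bar>u x\<bar> \<le> N" and l: "l > 0"
    and ueq: "\<And>\<phi>. \<phi> \<in> test_functions \<Longrightarrow> l * (LINT x|lborel. u x * \<phi> x) = (LINT x|lborel. u x * adj \<phi> x)"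
  shows "u x = 0"
proof (rule ccontr)
  assume ux: "u x \<noteq> 0"
  \<comment> \<open>Chosen so that \<open>l T |u x| = N + l |u x|\<close> exceeds \<open>N\<close>;
    then so does \<open>exp (l T) |u x|\<close>, against the bound by the initial value.\<close>
  define T where "T = N / (l * \<bar>u x\<bar>) + 1"
  have N0: "N \<ge> 0" using uN[of x] by linarith
  then have T0: "T \<ge> 0" unfolding T_def using l by simp
  define G where "G = exp (l * T)"
  have G: "exp (l * t) \<le> G" if "t \<in> {0..T}" for t unfolding G_def using that l by simp
  have G0: "G > 0" unfolding G_def by simp
  have "\<bar>exp (l * T) * u x\<bar> \<le> N"
  proof (rule weak_solution_0[where v="\<lambda>t x. exp (l * t) * u x" and T=T and N="G * N" and t=T])
    have "continuous_on UNIV u" by (rule uniformly_continuous_imp_continuous[OF uc])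
    then have "continuous_on ({0..T} \<times> UNIV) (u \<circ> snd)"
      by (intro continuous_on_compose continuous_intros) (auto intro: continuous_on_subset)
    then show "continuous_on ({0..T} \<times> UNIV) (\<lambda>(t, x). exp (l * t) * u x)"
      unfolding split_beta comp_def by (intro continuous_intros)
    show "\<bar>exp (l * t) * u x\<bar> \<le> G * N" if "t \<in> {0..T}" for t x
      using mult_mono[OF G[OF that] uN[of x]] G0 by (simp add: abs_mult)
    show "\<exists>\<delta>>0. \<forall>t\<in>{0..T}. \<forall>x y. norm y < \<delta> \<longrightarrow> \<bar>exp (l * t) * u (x + y) - exp (l * t) * u x\<bar> \<le> \<epsilon>"
      if e: "\<epsilon> > 0" for \<epsilon>
    proof -
      have "\<epsilon> / G > 0" using e G0 by simp
      then obtain \<delta> where d: "\<delta> > 0" "\<And>x y. dist y x < \<delta> \<Longrightarrow> dist (u y) (u x) < \<epsilon> / G"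
        using uc unfolding uniformly_continuous_on_def by blast
      have "\<bar>exp (l * t) * u (x + y) - exp (l * t) * u x\<bar> \<le> \<epsilon>" if "t \<in> {0..T}" "norm y < \<delta>" for t x y
      proof -
        have "\<bar>u (x + y) - u x\<bar> \<le> \<epsilon> / G" using d(2)[of "x + y" x] that(2) by (simp add: dist_norm dist_real_def)
        then have "exp (l * t) * \<bar>u (x + y) - u x\<bar> \<le> G * (\<epsilon> / G)" using G[OF that(1)] G0 by (intro mult_mono) auto
        then show ?thesis using G0 by (simp add: right_diff_distrib[symmetric] abs_mult)
      qed
      then show ?thesis using d(1) by blast
    qed
    show "((\<lambda>r. LINT x|lborel. exp (l * r) * u x * \<phi> x) has_real_derivative (LINT x|lborel. exp (l * t) * u x * adj \<phi> x)) (at t within {0..T})"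
      if \<phi>: "\<phi> \<in> test_functions" and "t \<in> {0..T}" for \<phi> t
    proof -
      have "((\<lambda>r. exp (l * r) * (LINT x|lborel. u x * \<phi> x)) has_real_derivative exp (l * t) * (l * (LINT x|lborel. u x * \<phi> x))) (at t within {0..T})"
        by (rule derivative_eq_intros refl | simp)+
      then show ?thesis unfolding ueq[OF \<phi>] by (simp add: mult.assoc)
    qed
    show "\<bar>exp (l * 0) * u x\<bar> \<le> N" for x using uN by simp
    show "T \<in> {0..T}" using T0 by simp
  qed
  moreover have "N < exp (l * T) * \<bar>u x\<bar>"
  proof -
    have "(l * T) * \<bar>u x\<bar> = N + l * \<bar>u x\<bar>" unfolding T_def using l ux by (simp add: distrib_left distrib_right)
    moreover have "0 < l * \<bar>u x\<bar>" using l ux by simp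
    ultimately have "N < (l * T) * \<bar>u x\<bar>" by linarith
    also have "\<dots> \<le> exp (l * T) * \<bar>u x\<bar>" using exp_ge_add_one_self[of "l * T"] by (intro mult_right_mono) linarith+
    finally show ?thesis .
  qed
  ultimately show False by (simp add: abs_mult)
qed

end

section \<open>The resolvent\<close>

text \<open>One integrable product bound settles both the exchange of integrals and the
  integrability of the two partial integrals.\<close>

lemma fubini_dominated:
  fixes h :: "'a::euclidean_space \<Rightarrow> 'b::euclidean_space \<Rightarrow> real"
  assumes hm: "(\<lambda>(s, x). h s x) \<in> borel_measurable borel" and \<theta>: "integrable lborel \<theta>" and \<psi>: "integrable lborel \<psi>"
    and le: "\<And>s x. \<bar>h s x\<bar> \<le> \<theta> s * \<psi> x"
  shows "(LINT x|lborel. LINT s|lborel. h s x) = (LINT s|lborel. LINT x|lborel. h s x)"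
    "integrable lborel (\<lambda>s. LINT x|lborel. h s x)" "integrable lborel (\<lambda>x. LINT s|lborel. h s x)"
proof -
  have [measurable]: "\<theta> \<in> borel_measurable borel" "\<psi> \<in> borel_measurable borel"
    using borel_measurable_integrable[OF \<theta>] borel_measurable_integrable[OF \<psi>] by simp_all
  have hm': "case_prod h \<in> borel_measurable (lborel \<Otimes>\<^sub>M lborel)" using hm by (simp add: lborel_prod)
  have "integrable (lborel \<Otimes>\<^sub>M lborel) (\<lambda>(s, x). \<theta> s * \<psi> x)"
  proof (rule lborel_pair.Fubini_integrable)
    show "integrable lborel (\<lambda>s. LINT x|lborel. norm (case (s, x) of (s, x) \<Rightarrow> \<theta> s * \<psi> x))"
      using integrable_abs[OF \<theta>] by (simp add: abs_mult)
    show "AE s in lborel. integrable lborel (\<lambda>x. case (s, x) of (s, x) \<Rightarrow> \<theta> s * \<psi> x)" using \<psi> by simp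
  qed measurable
  then have i: "integrable (lborel \<Otimes>\<^sub>M lborel) (case_prod h)"
  proof (rule Bochner_Integration.integrable_bound[OF _ hm'])
    show "AE p in lborel \<Otimes>\<^sub>M lborel. norm (case_prod h p) \<le> norm (case p of (s, x) \<Rightarrow> \<theta> s * \<psi> x)"
      by (intro AE_I2) (auto intro!: order_trans[OF le])
  qed
  show "(LINT x|lborel. LINT s|lborel. h s x) = (LINT s|lborel. LINT x|lborel. h s x)" by (rule lborel_pair.Fubini_integral[OF i])
  show "integrable lborel (\<lambda>s. LINT x|lborel. h s x)" by (rule lborel_pair.integrable_fst[OF i])
  show "integrable lborel (\<lambda>x. LINT s|lborel. h s x)" by (rule lborel_pair.integrable_snd[OF i])
qed

lemma continuous_on_indicator_measurable:
  fixes f :: "'a::topological_space \<Rightarrow> real"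
  assumes "continuous_on A f" "closed A"
  shows "(\<lambda>x. indicator A x * f x) \<in> borel_measurable borel"
  using borel_measurable_continuous_on_indicator[OF borel_closed[OF assms(2)] assms(1)] unfolding real_scaleR_def .

text \<open>Half-open intervals come from the step functions of the scheme; the endpoint is null. As
  \<open>c\<close> is continuous only on \<open>{0..T}\<close>, measurability is obtained through
  the indicator of a closed interval.\<close>

lemma indicator_integral_has_derivative:
  fixes c a :: "real \<Rightarrow> real"
  assumes c: "continuous_on {0..T} c" and a: "\<And>t. t \<in> {0..T} \<Longrightarrow> a t = a0 + (LINT s|lborel. indicator {0..<t} s * c s)"
    and t: "t \<in> {0..T}"
  shows "(a has_real_derivative c t) (at t within {0..T})"
proof -
  have "a t = a0 + integral {0..t} c" if t: "t \<in> {0..T}" for t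
  proof -
    have ct: "continuous_on {0..t} c" by (rule continuous_on_subset[OF c]) (use t in auto)
    have "(LINT s|lborel. indicator {0..<t} s * c s) = (LBINT s:{0..t}. c s)"
    proof -
      have "AE s in lborel. s \<noteq> t" by (rule AE_lborel_singleton)
      then have "AE s in lborel. indicator {0..<t} s * c s = indicator {0..t} s *\<^sub>R c s"
        by eventually_elim (auto simp: indicator_def)
      moreover have m1: "(\<lambda>s. indicator {0..t} s * c s) \<in> borel_measurable borel"
        by (rule continuous_on_indicator_measurable[OF ct]) simp
      moreover have "(\<lambda>s. indicator {0..<t} s * (indicator {0..t} s * c s)) \<in> borel_measurable borel"
        using m1 by measurable
      moreover have "indicator {0..<t} s * (indicator {0..t} s * c s) = indicator {0..<t} s * c s" for s
        by (auto simp: indicator_def)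
      ultimately show ?thesis unfolding set_lebesgue_integral_def by (intro integral_cong_AE) auto
    qed
    also have "\<dots> = integral {0..t} c"
      by (intro set_borel_integral_eq_integral borel_integrable_atLeastAtMost' ct)
    finally show ?thesis using a[OF t] by simp
  qed
  moreover have "((\<lambda>t. a0 + integral {0..t} c) has_real_derivative c t) (at t within {0..T})"
    using DERIV_add[OF DERIV_const integral_has_real_derivative[OF c t]] by simp
  ultimately show ?thesis using has_field_derivative_transform_within[of "\<lambda>t. a0 + integral {0..t} c" "c t" t "{0..T}" 1 a] t by simp
qed

lemma integrable_exp_decay:
  fixes l :: real assumes "l > 0"
  shows "integrable lborel (\<lambda>t. indicator {0..} t * exp (- l * t))"
proof -
  have "integrable lborel (\<lambda>x. indicator {0<..} x *\<^sub>R exp (- (x * l)))"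
    using integrable_I0i_exp_mscale[OF assms] by (simp add: set_integrable_def)
  then show ?thesis
  proof (rule integrable_cong_AE_imp)
    have "AE s in lborel. s \<noteq> (0::real)" by (rule AE_lborel_singleton)
    then show "AE t in lborel. indicator {0<..} t *\<^sub>R exp (- (t * l)) = indicator {0..} t * exp (- l * t)"
      by eventually_elim (auto simp: indicator_def mult.commute)
  qed measurable
qed

text \<open>The fundamental theorem for \<open>exp (- l t) a t\<close> on \<open>{0..n}\<close>,
  where the boundary term at \<open>n\<close> vanishes in the limit. In this way the Laplace
  transform turns the integrated equation into the resolvent equation.\<close>

lemma integral_exp_derivative:
  fixes a c :: "real \<Rightarrow> real"
  assumes l: "l > 0" and c: "continuous_on {0..} c" "\<And>t. t \<ge> 0 \<Longrightarrow> \<bar>c t\<bar> \<le> D" and ac: "continuous_on {0..} a" "\<And>t. t \<ge> 0 \<Longrightarrow> \<bar>a t\<bar> \<le> D"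
    and a: "\<And>t. t \<ge> 0 \<Longrightarrow> a t = a 0 + (LINT s|lborel. indicator {0..<t} s * c s)"
  shows "l * (LINT t|lborel. indicator {0..} t * exp (- l * t) * a t) =
    (LINT t|lborel. indicator {0..} t * exp (- l * t) * c t) + a 0"
proof -
  define F where "F t = exp (- l * t) * a t" for t
  define F' where "F' t = exp (- l * t) * c t - l * (exp (- l * t) * a t)" for t
  define e where "e t = indicator {0..} t * exp (- l * t)" for t
  have F'c: "continuous_on {0..} F'" unfolding F'_def by (intro continuous_intros c ac)
  have meas: "(\<lambda>t. e t * q t) \<in> borel_measurable borel" and int: "integrable lborel (\<lambda>t. e t * q t)"
    if q: "continuous_on {0..} q" "\<And>t. t \<ge> 0 \<Longrightarrow> \<bar>q t\<bar> \<le> D" for q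
  proof -
    have "(\<lambda>t. indicator {0..} t * (exp (- l * t) * q t)) \<in> borel_measurable borel"
      by (intro continuous_on_indicator_measurable continuous_intros q)
    then show m: "(\<lambda>t. e t * q t) \<in> borel_measurable borel" by (simp add: e_def mult.assoc)
    have D0: "D \<ge> 0" using q(2)[of 0] by linarith
    show "integrable lborel (\<lambda>t. e t * q t)"
    proof (rule Bochner_Integration.integrable_bound)
      show "integrable lborel (\<lambda>t. D * e t)" using integrable_exp_decay[OF l] by (simp add: e_def)
      show "(\<lambda>t. e t * q t) \<in> borel_measurable lborel" using m by simp
      show "AE t in lborel. norm (e t * q t) \<le> norm (D * e t)"
        using q(2) D0 by (intro AE_I2) (auto simp: e_def indicator_def abs_mult mult_right_mono mult.commute)
    qed
  qed
  note ic = int[OF c] and ia = int[OF ac]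
  have fin: "(LINT t|lborel. indicator {0..real n} t *\<^sub>R F' t) = F (real n) - F 0" for n
  proof (rule integral_FTC_Icc)
    show "continuous_on {0..real n} F'" by (rule continuous_on_subset[OF F'c]) auto
    show "(F has_vector_derivative F' t) (at t within {0..real n})" if "0 \<le> t" "t \<le> real n" for t
    proof -
      have "(a has_real_derivative c t) (at t within {0..real n})"
      proof (rule indicator_integral_has_derivative)
        show "continuous_on {0..real n} c" by (rule continuous_on_subset[OF c(1)]) auto
        show "a t = a 0 + (LINT s|lborel. indicator {0..<t} s * c s)" if "t \<in> {0..real n}" for t by (rule a) (use that in simp)
      qed (use that in auto)
      moreover have "((\<lambda>t. exp (- l * t)) has_real_derivative - l * exp (- l * t)) (at t within {0..real n})"
        by (auto intro!: derivative_eq_intros)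
      ultimately have "(F has_real_derivative F' t) (at t within {0..real n})"
        unfolding F_def F'_def by (intro DERIV_cong[OF DERIV_mult]) (assumption | simp add: mult_ac)+
      then show ?thesis by (simp add: has_real_derivative_iff_has_vector_derivative)
    qed
  qed simp
  have eF: "e t * c t - l * (e t * a t) = indicator {0..} t * F' t" for t
    by (simp add: e_def F'_def indicator_def)
  have "(\<lambda>n. LINT t|lborel. indicator {0..real n} t *\<^sub>R F' t) \<longlonglongrightarrow> (LINT t|lborel. e t * c t - l * (e t * a t))"
  proof (rule integral_dominated_convergence[where w="\<lambda>t. \<bar>e t * c t - l * (e t * a t)\<bar>"])
    show "(\<lambda>t. e t * c t - l * (e t * a t)) \<in> borel_measurable lborel" using meas[OF c] meas[OF ac] by simp
    show "(\<lambda>t. indicator {0..real n} t *\<^sub>R F' t) \<in> borel_measurable lborel" for n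
      using continuous_on_indicator_measurable[of "{0..real n}" F'] continuous_on_subset[OF F'c, of "{0..real n}"] by auto
    show "integrable lborel (\<lambda>t. \<bar>e t * c t - l * (e t * a t)\<bar>)" using ic ia by simp
    have "(\<lambda>n. indicator {0..real n} t *\<^sub>R F' t) \<longlonglongrightarrow> e t * c t - l * (e t * a t)" for t
    proof (rule tendsto_eventually)
      obtain N where "t \<le> real N" using real_arch_simple by blast
      then show "\<forall>\<^sub>F n in sequentially. indicator {0..real n} t *\<^sub>R F' t = e t * c t - l * (e t * a t)"
        unfolding eventually_sequentially eF by (intro exI[of _ N]) (auto simp: indicator_def)
    qed
    then show "AE t in lborel. (\<lambda>n. indicator {0..real n} t *\<^sub>R F' t) \<longlonglongrightarrow> e t * c t - l * (e t * a t)" by simp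
    show "AE t in lborel. norm (indicator {0..real n} t *\<^sub>R F' t) \<le> \<bar>e t * c t - l * (e t * a t)\<bar>" for n
      unfolding eF by (auto simp: indicator_def)
  qed
  moreover have "(\<lambda>n. F (real n) - F 0) \<longlonglongrightarrow> 0 - F 0"
  proof (rule tendsto_diff[OF _ tendsto_const], rule Lim_null_comparison)
    show "\<forall>\<^sub>F n in sequentially. norm (F (real n)) \<le> D * exp (- l * real n)"
    proof (intro always_eventually allI)
      fix n show "norm (F (real n)) \<le> D * exp (- l * real n)"
        unfolding F_def real_norm_def abs_mult abs_exp_cancel
        by (subst mult.commute) (rule mult_right_mono[OF ac(2)], simp_all)
    qed
    have "(\<lambda>n. D * exp (- l * real n)) \<longlonglongrightarrow> D * 0" using l by (intro tendsto_mult tendsto_const) real_asymp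
    then show "(\<lambda>n. D * exp (- l * real n)) \<longlonglongrightarrow> 0" by simp
  qed
  ultimately have "(LINT t|lborel. e t * c t - l * (e t * a t)) = 0 - F 0" unfolding fin by (rule LIMSEQ_unique)
  then have "(LINT t|lborel. e t * c t) - l * (LINT t|lborel. e t * a t) = - a 0"
    using ic ia by (simp add: F_def)
  then show ?thesis unfolding e_def by simp
qed

section \<open>The resolvent as Laplace transform of the semigroup\<close>

context sde
begin

text \<open>Up to time \<open>T\<close> the flow expands distances by at most
  \<open>exp (L T)\<close>, so the modulus of \<open>f\<close> is inherited uniformly on bounded
  time intervals.\<close>

lemma Pt_uniform_modulus:
  fixes f :: "real^'n \<Rightarrow> real"
  assumes f: "uniformly_continuous_on UNIV f" and C: "\<And>x. \<bar>f x\<bar> \<le> C" and \<epsilon>: "\<epsilon> > 0"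
  obtains \<delta> where "\<delta> > 0" "\<And>t x y. \<lbrakk>0 \<le> t; t \<le> T; norm (x - y) < \<delta>\<rbrakk> \<Longrightarrow> \<bar>Pt t f x - Pt t f y\<bar> \<le> \<epsilon>"
proof -
  obtain d where d: "d > 0" "\<And>x y. dist y x < d \<Longrightarrow> dist (f y) (f x) < \<epsilon>"
    using f \<epsilon> unfolding uniformly_continuous_on_def by blast
  have fm: "f \<in> borel_measurable borel"
    by (rule borel_measurable_continuous_onI[OF uniformly_continuous_imp_continuous[OF f]])
  show thesis
  proof (rule that[of "d / exp (L * T)"])
    show "d / exp (L * T) > 0" using d by simp
    fix t and x y :: "real^'n" assume t: "0 \<le> t" "t \<le> T" and xy: "norm (x - y) < d / exp (L * T)"
    note ix = Pt_bound(2)[OF t(1) fm C, of x] and iy = Pt_bound(2)[OF t(1) fm C, of y]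
    have "AE \<omega> in M. \<bar>f (X x t \<omega>) - f (X y t \<omega>)\<bar> \<le> \<epsilon>"
      using AE_flow_lipschitz[of x y]
    proof eventually_elim
      case (elim \<omega>)
      have "norm (X x t \<omega> - X y t \<omega>) \<le> exp (L * t) * norm (x - y)" using elim t by simp
      also have "\<dots> \<le> exp (L * T) * norm (x - y)" using t L_nonneg by (intro mult_right_mono) (auto simp: mult_left_mono)
      also have "\<dots> < d" using xy by (simp add: pos_less_divide_eq mult.commute)
      finally show ?case using d(2)[of "X x t \<omega>" "X y t \<omega>"] by (simp add: dist_norm dist_real_def)
    qed
    then have "expectation (\<lambda>\<omega>. \<bar>f (X x t \<omega>) - f (X y t \<omega>)\<bar>) \<le> expectation (\<lambda>_. \<epsilon>)"
      using ix iy by (intro integral_mono_AE) auto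
    moreover have "\<bar>expectation (\<lambda>\<omega>. f (X x t \<omega>) - f (X y t \<omega>))\<bar> \<le> expectation (\<lambda>\<omega>. \<bar>f (X x t \<omega>) - f (X y t \<omega>)\<bar>)"
      by (rule integral_abs_bound)
    ultimately show "\<bar>Pt t f x - Pt t f y\<bar> \<le> \<epsilon>"
      using ix iy by (simp add: transition_semigroup_def prob_space)
  qed
qed

lemma resolvent_integrand:
  fixes f :: "real^'n \<Rightarrow> real"
  assumes f: "uniformly_continuous_on UNIV f" and C: "\<And>x. \<bar>f x\<bar> \<le> C" and l: "l > 0"
  shows "integrable lborel (\<lambda>t. indicator {0..} t * (exp (- l * t) * Pt t f x))"
    and "\<bar>indicator {0..} t * (exp (- l * t) * Pt t f x)\<bar> \<le> C * (indicator {0..} t * exp (- l * t))"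
    and "(\<lambda>(t, x). indicator {0..} t * (exp (- l * t) * Pt t f x)) \<in> borel_measurable borel"
    and "(\<lambda>t. indicator {0..} t * (exp (- l * t) * Pt t f x)) \<in> borel_measurable borel"
proof -
  note fc = uniformly_continuous_imp_continuous[OF f]
  have fm: "f \<in> borel_measurable borel" by (rule borel_measurable_continuous_onI[OF fc])
  have C0: "C \<ge> 0" using C[of 0] by linarith
  show le: "\<bar>indicator {0..} t * (exp (- l * t) * Pt t f x)\<bar> \<le> C * (indicator {0..} t * exp (- l * t))" for t
    using Pt_bound(1)[OF _ fm C, of t x] by (auto simp: indicator_def abs_mult mult_right_mono mult.commute)
  have jc: "continuous_on ({0..} \<times> UNIV) (\<lambda>p. exp (- l * fst p) * Pt (fst p) f (snd p))"
    using Pt_continuous[OF fc C] unfolding split_beta by (intro continuous_intros)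
  have "(\<lambda>p. indicator ({0..} \<times> UNIV) p * (exp (- l * fst p) * Pt (fst p) f (snd p))) \<in> borel_measurable borel"
    by (rule continuous_on_indicator_measurable[OF jc]) (intro closed_Times closed_UNIV closed_atLeast)
  then show m: "(\<lambda>(t, x). indicator {0..} t * (exp (- l * t) * Pt t f x)) \<in> borel_measurable borel"
    by (simp add: split_beta indicator_times)
  have "continuous_on {0..} ((\<lambda>p. exp (- l * fst p) * Pt (fst p) f (snd p)) \<circ> (\<lambda>t. (t, x)))"
    by (rule continuous_on_compose) (intro continuous_intros, rule continuous_on_subset[OF jc], auto)
  then show m1: "(\<lambda>t. indicator {0..} t * (exp (- l * t) * Pt t f x)) \<in> borel_measurable borel"
    by (intro continuous_on_indicator_measurable) (simp_all add: comp_def)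
  show "integrable lborel (\<lambda>t. indicator {0..} t * (exp (- l * t) * Pt t f x))"
  proof (rule Bochner_Integration.integrable_bound)
    show "integrable lborel (\<lambda>t. C * (indicator {0..} t * exp (- l * t)))" by (rule integrable_mult_right[OF integrable_exp_decay[OF l]])
    show "AE t in lborel. norm (indicator {0..} t * (exp (- l * t) * Pt t f x)) \<le> norm (C * (indicator {0..} t * exp (- l * t)))"
    proof (intro AE_I2)
      fix t show "norm (indicator {0..} t * (exp (- l * t) * Pt t f x)) \<le> norm (C * (indicator {0..} t * exp (- l * t)))"
        using le[of t] unfolding real_norm_def by linarith
    qed
  qed (use m1 in simp)
qed

definition resolvent :: "real \<Rightarrow> (real^'n \<Rightarrow> real) \<Rightarrow> real^'n \<Rightarrow> real" where
  "resolvent l f x = (LBINT t:{0..}. exp (- l * t) * Pt t f x)"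

lemma resolvent_eq: "resolvent l f x = (LINT t|lborel. indicator {0..} t * (exp (- l * t) * Pt t f x))"
  by (simp only: resolvent_def set_lebesgue_integral_def real_scaleR_def)

text \<open>The factor \<open>exp (L t)\<close> in the flow estimate may outweigh the decay
  \<open>exp (- l t)\<close>, so the modulus is not integrated over time. Dominated convergence is
  applied instead, along sequences with \<open>dist (x n) (y n)\<close> tending to 0, since each
  fixed time has a modulus.\<close>

lemma resolvent_C_b:
  assumes f: "f \<in> C_b" and l: "l > 0"
  shows "resolvent l f \<in> C_b"
proof -
  have fu: "uniformly_continuous_on UNIV f" using f by (simp add: C_b_def)
  obtain C where C: "\<And>x. \<bar>f x\<bar> \<le> C" using f unfolding C_b_def bounded_iff by auto
  note ri = resolvent_integrand[OF fu C l]
  have "\<bar>resolvent l f x\<bar> \<le> (LINT t|lborel. C * (indicator {0..} t * exp (- l * t)))" for x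
  proof -
    have "(LINT t|lborel. \<bar>indicator {0..} t * (exp (- l * t) * Pt t f x)\<bar>) \<le> (LINT t|lborel. C * (indicator {0..} t * exp (- l * t)))"
      by (intro integral_mono integrable_abs ri(1) ri(2) integrable_mult_right integrable_exp_decay[OF l])
    then show ?thesis unfolding resolvent_eq
      using integral_abs_bound[of lborel "\<lambda>t. indicator {0..} t * (exp (- l * t) * Pt t f x)"] by linarith
  qed
  moreover have "uniformly_continuous_on UNIV (resolvent l f)"
    unfolding uniformly_continuous_on_sequentially
  proof (intro allI impI, elim conjE)
    fix x y :: "nat \<Rightarrow> real^'n" assume d: "(\<lambda>n. dist (x n) (y n)) \<longlonglongrightarrow> 0"
    let ?h = "\<lambda>n t. indicator {0..} t * (exp (- l * t) * Pt t f (x n)) - indicator {0..} t * (exp (- l * t) * Pt t f (y n))"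
    have "(\<lambda>n. LINT t|lborel. ?h n t) \<longlonglongrightarrow> (LINT t|(lborel::real measure). 0)"
    proof (rule integral_dominated_convergence[where w="\<lambda>t. 2 * (C * (indicator {0..} t * exp (- l * t)))"])
      show "integrable lborel (\<lambda>t. 2 * (C * (indicator {0..} t * exp (- l * t))))"
        by (intro integrable_mult_right integrable_exp_decay[OF l])
      show "?h n \<in> borel_measurable lborel" for n using ri(4)[of "x n"] ri(4)[of "y n"] by simp
      show "AE t in lborel. norm (?h n t) \<le> 2 * (C * (indicator {0..} t * exp (- l * t)))" for n
      proof (intro AE_I2)
        fix t show "norm (?h n t) \<le> 2 * (C * (indicator {0..} t * exp (- l * t)))"
          using ri(2)[of t "x n"] ri(2)[of t "y n"] unfolding real_norm_def by linarith
      qed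
      have "(\<lambda>n. ?h n t) \<longlonglongrightarrow> 0" for t
      proof (cases "t \<ge> 0")
        case True
        have "(\<lambda>n. Pt t f (x n) - Pt t f (y n)) \<longlonglongrightarrow> 0"
        proof (rule LIMSEQ_I)
          fix e :: real assume "e > 0"
          then have "e / 2 > 0" by simp
          from Pt_uniform_modulus[OF fu C this, of t]
          obtain \<delta> where \<delta>: "\<delta> > 0" "\<And>s x y. \<lbrakk>0 \<le> s; s \<le> t; norm (x - y) < \<delta>\<rbrakk> \<Longrightarrow> \<bar>Pt s f x - Pt s f y\<bar> \<le> e / 2" by blast
          from LIMSEQ_D[OF d \<delta>(1)] obtain N where "\<And>n. n \<ge> N \<Longrightarrow> norm (x n - y n) < \<delta>" by (auto simp: dist_norm)
          then have "\<bar>Pt t f (x n) - Pt t f (y n)\<bar> < e" if "n \<ge> N" for n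
            using \<delta>(2)[of t "x n" "y n"] that True \<open>e > 0\<close> by fastforce
          then show "\<exists>N. \<forall>n\<ge>N. norm (Pt t f (x n) - Pt t f (y n) - 0) < e" by auto
        qed
        then have "(\<lambda>n. exp (- l * t) * (Pt t f (x n) - Pt t f (y n))) \<longlonglongrightarrow> exp (- l * t) * 0" by (intro tendsto_intros)
        then show ?thesis using True by (simp add: right_diff_distrib)
      qed simp
      then show "AE t in lborel. (\<lambda>n. ?h n t) \<longlonglongrightarrow> 0" by simp
    qed simp
    then have "(\<lambda>n. resolvent l f (x n) - resolvent l f (y n)) \<longlonglongrightarrow> 0" unfolding resolvent_eq using ri(1) by simp
    then show "(\<lambda>n. dist (resolvent l f (x n)) (resolvent l f (y n))) \<longlonglongrightarrow> 0"
      unfolding dist_real_def by (rule tendsto_rabs_zero)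
  qed
  ultimately show ?thesis unfolding C_b_def bounded_iff by auto
qed

lemma resolvent_pairing:
  fixes \<psi> :: "real^'n \<Rightarrow> real"
  assumes fu: "uniformly_continuous_on UNIV f" and C: "\<And>x. \<bar>f x\<bar> \<le> C" and l: "l > 0" and \<psi>: "integrable lborel \<psi>"
  shows "(LINT x|lborel. resolvent l f x * \<psi> x) = (LINT t|lborel. indicator {0..} t * exp (- l * t) * (LINT x|lborel. Pt t f x * \<psi> x))"
proof -
  note ri = resolvent_integrand[OF fu C l]
  have [measurable]: "\<psi> \<in> borel_measurable borel" using borel_measurable_integrable[OF \<psi>] by simp
  let ?h = "\<lambda>t x. (indicator {0..} t * (exp (- l * t) * Pt t f x)) * \<psi> x"
  have "(\<lambda>p :: real \<times> (real^'n). \<psi> (snd p)) \<in> borel_measurable borel"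
    by (rule measurable_compose[OF borel_measurable_continuous_onI]) (auto intro: continuous_intros)
  from borel_measurable_times[OF ri(3) this]
  have "(\<lambda>(t, x). ?h t x) \<in> borel_measurable borel" by (simp add: split_beta)
  moreover have "\<bar>?h t x\<bar> \<le> (C * (indicator {0..} t * exp (- l * t))) * \<bar>\<psi> x\<bar>" for t x
    unfolding abs_mult[of _ "\<psi> x"] by (intro mult_right_mono ri(2)) simp
  ultimately have "(LINT x|lborel. LINT t|lborel. ?h t x) = (LINT t|lborel. LINT x|lborel. ?h t x)"
    by (rule fubini_dominated(1)[OF _ integrable_mult_right[OF integrable_exp_decay[OF l]] integrable_abs[OF \<psi>]])
  moreover have "(LINT x|lborel. ?h t x) = indicator {0..} t * exp (- l * t) * (LINT x|lborel. Pt t f x * \<psi> x)" for t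
    by (simp add: mult.assoc)
  ultimately show ?thesis unfolding resolvent_eq by (simp only: integral_mult_left_zero)
qed

end

text \<open>The Laplace transform of \<open>weak_equation\<close>; \<open>resolvent_pairing\<close>
  exchanges the spatial pairings with the time integral.\<close>

lemma (in smooth_sde) resolvent_weak_equation:
  assumes f: "f \<in> C_b" and l: "l > 0" and \<phi>: "\<phi> \<in> test_functions"
  shows "l * (LINT x|lborel. resolvent l f x * \<phi> x) = (LINT x|lborel. resolvent l f x * adj \<phi> x) + (LINT x|lborel. f x * \<phi> x)"
proof -
  have fu: "uniformly_continuous_on UNIV f" using f by (simp add: C_b_def)
  note fc = uniformly_continuous_imp_continuous[OF fu]
  have fm: "f \<in> borel_measurable borel" by (rule borel_measurable_continuous_onI[OF fc])
  obtain C where C: "\<And>x. \<bar>f x\<bar> \<le> C" using f unfolding C_b_def bounded_iff by auto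
  have C0: "C \<ge> 0" using C[of 0] by linarith
  note \<phi>i = test_function_integrable[OF \<phi>] and ai = adj_integrable[OF \<phi>]
  define D where "D = C * (LINT x|lborel. \<bar>\<phi> x\<bar>) + C * (LINT x|lborel. \<bar>adj \<phi> x\<bar>)"
  have n1: "0 \<le> C * (LINT x|lborel. \<bar>\<phi> x\<bar>)" "0 \<le> C * (LINT x|lborel. \<bar>adj \<phi> x\<bar>)" using C0 by simp_all
  have b: "\<bar>LINT x|lborel. Pt t f x * \<psi> x\<bar> \<le> C * (LINT x|lborel. \<bar>\<psi> x\<bar>)" if "integrable lborel \<psi>" "t \<ge> 0" for t \<psi>
    by (rule integral_mult_bound(2)[OF that(1) Pt_measurable(2)[OF fc C that(2)] Pt_bound(1)[OF that(2) fm C]])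
  have "l * (LINT t|lborel. indicator {0..} t * exp (- l * t) * (LINT x|lborel. Pt t f x * \<phi> x)) =
     (LINT t|lborel. indicator {0..} t * exp (- l * t) * (LINT x|lborel. Pt t f x * adj \<phi> x)) + (LINT x|lborel. Pt 0 f x * \<phi> x)"
  proof (rule integral_exp_derivative[OF l])
    show "continuous_on {0..} (\<lambda>t. LINT x|lborel. Pt t f x * adj \<phi> x)" by (rule Pt_pairing_continuous[OF ai fc C])
    show "continuous_on {0..} (\<lambda>t. LINT x|lborel. Pt t f x * \<phi> x)" by (rule Pt_pairing_continuous[OF \<phi>i fc C])
    show "\<bar>LINT x|lborel. Pt t f x * adj \<phi> x\<bar> \<le> D" if "t \<ge> 0" for t using b[OF ai that] n1 unfolding D_def by linarith
    show "\<bar>LINT x|lborel. Pt t f x * \<phi> x\<bar> \<le> D" if "t \<ge> 0" for t using b[OF \<phi>i that] n1 unfolding D_def by linarith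
    show "(LINT x|lborel. Pt t f x * \<phi> x) = (LINT x|lborel. Pt 0 f x * \<phi> x) + (LINT s|lborel. indicator {0..<t} s * (LINT x|lborel. Pt s f x * adj \<phi> x))"
      if "t \<ge> 0" for t
      using weak_equation[OF \<phi> fc C that] unfolding Pt_0[OF fm] by linarith
  qed
  then show ?thesis unfolding resolvent_pairing[OF fu C l \<phi>i] resolvent_pairing[OF fu C l ai] Pt_0[OF fm] .
qed

section \<open>The Duhamel formula\<close>

lemma integrable_indicator_Icc: "integrable lborel (indicator {a..b::real} :: real \<Rightarrow> real)"
  by (cases "a \<le> b") (auto intro!: integrable_real_indicator)

lemma pairing_continuous:
  fixes v :: "real \<Rightarrow> real^'n \<Rightarrow> real"
  assumes vc: "continuous_on ({0..T} \<times> UNIV) (\<lambda>(t, x). v t x)" and vN: "\<And>t x. t \<in> {0..T} \<Longrightarrow> \<bar>v t x\<bar> \<le> N"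
    and \<psi>: "integrable lborel \<psi>"
  shows "continuous_on {0..T} (\<lambda>t. LINT x|lborel. v t x * \<psi> x)"
  unfolding continuous_on_sequentially comp_def
proof (intro ballI allI impI, elim conjE)
  fix tN :: "nat \<Rightarrow> real" and t assume t: "t \<in> {0..T}" "\<forall>n. tN n \<in> {0..T}" "tN \<longlonglongrightarrow> t"
  show "(\<lambda>n. LINT x|lborel. v (tN n) x * \<psi> x) \<longlonglongrightarrow> (LINT x|lborel. v t x * \<psi> x)"
  proof (rule integral_mult_tendsto[OF \<psi>])
    show "v (tN n) \<in> borel_measurable borel" "v t \<in> borel_measurable borel" for n
      using continuous_slice(2)[OF vc] t by blast+
    show "\<bar>v (tN n) x\<bar> \<le> N" for n x using vN t(2) by blast
    fix x :: "real^'n" have "(\<lambda>n. (tN n, x)) \<longlonglongrightarrow> (t, x)" by (intro tendsto_intros t(3))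
    from continuous_on_tendsto_compose[OF vc this] t
    show "(\<lambda>n. v (tN n) x) \<longlonglongrightarrow> v t x" by simp
  qed
qed

section \<open>Time integrals of evolved sources\<close>

context sde
begin

definition duhamel :: "(real \<Rightarrow> real^'n \<Rightarrow> real) \<Rightarrow> real \<Rightarrow> real^'n \<Rightarrow> real" where
  "duhamel H t x = (LBINT s:{0..t}. Pt (t - s) (H s) x)"

lemma duhamel_eq: "duhamel H t x = (LINT s|lborel. indicator {0..t} s * Pt (t - s) (H s) x)"
  by (simp only: duhamel_def set_lebesgue_integral_def real_scaleR_def)

context
  fixes H :: "real \<Rightarrow> real^'n \<Rightarrow> real" and T C :: real
  assumes Hc: "continuous_on ({0..T} \<times> UNIV) (\<lambda>(t, x). H t x)"
    and HC: "\<And>t x. t \<in> {0..T} \<Longrightarrow> \<bar>H t x\<bar> \<le> C"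
begin

lemma source_Pt_bound: "s \<in> {0..T} \<Longrightarrow> 0 \<le> r \<Longrightarrow> \<bar>Pt r (H s) x\<bar> \<le> C"
  by (rule Pt_bound(1)[OF _ continuous_slice(2)[OF Hc] HC])

text \<open>The source itself varies with \<open>sN n\<close>; joint continuity of \<open>H\<close>
  gives exactly the convergence along moving points that \<open>Pt_tendsto\<close> asks for.\<close>

lemma source_Pt_tendsto:
  assumes s: "\<And>n. sN n \<in> {0..T}" "s \<in> {0..T}" "sN \<longlonglongrightarrow> s" and r: "\<And>n. 0 \<le> rN n" "rN \<longlonglongrightarrow> r" and x: "xN \<longlonglongrightarrow> x"
  shows "(\<lambda>n. Pt (rN n) (H (sN n)) (xN n)) \<longlonglongrightarrow> Pt r (H s) x"
proof (rule Pt_tendsto[OF continuous_slice(2)[OF Hc s(2)] continuous_slice(2)[OF Hc s(1)] HC[OF s(1)] _ r x])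
  fix y yN assume "yN \<longlonglongrightarrow> (y :: real^'n)"
  then have "(\<lambda>n. (sN n, yN n)) \<longlonglongrightarrow> (s, y)" by (intro tendsto_Pair s(3))
  from continuous_on_tendsto_compose[OF Hc this] s
  show "(\<lambda>n. H (sN n) (yN n)) \<longlonglongrightarrow> H s y" by simp
qed

lemma duhamel_integrand:
  assumes t: "t \<in> {0..T}"
  shows "(\<lambda>(s, x). indicator {0..t} s * Pt (t - s) (H s) x) \<in> borel_measurable borel"
    and "(\<lambda>s. indicator {0..t} s * Pt (t - s) (H s) x) \<in> borel_measurable borel"
    and "\<bar>indicator {0..t} s * Pt (t - s) (H s) x\<bar> \<le> C * indicator {0..t} s"
    and "integrable lborel (\<lambda>s. indicator {0..t} s * Pt (t - s) (H s) x)"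
proof -
  have jc: "continuous_on ({0..t} \<times> UNIV) (\<lambda>p. Pt (t - fst p) (H (fst p)) (snd p))"
    unfolding continuous_on_sequentially comp_def
  proof (intro ballI allI impI, elim conjE)
    fix p :: "nat \<Rightarrow> real \<times> (real^'n)" and q assume p: "q \<in> {0..t} \<times> UNIV" "\<forall>n. p n \<in> {0..t} \<times> UNIV" "p \<longlonglongrightarrow> q"
    have pt: "fst q \<in> {0..t}" "\<And>n. fst (p n) \<in> {0..t}" using p by (auto simp: mem_Times_iff)
    moreover have "{0..t} \<subseteq> {0..T}" using t by auto
    ultimately have "fst q \<in> {0..T}" "\<And>n. fst (p n) \<in> {0..T}" by blast+
    with pt show "(\<lambda>n. Pt (t - fst (p n)) (H (fst (p n))) (snd (p n))) \<longlonglongrightarrow> Pt (t - fst q) (H (fst q)) (snd q)"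
      by (intro source_Pt_tendsto tendsto_intros p(3)) auto
  qed
  have "(\<lambda>p. indicator ({0..t} \<times> UNIV) p * Pt (t - fst p) (H (fst p)) (snd p)) \<in> borel_measurable borel"
    by (rule continuous_on_indicator_measurable[OF jc]) (intro closed_Times closed_UNIV closed_atLeastAtMost)
  then show "(\<lambda>(s, x). indicator {0..t} s * Pt (t - s) (H s) x) \<in> borel_measurable borel"
    by (simp add: split_beta indicator_times)
  have "continuous_on {0..t} ((\<lambda>p. Pt (t - fst p) (H (fst p)) (snd p)) \<circ> (\<lambda>s. (s, x)))"
    by (rule continuous_on_compose) (intro continuous_intros, rule continuous_on_subset[OF jc], auto)
  then show m: "(\<lambda>s. indicator {0..t} s * Pt (t - s) (H s) x) \<in> borel_measurable borel"
    by (intro continuous_on_indicator_measurable) (simp_all add: comp_def)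
  show le: "\<bar>indicator {0..t} s * Pt (t - s) (H s) x\<bar> \<le> C * indicator {0..t} s" for s
    using source_Pt_bound[of s "t - s" x] t by (auto simp: indicator_def)
  show "integrable lborel (\<lambda>s. indicator {0..t} s * Pt (t - s) (H s) x)"
  proof (rule Bochner_Integration.integrable_bound)
    have "integrable lborel (indicator {0..t} :: real \<Rightarrow> real)" by (rule integrable_indicator_Icc)
    then show "integrable lborel (\<lambda>s. C * indicator {0..t} s)" by (rule integrable_mult_right)
    show "AE s in lborel. norm (indicator {0..t} s * Pt (t - s) (H s) x) \<le> norm (C * indicator {0..t} s)"
    proof (intro AE_I2)
      fix s show "norm (indicator {0..t} s * Pt (t - s) (H s) x) \<le> norm (C * indicator {0..t} s)"
        using le[of s] unfolding real_norm_def by linarith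
    qed
  qed (use m in simp)
qed

lemma duhamel_bound:
  assumes t: "t \<in> {0..T}" shows "\<bar>duhamel H t x\<bar> \<le> C * t"
proof -
  have "integrable lborel (indicator {0..t} :: real \<Rightarrow> real)" by (rule integrable_indicator_Icc)
  then have "integrable lborel (\<lambda>s. C * indicator {0..t} s)" by (rule integrable_mult_right)
  from abs_integral_le[OF duhamel_integrand(4)[OF t] this duhamel_integrand(3)[OF t]]
  show ?thesis unfolding duhamel_eq using t by simp
qed

lemma duhamel_continuous: "continuous_on ({0..T} \<times> UNIV) (\<lambda>(t, x). duhamel H t x)"
  unfolding continuous_on_sequentially comp_def split_beta
proof (intro ballI allI impI, elim conjE)
  fix p :: "nat \<Rightarrow> real \<times> (real^'n)" and q assume p: "q \<in> {0..T} \<times> UNIV" "\<forall>n. p n \<in> {0..T} \<times> UNIV" "p \<longlonglongrightarrow> q"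
  obtain t x where q: "q = (t, x)" by (cases q)
  define tN where "tN n = fst (p n)" for n
  have t: "t \<in> {0..T}" and tN: "\<And>n. tN n \<in> {0..T}" using p q by (auto simp: mem_Times_iff tN_def)
  have tl: "tN \<longlonglongrightarrow> t" and xl: "(\<lambda>n. snd (p n)) \<longlonglongrightarrow> x"
    using tendsto_fst[OF p(3)] tendsto_snd[OF p(3)] q by (simp_all add: tN_def[abs_def])
  have lim: "(\<lambda>n. indicator {0..tN n} s * Pt (tN n - s) (H s) (snd (p n))) \<longlonglongrightarrow> indicator {0..t} s * Pt (t - s) (H s) x"
    if "s \<noteq> t" for s
  proof (cases "0 \<le> s \<and> s < t")
    case True
    have ev: "\<forall>\<^sub>F n in sequentially. s < tN n" by (rule order_tendstoD(1)[OF tl]) (use True in simp)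
    have sT: "s \<in> {0..T}" using True t by auto
    have "(\<lambda>n. Pt (max 0 (tN n - s)) (H s) (snd (p n))) \<longlonglongrightarrow> Pt (max 0 (t - s)) (H s) x"
      by (intro source_Pt_tendsto[where sN="\<lambda>_. s"] tendsto_const sT tendsto_max tendsto_diff tl xl) auto
    then have "(\<lambda>n. Pt (max 0 (tN n - s)) (H s) (snd (p n))) \<longlonglongrightarrow> indicator {0..t} s * Pt (t - s) (H s) x"
      using True by simp
    then show ?thesis
      by (rule Lim_transform_eventually) (use ev in eventually_elim, use True in auto)
  next
    case False
    have "\<forall>\<^sub>F n in sequentially. indicator {0..tN n} s * Pt (tN n - s) (H s) (snd (p n)) = indicator {0..t} s * Pt (t - s) (H s) x"
    proof (cases "s < 0")
      case True then show ?thesis by simp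
    next
      case False
      then have "t < s" using \<open>\<not> (0 \<le> s \<and> s < t)\<close> that by auto
      from order_tendstoD(2)[OF tl this] show ?thesis by eventually_elim (use \<open>t < s\<close> in simp)
    qed
    then show ?thesis by (rule tendsto_eventually)
  qed
  have "(\<lambda>n. LINT s|lborel. indicator {0..tN n} s * Pt (tN n - s) (H s) (snd (p n))) \<longlonglongrightarrow> (LINT s|lborel. indicator {0..t} s * Pt (t - s) (H s) x)"
  proof (rule integral_dominated_convergence[where w="\<lambda>s. C * indicator {0..T} s"])
    have "integrable lborel (indicator {0..T} :: real \<Rightarrow> real)" by (rule integrable_indicator_Icc)
    then show "integrable lborel (\<lambda>s. C * indicator {0..T} s)" by (rule integrable_mult_right)
    show "(\<lambda>s. indicator {0..t} s * Pt (t - s) (H s) x) \<in> borel_measurable lborel"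
      "(\<lambda>s. indicator {0..tN n} s * Pt (tN n - s) (H s) (snd (p n))) \<in> borel_measurable lborel" for n
      using duhamel_integrand(2)[OF t] duhamel_integrand(2)[OF tN] by simp_all
    have "AE s in lborel. s \<noteq> t" by (rule AE_lborel_singleton)
    then show "AE s in lborel. (\<lambda>n. indicator {0..tN n} s * Pt (tN n - s) (H s) (snd (p n))) \<longlonglongrightarrow> indicator {0..t} s * Pt (t - s) (H s) x"
      by eventually_elim (rule lim)
    have C0: "C \<ge> 0" using HC[OF t, of 0] by linarith
    have "C * indicator {0..tN n} s \<le> C * indicator {0..T} s" for n s
      using C0 tN[of n] by (intro mult_left_mono) (auto simp: indicator_def)
    then show "AE s in lborel. norm (indicator {0..tN n} s * Pt (tN n - s) (H s) (snd (p n))) \<le> C * indicator {0..T} s" for n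
      using order_trans[OF duhamel_integrand(3)[OF tN]] by (intro AE_I2) simp
  qed
  then show "(\<lambda>n. duhamel H (fst (p n)) (snd (p n))) \<longlonglongrightarrow> duhamel H (fst q) (snd q)"
    unfolding duhamel_eq q tN_def by simp
qed

lemma duhamel_pairing:
  fixes \<psi> :: "real^'n \<Rightarrow> real"
  assumes t: "t \<in> {0..T}" and \<psi>: "integrable lborel \<psi>"
  shows "(LINT x|lborel. duhamel H t x * \<psi> x) = (LINT s|lborel. indicator {0..t} s * (LINT x|lborel. Pt (t - s) (H s) x * \<psi> x))"
proof -
  have [measurable]: "\<psi> \<in> borel_measurable borel" using borel_measurable_integrable[OF \<psi>] by simp
  let ?h = "\<lambda>s x. (indicator {0..t} s * Pt (t - s) (H s) x) * \<psi> x"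
  have "(\<lambda>p :: real \<times> (real^'n). \<psi> (snd p)) \<in> borel_measurable borel"
    by (rule measurable_compose[OF borel_measurable_continuous_onI]) (auto intro: continuous_intros)
  from borel_measurable_times[OF duhamel_integrand(1)[OF t] this]
  have hm: "(\<lambda>(s, x). ?h s x) \<in> borel_measurable borel" by (simp add: split_beta)
  have hb: "\<bar>?h s x\<bar> \<le> (C * indicator {0..t} s) * \<bar>\<psi> x\<bar>" for s x
    unfolding abs_mult[of _ "\<psi> x"] by (intro mult_right_mono duhamel_integrand(3)[OF t]) simp
  have "integrable lborel (indicator {0..t} :: real \<Rightarrow> real)" by (rule integrable_indicator_Icc)
  then have "integrable lborel (\<lambda>s. C * indicator {0..t} s)" by (rule integrable_mult_right)
  from fubini_dominated(1)[OF hm this integrable_abs[OF \<psi>] hb]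
  have "(LINT x|lborel. LINT s|lborel. ?h s x) = (LINT s|lborel. LINT x|lborel. ?h s x)" .
  moreover have "(LINT x|lborel. ?h s x) = indicator {0..t} s * (LINT x|lborel. Pt (t - s) (H s) x * \<psi> x)" for s
    by (simp add: mult.assoc)
  ultimately show ?thesis unfolding duhamel_eq by (simp only: integral_mult_left_zero)
qed

lemma source_pairing_continuous:
  assumes \<psi>: "integrable lborel \<psi>"
  shows "continuous_on {p. 0 \<le> snd p \<and> snd p \<le> fst p \<and> fst p \<le> T} (\<lambda>p. LINT x|lborel. Pt (fst p - snd p) (H (snd p)) x * \<psi> x)"
  unfolding continuous_on_sequentially comp_def
proof (intro ballI allI impI, elim conjE)
  let ?D = "{p. 0 \<le> snd p \<and> snd p \<le> fst p \<and> fst p \<le> T}"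
  fix p :: "nat \<Rightarrow> real \<times> real" and q assume q: "q \<in> ?D" and p: "\<forall>n. p n \<in> ?D" "p \<longlonglongrightarrow> q"
  have sq: "snd q \<in> {0..T}" "0 \<le> fst q - snd q" and sp: "snd (p n) \<in> {0..T}" "0 \<le> fst (p n) - snd (p n)" for n
    using q p(1)[rule_format, of n] by auto
  show "(\<lambda>n. LINT x|lborel. Pt (fst (p n) - snd (p n)) (H (snd (p n))) x * \<psi> x) \<longlonglongrightarrow> (LINT x|lborel. Pt (fst q - snd q) (H (snd q)) x * \<psi> x)"
  proof (rule integral_mult_tendsto[OF \<psi>])
    show "(\<lambda>x. Pt (fst q - snd q) (H (snd q)) x) \<in> borel_measurable borel"
      "(\<lambda>x. Pt (fst (p n) - snd (p n)) (H (snd (p n))) x) \<in> borel_measurable borel" for n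
      using Pt_measurable(2)[OF continuous_slice(1)[OF Hc] HC] sq sp by blast+
    show "\<bar>Pt (fst (p n) - snd (p n)) (H (snd (p n))) x\<bar> \<le> C" for n x by (rule source_Pt_bound[OF sp])
    show "(\<lambda>n. Pt (fst (p n) - snd (p n)) (H (snd (p n))) x) \<longlonglongrightarrow> Pt (fst q - snd q) (H (snd q)) x" for x
      by (intro source_Pt_tendsto tendsto_const tendsto_diff tendsto_fst[OF p(2)] tendsto_snd[OF p(2)] sp sq)
  qed
qed

end

end

text \<open>For each source time \<open>s\<close> the semigroup equation with datum
  \<open>H s\<close> is used up to time \<open>t - s\<close> and shifted to start at
  \<open>s\<close>. Integrating over \<open>s\<close> and exchanging the order on the triangle
  \<open>s \<le> q < t\<close> makes the inner integral the pairing with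
  \<open>duhamel H q\<close>.\<close>

lemma (in smooth_sde) duhamel_weak_equation:
  assumes Hc: "continuous_on ({0..T} \<times> UNIV) (\<lambda>(t, x). H t x)" and HC: "\<And>t x. t \<in> {0..T} \<Longrightarrow> \<bar>H t x\<bar> \<le> C"
    and \<phi>: "\<phi> \<in> test_functions" and t: "t \<in> {0..T}"
  shows "(LINT x|lborel. duhamel H t x * \<phi> x) =
    (LINT q|lborel. indicator {0..<t} q * ((LINT x|lborel. duhamel H q x * adj \<phi> x) + (LINT x|lborel. H q x * \<phi> x)))"
proof -
  note \<phi>i = test_function_integrable[OF \<phi>] and ai = adj_integrable[OF \<phi>]
  define k where "k s r = (LINT x|lborel. Pt r (H s) x * adj \<phi> x)" for s r
  define e where "e s = (LINT x|lborel. H s x * \<phi> x)" for s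
  define D where "D = C * (LINT x|lborel. \<bar>adj \<phi> x\<bar>)"
  have C0: "C \<ge> 0" using HC[OF t, of 0] by linarith
  have D0: "D \<ge> 0" unfolding D_def using C0 by simp
  have kD: "\<bar>k s r\<bar> \<le> D" if "s \<in> {0..T}" "0 \<le> r" for s r
    unfolding k_def D_def
    by (rule integral_mult_bound(2)[OF ai Pt_measurable(2)[OF continuous_slice(1)[OF Hc that(1)] HC[OF that(1)] that(2)] source_Pt_bound[OF Hc HC that]])
  have inner: "(LINT x|lborel. Pt (t - s) (H s) x * \<phi> x) = e s + (LINT q|lborel. indicator {s..<t} q * k s (q - s))"
    if s: "s \<in> {0..t}" for s
  proof -
    have sT: "s \<in> {0..T}" using s t by auto
    have ts: "0 \<le> t - s" using s by simp
    have "(\<lambda>r. indicator {0..} r * k s r) \<in> borel_measurable borel"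
      unfolding k_def by (intro continuous_on_indicator_measurable Pt_pairing_continuous[OF ai continuous_slice(1)[OF Hc sT] HC[OF sT]]) simp
    then have "(\<lambda>r. indicator {0..<t - s} r * (indicator {0..} r * k s r)) \<in> borel_measurable borel" by measurable
    moreover have "indicator {0..<t - s} r * (indicator {0..} r * k s r) = indicator {0..<t - s} r * k s r" for r
      by (auto simp: indicator_def)
    ultimately have m: "(\<lambda>r. indicator {0..<t - s} r * k s r) \<in> borel_measurable borel" by simp
    have "(LINT q|lborel. indicator {s..<t} q * k s (q - s)) = (LINT r|lborel. indicator {0..<t - s} r * k s r)"
    proof -
      have "indicator {0..<t - s} (q + (- s)) = (indicator {s..<t} q :: real)" for q by (auto simp: indicator_def)
      then show ?thesis using integral_translate[OF m, of "- s"] by simp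
    qed
    then show ?thesis
      using weak_equation[OF \<phi> continuous_slice(1)[OF Hc sT] HC[OF sT] ts] unfolding k_def e_def by linarith
  qed
  define h where "h q s = indicator {0..t} s * indicator {s..<t} q * k s (q - s)" for q s :: real
  have it: "integrable lborel (indicator {0..t} :: real \<Rightarrow> real)" by (rule integrable_indicator_Icc)
  have hm: "(\<lambda>(q, s). h q s) \<in> borel_measurable borel"
  proof -
    \<comment> \<open>Joint continuity holds on the closed triangle, which gives measurability of
      the integrand there; the strict bound \<open>q < t\<close> is imposed by a separate
      indicator.\<close>
    let ?D = "{p :: real \<times> real. 0 \<le> snd p \<and> snd p \<le> fst p \<and> fst p \<le> T}"
    have "closed ?D" by (intro closed_Collect_conj closed_Collect_le continuous_intros)
    from continuous_on_indicator_measurable[OF source_pairing_continuous[OF Hc HC ai] this]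
    have m: "(\<lambda>p. indicator ?D p * k (snd p) (fst p - snd p)) \<in> borel_measurable borel" unfolding k_def .
    have f: "fst \<in> borel_measurable (borel :: (real \<times> real) measure)"
      by (rule borel_measurable_continuous_onI) (intro continuous_intros)
    have "(\<lambda>p. indicator {..<t} (fst p) * (indicator ?D p * k (snd p) (fst p - snd p))) \<in> borel_measurable borel"
      by (intro borel_measurable_times m measurable_compose[OF f]) simp
    moreover have "indicator {..<t} (fst p) * (indicator ?D p * k (snd p) (fst p - snd p)) = (case p of (q, s) \<Rightarrow> h q s)" for p
      using t by (cases p) (auto simp: h_def indicator_def)
    ultimately show ?thesis by simp
  qed
  have hb: "\<bar>h q s\<bar> \<le> (D * indicator {0..t} q) * indicator {0..t} s" for q s
    using kD[of s "q - s"] t D0 by (auto simp: h_def indicator_def)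
  note fub = fubini_dominated[OF hm integrable_mult_right[OF it, of D] it hb]
  have hq: "(LINT s|lborel. h q s) = indicator {0..<t} q * (LINT x|lborel. duhamel H q x * adj \<phi> x)" for q
  proof (cases "q \<in> {0..<t}")
    case True
    then have "h q s = indicator {0..q} s * k s (q - s)" for s by (auto simp: h_def indicator_def)
    moreover have "q \<in> {0..T}" using True t by auto
    ultimately show ?thesis using True duhamel_pairing[OF Hc HC _ ai, of q] by (simp add: k_def)
  next
    case False
    then have "h q s = 0" for s by (auto simp: h_def indicator_def)
    then show ?thesis using False by simp
  qed
  have ec: "continuous_on {0..t} e"
    unfolding e_def by (rule continuous_on_subset[OF pairing_continuous[OF Hc HC \<phi>i]]) (use t in auto)
  have ei: "integrable lborel (\<lambda>s. indicator {0..t} s * e s)"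
    using borel_integrable_atLeastAtMost'[OF ec] by (simp add: set_integrable_def)
  have "AE s in lborel. s \<noteq> t" by (rule AE_lborel_singleton)
  then have ae: "AE s in lborel. indicator {0..t} s * e s = indicator {0..<t} s * e s"
    by eventually_elim (auto simp: indicator_def)
  have m2: "(\<lambda>s. indicator {0..<t} s * e s) \<in> borel_measurable lborel"
  proof -
    have "(\<lambda>s. indicator {0..<t} s * (indicator {0..t} s * e s)) \<in> borel_measurable lborel"
      using borel_measurable_integrable[OF ei] by measurable
    moreover have "indicator {0..<t} s * (indicator {0..t} s * e s) = indicator {0..<t} s * e s" for s by (auto simp: indicator_def)
    ultimately show ?thesis by simp
  qed
  have ei2: "integrable lborel (\<lambda>s. indicator {0..<t} s * e s)" by (rule integrable_cong_AE_imp[OF ei m2 ae])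
  have e2: "(LINT s|lborel. indicator {0..t} s * e s) = (LINT s|lborel. indicator {0..<t} s * e s)"
    by (rule integral_cong_AE[OF borel_measurable_integrable[OF ei] m2 ae])
  have "(LINT x|lborel. duhamel H t x * \<phi> x) = (LINT s|lborel. indicator {0..t} s * (LINT x|lborel. Pt (t - s) (H s) x * \<phi> x))"
    by (rule duhamel_pairing[OF Hc HC t \<phi>i])
  also have "\<dots> = (LINT s|lborel. indicator {0..t} s * e s + (LINT q|lborel. h q s))"
  proof (rule Bochner_Integration.integral_cong[OF refl])
    fix s show "indicator {0..t} s * (LINT x|lborel. Pt (t - s) (H s) x * \<phi> x) = indicator {0..t} s * e s + (LINT q|lborel. h q s)"
      using inner[of s] by (cases "s \<in> {0..t}") (simp_all add: h_def)
  qed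
  also have "\<dots> = (LINT s|lborel. indicator {0..<t} s * e s) + (LINT s|lborel. LINT q|lborel. h q s)"
    using ei fub(3) by (simp add: e2)
  also have "\<dots> = (LINT s|lborel. indicator {0..<t} s * e s) + (LINT q|lborel. indicator {0..<t} q * (LINT x|lborel. duhamel H q x * adj \<phi> x))"
    unfolding fub(1) hq ..
  also have "\<dots> = (LINT q|lborel. indicator {0..<t} q * e q + indicator {0..<t} q * (LINT x|lborel. duhamel H q x * adj \<phi> x))"
    using ei2 fub(2)[unfolded hq] by simp
  finally show ?thesis unfolding e_def by (simp add: distrib_left add.commute)
qed

section \<open>Existence for the Cauchy problem\<close>

locale hypoelliptic_sde = smooth_sde b L B K R M \<F> W X + control_sde b L R M \<F> W X A S k CR
  for b :: "real^'n::finite \<Rightarrow> real^'n" and L B K R and M :: "'w measure" and \<F> W X A S k CR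
begin

text \<open>Sources younger than \<open>d\<close> are estimated by their sup bound over an interval
  of length \<open>d\<close>; older ones have been smoothed for at least the time \<open>d\<close>
  and obey a Lipschitz bound in \<open>x\<close>, whatever the modulus of
  \<open>H s\<close>.\<close>

lemma duhamel_uniform_modulus:
  assumes Hc: "continuous_on ({0..T} \<times> UNIV) (\<lambda>(t, x). H t x)" and HC: "\<And>t x. t \<in> {0..T} \<Longrightarrow> \<bar>H t x\<bar> \<le> C"
    and \<epsilon>: "\<epsilon> > 0" and T: "T > 0"
  obtains \<delta> where "\<delta> > 0" "\<And>t x y. \<lbrakk>t \<in> {0..T}; norm y < \<delta>\<rbrakk> \<Longrightarrow> \<bar>duhamel H t (x + y) - duhamel H t x\<bar> \<le> \<epsilon>"
proof -
  have C0: "C \<ge> 0" using HC[of 0 0] T by auto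
  \<comment> \<open>Makes \<open>2 C d \<le> \<epsilon> / 2\<close>; the added 1 guards against
    \<open>C = 0\<close>, and in the same way against a zero denominator in \<delta> below.\<close>
  define d where "d = \<epsilon> / (4 * C + 1)"
  have d: "d > 0" unfolding d_def using \<epsilon> C0 by simp
  obtain C' where C': "C' \<ge> 0" "\<And>t x z f K. \<lbrakk>d \<le> t; t \<le> T; continuous_on UNIV f; \<And>y. \<bar>f y\<bar> \<le> K; norm z \<le> 1\<rbrakk> \<Longrightarrow>
     Pt t f (x + z) - Pt t f x \<le> C' * K * norm z"
    using smoothing[OF d, of T] by blast
  define \<delta> where "\<delta> = min 1 (\<epsilon> / (2 * (C' * C * T) + 1))"
  have CT: "0 \<le> C' * C * T" using C' C0 T by simp
  have \<delta>: "\<delta> > 0" unfolding \<delta>_def using \<epsilon> CT by simp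
  show thesis
  proof (rule that[OF \<delta>])
    fix t and x y :: "real^'n" assume t: "t \<in> {0..T}" and y: "norm y < \<delta>"
    have y1: "norm y \<le> 1" using y unfolding \<delta>_def by simp
    let ?k = "\<lambda>s. indicator {0..t} s * Pt (t - s) (H s) (x + y) - indicator {0..t} s * Pt (t - s) (H s) x"
    let ?m = "\<lambda>s. 2 * C * indicator {t - d..t} s + C' * C * norm y * indicator {0..t} s"
    have it: "integrable lborel (indicator {a..b} :: real \<Rightarrow> real)" for a b by (rule integrable_indicator_Icc)
    have im: "integrable lborel ?m" by (intro Bochner_Integration.integrable_add integrable_mult_right it)
    have ki: "integrable lborel ?k" using duhamel_integrand(4)[OF Hc HC t] by simp
    have le: "\<bar>?k s\<bar> \<le> ?m s" for s
    proof (cases "s \<in> {0..t}")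
      case True
      then have sT: "s \<in> {0..T}" using t by auto
      have nn: "0 \<le> C' * C * norm y" using C' C0 by simp
      show ?thesis
      proof (cases "s \<in> {t - d..t}")
        case s: True
        have "\<bar>Pt (t - s) (H s) (x + y)\<bar> \<le> C" "\<bar>Pt (t - s) (H s) x\<bar> \<le> C"
          using source_Pt_bound[OF Hc HC sT] True by simp_all
        then show ?thesis using True s nn by simp
      next
        case False
        then have td: "d \<le> t - s" "t - s \<le> T" using True t by auto
        note sm = C'(2)[OF td continuous_slice(1)[OF Hc sT] HC[OF sT]]
        \<comment> \<open>The one-sided estimate is used from \<open>x\<close> with \<open>y\<close>
          and from \<open>x + y\<close> with \<open>- y\<close>.\<close>
        have "\<bar>Pt (t - s) (H s) (x + y) - Pt (t - s) (H s) x\<bar> \<le> C' * C * norm y"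
          using sm[of y x] sm[of "- y" "x + y"] y1 by simp
        then show ?thesis using True False by simp
      qed
    next
      case False
      then have "?k s = 0" by simp
      moreover have "0 \<le> ?m s" using C0 C'(1) by (intro add_nonneg_nonneg mult_nonneg_nonneg) auto
      ultimately show ?thesis by linarith
    qed
    have "duhamel H t (x + y) - duhamel H t x = (LINT s|lborel. ?k s)"
      unfolding duhamel_eq using duhamel_integrand(4)[OF Hc HC t] by simp
    then have "\<bar>duhamel H t (x + y) - duhamel H t x\<bar> \<le> (LINT s|lborel. ?m s)"
      using abs_integral_le[OF ki im le] by simp
    also have "(LINT s|lborel. ?m s) = 2 * C * d + C' * C * norm y * t"
      using it t d by simp
    also have "2 * C * d \<le> \<epsilon> / 2" unfolding d_def using \<epsilon> C0 by (simp add: field_simps)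
    also have "C' * C * norm y * t \<le> \<epsilon> / 2"
    proof -
      have "C' * C * norm y * t \<le> C' * C * norm y * T" using t C' C0 by (intro mult_left_mono) auto
      also have "\<dots> = C' * C * T * norm y" by simp
      also have "\<dots> \<le> C' * C * T * (\<epsilon> / (2 * (C' * C * T) + 1))"
        using y CT unfolding \<delta>_def by (intro mult_left_mono) auto
      also have "\<dots> \<le> \<epsilon> / 2" using \<epsilon> CT by (simp add: divide_simps)
      finally show ?thesis .
    qed
    finally show "\<bar>duhamel H t (x + y) - duhamel H t x\<bar> \<le> \<epsilon>" by simp
  qed
qed

text \<open>Adding the integrated equations of the two summands gives one with integrand
  \<open>c\<close>. As \<open>c\<close> is continuous, the pairing is differentiable on all of
  \<open>{0..T}\<close>, with one-sided derivatives at the ends.\<close>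

lemma mild_solution:
  assumes g: "g \<in> C_b" and T: "T > 0"
    and Hc: "continuous_on ({0..T} \<times> UNIV) (\<lambda>(t, x). H t x)" and HC: "\<And>t x. t \<in> {0..T} \<Longrightarrow> \<bar>H t x\<bar> \<le> C"
  defines "v \<equiv> \<lambda>t x. Pt t g x + duhamel H t x"
  shows "continuous_on ({0..T} \<times> UNIV) (\<lambda>(t, x). v t x)"
    and "\<exists>N. \<forall>t\<in>{0..T}. \<forall>x. \<bar>v t x\<bar> \<le> N"
    and "v 0 x = g x"
    and "\<epsilon> > 0 \<Longrightarrow> \<exists>\<delta>>0. \<forall>t\<in>{0..T}. \<forall>x y. norm y < \<delta> \<longrightarrow> \<bar>v t (x + y) - v t x\<bar> \<le> \<epsilon>"
    and "\<lbrakk>\<phi> \<in> test_functions; t \<in> {0..T}\<rbrakk> \<Longrightarrow> ((\<lambda>r. LINT x|lborel. v r x * \<phi> x) has_real_derivative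
      (LINT x|lborel. v t x * adj \<phi> x) + (LINT x|lborel. H t x * \<phi> x)) (at t within {0..T})"
proof -
  have gu: "uniformly_continuous_on UNIV g" using g by (simp add: C_b_def)
  note gc = uniformly_continuous_imp_continuous[OF gu]
  have gm: "g \<in> borel_measurable borel" by (rule borel_measurable_continuous_onI[OF gc])
  obtain G where G: "\<And>x. \<bar>g x\<bar> \<le> G" using g unfolding C_b_def bounded_iff by auto
  have C0: "C \<ge> 0" using HC[of 0 0] T by auto
  have "continuous_on ({0..T} \<times> UNIV) (\<lambda>(t, x). Pt t g x)"
    by (rule continuous_on_subset[OF Pt_continuous[OF gc G]]) auto
  then show vc: "continuous_on ({0..T} \<times> UNIV) (\<lambda>(t, x). v t x)"
    using duhamel_continuous[OF Hc HC] unfolding v_def split_beta by (intro continuous_on_add)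
  have vN: "\<bar>v t x\<bar> \<le> G + C * T" if "t \<in> {0..T}" for t x
  proof -
    have "C * t \<le> C * T" using that C0 by (intro mult_left_mono) auto
    then show ?thesis using Pt_bound(1)[OF _ gm G, of t x] duhamel_bound[OF Hc HC that, of x] that unfolding v_def by auto
  qed
  then show "\<exists>N. \<forall>t\<in>{0..T}. \<forall>x. \<bar>v t x\<bar> \<le> N" by blast
  show "v 0 x = g x" using duhamel_bound[OF Hc HC, of 0 x] T unfolding v_def Pt_0[OF gm] by simp
  show "\<exists>\<delta>>0. \<forall>t\<in>{0..T}. \<forall>x y. norm y < \<delta> \<longrightarrow> \<bar>v t (x + y) - v t x\<bar> \<le> \<epsilon>" if "\<epsilon> > 0"
  proof -
    have e2: "\<epsilon> / 2 > 0" using that by simp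
    obtain d1 where d1: "d1 > 0" "\<And>t x y. \<lbrakk>0 \<le> t; t \<le> T; norm (x - y) < d1\<rbrakk> \<Longrightarrow> \<bar>Pt t g x - Pt t g y\<bar> \<le> \<epsilon> / 2"
      using Pt_uniform_modulus[OF gu G e2, of T] by blast
    obtain d2 where d2: "d2 > 0" "\<And>t x y. \<lbrakk>t \<in> {0..T}; norm y < d2\<rbrakk> \<Longrightarrow> \<bar>duhamel H t (x + y) - duhamel H t x\<bar> \<le> \<epsilon> / 2"
      using duhamel_uniform_modulus[OF Hc HC e2 T] by blast
    have "\<bar>v t (x + y) - v t x\<bar> \<le> \<epsilon>" if "t \<in> {0..T}" "norm y < min d1 d2" for t x y
    proof -
      have "\<bar>Pt t g (x + y) - Pt t g x\<bar> \<le> \<epsilon> / 2" using d1(2)[of t "x + y" x] that by simp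
      moreover have "\<bar>duhamel H t (x + y) - duhamel H t x\<bar> \<le> \<epsilon> / 2" using d2(2) that by simp
      ultimately show ?thesis unfolding v_def by linarith
    qed
    then show ?thesis using d1(1) d2(1) by (intro exI[of _ "min d1 d2"]) auto
  qed
  fix \<phi> :: "real^'n \<Rightarrow> real" and t assume \<phi>: "\<phi> \<in> test_functions" and t: "t \<in> {0..T}"
  note \<phi>i = test_function_integrable[OF \<phi>] and ai = adj_integrable[OF \<phi>]
  have split: "(LINT x|lborel. v r x * \<psi> x) = (LINT x|lborel. Pt r g x * \<psi> x) + (LINT x|lborel. duhamel H r x * \<psi> x)"
    if "integrable lborel \<psi>" "r \<in> {0..T}" for r \<psi>
  proof -
    have r0: "0 \<le> r" using that by simp
    have "integrable lborel (\<lambda>x. Pt r g x * \<psi> x)"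
      by (rule integral_mult_bound(1)[OF that(1) Pt_measurable(2)[OF gc G r0] Pt_bound(1)[OF r0 gm G]])
    moreover have "integrable lborel (\<lambda>x. duhamel H r x * \<psi> x)"
      by (rule integral_mult_bound(1)[OF that(1) continuous_slice(2)[OF duhamel_continuous[OF Hc HC] that(2)] duhamel_bound[OF Hc HC that(2)]])
    ultimately show ?thesis unfolding v_def by (simp add: distrib_right)
  qed
  define c where "c q = (LINT x|lborel. v q x * adj \<phi> x) + (LINT x|lborel. H q x * \<phi> x)" for q
  have cc: "continuous_on {0..T} c"
    unfolding c_def by (intro continuous_on_add pairing_continuous[OF vc vN ai] pairing_continuous[OF Hc HC \<phi>i])
  have "((\<lambda>r. LINT x|lborel. v r x * \<phi> x) has_real_derivative c t) (at t within {0..T})"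
  proof (rule indicator_integral_has_derivative[OF cc _ t])
    fix r assume r: "r \<in> {0..T}"
    define p where "p q = (LINT x|lborel. Pt q g x * adj \<phi> x)" for q
    define e where "e q = (LINT x|lborel. duhamel H q x * adj \<phi> x) + (LINT x|lborel. H q x * \<phi> x)" for q
    have pc: "continuous_on {0..T} p"
      unfolding p_def by (rule continuous_on_subset[OF Pt_pairing_continuous[OF ai gc G]]) auto
    have cpe: "c q = p q + e q" if "q \<in> {0..T}" for q unfolding c_def p_def e_def split[OF ai that] by simp
    have ind: "integrable lborel (\<lambda>q. indicator {0..<r} q * q' q)" if q': "continuous_on {0..T} q'" for q' :: "real \<Rightarrow> real"
    proof -
      have "set_integrable lborel {0..<r} q'"
        by (rule set_integrable_subset[OF borel_integrable_atLeastAtMost'[OF q']]) (use r in auto)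
      then show ?thesis by (simp add: set_integrable_def)
    qed
    \<comment> \<open>Continuity of \<open>e\<close> is read off from that of \<open>c\<close> and
      \<open>p\<close>, using \<open>c = p + e\<close>.\<close>
    have ec: "continuous_on {0..T} e"
    proof -
      have "continuous_on {0..T} (\<lambda>q. c q - p q)" by (intro continuous_on_diff cc pc)
      then show ?thesis by (rule continuous_on_eq) (simp add: cpe)
    qed
    have "(LINT x|lborel. v r x * \<phi> x) = (LINT x|lborel. g x * \<phi> x) + ((LINT q|lborel. indicator {0..<r} q * p q) + (LINT q|lborel. indicator {0..<r} q * e q))"
      using weak_equation[OF \<phi> gc G, of r] duhamel_weak_equation[OF Hc HC \<phi> r] r unfolding split[OF \<phi>i r] p_def e_def by simp
    also have "(LINT q|lborel. indicator {0..<r} q * p q) + (LINT q|lborel. indicator {0..<r} q * e q) =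
      (LINT q|lborel. indicator {0..<r} q * p q + indicator {0..<r} q * e q)" using ind[OF pc] ind[OF ec] by simp
    also have "\<dots> = (LINT q|lborel. indicator {0..<r} q * c q)"
      by (rule Bochner_Integration.integral_cong[OF refl]) (use r in \<open>auto simp: indicator_def cpe\<close>)
    finally show "(LINT x|lborel. v r x * \<phi> x) = (LINT x|lborel. g x * \<phi> x) + (LINT q|lborel. indicator {0..<r} q * c q)" .
  qed
  then show "((\<lambda>r. LINT x|lborel. v r x * \<phi> x) has_real_derivative
      (LINT x|lborel. v t x * adj \<phi> x) + (LINT x|lborel. H t x * \<phi> x)) (at t within {0..T})" unfolding c_def .
qed

end

section \<open>Coefficients and uniqueness\<close>

text \<open>\<open>f\<close> is \<open>Q\<close> with the identity added on the complementary
  coordinates: an injective, hence invertible, map that agrees with \<open>Q\<close> on vectors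
  supported in the first block. Solving \<open>Q u = v\<close> gives \<beta> = \<open>R u\<close>,
  since \<open>R R = Q\<close>.\<close>

lemma range_sqrt_block:
  fixes Q R :: "real^'n::{finite,linorder}^'n::{finite,linorder}"
  assumes Q: "block_diffusion p Q" and R: "nonneg_sqrt R Q"
  obtains C where "C \<ge> 0" "\<And>v. (\<And>i. i \<notin> first_coords p \<Longrightarrow> v $ i = 0) \<Longrightarrow> \<exists>\<beta>. R *v \<beta> = v \<and> norm \<beta> \<le> C * norm v"
proof -
  define f :: "(real, 'n) vec \<Rightarrow> (real, 'n) vec" where "f = (\<lambda>\<xi>. Q *v \<xi> + (\<chi> i. if i \<in> first_coords p then 0 else \<xi> $ i))"
  have lin: "linear f"
  proof (rule linearI)
    show "f (x + y) = f x + f y" for x y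
      by (simp add: f_def matrix_vector_right_distrib vec_eq_iff)
    show "f (c *\<^sub>R x) = c *\<^sub>R f x" for c x
      by (simp add: f_def vec_eq_iff matrix_vector_mult_scaleR distrib_left)
  qed
  have Q0: "(Q *v \<xi>) $ i = 0" if "i \<notin> first_coords p" for \<xi> i
    using Q that by (simp add: block_diffusion_def matrix_vector_mult_def)
  have fi: "f \<xi> $ i = \<xi> $ i" if "i \<notin> first_coords p" for \<xi> i
    using Q0[OF that, of \<xi>] that by (simp add: f_def)
  have fQ: "f \<xi> = Q *v \<xi>" if "\<And>i. i \<notin> first_coords p \<Longrightarrow> \<xi> $ i = 0" for \<xi>
    using that by (simp add: f_def vec_eq_iff)
  have f0: "\<xi> = 0" if "f \<xi> = 0" for \<xi>
  proof (rule ccontr)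
    assume "\<xi> \<noteq> 0"
    have z: "\<xi> $ i = 0" if "i \<notin> first_coords p" for i using fi[OF that, of \<xi>] \<open>f \<xi> = 0\<close> by simp
    then have "0 < \<xi> \<bullet> (Q *v \<xi>)" using Q \<open>\<xi> \<noteq> 0\<close> by (simp add: block_diffusion_def)
    then show False using fQ[OF z] that by simp
  qed
  have inj: "inj f" using linear_injective_0[OF lin] f0 by blast
  have surj: "surj f" by (rule linear_inj_imp_surj[OF lin inj])
  obtain e where e: "e > 0" "\<And>x. e * norm x \<le> norm (f x)" using linear_inj_bounded_below_pos[OF lin inj] by blast
  have blR: "bounded_linear ((*v) R)" by (rule matrix_vector_mul_bounded_linear)
  show thesis
  proof (rule that[of "onorm ((*v) R) * (1 / e)"])
    show "0 \<le> onorm ((*v) R) * (1 / e)" using onorm_pos_le[OF blR] e by simp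
    fix v :: "(real, 'n) vec" assume v: "\<And>i. i \<notin> first_coords p \<Longrightarrow> v $ i = 0"
    obtain u where u: "f u = v" using surj by (metis surjD)
    have "u $ i = 0" if "i \<notin> first_coords p" for i using fi[OF that, of u] v[OF that] u by simp
    then have "Q *v u = v" using fQ u by metis
    then have "R *v (R *v u) = v" using R by (simp add: nonneg_sqrt_def matrix_vector_mul_assoc)
    moreover have "norm (R *v u) \<le> onorm ((*v) R) * (1 / e) * norm v"
    proof -
      have "norm u \<le> (1 / e) * norm v" using e(2)[of u] e(1) u by (simp add: field_simps)
      then have "onorm ((*v) R) * norm u \<le> onorm ((*v) R) * ((1 / e) * norm v)"
        by (intro mult_left_mono onorm_pos_le[OF blR])
      then show ?thesis using onorm[OF blR, of u] by simp
    qed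
    ultimately show "\<exists>\<beta>. R *v \<beta> = v \<and> norm \<beta> \<le> onorm ((*v) R) * (1 / e) * norm v" by blast
  qed
qed

lemma bounded_partials_const: "bounded_partials k (\<lambda>x. c)"
proof (induction k arbitrary: c)
  case (Suc k)
  then show ?case by (simp add: partial_const)
qed simp

text \<open>Bounded second partials make the first ones Lipschitz, hence continuous, and continuous
  first partials give the Frechet derivative.\<close>

lemma bounded_partials_3D:
  fixes f :: "real^'n \<Rightarrow> real"
  assumes "bounded_partials 3 f"
  shows "\<exists>L\<ge>0. L-lipschitz_on UNIV f" "\<exists>K. \<forall>i x. \<bar>partial i f x\<bar> \<le> K" "\<exists>L\<ge>0. L-lipschitz_on UNIV (partial i f)"
    "(f has_derivative (\<lambda>v. grad f x \<bullet> v)) (at x)"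
proof -
  have hp: "has_partial i f" "bounded (range (partial i f))" "has_partial j (partial i f)" "bounded (range (partial j (partial i f)))" for i j
    using assms by (simp_all add: numeral_3_eq_3)
  show "\<exists>L\<ge>0. L-lipschitz_on UNIV f" by (rule lipschitz_bounded_partials[OF hp(1,2)])
  show lp: "\<exists>L\<ge>0. L-lipschitz_on UNIV (partial i f)" for i by (rule lipschitz_bounded_partials[OF hp(3,4)])
  have "\<exists>K. \<forall>x. \<bar>partial i f x\<bar> \<le> K" for i using hp(2)[of i] by (auto simp: bounded_iff)
  then obtain K where K: "\<And>i x. \<bar>partial i f x\<bar> \<le> K i" by metis
  have "\<bar>partial i f x\<bar> \<le> (\<Sum>i\<in>UNIV. \<bar>K i\<bar>)" for i x
    using K[of i x] member_le_sum[of i UNIV "\<lambda>i. \<bar>K i\<bar>"] by simp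
  then show "\<exists>K. \<forall>i x. \<bar>partial i f x\<bar> \<le> K" by blast
  have "isCont (partial i f) x" for i
  proof -
    obtain L where "L-lipschitz_on UNIV (partial i f)" using lp by blast
    from lipschitz_on_continuous_on[OF this] show ?thesis by (simp add: continuous_on_eq_continuous_at)
  qed
  then show "(f has_derivative (\<lambda>v. grad f x \<bullet> v)) (at x)" by (rule has_derivative_partials[OF hp(1)])
qed

lemma lipschitz_on_vec:
  fixes F :: "real^'n \<Rightarrow> real^'m"
  assumes "\<And>i. \<exists>L\<ge>0. L-lipschitz_on UNIV (\<lambda>x. F x $ i)"
  shows "\<exists>L\<ge>0. L-lipschitz_on UNIV F"
proof -
  obtain L where L: "\<And>i. L i \<ge> 0" "\<And>i. (L i)-lipschitz_on UNIV (\<lambda>x. F x $ i)" using assms by metis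
  have "(\<Sum>i\<in>UNIV. L i)-lipschitz_on UNIV F"
  proof (rule lipschitz_onI)
    fix x y
    have "norm (F x - F y) \<le> (\<Sum>i\<in>UNIV. \<bar>(F x - F y) $ i\<bar>)" by (rule norm_le_l1_cart)
    also have "\<dots> \<le> (\<Sum>i\<in>UNIV. L i * dist x y)"
      using lipschitz_onD[OF L(2)] by (intro sum_mono) (simp add: dist_real_def)
    finally show "dist (F x) (F y) \<le> (\<Sum>i\<in>UNIV. L i) * dist x y" by (simp add: dist_norm sum_distrib_right)
  qed (simp add: sum_nonneg L(1))
  then show ?thesis using L(1) by (intro exI[of _ "\<Sum>i\<in>UNIV. L i"]) (simp add: sum_nonneg)
qed

lemma smooth_drift_regular:
  fixes A :: "real^'n::{finite,linorder}^'n::{finite,linorder}" and F :: "real^'n::{finite,linorder} \<Rightarrow> real^'n::{finite,linorder}"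
  assumes F: "regular_drift p F"
  defines "b \<equiv> \<lambda>x. A *v x + F x"
    and "B \<equiv> \<lambda>x. (\<chi> i j. A $ i $ j + partial j (\<lambda>x. F x $ i) x)"
  obtains L K where "smooth_drift b L B K" "continuous_on UNIV F"
proof -
  have bp: "bounded_partials 3 (\<lambda>x. F x $ i)" for i
  proof (cases "i \<in> first_coords p")
    case False
    then have "(\<lambda>x. F x $ i) = (\<lambda>x. 0)" using F by (auto simp: regular_drift_def)
    then show ?thesis by (simp only: bounded_partials_const)
  qed (use F in \<open>simp add: regular_drift_def\<close>)
  obtain LF where LF: "LF \<ge> 0" "LF-lipschitz_on UNIV F" using lipschitz_on_vec[OF bounded_partials_3D(1)[OF bp]] by blast
  obtain K where K: "\<And>i j x. \<bar>partial j (\<lambda>x. F x $ i) x\<bar> \<le> K i" using bounded_partials_3D(2)[OF bp] by metis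
  define KK where "KK = (\<Sum>i\<in>UNIV. \<Sum>j\<in>UNIV. \<bar>A $ i $ j\<bar>) + (\<Sum>i\<in>UNIV. \<bar>K i\<bar>)"
  have blA: "bounded_linear ((*v) A)" by (rule matrix_vector_mul_bounded_linear)
  have "(onorm ((*v) A))-lipschitz_on UNIV ((*v) A)"
    by (rule lipschitz_onI)
      (simp_all only: dist_norm matrix_vector_mult_diff_distrib[symmetric] onorm[OF blA] onorm_pos_le[OF blA])
  then have lipb: "(onorm ((*v) A) + LF)-lipschitz_on UNIV b"
    unfolding b_def by (intro lipschitz_on_add LF(2))
  have "smooth_drift b (onorm ((*v) A) + LF) B KK"
  proof unfold_locales
    show "(onorm ((*v) A) + LF)-lipschitz_on UNIV b" by (rule lipb)
    fix x
    have D: "((\<lambda>x. \<Sum>i\<in>UNIV. F x $ i *\<^sub>R (axis i 1 :: (real, 'n) vec)) has_derivative (\<lambda>v. \<Sum>i\<in>UNIV. (grad (\<lambda>x. F x $ i) x \<bullet> v) *\<^sub>R axis i 1)) (at x)"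
      by (intro has_derivative_sum has_derivative_scaleR_left bounded_partials_3D(4)[OF bp])
    have E: "(\<Sum>i\<in>UNIV. F y $ i *\<^sub>R axis i 1) = F y" for y
      using basis_expansion[of "F y"] by (simp add: scalar_mult_eq_scaleR)
    have "(F has_derivative (\<lambda>v. \<Sum>i\<in>UNIV. (grad (\<lambda>x. F x $ i) x \<bullet> v) *\<^sub>R axis i 1)) (at x)"
      using D unfolding E .
    moreover have "((*v) A has_derivative (*v) A) (at x)"
      by (rule bounded_linear.has_derivative[OF blA has_derivative_ident])
    ultimately have "(b has_derivative (\<lambda>v. A *v v + (\<Sum>i\<in>UNIV. (grad (\<lambda>x. F x $ i) x \<bullet> v) *\<^sub>R axis i 1))) (at x)"
      unfolding b_def by (intro has_derivative_add)
    moreover have "A *v v + (\<Sum>i\<in>UNIV. (grad (\<lambda>x. F x $ i) x \<bullet> v) *\<^sub>R axis i 1) = B x *v v" for v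
    proof -
      have "(\<Sum>i\<in>UNIV. (grad (\<lambda>x. F x $ i) x \<bullet> v) *\<^sub>R axis i 1) = (\<chi> i. grad (\<lambda>x. F x $ i) x \<bullet> v)"
        using basis_expansion[of "\<chi> i. grad (\<lambda>x. F x $ i) x \<bullet> v"] by (simp add: scalar_mult_eq_scaleR)
      then show ?thesis
        by (simp add: B_def vec_eq_iff matrix_vector_mult_def grad_def inner_vec_def distrib_right sum.distrib)
    qed
    ultimately show "(b has_derivative (*v) (B x)) (at x)" by simp
    fix i j
    have "\<bar>A $ i $ j\<bar> \<le> (\<Sum>j\<in>UNIV. \<bar>A $ i $ j\<bar>)" by (rule member_le_sum) auto
    also have "\<dots> \<le> (\<Sum>i\<in>UNIV. \<Sum>j\<in>UNIV. \<bar>A $ i $ j\<bar>)"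
      by (rule member_le_sum[of i UNIV "\<lambda>i. \<Sum>j\<in>UNIV. \<bar>A $ i $ j\<bar>"]) (auto simp: sum_nonneg)
    finally have "\<bar>A $ i $ j\<bar> \<le> (\<Sum>i\<in>UNIV. \<Sum>j\<in>UNIV. \<bar>A $ i $ j\<bar>)" .
    moreover have "\<bar>partial j (\<lambda>x. F x $ i) x\<bar> \<le> (\<Sum>i\<in>UNIV. \<bar>K i\<bar>)"
      using K[of j i x] member_le_sum[of i UNIV "\<lambda>i. \<bar>K i\<bar>"] by simp
    moreover have "B x $ i $ j = A $ i $ j + partial j (\<lambda>x. F x $ i) x" by (simp add: B_def)
    ultimately show "\<bar>B x $ i $ j\<bar> \<le> KK" unfolding KK_def by linarith
  next
    fix i j
    obtain C where C: "C \<ge> 0" "C-lipschitz_on UNIV (partial j (\<lambda>x. F x $ i))" using bounded_partials_3D(3)[OF bp] by blast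
    have "(0 + C)-lipschitz_on UNIV (\<lambda>x. A $ i $ j + partial j (\<lambda>x. F x $ i) x)"
      by (intro lipschitz_on_add lipschitz_on_constant C(2))
    then show "\<exists>C\<ge>0. C-lipschitz_on UNIV (\<lambda>x. B x $ i $ j)" using C(1) unfolding B_def by auto
  qed
  then show thesis using that lipschitz_on_continuous_on[OF LF(2)] by blast
qed

text \<open>Along a continuous path both integrands are continuous, so the two Lebesgue integrals
  merge into one gauge integral of the full drift, the form used by the pathwise error
  estimate.\<close>

lemma strong_solution_drift_integral:
  fixes A R :: "real^'n^'n" and F :: "real^'n \<Rightarrow> real^'n"
  assumes Y: "strong_solution M \<F> W R A F x Y" and F: "continuous_on UNIV F"
  shows "AE \<omega> in M. continuous_on {0..} (\<lambda>t. Y t \<omega>) \<and>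
     (\<forall>t\<ge>0. Y t \<omega> = x + integral {0..t} (\<lambda>s. A *v Y s \<omega> + F (Y s \<omega>)) + R *v W t \<omega>)"
proof -
  have "AE \<omega> in M. continuous_on {0..} (\<lambda>t. Y t \<omega>) \<and>
        (\<forall>t\<ge>0. Y t \<omega> = x + (LBINT s:{0..t}. A *v Y s \<omega>) + (LBINT s:{0..t}. F (Y s \<omega>)) + R *v W t \<omega>)"
    using Y by (simp add: strong_solution_def)
  then show ?thesis
  proof eventually_elim
    case (elim \<omega>)
    have "(LBINT s:{0..t}. A *v Y s \<omega>) + (LBINT s:{0..t}. F (Y s \<omega>)) = integral {0..t} (\<lambda>s. A *v Y s \<omega> + F (Y s \<omega>))"
      if "t \<ge> 0" for t
    proof -
      have c: "continuous_on {0..t} (\<lambda>s. Y s \<omega>)" by (rule continuous_on_subset[OF conjunct1[OF elim]]) auto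
      have cA: "continuous_on {0..t} (\<lambda>s. A *v Y s \<omega>)"
        by (rule bounded_linear.continuous_on[OF matrix_vector_mul_bounded_linear c])
      have cF: "continuous_on {0..t} (\<lambda>s. F (Y s \<omega>))"
        by (rule continuous_on_compose2[OF F c]) simp
      note eA = set_borel_integral_eq_integral[OF borel_integrable_atLeastAtMost'[OF cA]]
        and eF = set_borel_integral_eq_integral[OF borel_integrable_atLeastAtMost'[OF cF]]
      show ?thesis unfolding eA(2) eF(2) by (rule integral_add[OF eA(1) eF(1), symmetric])
    qed
    then show ?case using elim by (simp add: add.assoc)
  qed
qed

text \<open>Boundedness of \<open>v\<close> enters because the supremum of an unbounded set of reals
  is a default value from which nothing pointwise can be read off.\<close>

lemma sup_modulus_pointwise:
  fixes v :: "real \<Rightarrow> real^'n \<Rightarrow> real"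
  assumes b: "\<And>t x. t \<in> {0..T} \<Longrightarrow> \<bar>v t x\<bar> \<le> N"
    and s: "(SUP (t, x)\<in>{0..T} \<times> UNIV. \<bar>v t (x + y) - v t x\<bar>) < \<epsilon>" and t: "t \<in> {0..T}"
  shows "\<bar>v t (x + y) - v t x\<bar> \<le> \<epsilon>"
proof -
  have "bdd_above ((\<lambda>(t, x). \<bar>v t (x + y) - v t x\<bar>) ` ({0..T} \<times> UNIV))"
  proof (rule bdd_aboveI2[where M="2 * N"], clarify)
    fix t x assume "t \<in> {0..T}"
    from b[OF this, of x] b[OF this, of "x + y"] show "\<bar>v t (x + y) - v t x\<bar> \<le> 2 * N" by linarith
  qed
  from cSUP_upper[OF _ this, of "(t, x)"] t s show ?thesis by simp
qed

context hypoelliptic_sde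
begin

text \<open>\<open>space_distributional_solution\<close> with \<open>adj\<close> as the adjoint and
  the coefficients left implicit; the two coincide by rewriting once the adjoints are
  identified.\<close>

definition cauchy_solution :: "real \<Rightarrow> (real \<Rightarrow> real^'n \<Rightarrow> real) \<Rightarrow> (real^'n \<Rightarrow> real) \<Rightarrow> (real \<Rightarrow> real^'n \<Rightarrow> real) \<Rightarrow> bool" where
  "cauchy_solution T H g v \<longleftrightarrow>
     continuous_on ({0..T} \<times> UNIV) (\<lambda>(t, x). v t x) \<and>
     bounded ((\<lambda>(t, x). v t x) ` ({0..T} \<times> UNIV)) \<and>
     (\<forall>x. v 0 x = g x) \<and>
     (\<forall>\<epsilon>>0. \<exists>\<delta>>0. \<forall>y. norm y < \<delta> \<longrightarrow>
        (SUP (t, x)\<in>{0..T} \<times> UNIV. \<bar>v t (x + y) - v t x\<bar>) < \<epsilon>) \<and>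
     (\<forall>\<phi>\<in>test_functions. \<exists>m'. continuous_on {0..T} m' \<and>
        (\<forall>t\<in>{0..T}.
           ((\<lambda>r. LINT x|lborel. v r x * \<phi> x) has_real_derivative m' t) (at t within {0..T}) \<and>
           m' t = (LINT x|lborel. v t x * adj \<phi> x) + (LINT x|lborel. H t x * \<phi> x)))"

lemma cauchy_solutionD:
  assumes v: "cauchy_solution T H g v"
  shows "continuous_on ({0..T} \<times> UNIV) (\<lambda>(t, x). v t x)" "\<exists>N. \<forall>t\<in>{0..T}. \<forall>x. \<bar>v t x\<bar> \<le> N" "v 0 x = g x"
    "\<epsilon> > 0 \<Longrightarrow> \<exists>\<delta>>0. \<forall>t\<in>{0..T}. \<forall>x y. norm y < \<delta> \<longrightarrow> \<bar>v t (x + y) - v t x\<bar> \<le> \<epsilon>"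
    "\<lbrakk>\<phi> \<in> test_functions; t \<in> {0..T}\<rbrakk> \<Longrightarrow> ((\<lambda>r. LINT x|lborel. v r x * \<phi> x) has_real_derivative
       (LINT x|lborel. v t x * adj \<phi> x) + (LINT x|lborel. H t x * \<phi> x)) (at t within {0..T})"
proof -
  show "continuous_on ({0..T} \<times> UNIV) (\<lambda>(t, x). v t x)" "v 0 x = g x" using v by (auto simp: cauchy_solution_def)
  have "bounded ((\<lambda>(t, x). v t x) ` ({0..T} \<times> UNIV))" using v by (simp add: cauchy_solution_def)
  then obtain N where N: "\<forall>z\<in>(\<lambda>(t, x). v t x) ` ({0..T} \<times> UNIV). norm z \<le> N" unfolding bounded_iff by blast
  have N: "\<bar>v t x\<bar> \<le> N" if "t \<in> {0..T}" for t x using N that by auto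
  then show "\<exists>N. \<forall>t\<in>{0..T}. \<forall>x. \<bar>v t x\<bar> \<le> N" by blast
  show "\<exists>\<delta>>0. \<forall>t\<in>{0..T}. \<forall>x y. norm y < \<delta> \<longrightarrow> \<bar>v t (x + y) - v t x\<bar> \<le> \<epsilon>" if "\<epsilon> > 0"
  proof -
    have "\<forall>\<epsilon>>0. \<exists>\<delta>>0. \<forall>y. norm y < \<delta> \<longrightarrow> (SUP (t, x)\<in>{0..T} \<times> UNIV. \<bar>v t (x + y) - v t x\<bar>) < \<epsilon>"
      using v unfolding cauchy_solution_def by (elim conjE)
    with that obtain \<delta> where "\<delta> > 0" "\<And>y. norm y < \<delta> \<Longrightarrow> (SUP (t, x)\<in>{0..T} \<times> UNIV. \<bar>v t (x + y) - v t x\<bar>) < \<epsilon>"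
      by blast
    then show ?thesis using sup_modulus_pointwise[where v=v and N=N and T=T, OF N] by blast
  qed
  show "((\<lambda>r. LINT x|lborel. v r x * \<phi> x) has_real_derivative
       (LINT x|lborel. v t x * adj \<phi> x) + (LINT x|lborel. H t x * \<phi> x)) (at t within {0..T})"
    if \<phi>: "\<phi> \<in> test_functions" and t: "t \<in> {0..T}"
  proof -
    have "\<forall>\<phi>\<in>test_functions. \<exists>m'. continuous_on {0..T} m' \<and>
        (\<forall>t\<in>{0..T}.
           ((\<lambda>r. LINT x|lborel. v r x * \<phi> x) has_real_derivative m' t) (at t within {0..T}) \<and>
           m' t = (LINT x|lborel. v t x * adj \<phi> x) + (LINT x|lborel. H t x * \<phi> x))"
      using v unfolding cauchy_solution_def by (elim conjE)
    from bspec[OF this \<phi>] obtain m' where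
      D: "((\<lambda>r. LINT x|lborel. v r x * \<phi> x) has_real_derivative m' t) (at t within {0..T})"
      and e: "m' t = (LINT x|lborel. v t x * adj \<phi> x) + (LINT x|lborel. H t x * \<phi> x)" using t by blast
    show ?thesis by (rule DERIV_cong[OF D e])
  qed
qed

lemma cauchy_solution_unique:
  assumes v: "cauchy_solution T H g v" and w: "cauchy_solution T H g w" and t: "t \<in> {0..T}"
  shows "w t x = v t x"
proof -
  note vD = cauchy_solutionD[OF v] and wD = cauchy_solutionD[OF w]
  obtain N1 where N1: "\<And>t x. t \<in> {0..T} \<Longrightarrow> \<bar>v t x\<bar> \<le> N1" using vD(2) by blast
  obtain N2 where N2: "\<And>t x. t \<in> {0..T} \<Longrightarrow> \<bar>w t x\<bar> \<le> N2" using wD(2) by blast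
  have "\<bar>w t x - v t x\<bar> \<le> 0"
  proof (rule weak_solution_0[where v="\<lambda>t x. w t x - v t x" and T=T and N="N2 + N1"])
    show "continuous_on ({0..T} \<times> UNIV) (\<lambda>(t, x). w t x - v t x)"
      using continuous_on_diff[OF wD(1) vD(1)] by (simp add: split_beta)
    show "\<bar>w t x - v t x\<bar> \<le> N2 + N1" if "t \<in> {0..T}" for t x
      using N1[OF that, of x] N2[OF that, of x] by linarith
    show "\<exists>\<delta>>0. \<forall>t\<in>{0..T}. \<forall>x y. norm y < \<delta> \<longrightarrow> \<bar>(w t (x + y) - v t (x + y)) - (w t x - v t x)\<bar> \<le> \<epsilon>"
      if "\<epsilon> > 0" for \<epsilon>
    proof -
      have e: "\<epsilon> / 2 > 0" using that by simp
      obtain d1 where d1: "d1 > 0" "\<forall>t\<in>{0..T}. \<forall>x y. norm y < d1 \<longrightarrow> \<bar>v t (x + y) - v t x\<bar> \<le> \<epsilon> / 2"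
        using vD(4)[OF e] by blast
      obtain d2 where d2: "d2 > 0" "\<forall>t\<in>{0..T}. \<forall>x y. norm y < d2 \<longrightarrow> \<bar>w t (x + y) - w t x\<bar> \<le> \<epsilon> / 2"
        using wD(4)[OF e] by blast
      have "\<bar>(w t (x + y) - v t (x + y)) - (w t x - v t x)\<bar> \<le> \<epsilon>" if "t \<in> {0..T}" "norm y < min d1 d2" for t x y
      proof -
        have "\<bar>v t (x + y) - v t x\<bar> \<le> \<epsilon> / 2" "\<bar>w t (x + y) - w t x\<bar> \<le> \<epsilon> / 2" using d1(2) d2(2) that by simp_all
        then show ?thesis by linarith
      qed
      then show ?thesis using d1(1) d2(1) by (intro exI[of _ "min d1 d2"]) auto
    qed
    fix \<phi> :: "real^'n \<Rightarrow> real" and t assume \<phi>: "\<phi> \<in> test_functions" and t: "t \<in> {0..T}"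
    have split: "(LINT x|lborel. (w r x - v r x) * \<psi> x) = (LINT x|lborel. w r x * \<psi> x) - (LINT x|lborel. v r x * \<psi> x)"
      if "integrable lborel \<psi>" "r \<in> {0..T}" for r \<psi>
      using integral_mult_bound(1)[OF that(1) continuous_slice(2)[OF vD(1) that(2)] N1[OF that(2)]]
        integral_mult_bound(1)[OF that(1) continuous_slice(2)[OF wD(1) that(2)] N2[OF that(2)]]
      by (simp add: left_diff_distrib)
    have "((\<lambda>r. (LINT x|lborel. w r x * \<phi> x) - (LINT x|lborel. v r x * \<phi> x)) has_real_derivative
        (LINT x|lborel. (w t x - v t x) * adj \<phi> x)) (at t within {0..T})"
      unfolding split[OF adj_integrable[OF \<phi>] t] by (rule DERIV_cong[OF DERIV_diff[OF wD(5)[OF \<phi> t] vD(5)[OF \<phi> t]]]) simp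
    then show "((\<lambda>r. LINT x|lborel. (w r x - v r x) * \<phi> x) has_real_derivative (LINT x|lborel. (w t x - v t x) * adj \<phi> x)) (at t within {0..T})"
      by (rule has_field_derivative_transform_within[where d=1]) (use t split[OF test_function_integrable[OF \<phi>]] in auto)
  qed (use vD(3) wD(3) t in simp_all)
  then show ?thesis by simp
qed

lemma cauchy_solution_exists:
  assumes g: "g \<in> C_b" and T: "T > 0" and Hc: "continuous_on ({0..T} \<times> UNIV) (\<lambda>(t, x). H t x)"
    and Hb: "bounded ((\<lambda>(t, x). H t x) ` ({0..T} \<times> UNIV))"
  shows "cauchy_solution T H g (\<lambda>t x. Pt t g x + duhamel H t x)"
    and "t \<in> {0..T} \<Longrightarrow> set_integrable lborel {0..t} (\<lambda>s. Pt (t - s) (H s) x)"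
proof -
  obtain C where "\<forall>z\<in>(\<lambda>(t, x). H t x) ` ({0..T} \<times> UNIV). norm z \<le> C" using Hb unfolding bounded_iff by blast
  then have HC: "\<bar>H t x\<bar> \<le> C" if "t \<in> {0..T}" for t x using that by auto
  show "set_integrable lborel {0..t} (\<lambda>s. Pt (t - s) (H s) x)" if "t \<in> {0..T}"
    using duhamel_integrand(4)[OF Hc HC that] by (simp add: set_integrable_def)
  define v where "v = (\<lambda>t x. Pt t g x + duhamel H t x)"
  have vc: "continuous_on ({0..T} \<times> UNIV) (\<lambda>(t, x). v t x)" unfolding v_def by (rule mild_solution(1)[OF g T Hc HC])
  have v0: "v 0 x = g x" for x unfolding v_def by (rule mild_solution(3)[OF g T Hc HC])
  have "\<exists>N. \<forall>t\<in>{0..T}. \<forall>x. \<bar>v t x\<bar> \<le> N" unfolding v_def by (rule mild_solution(2)[OF g T Hc HC])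
  then obtain N where N: "\<And>t x. t \<in> {0..T} \<Longrightarrow> \<bar>v t x\<bar> \<le> N" by blast
  have "\<exists>\<delta>>0. \<forall>y. norm y < \<delta> \<longrightarrow> (SUP (t, x)\<in>{0..T} \<times> UNIV. \<bar>v t (x + y) - v t x\<bar>) < \<epsilon>" if e: "\<epsilon> > 0" for \<epsilon>
  proof -
    \<comment> \<open>Half of \<epsilon>, because a supremum of quantities at most
      \<open>\<epsilon> / 2\<close> must come out strictly below \<epsilon>.\<close>
    have e2: "\<epsilon> / 2 > 0" using e by simp
    obtain \<delta> where d: "\<delta> > 0" "\<forall>t\<in>{0..T}. \<forall>x y. norm y < \<delta> \<longrightarrow> \<bar>v t (x + y) - v t x\<bar> \<le> \<epsilon> / 2"
      unfolding v_def using mild_solution(4)[OF g T Hc HC e2] by blast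
    have "(SUP (t, x)\<in>{0..T} \<times> UNIV. \<bar>v t (x + y) - v t x\<bar>) \<le> \<epsilon> / 2" if "norm y < \<delta>" for y
      by (rule cSUP_least) (use T d(2) that in auto)
    then have "(SUP (t, x)\<in>{0..T} \<times> UNIV. \<bar>v t (x + y) - v t x\<bar>) < \<epsilon>" if "norm y < \<delta>" for y using that e by fastforce
    then show ?thesis using d(1) by blast
  qed
  moreover have "\<exists>m'. continuous_on {0..T} m' \<and>
        (\<forall>t\<in>{0..T}. ((\<lambda>r. LINT x|lborel. v r x * \<phi> x) has_real_derivative m' t) (at t within {0..T}) \<and>
           m' t = (LINT x|lborel. v t x * adj \<phi> x) + (LINT x|lborel. H t x * \<phi> x))" if \<phi>: "\<phi> \<in> test_functions" for \<phi>
  proof (intro exI[of _ "\<lambda>t. (LINT x|lborel. v t x * adj \<phi> x) + (LINT x|lborel. H t x * \<phi> x)"] conjI ballI refl)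
    show "continuous_on {0..T} (\<lambda>t. (LINT x|lborel. v t x * adj \<phi> x) + (LINT x|lborel. H t x * \<phi> x))"
      by (intro continuous_on_add pairing_continuous[OF vc N adj_integrable[OF \<phi>]] pairing_continuous[OF Hc HC test_function_integrable[OF \<phi>]])
    show "((\<lambda>r. LINT x|lborel. v r x * \<phi> x) has_real_derivative
       (LINT x|lborel. v t x * adj \<phi> x) + (LINT x|lborel. H t x * \<phi> x)) (at t within {0..T})" if "t \<in> {0..T}" for t
      unfolding v_def by (rule mild_solution(5)[OF g T Hc HC \<phi> that])
  qed
  moreover have "bounded ((\<lambda>(t, x). v t x) ` ({0..T} \<times> UNIV))" unfolding bounded_iff using N by (intro exI[of _ N]) auto
  ultimately show "cauchy_solution T H g (\<lambda>t x. Pt t g x + duhamel H t x)"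
    unfolding v_def[symmetric] cauchy_solution_def using vc v0 by blast
qed

lemma resolvent_unique:
  fixes u w :: "real^'n \<Rightarrow> real"
  assumes l: "l > 0" and u: "u \<in> C_b" and w: "w \<in> C_b"
    and ueq: "\<And>\<phi>. \<phi> \<in> test_functions \<Longrightarrow> l * (LINT x|lborel. u x * \<phi> x) = (LINT x|lborel. u x * adj \<phi> x) + (LINT x|lborel. f x * \<phi> x)"
    and weq: "\<And>\<phi>. \<phi> \<in> test_functions \<Longrightarrow> l * (LINT x|lborel. w x * \<phi> x) = (LINT x|lborel. w x * adj \<phi> x) + (LINT x|lborel. f x * \<phi> x)"
  shows "u = w"
proof -
  have uc: "uniformly_continuous_on UNIV u" "uniformly_continuous_on UNIV w" using u w by (simp_all add: C_b_def)
  obtain N1 where N1: "\<And>x. \<bar>u x\<bar> \<le> N1" using u unfolding C_b_def bounded_iff by auto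
  obtain N2 where N2: "\<And>x. \<bar>w x\<bar> \<le> N2" using w unfolding C_b_def bounded_iff by auto
  note um = borel_measurable_continuous_onI[OF uniformly_continuous_imp_continuous[OF uc(1)]]
    and wm = borel_measurable_continuous_onI[OF uniformly_continuous_imp_continuous[OF uc(2)]]
  have split: "(LINT x|lborel. (u x - w x) * \<psi> x) = (LINT x|lborel. u x * \<psi> x) - (LINT x|lborel. w x * \<psi> x)"
    if "integrable lborel \<psi>" for \<psi>
    using integral_mult_bound(1)[OF that um N1] integral_mult_bound(1)[OF that wm N2] by (simp add: left_diff_distrib)
  have "u x - w x = 0" for x
  proof (rule elliptic_weak_solution_0[where u="\<lambda>x. u x - w x" and N="N1 + N2", OF _ _ l])
    show "uniformly_continuous_on UNIV (\<lambda>x. u x - w x)" by (rule uniformly_continuous_on_diff[OF uc])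
    show "\<bar>u x - w x\<bar> \<le> N1 + N2" for x using N1[of x] N2[of x] by linarith
    show "l * (LINT x|lborel. (u x - w x) * \<phi> x) = (LINT x|lborel. (u x - w x) * adj \<phi> x)" if "\<phi> \<in> test_functions" for \<phi>
      using ueq[OF that] weq[OF that] unfolding split[OF test_function_integrable[OF that]] split[OF adj_integrable[OF that]]
      by (simp add: right_diff_distrib)
  qed
  then show ?thesis by (intro ext) simp
qed

end

section \<open>The given coefficients as an instance of the abstract setting\<close>

theorem theorem4p1:
  fixes Q A R :: "real^'n::{finite,linorder}^'n::{finite,linorder}"
    and F :: "real^'n::{finite,linorder} \<Rightarrow> real^'n::{finite,linorder}"
    and p :: nat
    and M :: "'w measure"
    and \<F> :: "real \<Rightarrow> 'w measure"
    and W :: "real \<Rightarrow> 'w \<Rightarrow> real^'n::{finite,linorder}"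
    and X :: "real^'n::{finite,linorder} \<Rightarrow> real \<Rightarrow> 'w \<Rightarrow> real^'n::{finite,linorder}"
  assumes "1 \<le> p" and "p \<le> CARD('n)"
    and "block_diffusion p Q"
    and "regular_drift p F"
    and "generates p A"
    and "stochastic_basis M \<F>"
    and "wiener_process M \<F> W"
    and "nonneg_sqrt R Q"
    and "\<And>x. strong_solution M \<F> W R A F x (X x)"
  shows
    "(\<forall>lam f. 0 < lam \<and> f \<in> C_b \<longrightarrow>
        (\<exists>!u. distributional_solution Q A F lam f u) \<and>
        (\<forall>u. distributional_solution Q A F lam f u \<longrightarrow>
           (\<forall>x. set_integrable lborel {0..} (\<lambda>t. exp (- lam * t) * transition_semigroup M X t f x) \<and>
                u x = (LBINT t:{0..}. exp (- lam * t) * transition_semigroup M X t f x))))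
     \<and>
     (\<forall>g T H. g \<in> C_b \<and> 0 < T \<and>
        continuous_on ({0..T} \<times> UNIV) (\<lambda>(t, x). H t x) \<and>
        bounded ((\<lambda>(t, x). H t x) ` ({0..T} \<times> UNIV)) \<longrightarrow>
        (\<exists>v. space_distributional_solution Q A F T H g v \<and>
             (\<forall>w. space_distributional_solution Q A F T H g w \<longrightarrow>
                (\<forall>t\<in>{0..T}. \<forall>x. w t x = v t x))) \<and>
        (\<forall>v. space_distributional_solution Q A F T H g v \<longrightarrow>
           (\<forall>t\<in>{0..T}. \<forall>x.
              set_integrable lborel {0..t} (\<lambda>s. transition_semigroup M X (t - s) (H s) x) \<and>
              v t x = transition_semigroup M X t g x
                + (LBINT s:{0..t}. transition_semigroup M X (t - s) (H s) x))))"
proof -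
  define b where "b = (\<lambda>x. A *v x + F x)"
  define B where "B = (\<lambda>x. (\<chi> i j. A $ i $ j + partial j (\<lambda>x. F x $ i) x) :: ((real, 'n) vec, 'n) vec)"
  obtain L K where sd: "smooth_drift b L B K" and Fc: "continuous_on UNIV F"
    unfolding b_def B_def by (rule smooth_drift_regular[OF assms(4)])
  obtain k where k: "span {((*v) A ^^ j) (axis i 1) | i j. i \<in> first_coords p \<and> j \<le> k} = UNIV"
    using assms(5) unfolding generates_def by blast
  obtain CR where CR: "CR \<ge> 0" "\<And>v. (\<And>i. i \<notin> first_coords p \<Longrightarrow> v $ i = 0) \<Longrightarrow> \<exists>\<beta>. R *v \<beta> = v \<and> norm \<beta> \<le> CR * norm v"
    using range_sqrt_block[OF assms(3,8)] by blast
  interpret smooth_drift b L B K by (rule sd)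
  interpret hypoelliptic_sde b L B K R M \<F> W X A "first_coords p" k CR
  proof unfold_locales
    show "stochastic_basis M \<F>" "wiener_process M \<F> W" by (fact assms(6), fact assms(7))
    show "adapted \<F> (X x)" for x using assms(9)[of x] by (simp add: strong_solution_def)
    show "AE \<omega> in M. continuous_on {0..} (\<lambda>t. X x t \<omega>) \<and>
       (\<forall>t\<ge>0. X x t \<omega> = x + integral {0..t} (\<lambda>s. b (X x s \<omega>)) + R *v W t \<omega>)" for x
      unfolding b_def by (rule strong_solution_drift_integral[OF assms(9) Fc])
    \<comment> \<open>Outside the first block the components of \<open>F\<close> vanish, so those of
      \<open>b\<close> are linear.\<close>
    show "(b (x + z) - b x - A *v z) $ i = 0" if "i \<notin> first_coords p" for i x z
      using assms(4) that by (simp add: b_def regular_drift_def matrix_vector_right_distrib)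
  qed (use CR k in blast)+
  have RR: "R ** transpose R = Q" using assms(8) by (simp add: nonneg_sqrt_def)
  \<comment> \<open>The zero-order coefficient of the adjoint is the divergence of the full drift
    \<open>b\<close>.\<close>
  have "trace (B x) = divergence F x + trace A" for x
    by (simp add: B_def trace_def divergence_def sum.distrib)
  then have adj: "adjoint_operator Q A F \<phi> = adj \<phi>" for \<phi>
    by (intro ext) (simp add: adjoint_operator_def adj_def flux_def RR, simp add: b_def)
  have cs: "space_distributional_solution Q A F T H g v \<longleftrightarrow> cauchy_solution T H g v" for T H g v
    unfolding space_distributional_solution_def cauchy_solution_def adj ..
  have ell: "distributional_solution Q A F lam f (resolvent lam f)" if "0 < lam" "f \<in> C_b" for lam f
    unfolding distributional_solution_def adj
    using resolvent_C_b[OF that(2,1)] resolvent_weak_equation[OF that(2,1)] by blast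
  have ell_unique: "u = resolvent lam f" if "0 < lam" "f \<in> C_b" "distributional_solution Q A F lam f u" for lam f u
    using that(3) ell[OF that(1,2)] unfolding distributional_solution_def adj
    by (intro resolvent_unique[where f=f, OF that(1)]) blast+
  show ?thesis
  proof (intro conjI allI impI; (elim conjE)?)
    fix lam :: real and f :: "(real, 'n) vec \<Rightarrow> real" assume l: "0 < lam" and f: "f \<in> C_b"
    show "\<exists>!u. distributional_solution Q A F lam f u" by (rule ex1I[of _ "resolvent lam f"]) (rule ell[OF l f], rule ell_unique[OF l f])
    fix u x assume u: "distributional_solution Q A F lam f u"
    obtain C where C: "\<And>x. \<bar>f x\<bar> \<le> C" using f unfolding C_b_def bounded_iff by auto
    have "uniformly_continuous_on UNIV f" using f by (simp add: C_b_def)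
    from resolvent_integrand(1)[OF this C l, of x]
    show "set_integrable lborel {0..} (\<lambda>t. exp (- lam * t) * Pt t f x)" by (simp add: set_integrable_def)
    show "u x = (LBINT t:{0..}. exp (- lam * t) * Pt t f x)" using ell_unique[OF l f u] by (simp add: resolvent_def)
  next
    fix g :: "(real, 'n) vec \<Rightarrow> real" and T and H :: "real \<Rightarrow> (real, 'n) vec \<Rightarrow> real"
    assume g: "g \<in> C_b" and T: "0 < (T::real)" and H: "continuous_on ({0..T} \<times> UNIV) (\<lambda>(t, x). H t x)"
      "bounded ((\<lambda>(t, x). H t x) ` ({0..T} \<times> UNIV))"
    note ex = cauchy_solution_exists[OF g T H]
    show "\<exists>v. space_distributional_solution Q A F T H g v \<and>
             (\<forall>w. space_distributional_solution Q A F T H g w \<longrightarrow> (\<forall>t\<in>{0..T}. \<forall>x. w t x = v t x))"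
      unfolding cs using ex(1) cauchy_solution_unique[OF ex(1)] by blast
    fix v assume "space_distributional_solution Q A F T H g v"
    then have v: "cauchy_solution T H g v" unfolding cs .
    show "\<forall>t\<in>{0..T}. \<forall>x. set_integrable lborel {0..t} (\<lambda>s. Pt (t - s) (H s) x) \<and>
              v t x = Pt t g x + (LBINT s:{0..t}. Pt (t - s) (H s) x)"
      using ex(2) cauchy_solution_unique[OF ex(1) v] unfolding duhamel_def by blast
  qed
qed

end
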